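(* Fix $\beta>0$ and finite-dimensional systems with Hamiltonians. The channel free energy $f=F^\beta$ satisfies all of the following properties, and for every $\alpha\in(1,\infty)$ the sandwiched Rényi free energy $f=F^\beta_\alpha$ satisfies (A1)–(A5) together with quasi-convexity: $F^\beta_\alpha[\sum_x p_x\mathcal N^x]\le\max_x F^\beta_\alpha[\mathcal N^x]$ for any probability distribution $\{p_x\}$ and channels $\mathcal N^x:A'\to A$. (A1) For every Gibbs-preserving superchannel $\Theta$ from $\mathrm{Ch}(A',A)$ to $\mathrm{Ch}(B',B)$ and every $\mathcal N\in\mathrm{Ch}(A',A)$, $f[\Theta(\mathcal N)]\le f[\mathcal N]$. (A2) For every replacer channel $\mathcal R^\omega_{A'\to A}(Y)=\operatorname{tr}[Y]\omega$ with $\omega\in\mathrm{St}(A)$, $f[\mathcal R^\omega]$ equals the corresponding state free energy of $\omega$, i.e. $F^\beta[\mathcal R^\omega]=\beta^{-1}D(\omega\|\gamma^\beta_A)$ and $F^\beta_\alpha[\mathcal R^\omega]=\beta^{-1}D_\alpha(\omega\|\gamma^\beta_A)$. (A3) $f[\mathcal N]\ge0$ for all $\mathcal N\in\mathrm{Ch}(A',A)$, with equality if and only if $\mathcal N=\mathcal T^\beta_{A'\to A}$. (A4) (Uniform continuity) $\sup\{|f[\mathcal N]-f[\mathcal M]|:\mathcal N,\mathcal M\in\mathrm{Ch}(A',A),\ \tfrac12\|\mathcal N-\mathcal M\|_\diamond\le\varepsilon\}\to0$ as $\varepsilon\to0$. (A5) (Additivity) For channels $\mathcal N_{A_1'\to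 A_1}$, $\mathcal M_{A_2'\to A_2}$ with noninteracting output Hamiltonian $\widehat H_{A_1A_2}=\widehat H_{A_1}\otimes\mathbb 1_{A_2}+\mathbb 1_{A_1}\otimes\widehat H_{A_2}$, $f[\mathcal N\otimes\mathcal M]=f[\mathcal N]+f[\mathcal M]$. (A6) (Convexity; asserted for $f=F^\beta$) $F^\beta[p\mathcal N+(1-p)\mathcal M]\le pF^\beta[\mathcal N]+(1-p)F^\beta[\mathcal M]$ for $p\in[0,1]$.
   Context: All Hilbert spaces are finite-dimensional. For a system $X$ with Hamiltonian $\widehat H_X$ and $\beta>0$, $\gamma^\beta_X=e^{-\beta\widehat H_X}/Z^\beta_X$, $Z^\beta_X=\operatorname{tr}e^{-\beta\widehat H_X}$; the absolutely thermal channel is $\mathcal T^\beta_{A'\to A}(Y)=\operatorname{tr}[Y]\gamma^\beta_A$. $D$ is the Umegaki relative entropy and $D_\alpha(\rho\|\sigma)=\frac1{\alpha-1}\ln\operatorname{tr}[(\sigma^{\frac{1-\alpha}{2\alpha}}\rho\,\sigma^{\frac{1-\alpha}{2\alpha}})^\alpha]$ the sandwiched Rényi relative entropy (both $+\infty$ if $\operatorname{supp}\rho\not\subseteq\operatorname{supp}\sigma$). For any such state divergence $\mathbf D$, the channel divergence is $\mathbf D[\mathcal N\|\mathcal M]=\sup_{\psi\in\mathrm{St}(RA')}\mathbf D((\mathrm{id}_R\otimes\mathcal N)(\psi)\|(\mathrm{id}_R\otimes\mathcal M)(\psi))$ over all reference systems $R$. $F^\beta[\mathcal N]=\beta^{-1}D[\mathcal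 N\|\mathcal T^\beta]$, $F^\beta_\alpha[\mathcal N]=\beta^{-1}D_\alpha[\mathcal N\|\mathcal T^\beta]$. A superchannel $\Theta:\mathrm{Ch}(A',A)\to\mathrm{Ch}(B',B)$ is a map of the form $\Theta(\mathcal N)=\mathcal Q_{EA\to B}\circ(\mathrm{id}_E\otimes\mathcal N)\circ\mathcal P_{B'\to EA'}$ with quantum channels $\mathcal P,\mathcal Q$; it is Gibbs-preserving if $\Theta(\mathcal T^\beta_{A'\to A})=\mathcal T^\beta_{B'\to B}$. $\|\cdot\|_\diamond$ is the diamond norm. *)

theory Defs
  imports "Jordan_Normal_Form.Matrix" "HOL-Library.Extended_Real"
begin

type_synonym cmat = "complex mat"
type_synonym qmap = "complex mat \<Rightarrow> complex mat"

definition dagger :: "cmat \<Rightarrow> cmat" where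
  "dagger A = mat (dim_col A) (dim_row A) (\<lambda>(i,j). cnj (A $$ (j,i)))"

definition mtrace :: "cmat \<Rightarrow> complex" where
  "mtrace A = (\<Sum>i<dim_row A. A $$ (i,i))"

definition hermitian :: "nat \<Rightarrow> cmat \<Rightarrow> bool" where
  "hermitian d A \<longleftrightarrow> A \<in> carrier_mat d d \<and> dagger A = A"

definition unitary :: "nat \<Rightarrow> cmat \<Rightarrow> bool" where
  "unitary d U \<longleftrightarrow> U \<in> carrier_mat d d \<and> dagger U * U = 1\<^sub>m d \<and> U * dagger U = 1\<^sub>m d"

definition qform :: "cmat \<Rightarrow> complex vec \<Rightarrow> complex" where
  "qform A v = (\<Sum>i<dim_vec v. cnj (v $ i) * ((A *\<^sub>v v) $ i))"

definition psd :: "nat \<Rightarrow> cmat \<Rightarrow> bool" where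
  "psd d A \<longleftrightarrow> hermitian d A \<and>
     (\<forall>v \<in> carrier_vec d. Re (qform A v) \<ge> 0)"

definition is_state :: "nat \<Rightarrow> cmat \<Rightarrow> bool" where
  "is_state d \<rho> \<longleftrightarrow> psd d \<rho> \<and> mtrace \<rho> = 1"

text \<open>Functional calculus for Hermitian matrices via a (chosen) unitary diagonalisation
  A = U diag(lambda) U^dagger; the result does not depend on the choice.\<close>
definition mfun :: "(real \<Rightarrow> real) \<Rightarrow> nat \<Rightarrow> cmat \<Rightarrow> cmat" where
  "mfun f d A = (let (U, lam) = (SOME (U, lam). unitary d U \<and>
        A = U * mat_diag d (\<lambda>i. complex_of_real (lam i)) * dagger U)
     in U * mat_diag d (\<lambda>i. complex_of_real (f (lam i))) * dagger U)"

text \<open>Support inclusion supp rho \<subseteq> supp sigma (for PSD matrices: ker sigma \<subseteq> ker rho)\<close>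
definition supp_le :: "nat \<Rightarrow> cmat \<Rightarrow> cmat \<Rightarrow> bool" where
  "supp_le d \<rho> \<sigma> \<longleftrightarrow> (\<forall>v \<in> carrier_vec d. \<sigma> *\<^sub>v v = 0\<^sub>v d \<longrightarrow> \<rho> *\<^sub>v v = 0\<^sub>v d)"

text \<open>logarithm on the support (log 0 := 0, so that 0 log 0 = 0)\<close>
definition logp :: "real \<Rightarrow> real" where
  "logp x = (if x > 0 then ln x else 0)"

text \<open>power on the support (generalised inverse for negative exponents)\<close>
definition powp :: "real \<Rightarrow> real \<Rightarrow> real" where
  "powp s x = (if x > 0 then x powr s else 0)"

type_synonym sdiv = "nat \<Rightarrow> cmat \<Rightarrow> cmat \<Rightarrow> ereal"

definition umegaki :: sdiv where
  "umegaki d \<rho> \<sigma> = (if supp_le d \<rho> \<sigma>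
     then ereal (Re (mtrace (\<rho> * (mfun logp d \<rho> - mfun logp d \<sigma>))))
     else \<infinity>)"

definition sandwiched :: "real \<Rightarrow> sdiv" where
  "sandwiched \<alpha> d \<rho> \<sigma> = (if supp_le d \<rho> \<sigma>
     then (let S = mfun (powp ((1 - \<alpha>) / (2 * \<alpha>))) d \<sigma>
           in ereal (1 / (\<alpha> - 1) * ln (Re (mtrace (mfun (powp \<alpha>) d (S * \<rho> * S))))))
     else \<infinity>)"

definition gibbs :: "real \<Rightarrow> nat \<Rightarrow> cmat \<Rightarrow> cmat" where
  "gibbs \<beta> d H = (let E = mfun (\<lambda>x. exp (- \<beta> * x)) d H
                   in (1 / mtrace E) \<cdot>\<^sub>m E)"

text \<open>Kronecker product (first factor = most significant index)\<close>
definition kron :: "cmat \<Rightarrow> cmat \<Rightarrow> cmat" where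
  "kron A B = mat (dim_row A * dim_row B) (dim_col A * dim_col B)
     (\<lambda>(i,j). A $$ (i div dim_row B, j div dim_col B) * B $$ (i mod dim_row B, j mod dim_col B))"

definition blk :: "nat \<Rightarrow> cmat \<Rightarrow> nat \<Rightarrow> nat \<Rightarrow> cmat" where
  "blk n X p q = mat n n (\<lambda>(k,l). X $$ (p * n + k, q * n + l))"

text \<open>id_R (x) N for R of dimension r, N : C^{a'} -> C^{a} (input on R A')\<close>
definition idt :: "nat \<Rightarrow> nat \<Rightarrow> nat \<Rightarrow> qmap \<Rightarrow> qmap" where
  "idt r a' a N X = mat (r * a) (r * a)
     (\<lambda>(i,j). N (blk a' X (i div a) (j div a)) $$ (i mod a, j mod a))"

text \<open>block with respect to the second tensor factor (of dimension s), giving an n x n matrix\<close>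
definition blkL :: "nat \<Rightarrow> nat \<Rightarrow> cmat \<Rightarrow> nat \<Rightarrow> nat \<Rightarrow> cmat" where
  "blkL n s X p q = mat n n (\<lambda>(k,l). X $$ (k * s + p, l * s + q))"

text \<open>N (x) id_S for S of dimension s, N : C^{a'} -> C^{a}\<close>
definition tid :: "nat \<Rightarrow> nat \<Rightarrow> nat \<Rightarrow> qmap \<Rightarrow> qmap" where
  "tid a' a s N X = mat (a * s) (a * s)
     (\<lambda>(i,j). N (blkL a' s X (i mod s) (j mod s)) $$ (i div s, j div s))"

definition ctensor :: "nat \<Rightarrow> nat \<Rightarrow> nat \<Rightarrow> nat \<Rightarrow> qmap \<Rightarrow> qmap \<Rightarrow> qmap" where
  "ctensor a1' a1 a2' a2 N M X = tid a1' a1 a2 N (idt a1' a2' a2 M X)"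

definition linear_map :: "nat \<Rightarrow> nat \<Rightarrow> qmap \<Rightarrow> bool" where
  "linear_map a' a N \<longleftrightarrow>
     (\<forall>X \<in> carrier_mat a' a'. N X \<in> carrier_mat a a) \<and>
     (\<forall>X \<in> carrier_mat a' a'. \<forall>Y \<in> carrier_mat a' a'. N (X + Y) = N X + N Y) \<and>
     (\<forall>c. \<forall>X \<in> carrier_mat a' a'. N (c \<cdot>\<^sub>m X) = c \<cdot>\<^sub>m N X)"

definition channel :: "nat \<Rightarrow> nat \<Rightarrow> qmap \<Rightarrow> bool" where
  "channel a' a N \<longleftrightarrow> linear_map a' a N \<and>
     (\<forall>r. \<forall>X. psd (r * a') X \<longrightarrow> psd (r * a) (idt r a' a N X)) \<and>
     (\<forall>X \<in> carrier_mat a' a'. mtrace (N X) = mtrace X)"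

definition map_eq :: "nat \<Rightarrow> qmap \<Rightarrow> qmap \<Rightarrow> bool" where
  "map_eq a' N M \<longleftrightarrow> (\<forall>X \<in> carrier_mat a' a'. N X = M X)"

definition replacer :: "cmat \<Rightarrow> qmap" where
  "replacer \<omega> Y = mtrace Y \<cdot>\<^sub>m \<omega>"

definition thermal :: "real \<Rightarrow> nat \<Rightarrow> cmat \<Rightarrow> qmap" where
  "thermal \<beta> d H = replacer (gibbs \<beta> d H)"

definition chdiv :: "sdiv \<Rightarrow> nat \<Rightarrow> nat \<Rightarrow> qmap \<Rightarrow> qmap \<Rightarrow> ereal" where
  "chdiv D a' a N M = (SUP (r, \<psi>) \<in> {(r, \<psi>). is_state (r * a') \<psi>}.
       D (r * a) (idt r a' a N \<psi>) (idt r a' a M \<psi>))"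

definition chfree :: "sdiv \<Rightarrow> real \<Rightarrow> nat \<Rightarrow> nat \<Rightarrow> cmat \<Rightarrow> qmap \<Rightarrow> ereal" where
  "chfree D \<beta> a' a H N = ereal (1 / \<beta>) * chdiv D a' a N (thermal \<beta> a H)"

definition trnorm :: "nat \<Rightarrow> cmat \<Rightarrow> real" where
  "trnorm d X = Re (mtrace (mfun sqrt d (dagger X * X)))"

definition diamond :: "nat \<Rightarrow> nat \<Rightarrow> qmap \<Rightarrow> ereal" where
  "diamond a' a \<Phi> = (SUP (r, X) \<in> {(r, X). X \<in> carrier_mat (r * a') (r * a') \<and> trnorm (r * a') X \<le> 1}.
       ereal (trnorm (r * a) (idt r a' a \<Phi> X)))"

definition mapdiff :: "qmap \<Rightarrow> qmap \<Rightarrow> qmap" where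
  "mapdiff N M X = N X - M X"

definition superch :: "nat \<Rightarrow> nat \<Rightarrow> nat \<Rightarrow> qmap \<Rightarrow> qmap \<Rightarrow> qmap \<Rightarrow> qmap" where
  "superch e a' a P Q N = Q \<circ> idt e a' a N \<circ> P"

definition hamiltonian :: "nat \<Rightarrow> cmat \<Rightarrow> bool" where
  "hamiltonian d H \<longleftrightarrow> d \<ge> 1 \<and> hermitian d H"

definition A1 :: "sdiv \<Rightarrow> real \<Rightarrow> bool" where
  "A1 D \<beta> \<longleftrightarrow> (\<forall>a' a HA b' b HB e P Q N.
     a' \<ge> 1 \<longrightarrow> hamiltonian a HA \<longrightarrow> b' \<ge> 1 \<longrightarrow> hamiltonian b HB \<longrightarrow>
     channel b' (e * a') P \<longrightarrow> channel (e * a) b Q \<longrightarrow>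
     map_eq b' (superch e a' a P Q (thermal \<beta> a HA)) (thermal \<beta> b HB) \<longrightarrow>
     channel a' a N \<longrightarrow>
     chfree D \<beta> b' b HB (superch e a' a P Q N) \<le> chfree D \<beta> a' a HA N)"

definition A2 :: "sdiv \<Rightarrow> real \<Rightarrow> bool" where
  "A2 D \<beta> \<longleftrightarrow> (\<forall>a' a HA \<omega>.
     a' \<ge> 1 \<longrightarrow> hamiltonian a HA \<longrightarrow> is_state a \<omega> \<longrightarrow>
     chfree D \<beta> a' a HA (replacer \<omega>) = ereal (1 / \<beta>) * D a \<omega> (gibbs \<beta> a HA))"

definition A3 :: "sdiv \<Rightarrow> real \<Rightarrow> bool" where
  "A3 D \<beta> \<longleftrightarrow> (\<forall>a' a HA N.
     a' \<ge> 1 \<longrightarrow> hamiltonian a HA \<longrightarrow> channel a' a N \<longrightarrow>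
     chfree D \<beta> a' a HA N \<ge> 0 \<and>
     (chfree D \<beta> a' a HA N = 0 \<longleftrightarrow> map_eq a' N (thermal \<beta> a HA)))"

definition A4 :: "sdiv \<Rightarrow> real \<Rightarrow> bool" where
  "A4 D \<beta> \<longleftrightarrow> (\<forall>a' a HA.
     a' \<ge> 1 \<longrightarrow> hamiltonian a HA \<longrightarrow>
     ((\<lambda>\<epsilon>::real. SUP (N, M) \<in> {(N, M). channel a' a N \<and> channel a' a M \<and>
           ereal (1/2) * diamond a' a (mapdiff N M) \<le> ereal \<epsilon>}.
         \<bar>chfree D \<beta> a' a HA N - chfree D \<beta> a' a HA M\<bar>) \<longlongrightarrow> 0) (at_right 0))"

definition A5 :: "sdiv \<Rightarrow> real \<Rightarrow> bool" where
  "A5 D \<beta> \<longleftrightarrow> (\<forall>a1' a1 H1 a2' a2 H2 N M.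
     a1' \<ge> 1 \<longrightarrow> hamiltonian a1 H1 \<longrightarrow> a2' \<ge> 1 \<longrightarrow> hamiltonian a2 H2 \<longrightarrow>
     channel a1' a1 N \<longrightarrow> channel a2' a2 M \<longrightarrow>
     chfree D \<beta> (a1' * a2') (a1 * a2) (kron H1 (1\<^sub>m a2) + kron (1\<^sub>m a1) H2) (ctensor a1' a1 a2' a2 N M)
       = chfree D \<beta> a1' a1 H1 N + chfree D \<beta> a2' a2 H2 M)"

definition mixmap :: "nat \<Rightarrow> real \<Rightarrow> qmap \<Rightarrow> qmap \<Rightarrow> qmap" where
  "mixmap a p N M X = mat a a (\<lambda>ij. complex_of_real p * N X $$ ij + complex_of_real (1 - p) * M X $$ ij)"

definition mixture :: "nat \<Rightarrow> 'x set \<Rightarrow> ('x \<Rightarrow> real) \<Rightarrow> ('x \<Rightarrow> qmap) \<Rightarrow> qmap" where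
  "mixture a I p N X = mat a a (\<lambda>ij. \<Sum>x\<in>I. complex_of_real (p x) * N x X $$ ij)"

definition A6 :: "sdiv \<Rightarrow> real \<Rightarrow> bool" where
  "A6 D \<beta> \<longleftrightarrow> (\<forall>a' a HA N M p.
     a' \<ge> 1 \<longrightarrow> hamiltonian a HA \<longrightarrow> channel a' a N \<longrightarrow> channel a' a M \<longrightarrow>
     0 \<le> p \<longrightarrow> p \<le> 1 \<longrightarrow>
     chfree D \<beta> a' a HA (mixmap a p N M)
       \<le> ereal p * chfree D \<beta> a' a HA N + ereal (1 - p) * chfree D \<beta> a' a HA M)"

definition quasiconvex :: "sdiv \<Rightarrow> real \<Rightarrow> 'x itself \<Rightarrow> bool" where
  "quasiconvex D \<beta> _ \<longleftrightarrow> (\<forall>a' a HA (I :: 'x set) p N.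
     a' \<ge> 1 \<longrightarrow> hamiltonian a HA \<longrightarrow> finite I \<longrightarrow> I \<noteq> {} \<longrightarrow>
     (\<forall>x\<in>I. p x \<ge> 0) \<longrightarrow> (\<Sum>x\<in>I. p x) = 1 \<longrightarrow> (\<forall>x\<in>I. channel a' a (N x)) \<longrightarrow>
     chfree D \<beta> a' a HA (mixture a I p N) \<le> Max ((\<lambda>x. chfree D \<beta> a' a HA (N x)) ` I))"

end

theory Submission
  imports Defs "HOL-Complex_Analysis.Complex_Analysis" "Jordan_Normal_Form.Schur_Decomposition"
    "HOL-Real_Asymp.Real_Asymp"
begin

text \<open>
  Matrices of all sizes are placed in the algebra of finitely supported matrices over an arbitrary
  index type, in which reference systems and tensor factors are changed by relabelling.

  Data processing comes from complex interpolation. The three lines theorem for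
  \<open>tr \<Phi>(\<sigma>\<^sup>z\<^sup>/\<^sup>2 \<omega>\<^sup>1\<^sup>-\<^sup>z \<sigma>\<^sup>z\<^sup>/\<^sup>2) \<Phi>(\<sigma>)\<^sup>-\<^sup>z\<^sup>/\<^sup>2 \<tau>\<^sup>z \<Phi>(\<sigma>)\<^sup>-\<^sup>z\<^sup>/\<^sup>2\<close> with states \<open>\<omega>\<close>, \<open>\<tau>\<close> gives, by
  Schatten duality, the case of the sandwiched divergence of order \<open>1 / (1 - p)\<close>. A similar
  function gives Uhlmann's inequality \<open>tr \<rho>\<^sup>1\<^sup>-\<^sup>p \<sigma>\<^sup>p \<le> tr \<Phi>(\<rho>)\<^sup>1\<^sup>-\<^sup>p \<Phi>(\<sigma>)\<^sup>p\<close>, and its derivative at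
  \<open>p = 0\<close> is the case of the Umegaki divergence.

  Every output of a channel is dominated by the decoupled state, \<open>\<N>(\<psi>) \<le> C \<psi>\<^sub>R \<otimes> \<gamma>\<close>, since
  \<open>\<gamma>\<close> has full rank. Hence the channel divergences are finite. The same bound for a difference of
  channels reads \<open>\<N>(\<psi>) \<le> \<M>(\<psi>) + \<delta> \<psi>\<^sub>R \<otimes> \<gamma>\<close> with \<open>\<delta>\<close> proportional to the diamond norm,
  and the divergences are continuous under such perturbations, which is (A4). Monotonicity (A1) is
  data processing for the post-processing channel, because Gibbs preservation rewrites the thermal
  output as the image of a thermal output. For (A3) a maximally entangled input is tested. In (A5)
  product inputs give superadditivity; subadditivity follows from the chain rule
  \<open>D(\<N>(\<phi>) \<parallel> \<eta> \<otimes> \<gamma>) \<le> D[\<N> \<parallel> \<T>] + D(\<phi>\<^sub>R \<parallel> \<eta>)\<close>, where the reference of the first channel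
  contains the output of the second one.
\<close>


text \<open>An arbitrary index type leaves the algebra without a unit, so everything is tied to
  supports: the functional calculus discards the eigenvalue 0, \<open>sp A\<close> is the support
  projection, and \<open>sp S * R = R\<close> expresses that the support of \<open>R\<close> lies in
  that of \<open>S\<close>. This matches the conventions \<open>logp\<close> and
  \<open>powp\<close>, but not the exponential of a Hamiltonian, which is handled through complete
  spectral families instead. For the pairs met here the divergences are finite: a multiple of the
  second argument dominates the first, and domination yields the support inclusion. The sandwiched
  case is parametrised by p = (\<alpha> - 1) / \<alpha>. The divergence is then the logarithm of a
  Schatten norm divided by p, and p is the interpolation parameter itself. Interpolation sees maps
  only through positivity, a trace bound and a Cauchy-Schwarz inequality, so the partial trace and
  amplified channels are treated alike. Data processing for the partial trace also yields tr A log A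
  \<le> tr A log C for A \<le> C, on which finiteness and continuity in the Umegaki case
  rest.\<close>

class cvs = ab_group_add +
  fixes cs :: "complex \<Rightarrow> 'a \<Rightarrow> 'a" (infixr "*\<^sub>c" 75)
  assumes cs_add_right: "c *\<^sub>c (x + y) = c *\<^sub>c x + c *\<^sub>c y"
    and cs_add_left: "(b + c) *\<^sub>c x = b *\<^sub>c x + c *\<^sub>c x"
    and cs_cs: "b *\<^sub>c (c *\<^sub>c x) = (b * c) *\<^sub>c x"
    and cs_one: "1 *\<^sub>c x = x"
begin

lemma cs_zero_left [simp]: "0 *\<^sub>c x = 0"
  using cs_add_left[of 0 0 x] by simp

lemma cs_zero_right [simp]: "c *\<^sub>c 0 = 0"
  using cs_add_right[of c 0 0] by simp

lemma cs_minus_left: "(- c) *\<^sub>c x = - (c *\<^sub>c x)"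
  using cs_add_left[of c "- c" x] by (simp add: eq_neg_iff_add_eq_0 add.commute)

lemma cs_diff_right: "c *\<^sub>c (x - y) = c *\<^sub>c x - c *\<^sub>c y"
  using cs_add_right[of c "x - y" y] by (simp add: eq_diff_eq)

lemma cs_diff_left: "(b - c) *\<^sub>c x = b *\<^sub>c x - c *\<^sub>c x"
  using cs_add_left[of b "- c" x] by (simp add: cs_minus_left)

lemma cs_sum_right: "c *\<^sub>c sum f S = (\<Sum>i\<in>S. c *\<^sub>c f i)"
  by (induct S rule: infinite_finite_induct) (simp_all add: cs_add_right)

end

instantiation complex :: cvs
begin
definition "cs_complex (c::complex) x = c * x"
instance by standard (auto simp: cs_complex_def algebra_simps)
end

lemmas [simp] = cs_complex_def cs_one

abbreviation rs :: "real \<Rightarrow> 'a::cvs \<Rightarrow> 'a" (infixr "*\<^sub>r" 75) where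
  "r *\<^sub>r x \<equiv> complex_of_real r *\<^sub>c x"

definition lin :: "('a::cvs \<Rightarrow> 'b::cvs) \<Rightarrow> bool" where
  "lin f \<longleftrightarrow> (\<forall>x y. f (x + y) = f x + f y) \<and> (\<forall>c x. f (c *\<^sub>c x) = c *\<^sub>c f x)"

lemma linI: "(\<And>x y. f (x + y) = f x + f y) \<Longrightarrow> (\<And>c x. f (c *\<^sub>c x) = c *\<^sub>c f x) \<Longrightarrow> lin f"
  by (simp add: lin_def)

lemma lin_add: "lin f \<Longrightarrow> f (x + y) = f x + f y"
  and lin_cs: "lin f \<Longrightarrow> f (c *\<^sub>c x) = c *\<^sub>c f x"
  by (simp_all add: lin_def)

lemma lin_zero: assumes "lin f" shows "f 0 = 0"
  using lin_cs[OF assms, of 0 0] by simp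

lemma lin_minus: assumes "lin f" shows "f (- x) = - f x"
  using lin_cs[OF assms, of "-1" x] by (simp add: cs_minus_left)

lemma lin_diff: assumes "lin f" shows "f (x - y) = f x - f y"
  using lin_add[OF assms, of x "- y"] lin_minus[OF assms, of y] by simp

lemma lin_sum: assumes "lin f" shows "f (sum g S) = (\<Sum>i\<in>S. f (g i))"
  by (induct S rule: infinite_finite_induct) (simp_all add: lin_add[OF assms] lin_zero[OF assms])

lemmas lin_simps = lin_add lin_cs lin_zero lin_minus lin_diff lin_sum

section \<open>Matrices of finite support\<close>

text \<open>No dimension is stored, so sums and products are total and laws such as associativity
  hold without carrier conditions. Units exist only locally, as \<open>one S\<close> for finite
  \<open>S\<close>.\<close>

typedef 'i fm = "{f :: 'i \<Rightarrow> 'i \<Rightarrow> complex. finite {p. f (fst p) (snd p) \<noteq> 0}}"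
  morphisms ent Fm
  by (rule exI[of _ "\<lambda>_ _. 0"]) auto

setup_lifting type_definition_fm

lemma fm_eqI: "(\<And>i j. ent A i j = ent B i j) \<Longrightarrow> A = B"
  by (simp add: ent_inject[symmetric] fun_eq_iff)

instantiation fm :: (type) cvs
begin
lift_definition zero_fm :: "'a fm" is "\<lambda>_ _. 0" by simp
lift_definition plus_fm :: "'a fm \<Rightarrow> 'a fm \<Rightarrow> 'a fm" is "\<lambda>f g i j. f i j + g i j"
  subgoal for f g
    by (rule finite_subset[of _ "{p. f (fst p) (snd p) \<noteq> 0} \<union> {p. g (fst p) (snd p) \<noteq> 0}"]) auto
  done
lift_definition minus_fm :: "'a fm \<Rightarrow> 'a fm \<Rightarrow> 'a fm" is "\<lambda>f g i j. f i j - g i j"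
  subgoal for f g
    by (rule finite_subset[of _ "{p. f (fst p) (snd p) \<noteq> 0} \<union> {p. g (fst p) (snd p) \<noteq> 0}"]) auto
  done
lift_definition uminus_fm :: "'a fm \<Rightarrow> 'a fm" is "\<lambda>f i j. - f i j" by simp
lift_definition cs_fm :: "complex \<Rightarrow> 'a fm \<Rightarrow> 'a fm" is "\<lambda>c f i j. c * f i j"
  subgoal for c f
    by (rule finite_subset[of _ "{p. f (fst p) (snd p) \<noteq> 0}"]) auto
  done
instance
  by standard (transfer; auto simp: fun_eq_iff algebra_simps)+
end

lift_definition unit :: "'i \<Rightarrow> 'i \<Rightarrow> 'i fm" is "\<lambda>i j k l. if k = i \<and> l = j then 1 else 0"
  subgoal for i j by (rule finite_subset[of _ "{(i, j)}"]) auto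
  done

lift_definition dg :: "'i fm \<Rightarrow> 'i fm" is "\<lambda>f i j. cnj (f j i)"
  subgoal for f
    by (rule finite_subset[of _ "prod.swap ` {p. f (fst p) (snd p) \<noteq> 0}"])
      (auto simp: image_iff split: prod.splits)
  done

lemma ent_simps [simp]:
  "ent 0 i j = 0" "ent (A + B) i j = ent A i j + ent B i j"
  "ent (A - B) i j = ent A i j - ent B i j" "ent (- A) i j = - ent A i j"
  "ent (c *\<^sub>c A) i j = c * ent A i j"
  "ent (unit k l) i j = (if i = k \<and> j = l then 1 else 0)"
  "ent (dg A) i j = cnj (ent A j i)"
  by (transfer; simp)+

lemma ent_sum [simp]: "ent (sum f S) i j = (\<Sum>x\<in>S. ent (f x) i j)"
  by (induct S rule: infinite_finite_induct) auto

definition supp :: "'i fm \<Rightarrow> ('i \<times> 'i) set" where "supp A = {p. ent A (fst p) (snd p) \<noteq> 0}"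

lemma finite_supp [simp]: "finite (supp A)"
  unfolding supp_def by transfer simp

lemma fm_expand:
  assumes "finite S" "supp A \<subseteq> S"
  shows "A = (\<Sum>p\<in>S. ent A (fst p) (snd p) *\<^sub>c unit (fst p) (snd p))"
proof (rule fm_eqI)
  fix i j
  have "(\<Sum>p\<in>S. ent A (fst p) (snd p) * (if i = fst p \<and> j = snd p then 1 else 0))
      = (\<Sum>p\<in>S. if p = (i, j) then ent A i j else 0)"
    by (rule sum.cong) auto
  also have "\<dots> = ent A i j"
  proof -
    have "ent A i j = 0" if "(i, j) \<notin> S"
      using subsetD[OF assms(2), of "(i, j)"] that by (auto simp: supp_def)
    then show ?thesis using assms(1) by (auto simp: sum.delta)
  qed
  finally show "ent A i j = ent (\<Sum>p\<in>S. ent A (fst p) (snd p) *\<^sub>c unit (fst p) (snd p)) i j"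
    by simp
qed

text \<open>Identities between linear expressions are verified on matrix units only. Three clauses
  instead of an explicit expansion make this usable as an induction rule on each argument in
  turn.\<close>

lemma fm_induct [case_names zero add unit]:
  assumes "P 0" "\<And>A B. P A \<Longrightarrow> P B \<Longrightarrow> P (A + B)" "\<And>c i j. P (c *\<^sub>c unit i j)"
  shows "P A"
proof -
  have *: "P (\<Sum>p\<in>S. f p *\<^sub>c unit (fst p) (snd p))" for S :: "('a \<times> 'a) set" and f
    by (induct S rule: infinite_finite_induct) (auto intro: assms)
  have e: "A = (\<Sum>p\<in>supp A. ent A (fst p) (snd p) *\<^sub>c unit (fst p) (snd p))"
    by (rule fm_expand) simp_all
  show ?thesis by (rule ssubst[where P = P, OF e]) (rule *)
qed

lemma lin_eqI:
  assumes "lin f" "lin g" "\<And>i j. f (unit i j) = g (unit i j)"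
  shows "f A = g A"
  by (induct A rule: fm_induct) (simp_all add: lin_simps assms)

text \<open>Linear extension from values on matrix units. Product, trace, tensor product, partial
  trace and amplification are all defined this way, so their linearity comes for free.\<close>

definition lext :: "('i \<Rightarrow> 'i \<Rightarrow> 'b::cvs) \<Rightarrow> 'i fm \<Rightarrow> 'b" where
  "lext \<phi> A = (\<Sum>p\<in>supp A. ent A (fst p) (snd p) *\<^sub>c \<phi> (fst p) (snd p))"

lemma lext_superset:
  assumes "finite S" "supp A \<subseteq> S"
  shows "lext \<phi> A = (\<Sum>p\<in>S. ent A (fst p) (snd p) *\<^sub>c \<phi> (fst p) (snd p))"
  unfolding lext_def using assms by (intro sum.mono_neutral_left) (auto simp: supp_def)

lemma lin_lext: "lin (lext \<phi>)"
proof (rule linI)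
  fix A B :: "'a fm" and c
  let ?S = "supp A \<union> supp B"
  have "supp (A + B) \<subseteq> ?S" by (auto simp: supp_def)
  then show "lext \<phi> (A + B) = lext \<phi> A + lext \<phi> B"
    by (simp add: lext_superset[of ?S] cs_add_left sum.distrib)
  have "supp (c *\<^sub>c A) \<subseteq> supp A" by (auto simp: supp_def)
  then show "lext \<phi> (c *\<^sub>c A) = c *\<^sub>c lext \<phi> A"
    by (simp add: lext_superset[of "supp A"] cs_cs cs_sum_right)
qed

lemma lext_unit [simp]: "lext \<phi> (unit i j) = \<phi> i j"
proof -
  have "supp (unit i j) = {(i, j)}" by (auto simp: supp_def)
  then show ?thesis by (simp add: lext_def)
qed

lemmas lext_simps [simp] = lin_simps[OF lin_lext]

lemma lin_lext_arg:
  assumes "\<And>i j. lin (\<lambda>x. \<phi> x i j)"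
  shows "lin (\<lambda>x. lext (\<phi> x) A)"
  by (rule linI)
    (simp_all add: lext_def lin_add[OF assms] lin_cs[OF assms] cs_add_right sum.distrib
      cs_sum_right cs_cs mult.commute)

instantiation fm :: (type) ring
begin
definition "times_fm A B = lext (\<lambda>i j. lext (\<lambda>k l. if j = k then unit i l else 0) B) A"

lemma lin_mult_left: "lin (\<lambda>A. A * (B :: 'b fm))"
  unfolding times_fm_def by (rule lin_lext)

lemma lin_mult_right: "lin (\<lambda>B. (A :: 'b fm) * B)"
  unfolding times_fm_def by (rule lin_lext_arg) (rule lin_lext)

lemma unit_mult_unit: "unit i j * unit k l = (if j = k then unit i l else (0 :: 'b fm))"
  by (simp add: times_fm_def)

lemma mult_assoc_fm: "(A * B) * C = A * (B * (C :: 'b fm))"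
proof (induct A rule: fm_induct)
  case (unit c i j)
  show ?case
  proof (induct B rule: fm_induct)
    case (unit d k l)
    show ?case
      by (induct C rule: fm_induct)
        (simp_all add: lin_simps[OF lin_mult_left] lin_simps[OF lin_mult_right] unit_mult_unit)
  qed (simp_all add: lin_simps[OF lin_mult_left] lin_simps[OF lin_mult_right])
qed (simp_all add: lin_simps[OF lin_mult_left] lin_simps[OF lin_mult_right])

instance
  by standard (simp_all add: mult_assoc_fm lin_add[OF lin_mult_left] lin_add[OF lin_mult_right])
end

lemmas unit_mult_unit [simp]

lemma cs_mult_left [simp]: "(c *\<^sub>c A) * B = c *\<^sub>c (A * (B :: 'i fm))"
  and cs_mult_right [simp]: "A * (c *\<^sub>c B) = c *\<^sub>c (A * (B :: 'i fm))"
  using lin_cs[OF lin_mult_left, of c A B] lin_cs[OF lin_mult_right, of A c B] by simp_all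

text \<open>\<open>S\<close> has to contain the columns of the left factor only, so the right factor
  may be any matrix; entries of products with embedded concrete matrices are computed this way
  later.\<close>

lemma ent_mult:
  assumes "finite S" "\<And>i j. ent A i j \<noteq> 0 \<Longrightarrow> j \<in> S"
  shows "ent (A * B) i k = (\<Sum>j\<in>S. ent A i j * ent B j k)"
proof -
  have *: "ent (A * B) i k = lext (\<lambda>i' j. if i = i' then ent B j k else 0) A" for A
  proof (rule lin_eqI)
    fix a b
    show "ent (unit a b * B) i k = lext (\<lambda>i' j. if i = i' then ent B j k else 0) (unit a b)"
      by (induct B rule: fm_induct) (simp_all add: distrib_left)
  qed (auto intro!: linI simp: distrib_right)
  have sub: "supp A \<subseteq> fst ` supp A \<times> S"
  proof
    fix p assume p: "p \<in> supp A"
    then have "snd p \<in> S" using assms(2)[of "fst p" "snd p"] by (simp add: supp_def)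
    then show "p \<in> fst ` supp A \<times> S" using p by (simp add: mem_Times_iff)
  qed
  have "ent (A * B) i k = (\<Sum>p\<in>fst ` supp A \<times> S. ent A (fst p) (snd p) * (if i = fst p then ent B (snd p) k else 0))"
    unfolding * by (subst lext_superset[OF _ sub]) (use assms(1) in simp_all)
  also have "\<dots> = (\<Sum>x\<in>fst ` supp A. \<Sum>y\<in>S. ent A x y * (if i = x then ent B y k else 0))"
    by (simp add: sum.cartesian_product' cong: if_cong)
  also have "\<dots> = (\<Sum>i'\<in>fst ` supp A. if i = i' then (\<Sum>j\<in>S. ent A i j * ent B j k) else 0)"
    by (intro sum.cong refl) auto
  also have "\<dots> = (\<Sum>j\<in>S. ent A i j * ent B j k)"
    by (auto intro!: sum.neutral) (force simp: supp_def image_iff)+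
  finally show ?thesis .
qed

subsection \<open>Adjoint and trace\<close>

lemma dg_simps [simp]:
  "dg (0 :: 'i fm) = 0" "dg (A + B) = dg A + dg B" "dg (A - B) = dg A - dg (B :: 'i fm)"
  "dg (- A) = - dg A" "dg (c *\<^sub>c A) = cnj c *\<^sub>c dg A" "dg (dg A) = A" "dg (unit i j) = unit j i"
  by (auto intro!: fm_eqI)

lemma dg_sum [simp]: "dg (sum f S) = (\<Sum>x\<in>S. dg (f x))"
  by (induct S rule: infinite_finite_induct) auto

lemma dg_mult [simp]: "dg (A * B) = dg B * dg (A :: 'i fm)"
proof (induct A rule: fm_induct)
  case (unit c i j)
  show ?case by (induct B rule: fm_induct) (simp_all add: algebra_simps cs_cs cs_add_right)
qed (simp_all add: algebra_simps)

definition tr :: "'i fm \<Rightarrow> complex" where "tr = lext (\<lambda>i j. if i = j then 1 else 0)"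

lemma lin_tr: "lin tr" unfolding tr_def by (rule lin_lext)
lemmas tr_simps [simp] = lin_simps[OF lin_tr, unfolded cs_complex_def]

lemma tr_unit [simp]: "tr (unit i j) = (if i = j then 1 else 0)" by (simp add: tr_def)

lemma tr_dg [simp]: "tr (dg A) = cnj (tr A)"
  by (induct A rule: fm_induct) simp_all

lemma tr_commute: "tr (A * B) = tr (B * (A :: 'i fm))"
proof (induct A rule: fm_induct)
  case (unit c i j)
  have "tr (unit i j * B) = tr (B * unit i j)"
    by (induct B rule: fm_induct) (simp_all add: algebra_simps)
  then show ?case by simp
qed (simp_all add: algebra_simps)

lemma tr_ent:
  assumes "finite S" "\<And>i. ent A i i \<noteq> 0 \<Longrightarrow> i \<in> S"
  shows "tr A = (\<Sum>i\<in>S. ent A i i)"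
proof -
  have "tr A = (\<Sum>p\<in>supp A \<union> (\<lambda>i. (i,i)) ` S. ent A (fst p) (snd p) * (if fst p = snd p then 1 else 0))"
    unfolding tr_def by (subst lext_superset[of "supp A \<union> (\<lambda>i. (i,i)) ` S"]) (use assms in auto)
  also have "\<dots> = (\<Sum>p\<in>(\<lambda>i. (i,i)) ` S. ent A (fst p) (snd p) * (if fst p = snd p then 1 else 0))"
    using assms by (intro sum.mono_neutral_right) (force simp: image_iff)+
  also have "\<dots> = (\<Sum>i\<in>S. ent A i i)"
    by (subst sum.reindex) (auto simp: inj_on_def)
  finally show ?thesis .
qed

lemma tr_dg_mult_self:
  assumes "finite S" "supp A \<subseteq> S \<times> S"
  shows "tr (dg A * A) = complex_of_real (\<Sum>i\<in>S. \<Sum>j\<in>S. (cmod (ent A j i))\<^sup>2)"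
proof -
  have S: "ent A i j \<noteq> 0 \<Longrightarrow> i \<in> S \<and> j \<in> S" for i j
    using assms(2) by (force simp: supp_def)
  have e: "ent (dg A * A) i k = (\<Sum>j\<in>S. cnj (ent A j i) * ent A j k)" for i k
    by (subst ent_mult[of S]) (use assms(1) S in auto)
  have "tr (dg A * A) = (\<Sum>i\<in>S. ent (dg A * A) i i)"
    by (rule tr_ent)
      (use assms(1) S in \<open>auto simp: e elim: sum.not_neutral_contains_not_neutral\<close>)
  then show ?thesis
    by (simp add: e complex_norm_square[symmetric] mult.commute)
qed

lemma supp_box:
  obtains S where "finite S" "supp A \<subseteq> S \<times> S"
proof (rule that)
  show "supp A \<subseteq> (fst ` supp A \<union> snd ` supp A) \<times> (fst ` supp A \<union> snd ` supp A)"
    by (rule subrelI) (metis UnCI fst_conv image_eqI mem_Sigma_iff snd_conv)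
qed simp

lemma tr_dg_mult_nonneg: "0 \<le> Re (tr (dg A * A))" "Im (tr (dg A * A)) = 0"
proof -
  obtain S where s: "finite S" "supp A \<subseteq> S \<times> S" by (rule supp_box)
  show "0 \<le> Re (tr (dg A * A))" "Im (tr (dg A * A)) = 0"
    by (auto simp: tr_dg_mult_self[OF s] sum_nonneg simp del: of_real_sum)
qed

text \<open>Definiteness of the Hilbert-Schmidt form. Support identities below are proved by naming
  the defect \<open>G\<close> and showing that \<open>dg G * G\<close> has trace zero.\<close>

lemma dg_mult_self_zero:
  assumes "tr (dg A * A) = 0" shows "A = 0"
proof -
  obtain S where s: "finite S" "supp A \<subseteq> S \<times> S" by (rule supp_box)
  have z: "(\<Sum>i\<in>S. \<Sum>j\<in>S. (cmod (ent A j i))\<^sup>2) = 0"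
    using assms by (simp add: tr_dg_mult_self[OF s] del: of_real_sum)
  have "(\<Sum>j\<in>S. (cmod (ent A j i))\<^sup>2) = 0" if "i \<in> S" for i
    using z that sum_nonneg_eq_0_iff[of S "\<lambda>i. \<Sum>j\<in>S. (cmod (ent A j i))\<^sup>2"] s(1)
    by (simp add: sum_nonneg)
  then have "ent A j i = 0" if "i \<in> S" "j \<in> S" for i j
    using that sum_nonneg_eq_0_iff[of S "\<lambda>j. (cmod (ent A j i))\<^sup>2"] s(1) by simp
  then have "ent A i j = 0" for i j
    using subsetD[OF s(2), of "(i, j)"] by (cases "(i, j) \<in> supp A") (auto simp: supp_def)
  then show ?thesis by (auto intro!: fm_eqI)
qed

lemma tr_cauchy_schwarz: "2 * Re (tr (dg A * B)) \<le> Re (tr (dg A * A)) + Re (tr (dg B * B))"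
proof -
  have "Re (tr (dg (A - B) * (A - B))) \<ge> 0" by (rule tr_dg_mult_nonneg)
  moreover have "tr (dg B * A) = cnj (tr (dg A * B))"
    by (simp flip: tr_dg)
  ultimately show ?thesis by (simp add: algebra_simps)
qed

subsection \<open>Local units, tensor products and relabelling\<close>

definition one :: "'i set \<Rightarrow> 'i fm" where "one S = (\<Sum>i\<in>S. unit i i)"

lemma ent_one: "finite S \<Longrightarrow> ent (one S) i j = (if i = j \<and> i \<in> S then 1 else 0)"
proof -
  assume S: "finite S"
  have "ent (one S) i j = (\<Sum>k\<in>S. if i = k then (if i = j then 1 else 0) else 0)"
    unfolding one_def by (simp only: ent_sum, rule sum.cong) auto
  then show ?thesis using S by simp
qed

lemma dg_one [simp]: "dg (one S) = one S" by (simp add: one_def)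

lemma one_mult_unit [simp]: "finite S \<Longrightarrow> one S * unit i j = (if i \<in> S then unit i j else 0)"
proof -
  assume S: "finite S"
  have "one S * unit i j = (\<Sum>k\<in>S. if i = k then unit i j else 0)"
    unfolding one_def by (simp only: sum_distrib_right, rule sum.cong) auto
  then show ?thesis using S by simp
qed

lemma unit_mult_one [simp]: "finite S \<Longrightarrow> unit i j * one S = (if j \<in> S then unit i j else 0)"
proof -
  assume S: "finite S"
  have "dg (one S * unit j i) = (if j \<in> S then unit i j else 0)" using S by simp
  then show ?thesis by simp
qed

lemma one_mult_one [simp]: "finite S \<Longrightarrow> one S * one S = one S"
  by (subst (2 3) one_def) (simp add: sum_distrib_left)

lemma tr_one [simp]: "tr (one S) = of_nat (card S)"
  by (simp add: one_def)

lemma ent_one_mult: "finite S \<Longrightarrow> ent (one S * A) i j = (if i \<in> S then ent A i j else 0)"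
proof -
  assume S: "finite S"
  have "ent (one S * A) i j = (\<Sum>k\<in>S. ent (one S) i k * ent A k j)"
    using S by (intro ent_mult) (auto simp: ent_one split: if_splits)
  also have "\<dots> = (\<Sum>k\<in>S. if i = k then ent A i j else 0)"
    using S by (intro sum.cong) (auto simp: ent_one)
  finally have "ent (one S * A) i j = (\<Sum>k\<in>S. if i = k then ent A i j else 0)" .
  then show ?thesis using S by simp
qed

lemma ent_mult_one: "finite S \<Longrightarrow> ent (A * one S) i j = (if j \<in> S then ent A i j else 0)"
  using ent_one_mult[of S "dg A" j i] ent_simps(7)[of "one S * dg A" i j] by auto

lemma supp_subD: "supp A \<subseteq> S \<times> T \<Longrightarrow> ent A i j \<noteq> 0 \<Longrightarrow> i \<in> S \<and> j \<in> T"
  by (drule subsetD[of _ _ "(i, j)"]) (auto simp: supp_def)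

lemma one_mult_left: "finite S \<Longrightarrow> supp A \<subseteq> S \<times> S \<Longrightarrow> one S * A = A"
  by (rule fm_eqI) (auto simp: ent_one_mult dest: supp_subD)

lemma one_mult_right: "finite S \<Longrightarrow> supp A \<subseteq> S \<times> S \<Longrightarrow> A * one S = A"
  by (rule fm_eqI) (auto simp: ent_mult_one dest: supp_subD)

definition tn :: "'i fm \<Rightarrow> 'j fm \<Rightarrow> ('i \<times> 'j) fm" (infixl "\<star>" 70) where
  "A \<star> B = lext (\<lambda>i j. lext (\<lambda>k l. unit (i, k) (j, l)) B) A"

lemma lin_tn_left: "lin (\<lambda>A. A \<star> B)"
  unfolding tn_def by (rule lin_lext)

lemma lin_tn_right: "lin (\<lambda>B. A \<star> B)"
  unfolding tn_def by (rule lin_lext_arg) (rule lin_lext)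

lemmas tn_simps [simp] = lin_simps[OF lin_tn_left] lin_simps[OF lin_tn_right]

lemma tn_unit [simp]: "unit i j \<star> unit k l = unit (i, k) (j, l)"
  by (simp add: tn_def)

lemma ent_tn [simp]: "ent (A \<star> B) (i, k) (j, l) = ent A i j * ent B k l"
proof (induct A rule: fm_induct)
  case (unit c a b)
  have "ent (unit a b \<star> B) (i, k) (j, l) = ent (unit a b) i j * ent B k l"
    by (induct B rule: fm_induct) (simp_all add: algebra_simps)
  then show ?case by simp
qed (simp_all add: algebra_simps)

lemma tn_unit_mult_unit: "(unit i j \<star> B) * (unit k l \<star> D) = (if j = k then unit i l \<star> (B * D) else 0)"
proof (induct B rule: fm_induct)
  case (unit c a b)
  show ?case by (induct D rule: fm_induct) (simp_all add: algebra_simps)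
qed (simp_all add: algebra_simps)

lemma tn_mult [simp]: "(A \<star> B) * (C \<star> D) = (A * C) \<star> (B * D)"
proof (induct A rule: fm_induct)
  case (unit c i j)
  show ?case by (induct C rule: fm_induct) (simp_all add: algebra_simps tn_unit_mult_unit)
qed (simp_all add: algebra_simps)

lemma dg_tn [simp]: "dg (A \<star> B) = dg A \<star> dg B"
  by (rule fm_eqI) (auto simp: split_paired_all)

lemma tr_tn [simp]: "tr (A \<star> B) = tr A * tr B"
proof (induct A rule: fm_induct)
  case (unit c i j)
  have "tr (unit i j \<star> B) = tr (unit i j) * tr B"
    by (induct B rule: fm_induct) (simp_all add: algebra_simps)
  then show ?case by simp
qed (simp_all add: algebra_simps)

text \<open>Along an injection this is a trace-preserving embedding of algebras, so it serves both
  to rearrange tensor factors and to encode countable references in \<open>nat\<close>.\<close>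

definition reix :: "('i \<Rightarrow> 'j) \<Rightarrow> 'i fm \<Rightarrow> 'j fm" where
  "reix e = lext (\<lambda>i j. unit (e i) (e j))"

lemma lin_reix: "lin (reix e)" unfolding reix_def by (rule lin_lext)
lemmas reix_simps [simp] = lin_simps[OF lin_reix]

lemma reix_unit [simp]: "reix e (unit i j) = unit (e i) (e j)" by (simp add: reix_def)

lemma dg_reix [simp]: "dg (reix e A) = reix e (dg A)"
  by (induct A rule: fm_induct) simp_all

lemma reix_mult:
  assumes "inj e" shows "reix e (A * B) = reix e A * reix e B"
proof (induct A rule: fm_induct)
  case (unit c i j)
  have "reix e (unit i j * B) = unit (e i) (e j) * reix e B"
    by (induct B rule: fm_induct) (auto simp: algebra_simps inj_eq[OF assms])
  then show ?case by simp
qed (simp_all add: algebra_simps)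

lemma tr_reix:
  assumes "inj e" shows "tr (reix e A) = tr A"
  by (induct A rule: fm_induct) (auto simp: inj_eq[OF assms])

lemma ent_reix:
  assumes "inj e" shows "ent (reix e A) (e i) (e j) = ent A i j"
  by (induct A rule: fm_induct) (auto simp: inj_eq[OF assms])

lemma reix_inject:
  assumes "inj e" "reix e A = reix e B" shows "A = B"
  by (rule fm_eqI) (metis assms ent_reix)

lemma reix_id [simp]: "reix id A = A"
  by (induct A rule: fm_induct) simp_all

lemma reix_tn: "reix e A \<star> reix f B = reix (map_prod e f) (A \<star> B)"
proof (induct A rule: fm_induct)
  case (unit c i j)
  show ?case by (induct B rule: fm_induct) (simp_all add: algebra_simps)
qed (simp_all add: algebra_simps)

text \<open>Matrices \<open>B\<close> replace test vectors: the trace is the sum of the quadratic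
  forms of the columns of \<open>B\<close>, so no space of vectors over the index type has to be
  introduced.\<close>

definition fpsd :: "'i fm \<Rightarrow> bool" where
  "fpsd A \<longleftrightarrow> dg A = A \<and> (\<forall>B. 0 \<le> Re (tr (dg B * A * B)))"

lemma fpsd_dg: "fpsd A \<Longrightarrow> dg A = A" by (simp add: fpsd_def)

lemma fpsd_conj_tr: "fpsd A \<Longrightarrow> 0 \<le> Re (tr (dg B * A * B))" by (simp add: fpsd_def)

lemma fpsd_zero [simp]: "fpsd 0" by (simp add: fpsd_def)

lemma fpsd_add: "fpsd A \<Longrightarrow> fpsd B \<Longrightarrow> fpsd (A + B)"
  by (simp add: fpsd_def algebra_simps)

lemma fpsd_cs: "fpsd A \<Longrightarrow> 0 \<le> r \<Longrightarrow> fpsd (r *\<^sub>r A)"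
  by (simp add: fpsd_def)

lemma fpsd_sum: "(\<And>i. i \<in> S \<Longrightarrow> fpsd (f i)) \<Longrightarrow> fpsd (sum f S)"
  by (induct S rule: infinite_finite_induct) (auto intro: fpsd_add)

lemma fpsd_dgmult: "fpsd (dg B * B)"
proof -
  have "0 \<le> Re (tr (dg C * (dg B * B) * C))" for C
    using tr_dg_mult_nonneg(1)[of "B * C"] by (simp add: mult.assoc)
  then show ?thesis by (simp add: fpsd_def)
qed

lemma fpsd_conj: "fpsd A \<Longrightarrow> fpsd (dg B * A * B)"
  unfolding fpsd_def
  by (auto simp: mult.assoc) (metis dg_mult mult.assoc)

lemma tr_hermitian_real: "dg A = A \<Longrightarrow> Im (tr A) = 0"
  by (metis Reals_cnj_iff complex_is_Real_iff tr_dg)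

lemma of_real_Re_tr: "dg A = A \<Longrightarrow> complex_of_real (Re (tr A)) = tr A"
  by (simp add: complex_eq_iff tr_hermitian_real)

subsection \<open>Spectral decomposition\<close>

definition mk :: "'i set \<Rightarrow> ('i \<Rightarrow> 'i \<Rightarrow> complex) \<Rightarrow> 'i fm" where
  "mk S f = Fm (\<lambda>i j. if i \<in> S \<and> j \<in> S then f i j else 0)"

lemma ent_mk: assumes "finite S" shows "ent (mk S f) i j = (if i \<in> S \<and> j \<in> S then f i j else 0)"
proof -
  have "finite {p. (if fst p \<in> S \<and> snd p \<in> S then f (fst p) (snd p) else 0) \<noteq> 0}"
    by (rule finite_subset[of _ "S \<times> S"]) (use assms in \<open>auto split: if_splits\<close>)
  then show ?thesis unfolding mk_def by (subst Fm_inverse) auto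
qed

text \<open>Unit vectors enter only through their rank-one projections; an eigenvalue equation
  becomes B P = c P inside the matrix algebra.\<close>

definition ketbra :: "'i set \<Rightarrow> ('i \<Rightarrow> complex) \<Rightarrow> 'i fm" where
  "ketbra S u = mk S (\<lambda>i j. u i * cnj (u j))"

lemma ent_ketbra:
  "finite S \<Longrightarrow> ent (ketbra S u) i j = (if i \<in> S \<and> j \<in> S then u i * cnj (u j) else 0)"
  by (simp add: ketbra_def ent_mk)

lemma dg_ketbra: "finite S \<Longrightarrow> dg (ketbra S u) = ketbra S u"
  by (rule fm_eqI) (auto simp: ent_ketbra)

lemma tr_ketbra:
  "finite S \<Longrightarrow> tr (ketbra S u) = complex_of_real (\<Sum>i\<in>S. (cmod (u i))\<^sup>2)"
  by (subst tr_ent[of S]) (auto simp: ent_ketbra complex_norm_square[symmetric] split: if_splits)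

lemma one_ketbra: "finite S \<Longrightarrow> one S * ketbra S u = ketbra S u"
  by (rule fm_eqI) (auto simp: ent_one_mult ent_ketbra)

lemma ketbra_idem:
  assumes "finite S" "(\<Sum>i\<in>S. (cmod (u i))\<^sup>2) = 1"
  shows "ketbra S u * ketbra S u = ketbra S u"
proof (rule fm_eqI)
  fix i j
  have "ent (ketbra S u * ketbra S u) i j = (\<Sum>k\<in>S. ent (ketbra S u) i k * ent (ketbra S u) k j)"
    using assms by (intro ent_mult) (auto simp: ent_ketbra split: if_splits)
  also have "\<dots> = (\<Sum>k\<in>S. ent (ketbra S u) i j * complex_of_real ((cmod (u k))\<^sup>2))"
    using assms by (intro sum.cong) (auto simp: ent_ketbra complex_norm_square simp del: of_real_power)
  also have "\<dots> = ent (ketbra S u) i j"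
    using assms(2) by (simp flip: sum_distrib_left of_real_sum del: of_real_power)
  finally show "ent (ketbra S u * ketbra S u) i j = ent (ketbra S u) i j" .
qed

lemma mult_ketbra_eigen:
  assumes "finite S" "one S * B = B" "dg B = B"
    and ev: "\<And>x. x \<in> S \<Longrightarrow> (\<Sum>y\<in>S. ent B x y * u y) = c * u x"
  shows "B * ketbra S u = c *\<^sub>c ketbra S u"
proof (rule fm_eqI)
  fix i j
  have l: "ent B i k \<noteq> 0 \<Longrightarrow> i \<in> S" for i k
    using ent_one_mult[OF assms(1), of B i k] assms(2) by (auto split: if_splits)
  have "ent B i k \<noteq> 0 \<Longrightarrow> k \<in> S" for i k
    using l[of k i] assms(3) ent_simps(7)[of B k i] by auto
  then have "ent (B * ketbra S u) i j = (\<Sum>k\<in>S. ent B i k * ent (ketbra S u) k j)"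
    using assms(1) by (intro ent_mult) auto
  also have "\<dots> = (if j \<in> S then (\<Sum>k\<in>S. ent B i k * u k) * cnj (u j) else 0)"
    using assms(1) by (auto simp: ent_ketbra sum_distrib_right mult.assoc intro!: sum.cong)
  also have "\<dots> = (if i \<in> S \<and> j \<in> S then c * u i * cnj (u j) else 0)"
  proof (cases "i \<in> S")
    case False
    then have "ent B i k = 0" for k using l by blast
    then show ?thesis using False by simp
  qed (auto simp: ev)
  finally show "ent (B * ketbra S u) i j = ent (c *\<^sub>c ketbra S u) i j"
    using assms(1) by (simp add: ent_ketbra)
qed

text \<open>If all eigenvalues of a Hermitian matrix vanish, Schur triangularisation shows that the trace
  of its square vanishes, hence so does the matrix.\<close>

lemma mtrace_comm:
  assumes "A \<in> carrier_mat n m" "B \<in> carrier_mat m n"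
  shows "mtrace (A * B) = mtrace (B * A)"
proof -
  have "mtrace (A * B) = (\<Sum>i<n. \<Sum>j<m. A $$ (i, j) * B $$ (j, i))"
    using assms by (auto simp: mtrace_def scalar_prod_def atLeast0LessThan intro!: sum.cong)
  also have "\<dots> = (\<Sum>j<m. \<Sum>i<n. B $$ (j, i) * A $$ (i, j))"
    by (subst sum.swap) (simp add: mult.commute)
  also have "\<dots> = mtrace (B * A)"
    using assms by (auto simp: mtrace_def scalar_prod_def atLeast0LessThan intro!: sum.cong)
  finally show ?thesis .
qed

lemma mtrace_square_zero:
  assumes M: "M \<in> carrier_mat d d"
    and cp: "char_poly M = (\<Prod>e\<leftarrow>exp_sum. [:- e, 1:])" and z: "\<forall>e\<in>set exp_sum. e = (0::complex)"
  shows "mtrace (M * M) = 0"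
proof -
  obtain B P Q where matrix_div: "schur_decomposition M exp_sum = (B, P, Q)" by (metis prod_cases3)
  from schur_decomposition[OF M cp matrix_div]
  have sim: "similar_mat_wit M B P Q" and ut: "upper_triangular B" and dB: "diag_mat B = exp_sum" by auto
  from similar_mat_witD2[OF M sim]
  have c: "B \<in> carrier_mat d d" "P \<in> carrier_mat d d" "Q \<in> carrier_mat d d"
    and QP: "Q * P = 1\<^sub>m d" and Meq: "M = P * B * Q" by auto
  have bz: "B $$ (i, j) = 0" if "j \<le> i" "i < d" for i j
  proof (cases "j = i")
    case True
    have "B $$ (i, i) \<in> set (diag_mat B)" using that c by (auto simp: diag_mat_def)
    then show ?thesis using z dB True by auto
  next
    case False
    then show ?thesis using ut that c by (auto simp: upper_triangular_def)
  qed
  have "M * M = P * (B * (Q * P) * B * Q)"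
    unfolding Meq using c by (simp add: assoc_mult_mat[where ?n\<^sub>1=d and ?n\<^sub>2=d and ?n\<^sub>3=d and ?n\<^sub>4=d])
  also have "\<dots> = P * (B * B * Q)" unfolding QP using c by simp
  finally have "mtrace (M * M) = mtrace (B * B * Q * P)"
    using mtrace_comm[of P d d "B * B * Q"] c by simp
  also have "B * B * Q * P = B * B"
    using c QP by (simp add: assoc_mult_mat[where ?n\<^sub>1=d and ?n\<^sub>2=d and ?n\<^sub>3=d and ?n\<^sub>4=d])
  also have "mtrace (B * B) = (\<Sum>i<d. \<Sum>j<d. B $$ (i, j) * B $$ (j, i))"
    using c by (auto simp: mtrace_def scalar_prod_def atLeast0LessThan intro!: sum.cong)
  also have "\<dots> = 0"
    by (intro sum.neutral ballI) (metis bz lessThan_iff linorder_le_cases mult_zero_left mult_zero_right)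
  finally show ?thesis .
qed

text \<open>A nonzero eigenvalue places its eigenvector in the range of \<open>B\<close>. Applied to
  a complementary projection, this later produces eigenvectors orthogonal to those already
  found.\<close>

lemma hermitian_nonzero_eigen:
  fixes B :: "'i fm"
  assumes S: "finite S" and oB: "one S * B = B" and hB: "dg B = B" and nz: "B \<noteq> 0"
  shows "\<exists>(c::real) u. c \<noteq> 0 \<and> (\<Sum>i\<in>S. (cmod (u i))\<^sup>2) = 1
    \<and> B * ketbra S u = c *\<^sub>r ketbra S u"
proof -
  define d where "d = card S"
  \<comment> \<open>An enumeration of \<open>S\<close> transports \<open>B\<close> to a concrete
    matrix, where the characteristic polynomial splits.\<close>
  obtain g where g: "bij_betw g {..<d} S"
    using ex_bij_betw_nat_finite[OF S] by (auto simp: d_def atLeast0LessThan)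
  have sumS: "(\<Sum>x\<in>S. f x) = (\<Sum>i<d. f (g i))" for f :: "'i \<Rightarrow> 'b::comm_monoid_add"
    by (rule sum.reindex_bij_betw[OF g, symmetric])
  define M where "M = Matrix.mat d d (\<lambda>(i, j). ent B (g i) (g j))"
  have M: "M \<in> carrier_mat d d" by (simp add: M_def)
  obtain exp_sum where cp: "char_poly M = (\<Prod>e\<leftarrow>exp_sum. [:- e, 1:])"
    using char_poly_factorized[OF M] by auto
  have "\<exists>c\<in>set exp_sum. c \<noteq> 0"
  proof (rule ccontr)
    assume "\<not> ?thesis"
    then have "mtrace (M * M) = 0" using mtrace_square_zero[OF M cp] by blast
    then have "(\<Sum>i<d. \<Sum>j<d. ent B (g i) (g j) * ent B (g j) (g i)) = 0"
      by (simp add: M_def mtrace_def scalar_prod_def atLeast0LessThan)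
    then have z: "(\<Sum>i\<in>S. \<Sum>j\<in>S. ent B i j * ent B j i) = 0" by (simp add: sumS)
    have l: "ent B i j \<noteq> 0 \<Longrightarrow> i \<in> S" for i j
      using ent_one_mult[OF S, of B i j] oB by (auto split: if_splits)
    have r: "ent B i j \<noteq> 0 \<Longrightarrow> j \<in> S" for i j
      using l[of j i] hB ent_simps(7)[of B j i] by auto
    have "tr (dg B * B) = (\<Sum>i\<in>S. ent (B * B) i i)"
    proof (subst hB, rule tr_ent[OF S])
      fix i assume "ent (B * B) i i \<noteq> 0"
      moreover have "ent (B * B) i i = (\<Sum>j\<in>S. ent B i j * ent B j i)"
        by (rule ent_mult[OF S r])
      ultimately obtain j where "ent B i j * ent B j i \<noteq> 0"
        by (metis (no_types, lifting) sum.neutral)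
      then show "i \<in> S" using l by auto
    qed
    also have "\<dots> = 0" using z by (simp add: ent_mult[OF S r])
    finally show False using dg_mult_self_zero nz by blast
  qed
  then obtain c where c: "c \<in> set exp_sum" "c \<noteq> 0" by blast
  have "poly (char_poly M) c = 0"
    unfolding cp poly_prod_list using c(1) by (auto simp: prod_list_zero_iff image_iff intro!: bexI[of _ c])
  then have "eigenvalue M c" using eigenvalue_root_char_poly[OF M] by simp
  then obtain v where v: "v \<in> carrier_vec d" "v \<noteq> 0\<^sub>v d" "M *\<^sub>v v = c \<cdot>\<^sub>v v"
    using M by (auto simp: eigenvalue_def eigenvector_def)
  define w where "w x = vec_index v (inv_into {..<d} g x)" for x
  have wg: "w (g i) = vec_index v i" if "i < d" for i
    using that g by (simp add: w_def bij_betw_inv_into_left)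
  have ew: "(\<Sum>y\<in>S. ent B x y * w y) = c * w x" if x: "x \<in> S" for x
  proof -
    obtain i where i: "i < d" "x = g i" using x g by (auto simp: bij_betw_def)
    have "vec_index (M *\<^sub>v v) i = c * vec_index v i" using v i by simp
    moreover have "vec_index (M *\<^sub>v v) i = (\<Sum>j<d. ent B (g i) (g j) * vec_index v j)"
      using i v(1) by (simp add: M_def scalar_prod_def atLeast0LessThan)
    ultimately show ?thesis by (simp add: sumS i wg)
  qed
  define N where "N = (\<Sum>i\<in>S. (cmod (w i))\<^sup>2)"
  have "N > 0"
  proof -
    obtain i where i: "i < d" "vec_index v i \<noteq> 0" using v(1,2) by (metis carrier_vecD eq_vecI index_zero_vec)
    then have "g i \<in> S" "w (g i) \<noteq> 0" using g by (auto simp: bij_betw_def wg)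
    then show ?thesis unfolding N_def using S by (intro sum_pos2[of S "g i"]) auto
  qed
  define u where "u x = w x / complex_of_real (sqrt N)" for x
  have n1: "(\<Sum>i\<in>S. (cmod (u i))\<^sup>2) = 1"
    using \<open>N > 0\<close> by (simp add: u_def norm_divide power_divide flip: sum_divide_distrib N_def)
  have eu: "(\<Sum>y\<in>S. ent B x y * u y) = c * u x" if "x \<in> S" for x
    using ew[OF that] by (simp add: u_def flip: sum_divide_distrib)
  have BP: "B * ketbra S u = c *\<^sub>c ketbra S u"
    by (rule mult_ketbra_eigen[OF S oB hB eu])
  have t1: "tr (ketbra S u) = 1" using n1 tr_ketbra[OF S, of u] by simp
  \<comment> \<open>The projection has trace 1, so c is the trace of its product with
    \<open>B\<close>, which is real because both factors are Hermitian.\<close>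
  have "cnj c = tr (dg (B * ketbra S u))" by (simp only: tr_dg) (simp add: BP t1)
  also have "\<dots> = tr (B * ketbra S u)" by (simp add: hB dg_ketbra S tr_commute)
  also have "\<dots> = c" by (simp add: BP t1)
  finally have "complex_of_real (Re c) = c" by (metis Reals_cnj_iff of_real_Re)
  then show ?thesis using BP n1 c(2) by (intro exI[of _ "Re c"] exI[of _ u]) auto
qed

definition eigenfamily :: "'i set \<Rightarrow> 'i fm \<Rightarrow> nat \<Rightarrow> (nat \<Rightarrow> 'i \<Rightarrow> complex) \<Rightarrow> (nat \<Rightarrow> real) \<Rightarrow> bool" where
  "eigenfamily S A n u l \<longleftrightarrow> (\<forall>k<n. (\<Sum>i\<in>S. (cmod (u k i))\<^sup>2) = 1)
     \<and> (\<forall>k<n. \<forall>j<n. k \<noteq> j \<longrightarrow> ketbra S (u k) * ketbra S (u j) = 0)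
     \<and> (\<forall>k<n. A * ketbra S (u k) = (l k) *\<^sub>r ketbra S (u k))"

lemma eigenfamily_proj:
  assumes S: "finite S" and ef: "eigenfamily S A n u l"
  defines "Q \<equiv> \<Sum>k<n. ketbra S (u k)"
  shows "Q * Q = Q" "dg Q = Q" "tr Q = of_nat n" "one S * Q = Q"
    "k < n \<Longrightarrow> ketbra S (u k) * Q = ketbra S (u k)"
proof -
  have id: "ketbra S (u k) * ketbra S (u j) = (if k = j then ketbra S (u k) else 0)"
    if "k < n" "j < n" for k j
    using that ef ketbra_idem[OF S, of "u k"] by (auto simp: eigenfamily_def)
  have *: "ketbra S (u k) * Q = ketbra S (u k)" if "k < n" for k
  proof -
    have "ketbra S (u k) * Q = (\<Sum>j<n. if k = j then ketbra S (u k) else 0)"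
      unfolding Q_def sum_distrib_left using that by (intro sum.cong) (auto simp: id)
    then show ?thesis using that by simp
  qed
  show "k < n \<Longrightarrow> ketbra S (u k) * Q = ketbra S (u k)" by (rule *)
  show "Q * Q = Q" by (subst (1 3) Q_def) (simp add: sum_distrib_right *)
  show "dg Q = Q" by (simp add: Q_def dg_ketbra S)
  show "tr Q = of_nat n" using ef by (simp add: Q_def tr_ketbra S eigenfamily_def)
  show "one S * Q = Q" by (simp add: Q_def sum_distrib_left one_ketbra S)
qed

text \<open>An eigenfamily of maximal size is complete: with \<open>Q\<close> the sum of its
  projections, R = one S - Q commutes with \<open>A\<close>, and if \<open>R\<close> were nonzero,
  an eigenvector in its range would extend the family. Sizes are bounded because a projection below
  \<open>one S\<close> has trace at most \<open>card S\<close>.\<close>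

theorem hermitian_eigenbasis:
  fixes A :: "'i fm"
  assumes S: "finite S" and oA: "one S * A = A" and hA: "dg A = A"
  shows "\<exists>u l. eigenfamily S A (card S) u l \<and> (\<Sum>k<card S. ketbra S (u k)) = one S"
proof -
  have bound: "n \<le> card S" if "eigenfamily S A n u l" for n u l
  proof -
    note Q = eigenfamily_proj[OF S that]
    define Q where "Q = (\<Sum>k<n. ketbra S (u k))"
    note Q = Q[folded Q_def]
    have "Q * one S = Q" using arg_cong[OF Q(4), of dg] Q(2) by simp
    then have "dg (one S - Q) * (one S - Q) = one S - Q"
      using Q S by (simp add: algebra_simps)
    then have "0 \<le> Re (tr (one S - Q))" by (metis tr_dg_mult_nonneg(1))
    then show ?thesis using Q(3) by simp
  qed
  have "\<exists>n. (\<exists>u l. eigenfamily S A n u l) \<and> (\<forall>m. (\<exists>u l. eigenfamily S A m u l) \<longrightarrow> m \<le> n)"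
    by (rule ex_has_greatest_nat[of "\<lambda>n. \<exists>u l. eigenfamily S A n u l" 0 id "Suc (card S)", simplified])
      (auto simp: eigenfamily_def[of _ _ 0] less_Suc_eq_le bound)
  then obtain n u l where ef: "eigenfamily S A n u l"
    and mx: "\<And>m u l. eigenfamily S A m u l \<Longrightarrow> m \<le> n" by blast
  note Q = eigenfamily_proj[OF S ef]
  define Q where "Q = (\<Sum>k<n. ketbra S (u k))"
  note Q = Q[folded Q_def]
  define R where "R = one S - Q"
  have Qo: "Q * one S = Q" using arg_cong[OF Q(4), of dg] Q(2) by simp
  have hR: "dg R = R" and RR: "R * R = R" and oR: "one S * R = R"
    using Q S Qo by (simp_all add: R_def algebra_simps)
  have Ao: "A * one S = A" using arg_cong[OF oA, of dg] hA by simp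
  have AQ: "A * Q = (\<Sum>k<n. (l k) *\<^sub>r ketbra S (u k))"
    using ef by (simp add: Q_def sum_distrib_left eigenfamily_def)
  have "dg (A * Q) = A * Q" by (simp only: AQ) (simp add: dg_ketbra S)
  then have "Q * A = A * Q" by (simp add: hA Q)
  then have RA: "R * A = A * R" by (simp add: R_def algebra_simps oA Ao)
  have "R = 0"
  proof (rule ccontr)
    assume "R \<noteq> 0"
    have "\<exists>c v. (\<Sum>i\<in>S. (cmod (v i))\<^sup>2) = 1 \<and> R * ketbra S v = ketbra S v
        \<and> A * ketbra S v = c *\<^sub>r ketbra S v"
    \<comment> \<open>If \<open>A * R\<close> vanishes, every vector in the range of
      \<open>R\<close> is an eigenvector for 0. Otherwise \<open>A * R\<close> is Hermitian with a
      nonzero eigenvalue, whose eigenvector lies in the range of \<open>R\<close>.\<close>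
    proof (cases "A * R = 0")
      case True
      obtain c v where cv: "c \<noteq> 0" "(\<Sum>i\<in>S. (cmod (v i))\<^sup>2) = 1"
        "R * ketbra S v = c *\<^sub>r ketbra S v"
        using hermitian_nonzero_eigen[OF S oR hR \<open>R \<noteq> 0\<close>] by blast
      have "c *\<^sub>r (R * ketbra S v) = R * (R * ketbra S v)" by (simp add: cv(3))
      also have "\<dots> = c *\<^sub>r ketbra S v" using RR cv(3) by (metis mult.assoc)
      finally have "(1 / complex_of_real c) *\<^sub>c (c *\<^sub>r (R * ketbra S v))
          = (1 / complex_of_real c) *\<^sub>c (c *\<^sub>r ketbra S v)" by simp
      then have "R * ketbra S v = ketbra S v" using cv(1) by (simp add: cs_cs)
      moreover from this have "A * ketbra S v = A * R * ketbra S v" by (simp add: mult.assoc)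
      ultimately show ?thesis using cv(2) True by (intro exI[of _ 0] exI[of _ v]) simp
    next
      case False
      have "one S * (A * R) = A * R" by (simp add: oA flip: mult.assoc)
      moreover have "dg (A * R) = A * R" by (simp add: hA hR RA)
      ultimately obtain c v where cv: "c \<noteq> 0" "(\<Sum>i\<in>S. (cmod (v i))\<^sup>2) = 1"
        "A * R * ketbra S v = c *\<^sub>r ketbra S v"
        using hermitian_nonzero_eigen[OF S _ _ False] by blast
      have "c *\<^sub>r (R * ketbra S v) = R * (A * R) * ketbra S v"
        using arg_cong[OF cv(3), of "\<lambda>X. R * X"] by (simp add: mult.assoc)
      also have "R * (A * R) = A * R" using RA RR by (metis mult.assoc)
      finally have "(1 / complex_of_real c) *\<^sub>c (c *\<^sub>r (R * ketbra S v))
          = (1 / complex_of_real c) *\<^sub>c (c *\<^sub>r ketbra S v)" by (simp add: cv(3))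
      then have "R * ketbra S v = ketbra S v" using cv(1) by (simp add: cs_cs)
      then show ?thesis using cv(2,3) by (intro exI[of _ c] exI[of _ v]) (simp add: mult.assoc)
    qed
    then obtain c v where cv: "(\<Sum>i\<in>S. (cmod (v i))\<^sup>2) = 1" "R * ketbra S v = ketbra S v"
      "A * ketbra S v = c *\<^sub>r ketbra S v" by blast
    have o1: "ketbra S (u k) * ketbra S v = 0" if "k < n" for k
    proof -
      have "ketbra S (u k) * R = 0"
        using Q(5)[OF that] arg_cong[OF one_ketbra[OF S, of "u k"], of dg]
        by (simp add: R_def algebra_simps dg_ketbra S)
      then show ?thesis using cv(2) by (metis mult.assoc mult_zero_left)
    qed
    have o2: "ketbra S v * ketbra S (u k) = 0" if "k < n" for k
      using arg_cong[OF o1[OF that], of dg] by (simp add: dg_ketbra S)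
    have "eigenfamily S A (Suc n) (u(n := v)) (l(n := c))"
      using ef cv o1 o2 unfolding eigenfamily_def by (auto simp: less_Suc_eq)
    then show False using mx by fastforce
  qed
  then have "Q = one S" by (simp add: R_def)
  moreover from this have "of_nat n = (of_nat (card S) :: complex)" using Q(3) by simp
  ultimately show ?thesis using ef unfolding Q_def by auto
qed

subsection \<open>Functional calculus\<close>

text \<open>Weak on purpose: eigenvalues may repeat or vanish, projections may be 0, and they need
  not sum to a unit. The index type is free, so pairs and disjoint sums of indices describe tensor
  products and orthogonal sums.\<close>

definition sdec :: "'i fm \<Rightarrow> 'k set \<Rightarrow> ('k \<Rightarrow> real) \<Rightarrow> ('k \<Rightarrow> 'i fm) \<Rightarrow> bool" where
  "sdec A K l P \<longleftrightarrow> finite K \<and> (\<forall>k\<in>K. dg (P k) = P k)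
     \<and> (\<forall>k\<in>K. \<forall>j\<in>K. P k * P j = (if k = j then P k else 0))
     \<and> A = (\<Sum>k\<in>K. (l k) *\<^sub>r P k)"

definition on_nonzero :: "(real \<Rightarrow> complex) \<Rightarrow> real \<Rightarrow> complex" where
  "on_nonzero f x = (if x = 0 then 0 else f x)"

text \<open>Eigenvalue 0 is ignored, so that the value does not depend on the ambient dimension.\<close>
definition fc :: "(real \<Rightarrow> complex) \<Rightarrow> 'i fm \<Rightarrow> 'i fm" where
  "fc f A = (SOME X. \<exists>K l P. sdec A (K :: nat set) l P \<and> X = (\<Sum>k\<in>K. on_nonzero f (l k) *\<^sub>c P k))"

lemma sdecD:
  assumes "sdec A K l P"
  shows "finite K" "k \<in> K \<Longrightarrow> dg (P k) = P k"
    "k \<in> K \<Longrightarrow> j \<in> K \<Longrightarrow> P k * P j = (if k = j then P k else 0)"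
    "A = (\<Sum>k\<in>K. (l k) *\<^sub>r P k)"
  using assms by (auto simp: sdec_def)

lemma sdec_sum_mult_proj:
  assumes "sdec A K l P" "j \<in> K"
  shows "(\<Sum>k\<in>K. a k *\<^sub>c P k) * P j = a j *\<^sub>c P j" "P j * (\<Sum>k\<in>K. a k *\<^sub>c P k) = a j *\<^sub>c P j"
proof -
  have "(\<Sum>k\<in>K. a k *\<^sub>c P k) * P j = (\<Sum>k\<in>K. if k = j then a j *\<^sub>c P j else 0)"
    unfolding sum_distrib_right using assms by (intro sum.cong) (auto simp: sdecD(3))
  then show "(\<Sum>k\<in>K. a k *\<^sub>c P k) * P j = a j *\<^sub>c P j"
    using assms by (simp add: sdecD(1))
  have "P j * (\<Sum>k\<in>K. a k *\<^sub>c P k) = (\<Sum>k\<in>K. if k = j then a j *\<^sub>c P j else 0)"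
    unfolding sum_distrib_left using assms by (intro sum.cong) (auto simp: sdecD(3))
  then show "P j * (\<Sum>k\<in>K. a k *\<^sub>c P k) = a j *\<^sub>c P j"
    using assms by (simp add: sdecD(1))
qed

lemma sdec_mult_proj:
  assumes "sdec A K l P" "j \<in> K"
  shows "A * P j = (l j) *\<^sub>r P j" "P j * A = (l j) *\<^sub>r P j"
  using sdec_sum_mult_proj[OF assms, of "\<lambda>k. complex_of_real (l k)"] sdecD(4)[OF assms(1)] by auto

lemma sdec_sum_mult:
  assumes "sdec A K l P"
  shows "(\<Sum>k\<in>K. a k *\<^sub>c P k) * (\<Sum>k\<in>K. b k *\<^sub>c P k) = (\<Sum>k\<in>K. (a k * b k) *\<^sub>c P k)"
  by (simp add: sum_distrib_left[of "\<Sum>k\<in>K. a k *\<^sub>c P k"] sdec_sum_mult_proj[OF assms] cs_cs mult.commute)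

lemma sdec_cross:
  assumes "sdec A K l P" "sdec A J m Q" "k \<in> K" "j \<in> J" "l k \<noteq> m j"
  shows "P k * Q j = 0"
proof -
  have "(l k) *\<^sub>r (P k * Q j) = P k * A * Q j"
    by (simp add: sdec_mult_proj[OF assms(1,3)])
  also have "\<dots> = (m j) *\<^sub>r (P k * Q j)"
    by (simp add: mult.assoc sdec_mult_proj[OF assms(2,4)])
  finally have "(l k - m j) *\<^sub>r (P k * Q j) = 0"
    by (simp add: cs_diff_left)
  then have "(1 / complex_of_real (l k - m j)) *\<^sub>c ((l k - m j) *\<^sub>r (P k * Q j)) = 0"
    by simp
  then show ?thesis using assms(5) by (simp add: cs_cs del: of_real_diff)
qed

lemma sdec_proj_expand:
  assumes "sdec A K l P" "sdec A J m Q" "k \<in> K" "l k \<noteq> 0"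
  shows "P k = (\<Sum>j\<in>J. P k * Q j)"
proof -
  have "(l k) *\<^sub>r P k = P k * A" by (simp add: sdec_mult_proj[OF assms(1,3)])
  also have "\<dots> = (\<Sum>j\<in>J. (m j) *\<^sub>r (P k * Q j))"
    by (subst sdecD(4)[OF assms(2)]) (simp add: sum_distrib_left)
  also have "\<dots> = (\<Sum>j\<in>J. (l k) *\<^sub>r (P k * Q j))"
    using sdec_cross[OF assms(1,2,3)] by (intro sum.cong) (auto, metis cs_zero_right)
  finally have "(1 / complex_of_real (l k)) *\<^sub>c ((l k) *\<^sub>r P k)
      = (1 / complex_of_real (l k)) *\<^sub>c (\<Sum>j\<in>J. (l k) *\<^sub>r (P k * Q j))" by simp
  then show ?thesis using assms(4) by (simp add: cs_cs cs_sum_right)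
qed

lemma sdec_expand_double:
  assumes "sdec A K l P" "sdec A J m Q"
  shows "(\<Sum>k\<in>K. on_nonzero f (l k) *\<^sub>c P k) = (\<Sum>k\<in>K. \<Sum>j\<in>J. on_nonzero f (l k) *\<^sub>c (P k * Q j))"
proof (rule sum.cong)
  fix k assume k: "k \<in> K"
  show "on_nonzero f (l k) *\<^sub>c P k = (\<Sum>j\<in>J. on_nonzero f (l k) *\<^sub>c (P k * Q j))"
    by (cases "l k = 0")
      (simp_all add: on_nonzero_def cs_sum_right[symmetric] sdec_proj_expand[OF assms k, symmetric])
qed simp

text \<open>Projections of the two decompositions with different eigenvalues multiply to 0
  (\<open>sdec_cross\<close>), so both sides equal the same double sum over P k * Q j. Taking
  adjoints puts the factors of the second expansion into the same order.\<close>

lemma sdec_unique: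
  assumes "sdec A K l P" "sdec A J m Q"
  shows "(\<Sum>k\<in>K. on_nonzero f (l k) *\<^sub>c P k) = (\<Sum>j\<in>J. on_nonzero f (m j) *\<^sub>c Q j)"
proof -
  have "(\<Sum>j\<in>J. on_nonzero f (m j) *\<^sub>c Q j) = dg (dg (\<Sum>j\<in>J. on_nonzero f (m j) *\<^sub>c Q j))" by simp
  also have "dg (\<Sum>j\<in>J. on_nonzero f (m j) *\<^sub>c Q j) = (\<Sum>j\<in>J. on_nonzero (\<lambda>x. cnj (f x)) (m j) *\<^sub>c Q j)"
    using sdecD(2)[OF assms(2)] by (auto intro!: sum.cong simp: on_nonzero_def)
  also have "\<dots> = (\<Sum>j\<in>J. \<Sum>k\<in>K. on_nonzero (\<lambda>x. cnj (f x)) (m j) *\<^sub>c (Q j * P k))"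
    by (rule sdec_expand_double[OF assms(2,1)])
  also have "dg \<dots> = (\<Sum>j\<in>J. \<Sum>k\<in>K. on_nonzero f (m j) *\<^sub>c (P k * Q j))"
    using sdecD(2)[OF assms(1)] sdecD(2)[OF assms(2)] by (auto intro!: sum.cong simp: on_nonzero_def)
  also have "\<dots> = (\<Sum>j\<in>J. \<Sum>k\<in>K. on_nonzero f (l k) *\<^sub>c (P k * Q j))"
    using sdec_cross[OF assms] by (intro sum.cong refl) (metis cs_zero_right)
  also have "\<dots> = (\<Sum>k\<in>K. on_nonzero f (l k) *\<^sub>c P k)"
    unfolding sdec_expand_double[OF assms] by (rule sum.swap)
  finally show ?thesis ..
qed

lemma hermitian_sdec:
  assumes "dg A = A"
  obtains K :: "nat set" and l P where "sdec A K l P" "\<And>k. k \<in> K \<Longrightarrow> l k \<noteq> 0 \<and> P k \<noteq> 0"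
proof -
  obtain S where S: "finite S" "supp A \<subseteq> S \<times> S" by (rule supp_box)
  have oA: "one S * A = A" "A * one S = A"
    using one_mult_left[OF S] one_mult_right[OF S] by auto
  obtain u l where ef: "eigenfamily S A (card S) u l"
    and o: "(\<Sum>k<card S. ketbra S (u k)) = one S"
    using hermitian_eigenbasis[OF S(1) oA(1) assms] by blast
  have "A = (\<Sum>k<card S. A * ketbra S (u k))"
    by (simp only: sum_distrib_left[symmetric] o oA)
  also have "\<dots> = (\<Sum>k<card S. (l k) *\<^sub>r ketbra S (u k))"
    using ef by (intro sum.cong) (auto simp: eigenfamily_def)
  also have "\<dots> = (\<Sum>k\<in>{k. k < card S \<and> l k \<noteq> 0}. (l k) *\<^sub>r ketbra S (u k))"
    by (rule sum.mono_neutral_right) auto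
  finally have "sdec A {k. k < card S \<and> l k \<noteq> 0} l (\<lambda>k. ketbra S (u k))"
    using ef ketbra_idem[OF S(1)] dg_ketbra[OF S(1)] by (auto simp: sdec_def eigenfamily_def)
  moreover have "ketbra S (u k) \<noteq> 0" if "k < card S" for k
  proof -
    have "tr (ketbra S (u k)) = 1"
      using ef that by (simp add: tr_ketbra S(1) eigenfamily_def del: of_real_sum)
    then show ?thesis by auto
  qed
  ultimately show ?thesis using that by blast
qed

lemma sdec_hermitian: assumes "sdec A K l P" shows "dg A = A"
  by (subst (1 2) sdecD(4)[OF assms]) (simp add: sdecD(2)[OF assms])

lemma fc_sdec:
  assumes "sdec A K l P" shows "fc f A = (\<Sum>k\<in>K. on_nonzero f (l k) *\<^sub>c P k)"
proof -
  obtain K' l' P' where s: "sdec A (K' :: nat set) l' P'"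
    using hermitian_sdec[OF sdec_hermitian[OF assms]] by metis
  have "\<exists>K l P. sdec A (K :: nat set) l P \<and> fc f A = (\<Sum>k\<in>K. on_nonzero f (l k) *\<^sub>c P k)"
    unfolding fc_def by (rule someI_ex) (use s in blast)
  then show ?thesis using sdec_unique[OF assms] by metis
qed

lemma fc_mult: "dg A = A \<Longrightarrow> fc f A * fc g A = fc (\<lambda>x. f x * g x) A"
  by (erule hermitian_sdec) (auto simp: fc_sdec sdec_sum_mult on_nonzero_def intro!: sum.cong)

lemma fc_add: "dg A = A \<Longrightarrow> fc (\<lambda>x. f x + g x) A = fc f A + fc g A"
  by (erule hermitian_sdec)
    (auto simp: fc_sdec on_nonzero_def cs_add_left sum.distrib[symmetric] intro!: sum.cong)

lemma fc_cs: "dg A = A \<Longrightarrow> fc (\<lambda>x. c * f x) A = c *\<^sub>c fc f A"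
  by (erule hermitian_sdec) (auto simp: fc_sdec on_nonzero_def cs_sum_right cs_cs intro!: sum.cong)

lemma dg_fc: "dg A = A \<Longrightarrow> dg (fc f A) = fc (\<lambda>x. cnj (f x)) A"
  by (erule hermitian_sdec) (auto simp: fc_sdec on_nonzero_def sdecD(2) intro!: sum.cong)

lemma fc_id: "dg A = A \<Longrightarrow> fc complex_of_real A = A"
proof (erule hermitian_sdec)
  fix K :: "nat set" and l P assume s: "sdec A K l P"
  show "fc complex_of_real A = A"
    unfolding fc_sdec[OF s]
    by (rule trans[OF _ sdecD(4)[OF s, symmetric]]) (auto simp: on_nonzero_def intro!: sum.cong)
qed

lemma sdec_fc:
  assumes "sdec A K l P"
  shows "sdec (fc (\<lambda>x. complex_of_real (f x)) A) K (\<lambda>k. if l k = 0 then 0 else f (l k)) P"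
proof -
  have "fc (\<lambda>x. complex_of_real (f x)) A
      = (\<Sum>k\<in>K. (if l k = 0 then 0 else f (l k)) *\<^sub>r P k)"
    unfolding fc_sdec[OF assms] by (intro sum.cong) (auto simp: on_nonzero_def)
  then show ?thesis using assms by (auto simp: sdec_def)
qed

text \<open>A zero of \<open>f\<close> at a nonzero eigenvalue would be dropped by the outer
  calculus, but not by the right-hand side.\<close>

lemma fc_comp:
  assumes "dg A = A" "\<And>x. x \<noteq> 0 \<Longrightarrow> f x \<noteq> 0"
  shows "fc g (fc (\<lambda>x. complex_of_real (f x)) A) = fc (\<lambda>x. g (f x)) A"
proof -
  obtain K :: "nat set" and l P where s: "sdec A K l P" by (rule hermitian_sdec[OF assms(1)])
  show ?thesis
    by (subst fc_sdec[OF sdec_fc[OF s]]) (auto simp: fc_sdec[OF s] on_nonzero_def assms(2) intro!: sum.cong)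
qed

lemma fpsd_proj: "dg P = P \<Longrightarrow> P * P = P \<Longrightarrow> fpsd P"
  using fpsd_dgmult[of P] by simp

lemma tr_proj_pos: assumes "dg P = P" "P * P = P" "P \<noteq> 0" shows "0 < Re (tr P)"
proof -
  have "tr (dg P * P) \<noteq> 0" using dg_mult_self_zero assms(3) by blast
  then show ?thesis using tr_dg_mult_nonneg[of P] assms(1,2)
    by (auto simp: complex_eq_iff less_le)
qed

lemma fpsd_sdec:
  assumes "fpsd A"
  obtains K :: "nat set" and l P where "sdec A K l P" "\<And>k. k \<in> K \<Longrightarrow> 0 < l k \<and> P k \<noteq> 0"
proof -
  obtain K :: "nat set" and l P where s: "sdec A K l P" "\<And>k. k \<in> K \<Longrightarrow> l k \<noteq> 0 \<and> P k \<noteq> 0"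
    by (rule hermitian_sdec[OF fpsd_dg[OF assms]]) blast
  have "0 < l k" if k: "k \<in> K" for k
  proof -
    note p = sdecD(2)[OF s(1) k] sdecD(3)[OF s(1) k k]
    have "0 \<le> Re (tr (dg (P k) * A * P k))" by (rule fpsd_conj_tr[OF assms])
    also have "dg (P k) * A * P k = (l k) *\<^sub>r P k"
      using p by (simp add: sdec_mult_proj[OF s(1) k])
    finally have "0 \<le> l k * Re (tr (P k))" by simp
    moreover have "0 < Re (tr (P k))" using tr_proj_pos p s(2)[OF k] by auto
    ultimately show ?thesis using s(2)[OF k] by (simp add: zero_le_mult_iff less_le)
  qed
  then show ?thesis using that s by blast
qed

lemma fpsd_sdecI:
  assumes "sdec A K l P" "\<And>k. k \<in> K \<Longrightarrow> 0 \<le> l k" shows "fpsd A"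
  by (subst sdecD(4)[OF assms(1)])
    (intro fpsd_sum fpsd_cs assms(2) fpsd_proj; simp add: sdecD[OF assms(1)])

lemma fc_cong_psd:
  assumes "fpsd A" "\<And>x. 0 < x \<Longrightarrow> f x = g x" shows "fc f A = fc g A"
proof -
  obtain K :: "nat set" and l P where s: "sdec A K l P" "\<And>k. k \<in> K \<Longrightarrow> 0 < l k \<and> P k \<noteq> 0"
    by (rule fpsd_sdec[OF assms(1)]) blast
  show ?thesis using s(2) assms(2) by (auto simp: fc_sdec[OF s(1)] on_nonzero_def intro!: sum.cong)
qed

text \<open>Complex exponents serve the interpolation. Since the eigenvalue 0 is dropped, negative
  exponents are powers of the generalised inverse and exponent 0 gives the support
  projection.\<close>

definition pw :: "'i fm \<Rightarrow> complex \<Rightarrow> 'i fm" where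
  "pw A z = fc (\<lambda>x. exp (z * complex_of_real (ln x))) A"

definition lg :: "'i fm \<Rightarrow> 'i fm" where "lg A = fc (\<lambda>x. complex_of_real (ln x)) A"

abbreviation sp :: "'i fm \<Rightarrow> 'i fm" where "sp A \<equiv> pw A 0"

lemma pw_add: "fpsd A \<Longrightarrow> pw A z * pw A w = pw A (z + w)"
  by (simp add: pw_def fc_mult fpsd_dg algebra_simps exp_add)

lemma pw_add': "fpsd A \<Longrightarrow> pw A z * (pw A w * X) = pw A (z + w) * X"
  by (simp add: pw_add flip: mult.assoc)

lemma dg_pw [simp]: "fpsd A \<Longrightarrow> dg (pw A z) = pw A (cnj z)"
  by (simp add: pw_def dg_fc fpsd_dg exp_cnj)

lemma pw_one: assumes "fpsd A" shows "pw A 1 = A"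
proof -
  have "pw A 1 = fc complex_of_real A" unfolding pw_def
    by (rule fc_cong_psd[OF assms]) (simp add: exp_of_real)
  then show ?thesis by (simp add: fc_id fpsd_dg assms)
qed

lemma sp_mult [simp]: "fpsd A \<Longrightarrow> sp A * A = A" and mult_sp [simp]: "fpsd A \<Longrightarrow> A * sp A = A"
  using pw_add[of A 0 1] pw_add[of A 1 0] by (simp_all add: pw_one)

lemma fpsd_pw: "fpsd A \<Longrightarrow> fpsd (pw A (complex_of_real s))"
  using fpsd_dgmult[of "pw A (complex_of_real (s / 2))"] by (simp add: pw_add)

lemma fpsd_sqrt: "fpsd A \<Longrightarrow> \<exists>B. A = dg B * B"
  using pw_add[of A "1/2" "1/2"] by (intro exI[of _ "pw A (1/2)"]) (simp add: pw_one)

lemma fpsd_tr_mult: assumes "fpsd A" "fpsd B" shows "0 \<le> Re (tr (A * B))" "Im (tr (A * B)) = 0"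
proof -
  obtain C where C: "B = dg C * C" using fpsd_sqrt assms(2) by blast
  have "tr (A * B) = tr (C * A * dg C)" by (simp add: C tr_commute[of C] mult.assoc)
  then show "0 \<le> Re (tr (A * B))" "Im (tr (A * B)) = 0"
    using fpsd_conj_tr[OF assms(1), of "dg C"] tr_hermitian_real[of "C * A * dg C"] fpsd_dg[OF assms(1)]
    by (simp_all add: mult.assoc)
qed

lemma fpsd_tr: assumes "fpsd A" shows "0 \<le> Re (tr A)"
  using fpsd_sqrt[OF assms] tr_dg_mult_nonneg(1) by auto

lemma fpsd_tr_zero: assumes "fpsd A" "Re (tr A) = 0" shows "A = 0"
proof -
  obtain B where B: "A = dg B * B" using fpsd_sqrt assms(1) by blast
  have "tr (dg B * B) = 0" using assms(2) tr_dg_mult_nonneg(2)[of B] by (simp add: B complex_eq_iff)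
  then show ?thesis using B dg_mult_self_zero by (metis mult_zero_right)
qed

lemma fpsd_tn: "fpsd A \<Longrightarrow> fpsd B \<Longrightarrow> fpsd (A \<star> B)"
  by (metis dg_tn fpsd_dgmult fpsd_sqrt tn_mult)

lemma fpsd_reix: "inj e \<Longrightarrow> fpsd A \<Longrightarrow> fpsd (reix e A)"
  by (metis dg_reix fpsd_dgmult fpsd_sqrt reix_mult)

lemma fc_pw: "fpsd A \<Longrightarrow> fc g (pw A (complex_of_real s)) = fc (\<lambda>x. g (exp (s * ln x))) A"
  using fc_comp[of A "\<lambda>x. exp (s * ln x)" g]
  by (simp add: pw_def fpsd_dg exp_of_real flip: of_real_mult)

lemma pw_pw: "fpsd A \<Longrightarrow> pw (pw A (complex_of_real s)) z = pw A (z * complex_of_real s)"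
  by (simp add: fc_pw pw_def[of "pw A s" for s]) (simp add: pw_def mult.assoc)

lemma sdec_cs:
  "sdec A K l P \<Longrightarrow> sdec (r *\<^sub>r A) K (\<lambda>k. r * l k) P"
  by (auto simp: sdec_def cs_sum_right cs_cs)

lemma fc_scale:
  assumes "dg A = A" "r \<noteq> 0" shows "fc f (r *\<^sub>r A) = fc (\<lambda>x. f (r * x)) A"
proof -
  obtain K :: "nat set" and l P where s: "sdec A K l P" by (rule hermitian_sdec[OF assms(1)])
  show ?thesis using assms(2) by (simp add: fc_sdec[OF sdec_cs[OF s]] fc_sdec[OF s] on_nonzero_def)
qed

lemma pw_scale:
  assumes "fpsd A" "0 < r"
  shows "pw (r *\<^sub>r A) z = exp (z * complex_of_real (ln r)) *\<^sub>c pw A z"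
proof -
  have "pw (r *\<^sub>r A) z = fc (\<lambda>x. exp (z * complex_of_real (ln r)) * exp (z * complex_of_real (ln x))) A"
    unfolding pw_def using assms
    by (subst fc_scale) (auto simp: fpsd_dg ln_mult algebra_simps exp_add intro!: fc_cong_psd)
  then show ?thesis by (simp add: fc_cs fpsd_dg assms pw_def)
qed

lemma lg_scale:
  assumes "fpsd A" "0 < r"
  shows "lg (r *\<^sub>r A) = lg A + (ln r) *\<^sub>r sp A"
proof -
  have "lg (r *\<^sub>r A) = fc (\<lambda>x. complex_of_real (ln x) + complex_of_real (ln r) * exp (0 * complex_of_real (ln x))) A"
    unfolding lg_def using assms
    by (subst fc_scale) (auto simp: fpsd_dg ln_mult intro!: fc_cong_psd)
  then show ?thesis by (simp only: fc_cs[OF fpsd_dg[OF assms(1)]] fc_add[OF fpsd_dg[OF assms(1)]] pw_def lg_def)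
qed

lemma sdec_reix: "inj e \<Longrightarrow> sdec A K l P \<Longrightarrow> sdec (reix e A) K l (\<lambda>k. reix e (P k))"
  by (auto simp: sdec_def reix_mult[symmetric])

lemma fc_reix: assumes "inj e" "dg A = A" shows "fc f (reix e A) = reix e (fc f A)"
proof -
  obtain K :: "nat set" and l P where s: "sdec A K l P" by (rule hermitian_sdec[OF assms(2)])
  show ?thesis by (simp add: fc_sdec[OF sdec_reix[OF assms(1) s]] fc_sdec[OF s])
qed

lemma sdec_tn:
  assumes "sdec A K l P" "sdec B J m Q"
  shows "sdec (A \<star> B) (K \<times> J) (\<lambda>(k, j). l k * m j) (\<lambda>(k, j). P k \<star> Q j)"
proof -
  have "A \<star> B = (\<Sum>(k, j)\<in>K \<times> J. (l k * m j) *\<^sub>r (P k \<star> Q j))"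
    by (subst sdecD(4)[OF assms(1)], subst sdecD(4)[OF assms(2)])
      (simp add: sum.cartesian_product[symmetric] cs_sum_right cs_cs sum.swap[of _ J] mult.commute)
  then show ?thesis using assms by (auto simp: sdec_def split: prod.splits intro!: sum.cong)
qed

lemma fc_tn_mult:
  assumes "dg A = A" "dg B = B" "\<And>x y. x \<noteq> 0 \<Longrightarrow> y \<noteq> 0 \<Longrightarrow> f (x * y) = g x * h y"
  shows "fc f (A \<star> B) = fc g A \<star> fc h B"
proof -
  obtain K :: "nat set" and l P where s: "sdec A K l P" by (rule hermitian_sdec[OF assms(1)])
  obtain J :: "nat set" and m Q where t: "sdec B J m Q" by (rule hermitian_sdec[OF assms(2)])
  show ?thesis
    by (simp add: fc_sdec[OF sdec_tn[OF s t]] fc_sdec[OF s] fc_sdec[OF t] sum.cartesian_product' cs_sum_right cs_cs sum.swap[of _ J])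
      (auto simp: on_nonzero_def assms(3) mult.commute intro!: sum.cong)
qed

lemma pw_tn:
  assumes "fpsd A" "fpsd B" shows "pw (A \<star> B) z = pw A z \<star> pw B z"
proof -
  \<comment> \<open>With the absolute value under the logarithm the function is multiplicative on
    all nonzero reals, as \<open>fc_tn_mult\<close> requires; on positive eigenvalues nothing
    changes.\<close>
  have "pw (A \<star> B) z = fc (\<lambda>x. exp (z * complex_of_real (ln \<bar>x\<bar>))) (A \<star> B)"
    unfolding pw_def by (rule fc_cong_psd) (auto intro: fpsd_tn assms)
  also have "\<dots> = fc (\<lambda>x. exp (z * complex_of_real (ln \<bar>x\<bar>))) A \<star> fc (\<lambda>x. exp (z * complex_of_real (ln \<bar>x\<bar>))) B"
    by (rule fc_tn_mult) (auto simp: fpsd_dg assms abs_mult ln_mult algebra_simps exp_add)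
  also have "fc (\<lambda>x. exp (z * complex_of_real (ln \<bar>x\<bar>))) A = pw A z"
    unfolding pw_def by (rule fc_cong_psd) (auto intro: assms)
  also have "fc (\<lambda>x. exp (z * complex_of_real (ln \<bar>x\<bar>))) B = pw B z"
    unfolding pw_def by (rule fc_cong_psd) (auto intro: assms)
  finally show ?thesis .
qed

text \<open>The logarithm is additive rather than multiplicative, so the eigenvalue expansions are
  compared directly; each summand carries the support projection of the other factor.\<close>

lemma lg_tn:
  assumes A: "fpsd A" and B: "fpsd B"
  shows "lg (A \<star> B) = lg A \<star> sp B + sp A \<star> lg B"
proof -
  obtain K :: "nat set" and l P where s: "sdec A K l P" "\<And>k. k \<in> K \<Longrightarrow> 0 < l k \<and> P k \<noteq> 0"
    by (rule fpsd_sdec[OF A]) blast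
  obtain J :: "nat set" and m Q where t: "sdec B J m Q" "\<And>k. k \<in> J \<Longrightarrow> 0 < m k \<and> Q k \<noteq> 0"
    by (rule fpsd_sdec[OF B]) blast
  have l0: "l k \<noteq> 0" if "k \<in> K" for k using s(2)[OF that] by simp
  have m0: "m j \<noteq> 0" if "j \<in> J" for j using t(2)[OF that] by simp
  have "lg (A \<star> B) = (\<Sum>k\<in>K. \<Sum>j\<in>J. (ln (l k) + ln (m j)) *\<^sub>r (P k \<star> Q j))"
    unfolding lg_def fc_sdec[OF sdec_tn[OF s(1) t(1)]] sum.cartesian_product[symmetric]
    using s(2) t(2) by (auto simp: on_nonzero_def split_def ln_mult less_imp_neq sum.cartesian_product intro!: sum.cong) fastforce+
  also have "\<dots> = (\<Sum>k\<in>K. \<Sum>j\<in>J. (ln (l k)) *\<^sub>r (P k \<star> Q j))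
      + (\<Sum>k\<in>K. \<Sum>j\<in>J. (ln (m j)) *\<^sub>r (P k \<star> Q j))"
    by (simp add: cs_add_left sum.distrib)
  also have "(\<Sum>k\<in>K. \<Sum>j\<in>J. (ln (l k)) *\<^sub>r (P k \<star> Q j))
      = (\<Sum>k\<in>K. (ln (l k)) *\<^sub>r P k) \<star> (\<Sum>j\<in>J. Q j)"
    by (simp add: cs_sum_right sum.swap[of _ K])
  also have "(\<Sum>k\<in>K. \<Sum>j\<in>J. (ln (m j)) *\<^sub>r (P k \<star> Q j))
      = (\<Sum>k\<in>K. P k) \<star> (\<Sum>j\<in>J. (ln (m j)) *\<^sub>r Q j)"
    by (simp add: cs_sum_right sum.swap[of _ K])
  also have "(\<Sum>k\<in>K. (ln (l k)) *\<^sub>r P k) = lg A"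
    using l0 by (auto simp: lg_def fc_sdec[OF s(1)] on_nonzero_def intro!: sum.cong)
  also have "(\<Sum>j\<in>J. (ln (m j)) *\<^sub>r Q j) = lg B"
    using m0 by (auto simp: lg_def fc_sdec[OF t(1)] on_nonzero_def intro!: sum.cong)
  also have "(\<Sum>k\<in>K. P k) = sp A"
    using l0 by (auto simp: pw_def fc_sdec[OF s(1)] on_nonzero_def intro!: sum.cong)
  also have "(\<Sum>j\<in>J. Q j) = sp B"
    using m0 by (auto simp: pw_def fc_sdec[OF t(1)] on_nonzero_def intro!: sum.cong)
  finally show ?thesis .
qed

lemma lg_sp: "fpsd A \<Longrightarrow> lg A * sp A = lg A" "fpsd A \<Longrightarrow> sp A * lg A = lg A"
  by (simp_all add: lg_def pw_def fc_mult fpsd_dg)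

text \<open>Support inclusion is expressed by \<open>sp S * R = R\<close>.\<close>
lemma sp_mult_dominated:
  assumes R: "fpsd R" and S: "fpsd S" and le: "fpsd (c *\<^sub>r S - R)"
  shows "sp S * R = R"
proof -
  obtain E where E: "R = dg E * E" using fpsd_sqrt[OF R] by blast
  \<comment> \<open>\<open>G\<close> is the part of \<open>dg E\<close> outside the support of
    \<open>S\<close>. Testing c S - R on it leaves minus the squared norm of \<open>E * G\<close>,
    so \<open>E * G\<close> vanishes, and with it \<open>dg G * G\<close>.\<close>
  define G where "G = dg E - sp S * dg E"
  have SG: "S * G = 0" by (simp add: G_def right_diff_distrib S flip: mult.assoc)
  have PG: "sp S * G = 0" by (simp add: G_def right_diff_distrib S pw_add flip: mult.assoc)
  have "0 \<le> Re (tr (dg G * (c *\<^sub>r S - R) * G))" by (rule fpsd_conj_tr[OF le])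
  also have "dg G * (c *\<^sub>r S - R) * G = - (dg (E * G) * (E * G))"
    by (simp add: algebra_simps SG E)
  finally have "Re (tr (dg (E * G) * (E * G))) \<le> 0" by simp
  then have "tr (dg (E * G) * (E * G)) = 0"
    using tr_dg_mult_nonneg[of "E * G"] by (simp add: complex_eq_iff)
  then have EG: "E * G = 0" by (rule dg_mult_self_zero)
  have "dg G * G = E * G - E * (sp S * G)"
    by (subst (1) G_def) (simp add: algebra_simps S)
  then have "dg G * G = 0" using EG PG by simp
  then have "G = 0" using dg_mult_self_zero[of G] by simp
  then show ?thesis by (simp add: G_def E flip: mult.assoc)
qed

section \<open>Interpolation and data processing\<close>

text \<open>The factor exp (\<epsilon> (z^2 - 1)) has modulus at most 1 on both boundary lines and
  decays vertically. This reduces the strip to a rectangle, where the maximum principle applies; the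
  size of \<open>B\<close> only affects the height of the rectangle.\<close>

lemma three_lines:
  fixes f :: "complex \<Rightarrow> complex"
  assumes holo: "f holomorphic_on UNIV"
    and B: "\<And>z. 0 \<le> Re z \<Longrightarrow> Re z \<le> 1 \<Longrightarrow> cmod (f z) \<le> B"
    and b0: "\<And>y. cmod (f (Complex 0 y)) \<le> 1" and b1: "\<And>y. cmod (f (Complex 1 y)) \<le> 1"
    and p: "0 \<le> p" "p \<le> 1"
  shows "cmod (f (complex_of_real p)) \<le> 1"
proof (rule ccontr)
  assume "\<not> ?thesis"
  then have gt: "1 < cmod (f (complex_of_real p))" by simp
  \<comment> \<open>Half of the excess: damping costs at most a factor exp (- \<epsilon>) at the
    point p, where the modulus is exp (2 \<epsilon>), so a value of at least exp \<epsilon> > 1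
    would survive.\<close>
  define \<epsilon> where "\<epsilon> = ln (cmod (f (complex_of_real p))) / 2"
  have e: "0 < \<epsilon>" using ln_gt_zero[OF gt] by (simp add: \<epsilon>_def)
  define g where "g z = f z * exp (complex_of_real \<epsilon> * (z\<^sup>2 - 1))" for z
  have B1: "1 \<le> B" using B[of "complex_of_real p"] p gt by simp
  \<comment> \<open>Since R >= 1, also R^2 >= R >= ln B / \<epsilon>, so on the horizontal sides the
    damping outweighs \<open>B\<close>.\<close>
  define R where "R = 1 + ln B / \<epsilon>"
  have R1: "1 \<le> R" using B1 e by (simp add: R_def)
  have g: "cmod (g z) = cmod (f z) * exp (\<epsilon> * ((Re z)\<^sup>2 - (Im z)\<^sup>2 - 1))" for z
    by (simp add: g_def norm_mult power2_eq_square)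
  have front: "cmod (g z) \<le> 1" if z: "z \<in> frontier (cbox (Complex 0 (- R)) (Complex 1 R))" for z
  proof -
    have zc: "0 \<le> Re z" "Re z \<le> 1" "- R \<le> Im z" "Im z \<le> R"
      and zb: "Re z = 0 \<or> Re z = 1 \<or> \<bar>Im z\<bar> = R"
      using z unfolding frontier_def interior_cbox
      by (auto simp: in_cbox_complex_iff in_box_complex_iff)
    have sq: "(Re z)\<^sup>2 \<le> 1" using zc by (simp add: power_le_one)
    show ?thesis
    proof (cases "Re z = 0 \<or> Re z = 1")
      case True
      then have "cmod (f z) \<le> 1" using b0[of "Im z"] b1[of "Im z"] by (metis complex_surj)
      moreover have "(Re z)\<^sup>2 - (Im z)\<^sup>2 - 1 \<le> 0"
        using sq zero_le_power2[of "Im z"] by linarith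
      then have "exp (\<epsilon> * ((Re z)\<^sup>2 - (Im z)\<^sup>2 - 1)) \<le> 1"
        using e mult_nonneg_nonpos[of \<epsilon>] by simp
      ultimately show ?thesis unfolding g by (simp add: mult_le_one)
    next
      case False
      then have "(Im z)\<^sup>2 = R\<^sup>2" using zb by (metis power2_abs)
      moreover have "R \<le> R\<^sup>2" using R1 by (simp add: power2_eq_square)
      ultimately have "(Re z)\<^sup>2 - (Im z)\<^sup>2 - 1 \<le> - (ln B / \<epsilon>)" using sq by (simp add: R_def)
      then have "\<epsilon> * ((Re z)\<^sup>2 - (Im z)\<^sup>2 - 1) \<le> - ln B"
        using e by (simp add: field_simps)
      then have "exp (\<epsilon> * ((Re z)\<^sup>2 - (Im z)\<^sup>2 - 1)) \<le> 1 / B"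
        using B1 exp_le_cancel_iff[of _ "- ln B"] by (simp add: exp_minus inverse_eq_divide)
      then have "cmod (g z) \<le> B * (1 / B)" unfolding g using B[of z] zc B1 by (intro mult_mono) auto
      then show ?thesis using B1 by simp
    qed
  qed
  have "cmod (g (complex_of_real p)) \<le> 1"
  proof (rule maximum_modulus_frontier[where S = "cbox (Complex 0 (- R)) (Complex 1 R)" and f = g])
    have hg: "g holomorphic_on UNIV" unfolding g_def by (intro holomorphic_intros holo)
    show "g holomorphic_on interior (cbox (Complex 0 (- R)) (Complex 1 R))"
      using hg holomorphic_on_subset by blast
    show "continuous_on (closure (cbox (Complex 0 (- R)) (Complex 1 R))) g"
      using holomorphic_on_imp_continuous_on[OF hg] continuous_on_subset by blast
    show "complex_of_real p \<in> cbox (Complex 0 (- R)) (Complex 1 R)"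
      using p R1 by (simp add: in_cbox_complex_iff)
  qed (auto intro: front)
  moreover have "cmod (g (complex_of_real p)) \<ge> cmod (f (complex_of_real p)) * exp (- \<epsilon>)"
    unfolding g using e by (intro mult_left_mono) (auto simp: algebra_simps)
  moreover have "cmod (f (complex_of_real p)) = exp (2 * \<epsilon>)" 
  proof -
    have "f (complex_of_real p) \<noteq> 0" using gt by auto
    then show ?thesis by (simp add: \<epsilon>_def)
  qed
  ultimately have "exp \<epsilon> \<le> 1" by (simp flip: exp_add del: exp_le_one_iff)
  then show False using e by simp
qed

text \<open>Exponential sums with real frequencies are entire and bounded on the strip, hence
  satisfy the analytic hypotheses of the three lines theorem automatically, and they are closed
  under products and linear maps.\<close>

inductive exp_sum :: "(complex \<Rightarrow> 'i fm) \<Rightarrow> bool" where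
  exp_sum_exp: "exp_sum (\<lambda>z. exp (complex_of_real t * z) *\<^sub>c A)"
| exp_sum_add: "exp_sum F \<Longrightarrow> exp_sum G \<Longrightarrow> exp_sum (\<lambda>z. F z + G z)"

lemma exp_sum_const: "exp_sum (\<lambda>z. A)"
  using exp_sum_exp[of 0 A] by simp

lemma exp_sum_sum: "(\<And>k. k \<in> K \<Longrightarrow> exp_sum (F k)) \<Longrightarrow> exp_sum (\<lambda>z. \<Sum>k\<in>K. F k z)"
  by (induct K rule: infinite_finite_induct) (auto intro: exp_sum_const exp_sum_add)

lemma exp_sum_lin: "exp_sum F \<Longrightarrow> lin \<Phi> \<Longrightarrow> exp_sum (\<lambda>z. \<Phi> (F z))"
  by (induct rule: exp_sum.induct) (auto simp: lin_simps intro: exp_sum.intros)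

lemma exp_sum_mult: assumes "exp_sum F" "exp_sum G" shows "exp_sum (\<lambda>z. F z * G z)"
  using assms(1)
proof (induct rule: exp_sum.induct)
  case (exp_sum_exp t A)
  show ?case using assms(2)
  proof (induct rule: exp_sum.induct)
    case (exp_sum_exp s B)
    have "(\<lambda>z. (exp (complex_of_real t * z) *\<^sub>c A) * (exp (complex_of_real s * z) *\<^sub>c B))
        = (\<lambda>z. exp (complex_of_real (t + s) * z) *\<^sub>c (A * B))"
      by (simp add: cs_cs algebra_simps exp_add)
    then show ?case by (simp only: exp_sum.exp_sum_exp)
  qed (simp only: distrib_left exp_sum_add)
qed (simp only: distrib_right exp_sum_add)

lemma exp_sum_affine: "exp_sum F \<Longrightarrow> exp_sum (\<lambda>z. F (complex_of_real a * z + b))"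
proof (induct rule: exp_sum.induct)
  case (exp_sum_exp t A)
  have "(\<lambda>z. exp (complex_of_real t * (complex_of_real a * z + b)) *\<^sub>c A)
      = (\<lambda>z. exp (complex_of_real (t * a) * z) *\<^sub>c (exp (complex_of_real t * b) *\<^sub>c A))"
    by (simp add: cs_cs algebra_simps exp_add)
  then show ?case by (simp only: exp_sum.exp_sum_exp)
qed (rule exp_sum_add)

lemma exp_sum_pw0: assumes "dg A = A" shows "exp_sum (pw A)"
proof -
  obtain K :: "nat set" and l P where s: "sdec A K l P" "\<And>k. k \<in> K \<Longrightarrow> l k \<noteq> 0 \<and> P k \<noteq> 0"
    by (rule hermitian_sdec[OF assms]) blast
  have "pw A = (\<lambda>z. \<Sum>k\<in>K. exp (complex_of_real (ln (l k)) * z) *\<^sub>c P k)"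
    using s(2) by (auto simp: pw_def fc_sdec[OF s(1)] on_nonzero_def mult.commute fun_eq_iff intro!: sum.cong)
  then show ?thesis by (auto intro: exp_sum_sum exp_sum_exp)
qed

lemma exp_sum_pw:
  assumes "fpsd A" "\<And>z. h z = complex_of_real a * z + b"
  shows "exp_sum (\<lambda>z. pw A (h z))"
  using exp_sum_affine[OF exp_sum_pw0[OF fpsd_dg[OF assms(1)]], of a b] by (simp add: assms(2))

lemma three_lines_exp_sum:
  assumes exp_sum: "exp_sum F"
    and b: "\<And>y. cmod (tr (F (Complex 0 y))) \<le> 1" "\<And>y. cmod (tr (F (Complex 1 y))) \<le> 1"
    and p: "0 \<le> p" "p \<le> 1"
  shows "cmod (tr (F (complex_of_real p))) \<le> 1"
proof -
  have "(\<lambda>z. tr (F z)) holomorphic_on UNIV \<and>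
      (\<exists>B. \<forall>z. 0 \<le> Re z \<longrightarrow> Re z \<le> 1 \<longrightarrow> cmod (tr (F z)) \<le> B)"
    using exp_sum
  proof (induct rule: exp_sum.induct)
    case (exp_sum_exp t A)
    have "cmod (tr (exp (complex_of_real t * z) *\<^sub>c A)) \<le> exp \<bar>t\<bar> * cmod (tr A)"
      if "0 \<le> Re z" "Re z \<le> 1" for z
    proof -
      have "t * Re z \<le> \<bar>t\<bar> * Re z" using that by (simp add: mult_right_mono)
      also have "\<dots> \<le> \<bar>t\<bar>" using that by (simp add: mult_left_le)
      finally have "t * Re z \<le> \<bar>t\<bar>" .
      then show ?thesis by (simp add: norm_mult mult_right_mono)
    qed
    then show ?case by (auto intro!: holomorphic_intros)
  next
    case (exp_sum_add F G)
    then obtain B C where "\<forall>z. 0 \<le> Re z \<longrightarrow> Re z \<le> 1 \<longrightarrow> cmod (tr (F z)) \<le> B"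
      "\<forall>z. 0 \<le> Re z \<longrightarrow> Re z \<le> 1 \<longrightarrow> cmod (tr (G z)) \<le> C" by blast
    then have "cmod (tr (F z + G z)) \<le> B + C" if "0 \<le> Re z" "Re z \<le> 1" for z
      using that norm_triangle_mono[of "tr (F z)" B "tr (G z)" C] by simp
    moreover have "(\<lambda>z. tr (F z + G z)) holomorphic_on UNIV"
      using exp_sum_add by (auto intro!: holomorphic_intros)
    ultimately show ?case by blast
  qed
  then obtain B where "(\<lambda>z. tr (F z)) holomorphic_on UNIV"
    "\<And>z. 0 \<le> Re z \<Longrightarrow> Re z \<le> 1 \<Longrightarrow> cmod (tr (F z)) \<le> B" by blast
  from three_lines[OF this b p] show ?thesis .
qed

subsection \<open>Contractions and Schwarz maps\<close>

text \<open>Operator norm at most 1, expressed by Hilbert-Schmidt norms so that it combines directly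
  with traces.\<close>

definition contractive :: "'i fm \<Rightarrow> bool" where
  "contractive h \<longleftrightarrow> (\<forall>X. Re (tr (dg (h * X) * (h * X))) \<le> Re (tr (dg X * X)))"

lemma contractiveD: "contractive h \<Longrightarrow> Re (tr (dg (h * X) * (h * X))) \<le> Re (tr (dg X * X))"
  by (simp add: contractive_def)

lemma tr_dg_swap: "tr (dg (X * h) * (X * h)) = tr (dg (dg h * dg X) * (dg h * dg X))"
  by (simp add: tr_commute[of "dg h * dg X"])

lemma contractiveD_right: "contractive (dg h) \<Longrightarrow> Re (tr (dg (X * h) * (X * h))) \<le> Re (tr (dg X * X))"
  using contractiveD[of "dg h" "dg X"] tr_dg_swap[of X h] tr_commute[of "dg X" X] by simp

lemma contractive_mult: "contractive h \<Longrightarrow> contractive g \<Longrightarrow> contractive (h * g)"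
  unfolding contractive_def by (metis mult.assoc order_trans)

text \<open>The loss is exact: it is the squared Hilbert-Schmidt norm of X - P X. With
  \<open>P\<close> a support projection this covers imaginary powers, which are only partial
  isometries.\<close>

lemma contractive_isometry:
  assumes "dg P = P" "P * P = P" "dg h * h = P" shows "contractive h"
proof -
  have "Re (tr (dg (h * X) * (h * X))) \<le> Re (tr (dg X * X))" for X
  proof -
    have e: "dg (h * X) * (h * X) = dg X * (P * X)" by (simp add: assms(3)[symmetric] mult.assoc)
    have f: "dg (X - P * X) * (X - P * X) = dg X * X - dg X * (P * X)"
      using assms(1,2) by (simp add: algebra_simps) (simp add: assms(2) flip: mult.assoc)
    show ?thesis using tr_dg_mult_nonneg(1)[of "X - P * X"] unfolding e f by simp
  qed
  then show ?thesis by (simp add: contractive_def)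
qed

lemma contractive_pw: "fpsd A \<Longrightarrow> Re z = 0 \<Longrightarrow> contractive (pw A z)"
proof (rule contractive_isometry[of "sp A"])
  assume "fpsd A" "Re z = 0"
  moreover from this have "cnj z = - z" by (simp add: complex_eq_iff)
  ultimately show "dg (pw A z) * pw A z = sp A" by (simp add: pw_add)
qed (simp_all add: pw_add)

lemma fpsd_contractive:
  assumes "fpsd A" "contractive (dg e)" shows "Re (tr (dg e * A * e)) \<le> Re (tr A)"
proof -
  obtain G where G: "A = dg G * G" using fpsd_sqrt assms(1) by blast
  show ?thesis using contractiveD_right[OF assms(2), of G] by (simp add: G mult.assoc)
qed

text \<open>The only consequences of complete positivity and trace preservation that the interpolation
  arguments use.\<close>
definition schwarz_map :: "('i fm \<Rightarrow> 'j fm) \<Rightarrow> bool" where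
  "schwarz_map \<Phi> \<longleftrightarrow> lin \<Phi> \<and> (\<forall>A. fpsd A \<longrightarrow> fpsd (\<Phi> A))
     \<and> (\<forall>a. Re (tr (\<Phi> (dg a * a))) \<le> Re (tr (dg a * a)))
     \<and> (\<forall>a b c e. 2 * Re (tr (dg c * \<Phi> (dg a * b) * e))
          \<le> Re (tr (dg c * \<Phi> (dg a * a) * c)) + Re (tr (dg e * \<Phi> (dg b * b) * e)))"

lemma schwarz_map_tr_le: "schwarz_map \<Phi> \<Longrightarrow> Re (tr (\<Phi> (dg a * a))) \<le> Re (tr (dg a * a))"
  by (simp add: schwarz_map_def)

text \<open>Multiplying \<open>b\<close> by a phase turns the trace into its modulus and leaves
  \<open>dg b * b\<close> unchanged.\<close>

lemma schwarz_map_cmod: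
  assumes s: "schwarz_map \<Phi>"
    and 1: "Re (tr (dg c * \<Phi> (dg a * a) * c)) \<le> 1" and 2: "Re (tr (dg e * \<Phi> (dg b * b) * e)) \<le> 1"
  shows "cmod (tr (dg c * \<Phi> (dg a * b) * e)) \<le> 1"
proof (cases "tr (dg c * \<Phi> (dg a * b) * e) = 0")
  case False
  define w where "w = tr (dg c * \<Phi> (dg a * b) * e)"
  define \<zeta> where "\<zeta> = cnj w / complex_of_real (cmod w)"
  have lin: "lin \<Phi>" using s by (simp add: schwarz_map_def)
  have w: "w \<noteq> 0" using False by (simp add: w_def)
  have z1: "cnj \<zeta> * \<zeta> = 1"
    using w by (simp add: \<zeta>_def complex_norm_square[symmetric] power2_eq_square field_simps)
  have zw: "\<zeta> * w = complex_of_real (cmod w)"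
    using w by (simp add: \<zeta>_def field_simps complex_norm_square[symmetric] power2_eq_square)
  have "2 * Re (tr (dg c * \<Phi> (dg a * (\<zeta> *\<^sub>c b)) * e))
      \<le> Re (tr (dg c * \<Phi> (dg a * a) * c)) + Re (tr (dg e * \<Phi> (dg (\<zeta> *\<^sub>c b) * (\<zeta> *\<^sub>c b)) * e))"
    using s unfolding schwarz_map_def by blast
  also have "tr (dg c * \<Phi> (dg a * (\<zeta> *\<^sub>c b)) * e) = \<zeta> * w" by (simp add: w_def lin_cs[OF lin])
  also have "dg (\<zeta> *\<^sub>c b) * (\<zeta> *\<^sub>c b) = dg b * b" by (simp add: cs_cs z1 mult.commute[of \<zeta>])
  finally have "2 * cmod w \<le> 2" using 1 2 by (simp add: zw)
  then show ?thesis by (simp add: w_def)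
qed simp

lemma schwarz_map_mono:
  assumes s: "schwarz_map \<Phi>" and le: "fpsd (B - A)"
  shows "Re (tr (dg e * \<Phi> A * e)) \<le> Re (tr (dg e * \<Phi> B * e))"
proof -
  have lin: "lin \<Phi>" and "fpsd (\<Phi> (B - A))" using s le by (auto simp: schwarz_map_def)
  then have "0 \<le> Re (tr (dg e * (\<Phi> B - \<Phi> A) * e))" by (metis fpsd_conj_tr lin_diff)
  then show ?thesis by (simp add: algebra_simps)
qed

subsection \<open>Schatten norms of positive matrices\<close>

text \<open>The Schatten norm with exponent \<open>1 / (1 - p)\<close>.\<close>
definition schatten :: "real \<Rightarrow> 'i fm \<Rightarrow> real" where
  "schatten p X = Re (tr (pw X (complex_of_real (1 / (1 - p))))) powr (1 - p)"

lemma pw_zero_arg [simp]: "pw 0 z = 0"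
  using fc_sdec[of 0 "{}" undefined undefined] by (simp add: pw_def sdec_def)

lemma schatten_zero [simp]: "schatten p 0 = 0" by (simp add: schatten_def)

lemma schatten_nonneg [simp]: "0 \<le> schatten p X" by (simp add: schatten_def)

lemma pw_eq_zero: assumes "fpsd X" "pw X z = 0" shows "X = 0"
proof -
  have "X = pw X z * pw X (1 - z)" by (simp add: pw_add pw_one assms(1))
  then show ?thesis by (simp add: assms(2))
qed

lemma tr_pw_pos: assumes "fpsd X" "X \<noteq> 0" shows "0 < Re (tr (pw X (complex_of_real s)))"
  using fpsd_tr[OF fpsd_pw[OF assms(1), of s]] fpsd_tr_zero[OF fpsd_pw[OF assms(1), of s]]
    pw_eq_zero[OF assms(1)] assms(2) by (metis less_eq_real_def)

lemma schatten_pos: "fpsd X \<Longrightarrow> X \<noteq> 0 \<Longrightarrow> 0 < schatten p X"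
  using tr_pw_pos[of X "1 / (1 - p)"] by (simp add: schatten_def)

text \<open>With \<alpha> = 1 / (1 - p), the state X^\<alpha> / tr X^\<alpha> attains the duality
  between Schatten norms. Conversely \<open>X\<close> is a multiple of its power 1 - p, so a
  positive matrix is exchanged for a norm and a state.\<close>

lemma schatten_attained:
  assumes X: "fpsd X" "X \<noteq> 0" and p: "0 < p" "p < 1"
  obtains \<tau> where "fpsd \<tau>" "tr \<tau> = 1" "tr (X * pw \<tau> (complex_of_real p)) = complex_of_real (schatten p X)"
    "X = (schatten p X) *\<^sub>r pw \<tau> (complex_of_real (1 - p))"
    "pw X (complex_of_real (1 / (1 - p))) = complex_of_real (Re (tr (pw X (complex_of_real (1 / (1 - p)))))) *\<^sub>c \<tau>"
proof -
  define \<alpha> where "\<alpha> = 1 / (1 - p)"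
  define T where "T = Re (tr (pw X (complex_of_real \<alpha>)))"
  have T: "0 < T" unfolding T_def by (rule tr_pw_pos[OF X])
  have trT: "tr (pw X (complex_of_real \<alpha>)) = complex_of_real T"
    unfolding T_def by (simp add: of_real_Re_tr fpsd_dg fpsd_pw X)
  define \<tau> where "\<tau> = (1 / T) *\<^sub>r pw X (complex_of_real \<alpha>)"
  have pt: "fpsd \<tau>" unfolding \<tau>_def using T by (intro fpsd_cs fpsd_pw X) simp
  have tt: "tr \<tau> = 1" using T by (simp add: \<tau>_def trT)
  have pwt: "pw \<tau> (complex_of_real s) = (T powr (- s)) *\<^sub>r pw X (complex_of_real (s * \<alpha>))" for s
    unfolding \<tau>_def using T
    by (subst pw_scale) (auto intro: fpsd_pw X simp: pw_pw X powr_def ln_div exp_of_real simp flip: of_real_mult of_real_minus)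
  have pnT: "schatten p X = T powr (1 - p)" by (simp add: schatten_def T_def \<alpha>_def)
  have a: "(1 - p) * \<alpha> = 1" "1 + p * \<alpha> = \<alpha>" using p by (simp_all add: \<alpha>_def field_simps)
  have "tr (X * pw \<tau> (complex_of_real p)) = complex_of_real (T powr (- p)) * tr (pw X 1 * pw X (complex_of_real (p * \<alpha>)))"
    by (simp add: pwt pw_one X)
  also have "pw X 1 * pw X (complex_of_real (p * \<alpha>)) = pw X (complex_of_real \<alpha>)"
    using a(2) by (simp add: pw_add X flip: of_real_mult) (metis of_real_1 of_real_add)
  also have "complex_of_real (T powr (- p)) * tr (pw X (complex_of_real \<alpha>)) = complex_of_real (T powr (- p) * T powr 1)"
    using T by (simp add: trT)
  also have "\<dots> = complex_of_real (schatten p X)" by (simp only: pnT flip: powr_add) simp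
  finally have 1: "tr (X * pw \<tau> (complex_of_real p)) = complex_of_real (schatten p X)" .
  have "(schatten p X) *\<^sub>r pw \<tau> (complex_of_real (1 - p))
      = (T powr (1 - p) * T powr (- (1 - p))) *\<^sub>r pw X (complex_of_real 1)"
    by (simp only: pwt pnT a(1) cs_cs of_real_mult)
  also have "\<dots> = X" using T by (simp add: pw_one X flip: powr_add)
  finally have 2: "X = (schatten p X) *\<^sub>r pw \<tau> (complex_of_real (1 - p))" ..
  have 3: "pw X (complex_of_real \<alpha>) = T *\<^sub>r \<tau>"
    using T by (simp add: \<tau>_def cs_cs)
  show ?thesis using that[OF pt tt 1 2] 3 by (simp add: T_def \<alpha>_def)
qed

subsection \<open>Data processing for the sandwiched divergence\<close>

text \<open>For p = (\<alpha> - 1) / \<alpha> this is the Schatten \<alpha>-norm of the sandwiched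
  matrix, since (1 - \<alpha>) / (2 \<alpha>) = - p / 2. The divergence of order \<alpha> is its
  logarithm divided by p.\<close>

definition sandwich_norm :: "real \<Rightarrow> 'i fm \<Rightarrow> 'i fm \<Rightarrow> real" where
  "sandwich_norm p \<rho> \<sigma> = schatten p (pw \<sigma> (- complex_of_real (p / 2)) * \<rho> * pw \<sigma> (- complex_of_real (p / 2)))"

text \<open>On each boundary line the trace is written as tr (c* \<Phi>(a* b) e). For Re z = 0 the
  outer factors are contractions and a, b have Hilbert-Schmidt norm at most 1. For Re z = 1 both a*
  a and b* b are at most \<sigma>, the powers of \<Phi>(\<sigma>) in c and e cancel \<Phi>(\<sigma>)
  down to a support projection, and what remains is bounded by tr \<tau> = 1.\<close>

lemma dpi_bound:
  fixes \<Phi> :: "'i fm \<Rightarrow> 'j fm"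
  assumes s: "schwarz_map \<Phi>" and \<sigma>: "fpsd \<sigma>" and \<omega>: "fpsd \<omega>" "tr \<omega> = 1" and \<tau>: "fpsd \<tau>" "tr \<tau> = 1"
    and p: "0 \<le> p" "p \<le> 1"
  defines "F \<equiv> \<lambda>z. \<Phi> (pw \<sigma> (z / 2) * pw \<omega> (1 - z) * pw \<sigma> (z / 2))
      * (pw (\<Phi> \<sigma>) (- z / 2) * pw \<tau> z * pw (\<Phi> \<sigma>) (- z / 2))"
  shows "cmod (tr (F (complex_of_real p))) \<le> 1"
proof (rule three_lines_exp_sum[OF _ _ _ p])
  have lin: "lin \<Phi>" and s': "fpsd (\<Phi> \<sigma>)" and pos: "\<And>A. fpsd A \<Longrightarrow> fpsd (\<Phi> A)"
    using s \<sigma> by (auto simp: schwarz_map_def)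
  show "exp_sum F" unfolding F_def
    by (intro exp_sum_mult exp_sum_lin[OF _ lin] exp_sum_pw[OF \<sigma>, of _ "1/2" 0] exp_sum_pw[OF s', of _ "-1/2" 0]
        exp_sum_pw[OF \<omega>(1), of _ "-1" 1] exp_sum_pw[OF \<tau>(1), of _ 1 0]) simp_all
  fix y
  define u where "u = Complex 0 (y / 2)"
  have cu: "cnj u = - u" "Re u = 0" by (simp_all add: u_def complex_eq_iff)
  have u0: "Complex 0 y / 2 = u" "- Complex 0 y / 2 = - u" and u0': "Complex 0 y = 2 * u"
    by (simp_all add: u_def complex_eq_iff)
  have u1: "Complex 1 y / 2 = 1 / 2 + u" "- Complex 1 y / 2 = - (1 / 2 + u)" "1 - Complex 1 y = - 2 * u"
    and u1': "Complex 1 y = 1 + 2 * u"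
    by (simp_all add: u_def complex_eq_iff)
  have uc: "- u - 1 / 2 = - (1 / 2) - u" by simp
  show "cmod (tr (F (Complex 0 y))) \<le> 1"
  proof -
    define a where "a = pw \<omega> (1 / 2) * pw \<sigma> (- u)"
    define b where "b = pw \<omega> (1 / 2 - 2 * u) * pw \<sigma> u"
    define c where "c = sp (\<Phi> \<sigma>)"
    define e where "e = pw (\<Phi> \<sigma>) (- u) * pw \<tau> (2 * u) * pw (\<Phi> \<sigma>) (- u)"
    have ab: "dg a * b = pw \<sigma> u * pw \<omega> (1 - 2 * u) * pw \<sigma> u"
      by (simp add: a_def b_def \<sigma> \<omega> cu pw_add pw_add' mult.assoc add_divide_distrib[symmetric])
    have "tr (F (Complex 0 y)) = tr (\<Phi> (dg a * b) * (e * c))"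
      unfolding F_def u0 ab unfolding u0' by (simp add: e_def c_def mult.assoc pw_add s')
    also have "\<dots> = tr (dg c * \<Phi> (dg a * b) * e)"
      by (simp add: c_def s' tr_commute[of _ "sp (\<Phi> \<sigma>)"] flip: mult.assoc)
    finally have F: "tr (F (Complex 0 y)) = tr (dg c * \<Phi> (dg a * b) * e)" .
    have half: "tr (dg (pw \<omega> (1 / 2)) * pw \<omega> (1 / 2)) = 1"
      "tr (dg (pw \<omega> (1 / 2 - 2 * u)) * pw \<omega> (1 / 2 - 2 * u)) = 1"
      by (simp_all add: \<omega> pw_add pw_one cu)
    have "Re (tr (dg a * a)) \<le> 1" unfolding a_def
      using contractiveD_right[of "pw \<sigma> (- u)" "pw \<omega> (1 / 2)"] half by (simp add: contractive_pw \<sigma> cu)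
    then have ta: "Re (tr (\<Phi> (dg a * a))) \<le> 1" using schwarz_map_tr_le[OF s] order_trans by blast
    have "Re (tr (dg b * b)) \<le> 1" unfolding b_def
      using contractiveD_right[of "pw \<sigma> u" "pw \<omega> (1 / 2 - 2 * u)"] half by (simp add: contractive_pw \<sigma> cu)
    then have tb: "Re (tr (\<Phi> (dg b * b))) \<le> 1" using schwarz_map_tr_le[OF s] order_trans by blast
    have "contractive (dg c)" "contractive (dg e)"
      unfolding c_def e_def using s' \<tau>(1) cu(2) by (auto intro!: contractive_mult contractive_pw)
    then show ?thesis unfolding F
      using fpsd_contractive[OF pos[OF fpsd_dgmult]] ta tb by (intro schwarz_map_cmod[OF s]) (meson order_trans)+
  qed
  show "cmod (tr (F (Complex 1 y))) \<le> 1"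
  proof -
    define a where "a = pw \<sigma> (1 / 2 - u)"
    define b where "b = pw \<omega> (- 2 * u) * pw \<sigma> (1 / 2 + u)"
    define c where "c = pw (\<Phi> \<sigma>) (- (1 / 2 - u)) * pw \<tau> (1 / 2 - 2 * u)"
    define e where "e = pw (\<Phi> \<sigma>) (- (1 / 2 + u)) * pw \<tau> (1 / 2)"
    have ab: "dg a * b = pw \<sigma> (1 / 2 + u) * pw \<omega> (- 2 * u) * pw \<sigma> (1 / 2 + u)"
      by (simp add: a_def b_def \<sigma> cu mult.assoc)
    have ec: "e * dg c = pw (\<Phi> \<sigma>) (- (1 / 2 + u)) * pw \<tau> (1 + 2 * u) * pw (\<Phi> \<sigma>) (- (1 / 2 + u))"
      by (simp add: e_def c_def s' \<tau> cu mult.assoc pw_add pw_add' uc)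
    have "tr (F (Complex 1 y)) = tr (\<Phi> (dg a * b) * (e * dg c))"
      unfolding F_def ab ec u1 unfolding u1' ..
    also have "\<dots> = tr (dg c * \<Phi> (dg a * b) * e)"
      by (simp add: tr_commute[of _ "dg c"] flip: mult.assoc)
    finally have F: "tr (F (Complex 1 y)) = tr (dg c * \<Phi> (dg a * b) * e)" .
    have sand: "pw (\<Phi> \<sigma>) (- w) * \<Phi> \<sigma> * pw (\<Phi> \<sigma>) (- (1 - w)) = sp (\<Phi> \<sigma>)" for w
      using pw_one[OF s'] pw_add[OF s'] pw_add'[OF s', of _ 1]
      by (metis (no_types, opaque_lifting) add.commute add.right_inverse diff_add_cancel minus_diff_eq mult.assoc pw_add[OF s'] uminus_add_conv_diff)
    have "dg a * a = \<sigma>" by (simp add: a_def \<sigma> cu pw_add pw_one)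
    then have "dg c * \<Phi> (dg a * a) * c
        = pw \<tau> (1 / 2 + 2 * u) * (pw (\<Phi> \<sigma>) (- (1 / 2 + u)) * \<Phi> \<sigma> * pw (\<Phi> \<sigma>) (- (1 - (1 / 2 + u)))) * pw \<tau> (1 / 2 - 2 * u)"
      by (simp add: c_def s' \<tau> cu mult.assoc uc)
    also have "\<dots> = dg (sp (\<Phi> \<sigma>) * pw \<tau> (1 / 2 - 2 * u)) * (sp (\<Phi> \<sigma>) * pw \<tau> (1 / 2 - 2 * u))"
      unfolding sand by (simp add: s' \<tau> cu pw_add' mult.assoc)
    finally have "Re (tr (dg c * \<Phi> (dg a * a) * c)) \<le> Re (tr (dg (pw \<tau> (1 / 2 - 2 * u)) * pw \<tau> (1 / 2 - 2 * u)))"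
      using contractiveD[of "sp (\<Phi> \<sigma>)"] contractive_pw[OF s', of 0] by simp
    also have "\<dots> = 1" by (simp add: \<tau> cu pw_add pw_one)
    finally have tc: "Re (tr (dg c * \<Phi> (dg a * a) * c)) \<le> 1" .
    \<comment> \<open>An imaginary power of \<omega> is only a partial isometry, so b* b is merely
      bounded by \<sigma>; the difference is a square.\<close>
    have "\<sigma> - dg b * b = dg (pw \<sigma> (1 / 2 + u) - sp \<omega> * pw \<sigma> (1 / 2 + u)) * (pw \<sigma> (1 / 2 + u) - sp \<omega> * pw \<sigma> (1 / 2 + u))"
      by (simp add: b_def \<sigma> \<omega> cu pw_add pw_add' pw_one algebra_simps)
    then have "fpsd (\<sigma> - dg b * b)" by (simp only: fpsd_dgmult)
    then have "Re (tr (dg e * \<Phi> (dg b * b) * e)) \<le> Re (tr (dg e * \<Phi> \<sigma> * e))"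
      by (rule schwarz_map_mono[OF s])
    also have "dg e * \<Phi> \<sigma> * e
        = pw \<tau> (1 / 2) * (pw (\<Phi> \<sigma>) (- (1 / 2 - u)) * \<Phi> \<sigma> * pw (\<Phi> \<sigma>) (- (1 - (1 / 2 - u)))) * pw \<tau> (1 / 2)"
      by (simp add: e_def s' \<tau> cu mult.assoc add.commute)
    also have "\<dots> = dg (sp (\<Phi> \<sigma>) * pw \<tau> (1 / 2)) * (sp (\<Phi> \<sigma>) * pw \<tau> (1 / 2))"
      unfolding sand by (simp add: s' \<tau> cu pw_add' mult.assoc)
    also have "Re (tr \<dots>) \<le> Re (tr (dg (pw \<tau> (1 / 2)) * pw \<tau> (1 / 2)))"
      using contractiveD[of "sp (\<Phi> \<sigma>)"] contractive_pw[OF s', of 0] by simp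
    also have "\<dots> = 1" by (simp add: \<tau> pw_add pw_one)
    finally have te: "Re (tr (dg e * \<Phi> (dg b * b) * e)) \<le> 1" .
    show ?thesis unfolding F by (rule schwarz_map_cmod[OF s tc te])
  qed
qed

lemma sandwich_undo:
  assumes "fpsd \<rho>" "fpsd \<sigma>" "sp \<sigma> * \<rho> = \<rho>"
  shows "pw \<sigma> z * (pw \<sigma> (- z) * \<rho> * pw \<sigma> (- z)) * pw \<sigma> z = \<rho>"
proof -
  have "\<rho> * sp \<sigma> = \<rho>" using arg_cong[OF assms(3), of dg] assms(1,2) by (simp add: fpsd_dg)
  moreover have "pw \<sigma> z * (pw \<sigma> (- z) * \<rho> * pw \<sigma> (- z)) * pw \<sigma> z = sp \<sigma> * (\<rho> * sp \<sigma>)"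
    using assms(2) by (simp add: mult.assoc pw_add') (simp add: pw_add)
  ultimately show ?thesis using assms(3) by simp
qed

lemma fpsd_sandwich: "fpsd \<rho> \<Longrightarrow> fpsd \<sigma> \<Longrightarrow> fpsd (pw \<sigma> (complex_of_real r) * \<rho> * pw \<sigma> (complex_of_real r))"
  using fpsd_conj[of \<rho> "pw \<sigma> (complex_of_real r)"] by simp

text \<open>Once \<open>X\<close> is written as its norm times \<omega>^(1-p), the interpolated
  trace at p is, up to that norm, the pairing of the output matrix \<open>Y\<close> with its dual
  state. The support condition allows \<rho> to be recovered from \<open>X\<close>.\<close>

theorem sandwiched_dpi:
  assumes s: "schwarz_map \<Phi>" and \<rho>: "fpsd \<rho>" and \<sigma>: "fpsd \<sigma>" and sub: "sp \<sigma> * \<rho> = \<rho>" and p: "0 < p" "p < 1"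
  shows "sandwich_norm p (\<Phi> \<rho>) (\<Phi> \<sigma>) \<le> sandwich_norm p \<rho> \<sigma>"
proof -
  have lin: "lin \<Phi>" and s': "fpsd (\<Phi> \<sigma>)" and r': "fpsd (\<Phi> \<rho>)"
    using s \<rho> \<sigma> by (auto simp: schwarz_map_def)
  define X where "X = pw \<sigma> (- complex_of_real (p / 2)) * \<rho> * pw \<sigma> (- complex_of_real (p / 2))"
  define Y where "Y = pw (\<Phi> \<sigma>) (- complex_of_real (p / 2)) * \<Phi> \<rho> * pw (\<Phi> \<sigma>) (- complex_of_real (p / 2))"
  have pX: "fpsd X" unfolding X_def using fpsd_sandwich[OF \<rho> \<sigma>, of "- (p / 2)"] by simp
  have pY: "fpsd Y" unfolding Y_def using fpsd_sandwich[OF r' s', of "- (p / 2)"] by simp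
  have rX: "\<rho> = pw \<sigma> (complex_of_real (p / 2)) * X * pw \<sigma> (complex_of_real (p / 2))"
    unfolding X_def using sandwich_undo[OF \<rho> \<sigma> sub] by simp
  show ?thesis
  proof (cases "Y = 0")
    case True
    then show ?thesis by (simp add: sandwich_norm_def Y_def)
  next
    case False
    have X0: "X \<noteq> 0"
    proof
      assume "X = 0"
      then have "\<rho> = 0" using rX by simp
      then show False using False by (simp add: Y_def lin_zero[OF lin])
    qed
    obtain \<omega> where o: "fpsd \<omega>" "tr \<omega> = 1" "X = (schatten p X) *\<^sub>r pw \<omega> (complex_of_real (1 - p))"
      by (rule schatten_attained[OF pX X0 p])
    obtain \<tau> where t: "fpsd \<tau>" "tr \<tau> = 1" "tr (Y * pw \<tau> (complex_of_real p)) = complex_of_real (schatten p Y)"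
      by (rule schatten_attained[OF pY False p])
    let ?F = "\<Phi> (pw \<sigma> (complex_of_real p / 2) * pw \<omega> (1 - complex_of_real p) * pw \<sigma> (complex_of_real p / 2))
      * (pw (\<Phi> \<sigma>) (- complex_of_real p / 2) * pw \<tau> (complex_of_real p) * pw (\<Phi> \<sigma>) (- complex_of_real p / 2))"
    have le: "cmod (tr ?F) \<le> 1"
      using dpi_bound[OF s \<sigma> o(1,2) t(1,2), of p] p by simp
    have "\<rho> = (schatten p X) *\<^sub>r (pw \<sigma> (complex_of_real p / 2) * pw \<omega> (1 - complex_of_real p) * pw \<sigma> (complex_of_real p / 2))"
      by (subst rX, subst o(3)) simp
    then have "complex_of_real (schatten p X) * tr ?F
        = tr (\<Phi> \<rho> * (pw (\<Phi> \<sigma>) (- complex_of_real p / 2) * pw \<tau> (complex_of_real p) * pw (\<Phi> \<sigma>) (- complex_of_real p / 2)))"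
      by (metis cs_mult_left lin_cs[OF lin] tr_simps(2))
    also have "\<dots> = tr (Y * pw \<tau> (complex_of_real p))"
      by (simp add: Y_def mult.assoc tr_commute[of "pw (\<Phi> \<sigma>) (- (complex_of_real p / 2))"])
    finally have "complex_of_real (schatten p Y) = complex_of_real (schatten p X) * tr ?F" by (simp add: t(3))
    then have "schatten p Y = schatten p X * cmod (tr ?F)"
      by (metis norm_mult norm_of_real abs_of_nonneg schatten_nonneg)
    also have "\<dots> \<le> schatten p X * 1" by (rule mult_left_mono[OF le]) simp
    finally show ?thesis by (simp add: sandwich_norm_def X_def Y_def)
  qed
qed

subsection \<open>Data processing for the Umegaki divergence\<close>

lemma pw_conj_self: "fpsd A \<Longrightarrow> pw A (- w) * A * pw A (- (1 - w)) = sp A"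
proof -
  assume A: "fpsd A"
  have "pw A (- w) * A * pw A (- (1 - w)) = pw A (- w) * (pw A 1 * pw A (- (1 - w)))"
    by (simp add: pw_one A mult.assoc)
  then show ?thesis by (simp only: pw_add[OF A]) simp
qed

text \<open>The free matrices \<open>X\<close> and \<open>Y\<close> will be normalised multiples of
  \<sigma>^(p/2) \<rho>^((1-p)/2), formed after and before \<Phi>, so that the value at p compares
  the two traces. The boundary lines exchange the roles of \<rho> and \<sigma>.\<close>

lemma uhlmann_bound:
  fixes \<Phi> :: "'i fm \<Rightarrow> 'j fm"
  assumes s: "schwarz_map \<Phi>" and \<rho>: "fpsd \<rho>" and \<sigma>: "fpsd \<sigma>"
    and X: "Re (tr (dg X * X)) \<le> 1" and Y: "Re (tr (dg Y * Y)) \<le> 1" and p: "0 \<le> p" "p \<le> 1"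
  defines "F \<equiv> \<lambda>z. \<Phi> (pw \<rho> ((1 - z) / 2) * dg Y * pw \<sigma> (z / 2))
      * (pw (\<Phi> \<sigma>) (- z / 2) * X * pw (\<Phi> \<rho>) (- (1 - z) / 2))"
  shows "cmod (tr (F (complex_of_real p))) \<le> 1"
proof (rule three_lines_exp_sum[OF _ _ _ p])
  have lin: "lin \<Phi>" and s': "fpsd (\<Phi> \<sigma>)" and r': "fpsd (\<Phi> \<rho>)" and pos: "\<And>A. fpsd A \<Longrightarrow> fpsd (\<Phi> A)"
    using s \<sigma> \<rho> by (auto simp: schwarz_map_def)
  show "exp_sum F" unfolding F_def
    by (intro exp_sum_mult exp_sum_lin[OF _ lin] exp_sum_const exp_sum_pw[OF \<rho>, of _ "-1/2" "1/2"] exp_sum_pw[OF \<sigma>, of _ "1/2" 0]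
        exp_sum_pw[OF s', of _ "-1/2" 0] exp_sum_pw[OF r', of _ "1/2" "-1/2"]) (simp_all add: field_simps)
  have X': "Re (tr (dg (dg X) * dg X)) \<le> 1" using X by (simp add: tr_commute[of X])
  have Y': "Re (tr (dg (dg Y) * dg Y)) \<le> 1" using Y by (simp add: tr_commute[of Y])
  fix y
  define u where "u = Complex 0 (y / 2)"
  have cu: "cnj u = - u" "Re u = 0" by (simp_all add: u_def complex_eq_iff)
  have u0: "Complex 0 y / 2 = u" "- Complex 0 y / 2 = - u" "(1 - Complex 0 y) / 2 = 1 / 2 - u"
    "- (1 - Complex 0 y) / 2 = - (1 / 2 - u)"
    by (simp_all add: u_def complex_eq_iff)
  have u1: "Complex 1 y / 2 = 1 / 2 + u" "- Complex 1 y / 2 = - (1 / 2 + u)" "(1 - Complex 1 y) / 2 = - u"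
    "- (1 - Complex 1 y) / 2 = u"
    by (simp_all add: u_def complex_eq_iff)
  have uc: "- u - 1 / 2 = - (1 / 2) - u" by simp
  show "cmod (tr (F (Complex 0 y))) \<le> 1"
  proof -
    define a where "a = pw \<rho> (1 / 2 + u)"
    define b where "b = dg Y * pw \<sigma> u"
    define c where "c = pw (\<Phi> \<rho>) (- (1 / 2 + u)) * dg X"
    define e where "e = pw (\<Phi> \<sigma>) (- u)"
    have ab: "dg a * b = pw \<rho> (1 / 2 - u) * dg Y * pw \<sigma> u"
      by (simp add: a_def b_def \<rho> cu mult.assoc)
    have ec: "e * dg c = pw (\<Phi> \<sigma>) (- u) * X * pw (\<Phi> \<rho>) (- (1 / 2 - u))"
      by (simp add: e_def c_def r' cu mult.assoc add.commute)
    have "tr (F (Complex 0 y)) = tr (\<Phi> (dg a * b) * (e * dg c))"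
      unfolding F_def ab ec u0 ..
    also have "\<dots> = tr (dg c * \<Phi> (dg a * b) * e)"
      by (simp add: tr_commute[of _ "dg c"] flip: mult.assoc)
    finally have F: "tr (F (Complex 0 y)) = tr (dg c * \<Phi> (dg a * b) * e)" .
    have "dg a * a = \<rho>" by (simp add: a_def \<rho> cu pw_add pw_one)
    then have "dg c * \<Phi> (dg a * a) * c
        = X * (pw (\<Phi> \<rho>) (- (1 / 2 - u)) * \<Phi> \<rho> * pw (\<Phi> \<rho>) (- (1 - (1 / 2 - u)))) * dg X"
      by (simp add: c_def r' cu mult.assoc uc add.commute)
    also have "\<dots> = dg (sp (\<Phi> \<rho>) * dg X) * (sp (\<Phi> \<rho>) * dg X)"
      unfolding pw_conj_self[OF r'] by (simp add: r' pw_add' mult.assoc)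
    finally have tc: "Re (tr (dg c * \<Phi> (dg a * a) * c)) \<le> 1"
      using contractiveD[of "sp (\<Phi> \<rho>)" "dg X"] contractive_pw[OF r', of 0] X' by simp
    have "Re (tr (dg b * b)) \<le> 1" unfolding b_def
      using contractiveD_right[of "pw \<sigma> u" "dg Y"] Y' by (simp add: contractive_pw \<sigma> cu)
    then have "Re (tr (\<Phi> (dg b * b))) \<le> 1" using schwarz_map_tr_le[OF s] order_trans by blast
    moreover have "contractive (dg e)" unfolding e_def using s' cu(2) by (auto intro!: contractive_pw)
    ultimately have te: "Re (tr (dg e * \<Phi> (dg b * b) * e)) \<le> 1"
      using fpsd_contractive[OF pos[OF fpsd_dgmult]] order_trans by blast
    show ?thesis unfolding F by (rule schwarz_map_cmod[OF s tc te])
  qed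
  show "cmod (tr (F (Complex 1 y))) \<le> 1"
  proof -
    define a where "a = Y * pw \<rho> u"
    define b where "b = pw \<sigma> (1 / 2 + u)"
    define c where "c = pw (\<Phi> \<rho>) (- u)"
    define e where "e = pw (\<Phi> \<sigma>) (- (1 / 2 + u)) * X"
    have ab: "dg a * b = pw \<rho> (- u) * dg Y * pw \<sigma> (1 / 2 + u)"
      by (simp add: a_def b_def \<rho> cu mult.assoc)
    have ec: "e * dg c = pw (\<Phi> \<sigma>) (- (1 / 2 + u)) * X * pw (\<Phi> \<rho>) u"
      by (simp add: e_def c_def r' cu)
    have "tr (F (Complex 1 y)) = tr (\<Phi> (dg a * b) * (e * dg c))"
      unfolding F_def ab ec u1 ..
    also have "\<dots> = tr (dg c * \<Phi> (dg a * b) * e)"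
      by (simp add: tr_commute[of _ "dg c"] flip: mult.assoc)
    finally have F: "tr (F (Complex 1 y)) = tr (dg c * \<Phi> (dg a * b) * e)" .
    have "dg b * b = \<sigma>" by (simp add: b_def \<sigma> cu pw_add pw_one)
    then have "dg e * \<Phi> (dg b * b) * e
        = dg X * (pw (\<Phi> \<sigma>) (- (1 / 2 - u)) * \<Phi> \<sigma> * pw (\<Phi> \<sigma>) (- (1 - (1 / 2 - u)))) * X"
      by (simp add: e_def s' cu mult.assoc uc add.commute)
    also have "\<dots> = dg (sp (\<Phi> \<sigma>) * X) * (sp (\<Phi> \<sigma>) * X)"
      unfolding pw_conj_self[OF s'] by (simp add: s' pw_add' mult.assoc)
    finally have te: "Re (tr (dg e * \<Phi> (dg b * b) * e)) \<le> 1"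
      using contractiveD[of "sp (\<Phi> \<sigma>)" X] contractive_pw[OF s', of 0] X by simp
    have "Re (tr (dg a * a)) \<le> 1" unfolding a_def
      using contractiveD_right[of "pw \<rho> u" Y] Y by (simp add: contractive_pw \<rho> cu)
    then have "Re (tr (\<Phi> (dg a * a))) \<le> 1" using schwarz_map_tr_le[OF s] order_trans by blast
    moreover have "contractive (dg c)" unfolding c_def using r' cu(2) by (auto intro!: contractive_pw)
    ultimately have tc: "Re (tr (dg c * \<Phi> (dg a * a) * c)) \<le> 1"
      using fpsd_contractive[OF pos[OF fpsd_dgmult]] order_trans by blast
    show ?thesis unfolding F by (rule schwarz_map_cmod[OF s tc te])
  qed
qed

text \<open>Real powers of \<open>A\<close> share its support. As a positive map preserves
  domination, the support of \<Phi>(A) then also bounds the supports of the images of these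
  powers.\<close>

lemma pw_dominated:
  assumes "fpsd A" shows "\<exists>C. fpsd (C *\<^sub>r A - pw A (complex_of_real r))"
proof -
  obtain K :: "nat set" and l P where s: "sdec A K l P" "\<And>k. k \<in> K \<Longrightarrow> 0 < l k \<and> P k \<noteq> 0"
    by (rule fpsd_sdec[OF assms]) blast
  define C where "C = (\<Sum>k\<in>K. exp (r * ln (l k)) / l k)"
  have C: "0 \<le> C * l k - exp (r * ln (l k))" if "k \<in> K" for k
  proof -
    have "exp (r * ln (l k)) / l k \<le> C" unfolding C_def
      using s that by (intro member_le_sum) (auto simp: sdecD(1) less_imp_le)
    then show ?thesis using s(2)[OF that] by (simp add: divide_le_eq)
  qed
  have "l k \<noteq> 0" if "k \<in> K" for k using s(2)[OF that] by simp
  then have "pw A (complex_of_real r) = (\<Sum>k\<in>K. (exp (r * ln (l k))) *\<^sub>r P k)"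
    by (auto simp: pw_def fc_sdec[OF s(1)] on_nonzero_def exp_of_real[symmetric] intro!: sum.cong)
  then have "C *\<^sub>r A - pw A (complex_of_real r)
      = (\<Sum>k\<in>K. (C * l k - exp (r * ln (l k))) *\<^sub>r P k)"
    by (subst sdecD(4)[OF s(1)]) (simp add: cs_sum_right cs_cs cs_diff_left sum_subtractf)
  then have "sdec (C *\<^sub>r A - pw A (complex_of_real r)) K (\<lambda>k. C * l k - exp (r * ln (l k))) P"
    using s(1) by (auto simp: sdec_def)
  then show ?thesis using C fpsd_sdecI by blast
qed

text \<open>For c outside the support of \<open>R\<close> the quadratic term in c vanishes, so the
  Schwarz inequality bounds t times a fixed trace for every real t. That trace is therefore at most
  0, and the choice e = M* c makes it the squared norm of e.\<close>

lemma schwarz_map_supp_left: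
  assumes s: "schwarz_map \<Phi>" and R: "fpsd R" and sub: "sp R * \<Phi> (dg a * a) = \<Phi> (dg a * a)"
  shows "sp R * \<Phi> (dg a * b) = \<Phi> (dg a * b)"
proof -
  define M where "M = \<Phi> (dg a * b)"
  define c where "c = M - sp R * M"
  define e where "e = dg M * c"
  have cR: "dg c * sp R = 0" by (simp add: c_def R left_diff_distrib mult.assoc pw_add)
  have c0: "dg c * \<Phi> (dg a * a) = 0" by (metis sub cR mult.assoc mult_zero_left)
  have bound: "2 * t * Re (tr (dg c * M * e)) \<le> Re (tr (dg e * \<Phi> (dg b * b) * e))" for t
  proof -
    have "2 * Re (tr (dg (t *\<^sub>r c) * M * e))
      \<le> Re (tr (dg (t *\<^sub>r c) * \<Phi> (dg a * a) * (t *\<^sub>r c)))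
        + Re (tr (dg e * \<Phi> (dg b * b) * e))"
      using s unfolding M_def schwarz_map_def by blast
    then show ?thesis by (simp add: c0)
  qed
  have ee: "dg c * M * e = dg e * e" by (simp add: e_def mult.assoc)
  have "Re (tr (dg e * e)) \<le> 0"
  proof (rule ccontr)
    assume "\<not> ?thesis"
    then have pos: "0 < Re (tr (dg e * e))" by simp
    define B where "B = Re (tr (dg e * \<Phi> (dg b * b) * e))"
    have r: "2 * (\<bar>r\<bar> + 1) \<le> r \<Longrightarrow> False" for r :: real
      by (cases "0 \<le> r") auto
    \<comment> \<open>The scaling makes the left side equal to 2 (|B| + 1), which exceeds
      \<open>B\<close>.\<close>
    have "2 * ((\<bar>B\<bar> + 1) / Re (tr (dg e * e))) * Re (tr (dg e * e)) \<le> B"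
      using bound[of "(\<bar>B\<bar> + 1) / Re (tr (dg e * e))"] unfolding ee B_def .
    then have "2 * (\<bar>B\<bar> + 1) \<le> B" using pos by simp
    then show False by (rule r)
  qed
  then have "tr (dg e * e) = 0"
    using tr_dg_mult_nonneg[of e] by (simp add: complex_eq_iff)
  then have "e = 0" by (rule dg_mult_self_zero)
  from arg_cong[OF this, of dg] have z: "dg c * M = 0" by (simp add: e_def)
  have "dg c * c = dg c * M - dg c * sp R * M" by (subst (2) c_def) (simp add: right_diff_distrib mult.assoc)
  then have "dg c * c = 0" by (simp add: z cR)
  then have "c = 0" using dg_mult_self_zero[of c] by simp
  then show ?thesis by (simp add: c_def M_def)
qed

text \<open>Taking adjoints turns the support statement for the left side into one for the right
  side; the flipped map has the same values on positive matrices.\<close>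

lemma schwarz_map_flip:
  assumes s: "schwarz_map \<Phi>" shows "schwarz_map (\<lambda>X. dg (\<Phi> (dg X)))"
  unfolding schwarz_map_def
proof (intro conjI allI impI)
  have lin: "lin \<Phi>" using s by (simp add: schwarz_map_def)
  show "lin (\<lambda>X. dg (\<Phi> (dg X)))" by (rule linI) (simp_all add: lin_simps[OF lin])
  fix A show "fpsd A \<Longrightarrow> fpsd (dg (\<Phi> (dg A)))"
    using s by (simp add: schwarz_map_def fpsd_dg)
next
  fix a show "Re (tr (dg (\<Phi> (dg (dg a * a))))) \<le> Re (tr (dg a * a))"
    using schwarz_map_tr_le[OF s, of a] by simp
next
  fix a b c e
  have "2 * Re (tr (dg e * \<Phi> (dg b * a) * c))
      \<le> Re (tr (dg e * \<Phi> (dg b * b) * e)) + Re (tr (dg c * \<Phi> (dg a * a) * c))"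
    using s unfolding schwarz_map_def by blast
  moreover have "tr (dg c * dg (\<Phi> (dg (dg a * b))) * e) = cnj (tr (dg e * \<Phi> (dg b * a) * c))"
    by (simp flip: tr_dg add: mult.assoc)
  moreover have "tr (dg c * dg (\<Phi> (dg (dg a * a))) * c) = cnj (tr (dg c * \<Phi> (dg a * a) * c))" for a c
    by (simp flip: tr_dg add: mult.assoc)
  ultimately show "2 * Re (tr (dg c * dg (\<Phi> (dg (dg a * b))) * e))
      \<le> Re (tr (dg c * dg (\<Phi> (dg (dg a * a))) * c)) + Re (tr (dg e * dg (\<Phi> (dg (dg b * b))) * e))"
    by simp
qed

lemma schwarz_map_sp_pw:
  assumes s: "schwarz_map \<Phi>" and A: "fpsd A"
  shows "sp (\<Phi> A) * \<Phi> (pw A (complex_of_real r)) = \<Phi> (pw A (complex_of_real r))"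
proof -
  have lin: "lin \<Phi>" and pos: "\<And>A. fpsd A \<Longrightarrow> fpsd (\<Phi> A)" using s by (auto simp: schwarz_map_def)
  obtain C where "fpsd (C *\<^sub>r A - pw A (complex_of_real r))"
    using pw_dominated[OF A] by blast
  from pos[OF this] show ?thesis
    by (intro sp_mult_dominated[of _ _ C]) (auto intro: pos A fpsd_pw simp: lin_simps[OF lin])
qed

text \<open>If the left trace T exceeded the right trace T', the normalised products inserted in
  \<open>uhlmann_bound\<close> would give T / max T' (T / 2) <= 1, a contradiction. At p the powers
  cancel to the support projections of \<Phi>(\<rho>) and \<Phi>(\<sigma>), which the image absorbs
  on its two sides, and \<open>tp\<close> then returns T.\<close>

lemma uhlmann:
  assumes s: "schwarz_map \<Phi>" and \<rho>: "fpsd \<rho>" and \<sigma>: "fpsd \<sigma>"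
    and tp: "\<And>Z. tr (\<Phi> (\<rho> * Z)) = tr (\<rho> * Z)" and p: "0 < p" "p < 1"
  shows "Re (tr (pw \<rho> (1 - complex_of_real p) * pw \<sigma> (complex_of_real p)))
    \<le> Re (tr (pw (\<Phi> \<rho>) (1 - complex_of_real p) * pw (\<Phi> \<sigma>) (complex_of_real p)))"
    (is "?T \<le> ?T'")
proof (rule ccontr)
  assume "\<not> ?thesis"
  then have lt: "?T' < ?T" by simp
  have s': "fpsd (\<Phi> \<sigma>)" and r': "fpsd (\<Phi> \<rho>)" using s \<sigma> \<rho> by (auto simp: schwarz_map_def)
  have T'0: "0 \<le> ?T'"
    using fpsd_tr_mult(1)[OF fpsd_pw[OF r', of "1 - p"] fpsd_pw[OF s', of p]] by simp
  have T0: "0 < ?T" using T'0 lt by simp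
  \<comment> \<open>The maximum with T / 2 keeps the normalisation finite when T' = 0 and still
    stays below T.\<close>
  define m where "m = 1 / sqrt (max ?T' (?T / 2))"
  define n where "n = 1 / sqrt ?T"
  have half: "complex_of_real p / 2 + complex_of_real p / 2 = complex_of_real p"
    "(1 - complex_of_real p) / 2 + (1 - complex_of_real p) / 2 = 1 - complex_of_real p"
    by (simp_all add: field_simps)
  define X where "X = m *\<^sub>r (pw (\<Phi> \<sigma>) (complex_of_real p / 2) * pw (\<Phi> \<rho>) ((1 - complex_of_real p) / 2))"
  define Y where "Y = n *\<^sub>r (pw \<sigma> (complex_of_real p / 2) * pw \<rho> ((1 - complex_of_real p) / 2))"
  have XX: "tr (dg X * X) = complex_of_real (m\<^sup>2) * tr (pw (\<Phi> \<rho>) (1 - complex_of_real p) * pw (\<Phi> \<sigma>) (complex_of_real p))"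
    by (simp add: X_def s' r' mult.assoc pw_add' power2_eq_square half
        tr_commute[of "pw (\<Phi> \<rho>) ((1 - complex_of_real p) / 2)"])
      (simp add: pw_add r' half tr_commute[of "pw (\<Phi> \<sigma>) (complex_of_real p)"])
  have YY: "tr (dg Y * Y) = complex_of_real (n\<^sup>2) * tr (pw \<rho> (1 - complex_of_real p) * pw \<sigma> (complex_of_real p))"
    by (simp add: Y_def \<sigma> \<rho> mult.assoc pw_add' power2_eq_square half
        tr_commute[of "pw \<rho> ((1 - complex_of_real p) / 2)"])
      (simp add: pw_add \<rho> half tr_commute[of "pw \<sigma> (complex_of_real p)"])
  have m: "0 < m" "m\<^sup>2 = 1 / max ?T' (?T / 2)" using T0 T'0 by (auto simp: m_def power_divide less_max_iff_disj)
  have n: "0 < n" "n\<^sup>2 = 1 / ?T" using T0 by (auto simp: n_def power_divide)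
  have X1: "Re (tr (dg X * X)) \<le> 1"
    unfolding XX using T0 by (simp add: m(2) del: of_real_power)
  have Y1: "Re (tr (dg Y * Y)) \<le> 1"
    unfolding YY using T0 by (simp add: n(2) del: of_real_power)
  let ?A = "pw \<rho> (complex_of_real (1 - p)) * pw \<sigma> (complex_of_real p)"
  have "cmod (tr (\<Phi> (pw \<rho> ((1 - complex_of_real p) / 2) * dg Y * pw \<sigma> (complex_of_real p / 2))
      * (pw (\<Phi> \<sigma>) (- complex_of_real p / 2) * X * pw (\<Phi> \<rho>) (- (1 - complex_of_real p) / 2)))) \<le> 1"
    using uhlmann_bound[OF s \<rho> \<sigma> X1 Y1, of p] p by simp
  also have "pw \<rho> ((1 - complex_of_real p) / 2) * dg Y * pw \<sigma> (complex_of_real p / 2) = n *\<^sub>r ?A"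
    by (simp add: Y_def \<rho> \<sigma> mult.assoc pw_add pw_add' half)
  also have "pw (\<Phi> \<sigma>) (- complex_of_real p / 2) * X * pw (\<Phi> \<rho>) (- (1 - complex_of_real p) / 2)
      = m *\<^sub>r (sp (\<Phi> \<sigma>) * sp (\<Phi> \<rho>))"
  proof -
    have "(1 - complex_of_real p) / 2 + - (1 - complex_of_real p) / 2 = 0"
      "- complex_of_real p / 2 + complex_of_real p / 2 = 0" by (simp_all add: field_simps)
    then show ?thesis
      by (simp only: X_def cs_mult_right cs_mult_left mult.assoc pw_add[OF r'] pw_add'[OF s'])
  qed
  also have "\<Phi> (n *\<^sub>r ?A) = n *\<^sub>r \<Phi> ?A"
    using s by (auto simp: schwarz_map_def lin_simps)
  finally have "cmod (complex_of_real (n * m) * tr (\<Phi> ?A * (sp (\<Phi> \<sigma>) * sp (\<Phi> \<rho>)))) \<le> 1"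
    by (simp add: mult.assoc mult.commute[of "complex_of_real m"])
  moreover have "\<Phi> ?A * (sp (\<Phi> \<sigma>) * sp (\<Phi> \<rho>)) = \<Phi> ?A * sp (\<Phi> \<rho>)"
  proof -
    define \<Psi> where "\<Psi> X = dg (\<Phi> (dg X))" for X
    have \<Psi>: "schwarz_map \<Psi>" unfolding \<Psi>_def by (rule schwarz_map_flip[OF s])
    have ps: "\<Psi> \<sigma> = \<Phi> \<sigma>" by (simp add: \<Psi>_def \<sigma> fpsd_dg s')
    have e: "pw \<sigma> (complex_of_real (2 * p)) = dg (pw \<sigma> (complex_of_real p)) * pw \<sigma> (complex_of_real p)"
      by (simp add: \<sigma> pw_add)
    have "sp (\<Phi> \<sigma>) * \<Psi> (dg (pw \<sigma> (complex_of_real p)) * pw \<rho> (complex_of_real (1 - p)))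
        = \<Psi> (dg (pw \<sigma> (complex_of_real p)) * pw \<rho> (complex_of_real (1 - p)))"
      by (rule schwarz_map_supp_left[OF \<Psi> s' schwarz_map_sp_pw[OF \<Psi> \<sigma>, of "2 * p", unfolded ps e]])
    from arg_cong[OF this, of dg] have "\<Phi> ?A * sp (\<Phi> \<sigma>) = \<Phi> ?A"
      by (simp add: \<Psi>_def \<sigma> \<rho> s')
    then show ?thesis by (simp flip: mult.assoc)
  qed
  moreover have "tr (\<Phi> ?A * sp (\<Phi> \<rho>)) = tr ?A"
  proof -
    have e: "pw \<rho> (complex_of_real (2 * (1 - p))) = dg (pw \<rho> (complex_of_real (1 - p))) * pw \<rho> (complex_of_real (1 - p))"
      by (simp add: \<rho> pw_add algebra_simps)
    have "sp (\<Phi> \<rho>) * \<Phi> (dg (pw \<rho> (complex_of_real (1 - p))) * pw \<sigma> (complex_of_real p))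
        = \<Phi> (dg (pw \<rho> (complex_of_real (1 - p))) * pw \<sigma> (complex_of_real p))"
      by (rule schwarz_map_supp_left[OF s r' schwarz_map_sp_pw[OF s \<rho>, of "2 * (1 - p)", unfolded e]])
    then have "sp (\<Phi> \<rho>) * \<Phi> ?A = \<Phi> ?A" by (simp add: \<rho>)
    then have "tr (\<Phi> ?A * sp (\<Phi> \<rho>)) = tr (\<Phi> ?A)" by (simp add: tr_commute[of _ "sp (\<Phi> \<rho>)"])
    also have "\<dots> = tr ?A"
    proof -
      have A: "?A = \<rho> * (pw \<rho> (complex_of_real (- p)) * pw \<sigma> (complex_of_real p))"
        using pw_add'[OF \<rho>, of 1] by (simp add: pw_one \<rho>)
      show ?thesis unfolding A by (rule tp)
    qed
    finally show ?thesis .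
  qed
  moreover have "cmod (tr ?A) = ?T"
    using fpsd_tr_mult[OF fpsd_pw[OF \<rho>, of "1 - p"] fpsd_pw[OF \<sigma>, of p]] by (simp add: cmod_eq_Re)
  ultimately have le: "n * m * ?T \<le> 1" using n m by (simp add: norm_mult)
  have "1 < (n * m * ?T)\<^sup>2"
  proof -
    have "(n * m * ?T)\<^sup>2 = ?T / max ?T' (?T / 2)" 
      unfolding power_mult_distrib n(2) m(2) using T0 by (simp add: power2_eq_square)
    then show ?thesis using T0 lt by (simp add: less_divide_eq less_max_iff_disj)
  qed
  moreover have "0 \<le> n * m * ?T" using n m T0 by simp
  ultimately show False using le by (meson not_less power_le_one)
qed

section \<open>Overlaps of eigenprojections and the limit to the Umegaki divergence\<close>

definition umegaki_div :: "'i fm \<Rightarrow> 'i fm \<Rightarrow> real" where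
  "umegaki_div \<rho> \<sigma> = Re (tr (\<rho> * (lg \<rho> - lg \<sigma>)))"

text \<open>\<open>w\<close> is the overlap of the eigenprojections.\<close>
lemma spectral_coupling:
  assumes A: "fpsd A" and B: "fpsd B"
  obtains K J :: "nat set" and l m :: "nat \<Rightarrow> real" and w :: "nat \<Rightarrow> nat \<Rightarrow> real" and a b :: "nat \<Rightarrow> real"
  where "finite K" "finite J" "\<And>k. k \<in> K \<Longrightarrow> 0 < l k" "\<And>j. j \<in> J \<Longrightarrow> 0 < m j"
    "\<And>k j. k \<in> K \<Longrightarrow> j \<in> J \<Longrightarrow> 0 \<le> w k j"
    "\<And>f g. Re (tr (fc (\<lambda>x. complex_of_real (f x)) A * fc (\<lambda>x. complex_of_real (g x)) B))
        = (\<Sum>k\<in>K. \<Sum>j\<in>J. w k j * (f (l k) * g (m j)))"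
    "\<And>f. Re (tr (fc (\<lambda>x. complex_of_real (f x)) A)) = (\<Sum>k\<in>K. f (l k) * a k)"
    "\<And>f. Re (tr (fc (\<lambda>x. complex_of_real (f x)) B)) = (\<Sum>j\<in>J. f (m j) * b j)"
    "\<And>k. k \<in> K \<Longrightarrow> (\<Sum>j\<in>J. w k j) \<le> a k" "\<And>j. j \<in> J \<Longrightarrow> (\<Sum>k\<in>K. w k j) \<le> b j"
    "sp B * A = A \<Longrightarrow> \<forall>k\<in>K. (\<Sum>j\<in>J. w k j) = a k"
    "(\<forall>k\<in>K. \<forall>j\<in>J. w k j \<noteq> 0 \<longrightarrow> l k = m j) \<Longrightarrow> (\<forall>k\<in>K. (\<Sum>j\<in>J. w k j) = a k)
        \<Longrightarrow> (\<forall>j\<in>J. (\<Sum>k\<in>K. w k j) = b j) \<Longrightarrow> A = B"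
proof -
  obtain K :: "nat set" and l P where s: "sdec A K l P" "\<And>k. k \<in> K \<Longrightarrow> 0 < l k \<and> P k \<noteq> 0"
    by (rule fpsd_sdec[OF A]) blast
  obtain J :: "nat set" and m Q where t: "sdec B J m Q" "\<And>k. k \<in> J \<Longrightarrow> 0 < m k \<and> Q k \<noteq> 0"
    by (rule fpsd_sdec[OF B]) blast
  have fs: "finite K" "finite J" using s(1) t(1) by (auto simp: sdecD(1))
  have l0: "l k \<noteq> 0" if "k \<in> K" for k using s(2)[OF that] by simp
  have m0: "m j \<noteq> 0" if "j \<in> J" for j using t(2)[OF that] by simp
  define w where "w k j = Re (tr (P k * Q j))" for k j
  have pP: "dg (P k) = P k" "P k * P k = P k" if "k \<in> K" for k
    using that sdecD(2)[OF s(1)] sdecD(3)[OF s(1)] by auto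
  have pQ: "dg (Q j) = Q j" "Q j * Q j = Q j" if "j \<in> J" for j
    using that sdecD(2)[OF t(1)] sdecD(3)[OF t(1)] by auto
  have fA: "fc f A = (\<Sum>k\<in>K. f (l k) *\<^sub>c P k)" for f
    using l0 by (auto simp: fc_sdec[OF s(1)] on_nonzero_def intro!: sum.cong)
  have fB: "fc f B = (\<Sum>j\<in>J. f (m j) *\<^sub>c Q j)" for f
    using m0 by (auto simp: fc_sdec[OF t(1)] on_nonzero_def intro!: sum.cong)
  have spA: "sp A = (\<Sum>k\<in>K. P k)" and spB: "sp B = (\<Sum>j\<in>J. Q j)"
    unfolding pw_def fA fB by simp_all
  have wn: "0 \<le> w k j" if "k \<in> K" "j \<in> J" for k j
    unfolding w_def by (intro fpsd_tr_mult fpsd_proj pP pQ that)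
  have wa: "(\<Sum>j\<in>J. w k j) = Re (tr (P k * sp B))" for k
    by (simp add: w_def spB sum_distrib_left)
  have wb: "(\<Sum>k\<in>K. w k j) = Re (tr (sp A * Q j))" for j
    by (simp add: w_def spA sum_distrib_right)
  \<comment> \<open>The missing part of p is a square: tr p - tr (p sp C) is the squared
    Hilbert-Schmidt norm of p - sp C p. This gives the inequality together with its equality
    case.\<close>
  have defect: "0 \<le> Re (tr p) - Re (tr (p * sp C))"
    "Re (tr p) = Re (tr (p * sp C)) \<Longrightarrow> sp C * p = p"
    if "fpsd C" "dg p = p" "p * p = p" for p C :: "'a fm"
  proof -
    have "tr (dg (p - sp C * p) * (p - sp C * p)) = tr (p - p * (sp C * p))"
      using that by (simp add: algebra_simps pw_add')
    also have "\<dots> = tr p - tr (p * sp C)"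
      using that(3) by (simp add: tr_commute[of p] mult.assoc)
    finally have e: "tr (dg (p - sp C * p) * (p - sp C * p)) = tr p - tr (p * sp C)" .
    show "0 \<le> Re (tr p) - Re (tr (p * sp C))" using tr_dg_mult_nonneg(1)[of "p - sp C * p"] e by simp
    assume "Re (tr p) = Re (tr (p * sp C))"
    then have "tr (dg (p - sp C * p) * (p - sp C * p)) = 0"
      using tr_dg_mult_nonneg(2)[of "p - sp C * p"] e by (simp add: complex_eq_iff)
    then have "p - sp C * p = 0" by (rule dg_mult_self_zero)
    then show "sp C * p = p" by simp
  qed
  show ?thesis
  proof (rule that[of K J l m w "\<lambda>k. Re (tr (P k))" "\<lambda>j. Re (tr (Q j))"])
    show "Re (tr (fc (\<lambda>x. complex_of_real (f x)) A * fc (\<lambda>x. complex_of_real (g x)) B))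
        = (\<Sum>k\<in>K. \<Sum>j\<in>J. w k j * (f (l k) * g (m j)))" for f g
      by (simp add: fA fB sum_distrib_left sum_distrib_right w_def mult_ac sum.swap[of _ J])
    show "(\<Sum>j\<in>J. w k j) \<le> Re (tr (P k))" if "k \<in> K" for k
      unfolding wa using defect(1)[OF B pP[OF that]] by simp
    show "(\<Sum>k\<in>K. w k j) \<le> Re (tr (Q j))" if "j \<in> J" for j
      unfolding wb tr_commute[of "sp A"] using defect(1)[OF A pQ[OF that]] by simp
    show "\<forall>k\<in>K. (\<Sum>j\<in>J. w k j) = Re (tr (P k))" if sub: "sp B * A = A"
    proof
      fix k assume k: "k \<in> K"
      have "(l k) *\<^sub>r (sp B * P k) = sp B * (A * P k)"
        by (simp add: sdec_mult_proj[OF s(1) k])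
      also have "\<dots> = (l k) *\<^sub>r P k"
        by (metis mult.assoc sub sdec_mult_proj(1)[OF s(1) k])
      finally have "(1 / complex_of_real (l k)) *\<^sub>c ((l k) *\<^sub>r (sp B * P k))
          = (1 / complex_of_real (l k)) *\<^sub>c ((l k) *\<^sub>r P k)" by simp
      then have "sp B * P k = P k" using l0[OF k] by (simp add: cs_cs)
      then show "(\<Sum>j\<in>J. w k j) = Re (tr (P k))" by (simp add: wa tr_commute[of _ "sp B"])
    qed
    assume eq: "\<forall>k\<in>K. \<forall>j\<in>J. w k j \<noteq> 0 \<longrightarrow> l k = m j"
      and ra: "\<forall>k\<in>K. (\<Sum>j\<in>J. w k j) = Re (tr (P k))" and rb: "\<forall>j\<in>J. (\<Sum>k\<in>K. w k j) = Re (tr (Q j))"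
    have PB: "sp B * P k = P k" if "k \<in> K" for k
      using defect(2)[OF B pP[OF that]] ra that by (simp add: wa)
    have QA: "sp A * Q j = Q j" if "j \<in> J" for j
      using defect(2)[OF A pQ[OF that]] rb that by (simp add: wb tr_commute[of "sp A"])
    have "sp B * A = A" by (subst (1 2) sdecD(4)[OF s(1)]) (simp add: sum_distrib_left PB)
    from arg_cong[OF this, of dg] have AB: "A * sp B = A" by (simp add: A B fpsd_dg)
    have BA: "sp A * B = B" by (subst (1 2) sdecD(4)[OF t(1)]) (simp add: sum_distrib_left QA)
    \<comment> \<open>The overlap is the squared norm of P k * Q j, so if it vanishes the product
      does; otherwise the eigenvalues agree by hypothesis.\<close>
    have PQ: "(l k) *\<^sub>r (P k * Q j) = (m j) *\<^sub>r (P k * Q j)"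
      if "k \<in> K" "j \<in> J" for k j
    proof (cases "w k j = 0")
      case True
      have "dg (P k * Q j) * (P k * Q j) = Q j * (P k * Q j)"
        using pP[OF that(1)] pQ[OF that(2)] by (simp add: mult.assoc) (simp flip: mult.assoc)
      also have "tr \<dots> = tr (P k * Q j)"
        using pQ[OF that(2)] by (simp add: tr_commute[of "Q j"] mult.assoc)
      finally have "Re (tr (dg (P k * Q j) * (P k * Q j))) = 0" using True by (simp add: w_def)
      then have "tr (dg (P k * Q j) * (P k * Q j)) = 0"
        using tr_dg_mult_nonneg(2)[of "P k * Q j"] by (simp add: complex_eq_iff)
      then have "P k * Q j = 0" by (rule dg_mult_self_zero)
      then show ?thesis by simp
    next
      case False
      then show ?thesis using eq that by auto
    qed
    have "A = A * sp B" by (simp add: AB)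
    also have "\<dots> = (\<Sum>k\<in>K. \<Sum>j\<in>J. (l k) *\<^sub>r (P k * Q j))"
      by (subst sdecD(4)[OF s(1)], simp add: spB sum_distrib_left sum_distrib_right cs_sum_right)
        (rule sum.swap)
    also have "\<dots> = (\<Sum>k\<in>K. \<Sum>j\<in>J. (m j) *\<^sub>r (P k * Q j))"
      by (intro sum.cong refl) (rule PQ)
    also have "\<dots> = sp A * B"
      by (subst sdecD(4)[OF t(1)]) (simp add: spA sum_distrib_left sum_distrib_right cs_sum_right sum.swap[of _ J])
    finally show "A = B" by (simp add: BA)
  qed (use fs s(2) t(2) wn in \<open>auto simp: fA fB mult.commute\<close>)
qed

lemma pw_real: "pw A (complex_of_real r) = fc (\<lambda>x. complex_of_real (exp (r * ln x))) A"
  by (simp add: pw_def exp_of_real flip: of_real_mult)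

lemma mult_lg_self: "fpsd A \<Longrightarrow> A * lg A = fc (\<lambda>x. complex_of_real (x * ln x)) A"
  using fc_mult[of A complex_of_real "\<lambda>x. complex_of_real (ln x)"] by (simp add: fpsd_dg fc_id lg_def)

lemma sum_weights:
  assumes "finite K" "\<forall>k\<in>K. (\<Sum>j\<in>J. w k j) = a k"
  shows "(\<Sum>k\<in>K. f k * a k) = (\<Sum>k\<in>K. \<Sum>j\<in>J. w k j * (f k :: real))"
proof (rule sum.cong)
  fix k assume "k \<in> K"
  then show "f k * a k = (\<Sum>j\<in>J. w k j * f k)"
    using assms(2) sum_distrib_right[of "w k" J "f k"] by (simp add: mult.commute[of "f k"])
qed simp

text \<open>In the two eigenbases the trace is a finite sum of exponentials in s, whose derivative
  at 0 is minus the divergence. The support condition makes the row sums of the overlaps full, so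
  that the value at s = 0 is tr \<rho>.\<close>

theorem umegaki_div_limit:
  assumes \<rho>: "fpsd \<rho>" and \<sigma>: "fpsd \<sigma>" and sub: "sp \<sigma> * \<rho> = \<rho>"
  shows "((\<lambda>s. (Re (tr \<rho>) - Re (tr (pw \<rho> (1 - complex_of_real s) * pw \<sigma> (complex_of_real s)))) / s)
    \<longlongrightarrow> umegaki_div \<rho> \<sigma>) (at_right 0)"
proof (rule spectral_coupling[OF \<rho> \<sigma>])
  fix K J :: "nat set" and l m :: "nat \<Rightarrow> real" and w a b
  assume fin: "finite K" "finite J" and l: "\<And>k. k \<in> K \<Longrightarrow> 0 < l k" and m: "\<And>j. j \<in> J \<Longrightarrow> 0 < m j"
    and T: "\<And>f g. Re (tr (fc (\<lambda>x. complex_of_real (f x)) \<rho> * fc (\<lambda>x. complex_of_real (g x)) \<sigma>))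
        = (\<Sum>k\<in>K. \<Sum>j\<in>J. w k j * (f (l k) * g (m j)))"
    and T1: "\<And>f. Re (tr (fc (\<lambda>x. complex_of_real (f x)) \<rho>)) = (\<Sum>k\<in>K. f (l k) * a k)"
    and row: "sp \<sigma> * \<rho> = \<rho> \<Longrightarrow> \<forall>k\<in>K. (\<Sum>j\<in>J. w k j) = a k"
  note row = row[OF sub]
  define h where "h s = (\<Sum>k\<in>K. \<Sum>j\<in>J. w k j * (exp ((1 - s) * ln (l k)) * exp (s * ln (m j))))" for s
  have h: "Re (tr (pw \<rho> (1 - complex_of_real s) * pw \<sigma> (complex_of_real s))) = h s" for s
    using T[of "\<lambda>x. exp ((1 - s) * ln x)" "\<lambda>x. exp (s * ln x)"]
    by (simp add: h_def flip: pw_real)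
  have h0: "h 0 = Re (tr \<rho>)"
  proof -
    have "Re (tr \<rho>) = (\<Sum>k\<in>K. l k * a k)" using T1[of "\<lambda>x. x"] by (simp add: fc_id fpsd_dg \<rho>)
    also have "\<dots> = h 0" using l by (simp add: sum_weights[OF fin(1) row] h_def cong: sum.cong)
    finally show ?thesis ..
  qed
  have d: "umegaki_div \<rho> \<sigma> = - (\<Sum>k\<in>K. \<Sum>j\<in>J. w k j * (l k * (ln (m j) - ln (l k))))"
  proof -
    have "Re (tr (\<rho> * lg \<rho>)) = (\<Sum>k\<in>K. \<Sum>j\<in>J. w k j * (l k * ln (l k)))"
      using T1[of "\<lambda>x. x * ln x"] by (simp add: mult_lg_self \<rho> sum_weights[OF fin(1) row])
    moreover have "Re (tr (\<rho> * lg \<sigma>)) = (\<Sum>k\<in>K. \<Sum>j\<in>J. w k j * (l k * ln (m j)))"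
      using T[of "\<lambda>x. x" ln] by (simp add: fc_id fpsd_dg \<rho> lg_def)
    ultimately show ?thesis by (simp add: umegaki_div_def right_diff_distrib sum_subtractf)
  qed
  have "(h has_real_derivative (\<Sum>k\<in>K. \<Sum>j\<in>J. w k j * (l k * (ln (m j) - ln (l k))))) (at 0)"
    unfolding h_def
  proof (intro DERIV_sum)
    fix k j assume kj: "k \<in> K" "j \<in> J"
    show "((\<lambda>s. w k j * (exp ((1 - s) * ln (l k)) * exp (s * ln (m j))))
        has_real_derivative w k j * (l k * (ln (m j) - ln (l k)))) (at 0)"
      by (rule derivative_eq_intros refl)+ (use l[OF kj(1)] in \<open>simp add: algebra_simps\<close>)
  qed
  then have "((\<lambda>s. (h s - h 0) / s) \<longlongrightarrow> - umegaki_div \<rho> \<sigma>) (at 0)"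
    unfolding d by (simp add: has_field_derivative_iff)
  then have "((\<lambda>s. - ((h s - h 0) / s)) \<longlongrightarrow> umegaki_div \<rho> \<sigma>) (at 0)"
    using tendsto_minus by fastforce
  moreover have "- ((h s - h 0) / s) = (Re (tr \<rho>) - h s) / s" for s by (simp add: h0 minus_divide_left)
  ultimately have "((\<lambda>s. (Re (tr \<rho>) - h s) / s) \<longlongrightarrow> umegaki_div \<rho> \<sigma>) (at 0)" by simp
  then show ?thesis unfolding h by (rule filterlim_mono) (simp_all add: at_le)
qed

theorem umegaki_dpi:
  assumes s: "schwarz_map \<Phi>" and \<rho>: "fpsd \<rho>" and \<sigma>: "fpsd \<sigma>" and sub: "sp \<sigma> * \<rho> = \<rho>"
    and sub': "sp (\<Phi> \<sigma>) * \<Phi> \<rho> = \<Phi> \<rho>" and tp: "\<And>Z. tr (\<Phi> (\<rho> * Z)) = tr (\<rho> * Z)"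
  shows "umegaki_div (\<Phi> \<rho>) (\<Phi> \<sigma>) \<le> umegaki_div \<rho> \<sigma>"
proof -
  have s': "fpsd (\<Phi> \<sigma>)" and r': "fpsd (\<Phi> \<rho>)" using s \<sigma> \<rho> by (auto simp: schwarz_map_def)
  have tr: "tr (\<Phi> \<rho>) = tr \<rho>" using tp[of "sp \<rho>"] by (simp add: \<rho>)
  show ?thesis
  proof (rule tendsto_le[OF _ umegaki_div_limit[OF \<rho> \<sigma> sub] umegaki_div_limit[OF r' s' sub']])
    have "\<forall>\<^sub>F x in at_right 0. (0::real) < x \<and> x < 1"
      by (auto simp: eventually_at_right_less intro!: eventually_conj eventually_at_rightI[of 0 1])
    then show "\<forall>\<^sub>F x in at_right 0.
       (Re (tr (\<Phi> \<rho>)) - Re (tr (pw (\<Phi> \<rho>) (1 - complex_of_real x) * pw (\<Phi> \<sigma>) (complex_of_real x)))) / x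
       \<le> (Re (tr \<rho>) - Re (tr (pw \<rho> (1 - complex_of_real x) * pw \<sigma> (complex_of_real x)))) / x"
    proof eventually_elim
      case (elim x)
      then show ?case using uhlmann[OF s \<rho> \<sigma> tp, of x] by (simp add: tr divide_right_mono)
    qed
  qed simp
qed

subsection \<open>The inequalities of Klein and Hoelder\<close>

lemma klein_scalar:
  assumes "0 < x" "0 < (y::real)"
  shows "0 \<le> x * ln x - x * ln y - x + y" "x * ln x - x * ln y - x + y = 0 \<Longrightarrow> x = y"
proof -
  have e: "x * ln x - x * ln y - x + y = x * (y / x - 1 - ln (y / x))"
    using assms by (simp add: ln_div field_simps)
  show "0 \<le> x * ln x - x * ln y - x + y" unfolding e using assms ln_le_minus_one[of "y / x"] by simp
  assume "x * ln x - x * ln y - x + y = 0"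
  then have "ln (y / x) = y / x - 1" unfolding e using assms by simp
  then have "y / x = 1" using assms ln_eq_minus_one[of "y / x"] by simp
  then show "x = y" using assms by simp
qed

text \<open>Dividing by the weighted mean t reduces both parts to ln u <= u - 1 at u = x / t and u =
  y / t, with equality only for u = 1.\<close>

lemma young_scalar:
  assumes "0 < x" "0 < (y::real)" and p: "0 < p" "p < 1"
  shows "0 \<le> (1 - p) * x + p * y - exp ((1 - p) * ln x) * exp (p * ln y)"
    "(1 - p) * x + p * y - exp ((1 - p) * ln x) * exp (p * ln y) = 0 \<Longrightarrow> x = y"
proof -
  define t where "t = (1 - p) * x + p * y"
  have t: "0 < t" unfolding t_def using assms by (simp add: add_pos_pos)
  have a: "ln (x / t) \<le> x / t - 1" "ln (y / t) \<le> y / t - 1"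
    using assms t by (simp_all add: ln_le_minus_one)
  have sum: "(1 - p) * (x / t - 1) + p * (y / t - 1) = 0"
  proof -
    have "(1 - p) * (x / t - 1) + p * (y / t - 1) = ((1 - p) * x + p * y) / t - 1"
      using t by (simp add: field_simps)
    then show ?thesis using t by (simp add: t_def)
  qed
  have le: "(1 - p) * ln (x / t) \<le> (1 - p) * (x / t - 1)" "p * ln (y / t) \<le> p * (y / t - 1)"
    using a p by (simp_all add: mult_left_mono)
  have e: "exp ((1 - p) * ln x) * exp (p * ln y) = t * exp ((1 - p) * ln (x / t) + p * ln (y / t))"
  proof -
    have "(1 - p) * ln x + p * ln y = ln t + ((1 - p) * ln (x / t) + p * ln (y / t))"
      using assms t by (simp add: ln_div algebra_simps)
    then show ?thesis using t by (simp flip: exp_add) (simp add: exp_add)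
  qed
  have "exp ((1 - p) * ln (x / t) + p * ln (y / t)) \<le> 1" using le sum by simp
  then show "0 \<le> (1 - p) * x + p * y - exp ((1 - p) * ln x) * exp (p * ln y)"
    unfolding e t_def[symmetric] using t by simp
  assume "(1 - p) * x + p * y - exp ((1 - p) * ln x) * exp (p * ln y) = 0"
  then have "(1 - p) * ln (x / t) + p * ln (y / t) = 0"
    unfolding e t_def[symmetric] using t by simp
  then have "(1 - p) * ln (x / t) = (1 - p) * (x / t - 1)" "p * ln (y / t) = p * (y / t - 1)"
    using le sum by linarith+
  then have "ln (x / t) = x / t - 1" "ln (y / t) = y / t - 1" using p by auto
  then have "x / t = 1" "y / t = 1"
    using assms t ln_eq_minus_one[of "x / t"] ln_eq_minus_one[of "y / t"] by simp_all
  then show "x = y" using t by simp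
qed

text \<open>With \<open>r\<close> and \<open>c\<close> the deficits of the row and column sums of the overlap matrix, both
  inequalities below take this form.\<close>
lemma weighted_defect:
  fixes w :: "nat \<Rightarrow> nat \<Rightarrow> real"
  assumes fin: "finite K" "finite J" and w: "\<And>k j. k \<in> K \<Longrightarrow> j \<in> J \<Longrightarrow> 0 \<le> w k j"
    and g: "\<And>k j. k \<in> K \<Longrightarrow> j \<in> J \<Longrightarrow> 0 \<le> g k j"
    and r: "\<And>k. k \<in> K \<Longrightarrow> 0 \<le> r k" and c: "\<And>j. j \<in> J \<Longrightarrow> 0 \<le> c j"
    and D: "D = (\<Sum>k\<in>K. \<Sum>j\<in>J. w k j * g k j) + (\<Sum>k\<in>K. r k) + (\<Sum>j\<in>J. c j)"
  shows "0 \<le> D" "D = 0 \<Longrightarrow> (\<forall>k\<in>K. \<forall>j\<in>J. w k j * g k j = 0) \<and> (\<forall>k\<in>K. r k = 0) \<and> (\<forall>j\<in>J. c j = 0)"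
proof -
  have n: "0 \<le> (\<Sum>k\<in>K. \<Sum>j\<in>J. w k j * g k j)" "0 \<le> (\<Sum>k\<in>K. r k)" "0 \<le> (\<Sum>j\<in>J. c j)"
    using w g r c by (auto intro!: sum_nonneg)
  show "0 \<le> D" unfolding D using n by simp
  assume "D = 0"
  then have z: "(\<Sum>k\<in>K. \<Sum>j\<in>J. w k j * g k j) = 0" "(\<Sum>k\<in>K. r k) = 0" "(\<Sum>j\<in>J. c j) = 0"
    using n D by linarith+
  have "(\<Sum>j\<in>J. w k j * g k j) = 0" if "k \<in> K" for k
    using z(1) that fin w g sum_nonneg_eq_0_iff[of K "\<lambda>k. \<Sum>j\<in>J. w k j * g k j"] by (simp add: sum_nonneg)
  then have "w k j * g k j = 0" if "k \<in> K" "j \<in> J" for k j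
    using that fin w g sum_nonneg_eq_0_iff[of J "\<lambda>j. w k j * g k j"] by simp
  moreover have "r k = 0" if "k \<in> K" for k using z(2) that fin r sum_nonneg_eq_0_iff[of K r] by simp
  moreover have "c j = 0" if "j \<in> J" for j using z(3) that fin c sum_nonneg_eq_0_iff[of J c] by simp
  ultimately show "(\<forall>k\<in>K. \<forall>j\<in>J. w k j * g k j = 0) \<and> (\<forall>k\<in>K. r k = 0) \<and> (\<forall>j\<in>J. c j = 0)" by blast
qed

text \<open>The scalar inequality is summed with the overlaps as weights. Support inclusion removes
  the row deficits; the column deficits measure the part of \<sigma> outside the support of \<rho>,
  and equality forces them to vanish as well.\<close>

lemma klein:
  assumes \<rho>: "fpsd \<rho>" and \<sigma>: "fpsd \<sigma>" and sub: "sp \<sigma> * \<rho> = \<rho>"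
  shows "Re (tr \<rho>) - Re (tr \<sigma>) \<le> umegaki_div \<rho> \<sigma> \<and> (umegaki_div \<rho> \<sigma> = Re (tr \<rho>) - Re (tr \<sigma>) \<longrightarrow> \<rho> = \<sigma>)"
proof (rule spectral_coupling[OF \<rho> \<sigma>])
  fix K J :: "nat set" and l m :: "nat \<Rightarrow> real" and w a b
  assume fin: "finite K" "finite J" and l: "\<And>k. k \<in> K \<Longrightarrow> 0 < l k" and m: "\<And>j. j \<in> J \<Longrightarrow> 0 < m j"
    and w: "\<And>k j. k \<in> K \<Longrightarrow> j \<in> J \<Longrightarrow> 0 \<le> w k j"
    and T: "\<And>f g. Re (tr (fc (\<lambda>x. complex_of_real (f x)) \<rho> * fc (\<lambda>x. complex_of_real (g x)) \<sigma>))
        = (\<Sum>k\<in>K. \<Sum>j\<in>J. w k j * (f (l k) * g (m j)))"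
    and T1: "\<And>f. Re (tr (fc (\<lambda>x. complex_of_real (f x)) \<rho>)) = (\<Sum>k\<in>K. f (l k) * a k)"
    and T2: "\<And>f. Re (tr (fc (\<lambda>x. complex_of_real (f x)) \<sigma>)) = (\<Sum>j\<in>J. f (m j) * b j)"
    and col: "\<And>j. j \<in> J \<Longrightarrow> (\<Sum>k\<in>K. w k j) \<le> b j"
    and row: "sp \<sigma> * \<rho> = \<rho> \<Longrightarrow> \<forall>k\<in>K. (\<Sum>j\<in>J. w k j) = a k"
    and eq: "\<forall>k\<in>K. \<forall>j\<in>J. w k j \<noteq> 0 \<longrightarrow> l k = m j \<Longrightarrow> \<forall>k\<in>K. (\<Sum>j\<in>J. w k j) = a k
        \<Longrightarrow> \<forall>j\<in>J. (\<Sum>k\<in>K. w k j) = b j \<Longrightarrow> \<rho> = \<sigma>"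
  note row = row[OF sub]
  define g where "g k j = l k * ln (l k) - l k * ln (m j) - l k + m j" for k j
  define c where "c j = m j * (b j - (\<Sum>k\<in>K. w k j))" for j
  have "Re (tr \<rho>) = (\<Sum>k\<in>K. \<Sum>j\<in>J. w k j * l k)"
    using T1[of "\<lambda>x. x"] by (simp add: fc_id fpsd_dg \<rho> sum_weights[OF fin(1) row])
  moreover have "Re (tr \<sigma>) = (\<Sum>j\<in>J. m j * b j)"
    using T2[of "\<lambda>x. x"] by (simp add: fc_id fpsd_dg \<sigma>)
  moreover have "(\<Sum>j\<in>J. c j) = (\<Sum>j\<in>J. m j * b j) - (\<Sum>k\<in>K. \<Sum>j\<in>J. w k j * m j)"
    by (simp add: c_def right_diff_distrib sum_subtractf sum_distrib_left mult.commute)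
      (rule sum.swap)
  moreover have "Re (tr (\<rho> * lg \<rho>)) = (\<Sum>k\<in>K. \<Sum>j\<in>J. w k j * (l k * ln (l k)))"
    using T1[of "\<lambda>x. x * ln x"] by (simp add: mult_lg_self \<rho> sum_weights[OF fin(1) row])
  moreover have "Re (tr (\<rho> * lg \<sigma>)) = (\<Sum>k\<in>K. \<Sum>j\<in>J. w k j * (l k * ln (m j)))"
    using T[of "\<lambda>x. x" ln] by (simp add: fc_id fpsd_dg \<rho> lg_def)
  moreover have "(\<Sum>k\<in>K. \<Sum>j\<in>J. w k j * g k j) = (\<Sum>k\<in>K. \<Sum>j\<in>J. w k j * (l k * ln (l k)))
      - (\<Sum>k\<in>K. \<Sum>j\<in>J. w k j * (l k * ln (m j))) - (\<Sum>k\<in>K. \<Sum>j\<in>J. w k j * l k) + (\<Sum>k\<in>K. \<Sum>j\<in>J. w k j * m j)"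
    by (simp add: g_def algebra_simps sum_subtractf sum.distrib)
  ultimately have D: "umegaki_div \<rho> \<sigma> - (Re (tr \<rho>) - Re (tr \<sigma>))
      = (\<Sum>k\<in>K. \<Sum>j\<in>J. w k j * g k j) + (\<Sum>k\<in>K. 0) + (\<Sum>j\<in>J. c j)"
    by (simp add: umegaki_div_def right_diff_distrib)
  have g0: "0 \<le> g k j" and g1: "g k j = 0 \<Longrightarrow> l k = m j" if "k \<in> K" "j \<in> J" for k j
    unfolding g_def using klein_scalar[OF l[OF that(1)] m[OF that(2)]] by auto
  have c0: "0 \<le> c j" if "j \<in> J" for j unfolding c_def using m[OF that] col[OF that] by simp
  note wd = weighted_defect[OF fin w g0 _ c0 D]
  show ?thesis
  proof (intro conjI impI)
    show "Re (tr \<rho>) - Re (tr \<sigma>) \<le> umegaki_div \<rho> \<sigma>" using wd(1) by simp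
    assume "umegaki_div \<rho> \<sigma> = Re (tr \<rho>) - Re (tr \<sigma>)"
    then have z: "\<forall>k\<in>K. \<forall>j\<in>J. w k j * g k j = 0" "\<forall>j\<in>J. c j = 0" using wd(2) by auto
    have "(\<Sum>k\<in>K. w k j) = b j" if "j \<in> J" for j
      using z(2) m[OF that] that by (force simp: c_def)
    moreover have "l k = m j" if "k \<in> K" "j \<in> J" "w k j \<noteq> 0" for k j using z(1) g1 that by auto
    ultimately show "\<rho> = \<sigma>" using eq row by blast
  qed
qed

text \<open>The scalar Young inequality is summed over the overlaps, with both kinds of deficits
  entering nonnegatively. For two states the conclusion bounds tr \<omega>^(1-p) \<tau>^p by 1, with
  equality only for \<omega> = \<tau>.\<close>

lemma hoelder:
  assumes A: "fpsd A" and B: "fpsd B" and p: "0 < p" "p < 1"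
  defines "D \<equiv> (1 - p) * Re (tr A) + p * Re (tr B)
      - Re (tr (pw A (complex_of_real (1 - p)) * pw B (complex_of_real p)))"
  shows "0 \<le> D \<and> (D = 0 \<longrightarrow> A = B)"
proof (rule spectral_coupling[OF A B])
  fix K J :: "nat set" and l m :: "nat \<Rightarrow> real" and w a b
  assume fin: "finite K" "finite J" and l: "\<And>k. k \<in> K \<Longrightarrow> 0 < l k" and m: "\<And>j. j \<in> J \<Longrightarrow> 0 < m j"
    and w: "\<And>k j. k \<in> K \<Longrightarrow> j \<in> J \<Longrightarrow> 0 \<le> w k j"
    and T: "\<And>f g. Re (tr (fc (\<lambda>x. complex_of_real (f x)) A * fc (\<lambda>x. complex_of_real (g x)) B))
        = (\<Sum>k\<in>K. \<Sum>j\<in>J. w k j * (f (l k) * g (m j)))"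
    and T1: "\<And>f. Re (tr (fc (\<lambda>x. complex_of_real (f x)) A)) = (\<Sum>k\<in>K. f (l k) * a k)"
    and T2: "\<And>f. Re (tr (fc (\<lambda>x. complex_of_real (f x)) B)) = (\<Sum>j\<in>J. f (m j) * b j)"
    and row: "\<And>k. k \<in> K \<Longrightarrow> (\<Sum>j\<in>J. w k j) \<le> a k" and col: "\<And>j. j \<in> J \<Longrightarrow> (\<Sum>k\<in>K. w k j) \<le> b j"
    and eq: "\<forall>k\<in>K. \<forall>j\<in>J. w k j \<noteq> 0 \<longrightarrow> l k = m j \<Longrightarrow> \<forall>k\<in>K. (\<Sum>j\<in>J. w k j) = a k
        \<Longrightarrow> \<forall>j\<in>J. (\<Sum>k\<in>K. w k j) = b j \<Longrightarrow> A = B"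
  define g where "g k j = (1 - p) * l k + p * m j - exp ((1 - p) * ln (l k)) * exp (p * ln (m j))" for k j
  define r where "r k = (1 - p) * l k * (a k - (\<Sum>j\<in>J. w k j))" for k
  define c where "c j = p * m j * (b j - (\<Sum>k\<in>K. w k j))" for j
  have "Re (tr A) = (\<Sum>k\<in>K. l k * a k)" "Re (tr B) = (\<Sum>j\<in>J. m j * b j)"
    using T1[of "\<lambda>x. x"] T2[of "\<lambda>x. x"] by (simp_all add: fc_id fpsd_dg A B)
  moreover have "(\<Sum>j\<in>J. c j) = p * (\<Sum>j\<in>J. m j * b j) - (\<Sum>k\<in>K. \<Sum>j\<in>J. w k j * (p * m j))"
    by (simp add: c_def right_diff_distrib sum_subtractf sum_distrib_left mult_ac) (rule sum.swap)
  moreover have "(\<Sum>k\<in>K. r k) = (1 - p) * (\<Sum>k\<in>K. l k * a k) - (\<Sum>k\<in>K. \<Sum>j\<in>J. w k j * ((1 - p) * l k))"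
    unfolding r_def right_diff_distrib sum_subtractf sum_distrib_left
    by (simp add: mult_ac)
  moreover have "Re (tr (pw A (complex_of_real (1 - p)) * pw B (complex_of_real p)))
      = (\<Sum>k\<in>K. \<Sum>j\<in>J. w k j * (exp ((1 - p) * ln (l k)) * exp (p * ln (m j))))"
    unfolding pw_real by (rule T)
  moreover have "(\<Sum>k\<in>K. \<Sum>j\<in>J. w k j * g k j) = (\<Sum>k\<in>K. \<Sum>j\<in>J. w k j * ((1 - p) * l k))
      + (\<Sum>k\<in>K. \<Sum>j\<in>J. w k j * (p * m j)) - (\<Sum>k\<in>K. \<Sum>j\<in>J. w k j * (exp ((1 - p) * ln (l k)) * exp (p * ln (m j))))"
    unfolding g_def right_diff_distrib distrib_left sum_subtractf sum.distrib ..
  ultimately have D: "D = (\<Sum>k\<in>K. \<Sum>j\<in>J. w k j * g k j) + (\<Sum>k\<in>K. r k) + (\<Sum>j\<in>J. c j)"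
    unfolding D_def by simp
  have g0: "0 \<le> g k j" and g1: "g k j = 0 \<Longrightarrow> l k = m j" if "k \<in> K" "j \<in> J" for k j
    unfolding g_def using young_scalar[OF l[OF that(1)] m[OF that(2)] p] by auto
  have c0: "0 \<le> c j" if "j \<in> J" for j unfolding c_def using m[OF that] col[OF that] p by simp
  have r0: "0 \<le> r k" if "k \<in> K" for k unfolding r_def using l[OF that] row[OF that] p by simp
  note wd = weighted_defect[OF fin w g0 r0 c0 D]
  show ?thesis
  proof (intro conjI impI)
    show "0 \<le> D" by (rule wd(1))
    assume "D = 0"
    then have z: "\<forall>k\<in>K. \<forall>j\<in>J. w k j * g k j = 0" "\<forall>k\<in>K. r k = 0" "\<forall>j\<in>J. c j = 0" using wd(2) by auto
    have "(\<Sum>k\<in>K. w k j) = b j" if "j \<in> J" for j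
      using z(3) m[OF that] that p by (force simp: c_def)
    moreover have "(\<Sum>j\<in>J. w k j) = a k" if "k \<in> K" for k
      using z(2) l[OF that] that p by (force simp: r_def)
    moreover have "l k = m j" if "k \<in> K" "j \<in> J" "w k j \<noteq> 0" for k j using z(1) g1 that by auto
    ultimately show "A = B" using eq by blast
  qed
qed

subsection \<open>Minkowski's inequality and multiplicativity\<close>

lemma hoelder_schatten:
  assumes X: "fpsd X" and \<tau>: "fpsd \<tau>" "tr \<tau> = 1" and p: "0 < p" "p < 1"
  shows "Re (tr (X * pw \<tau> (complex_of_real p))) \<le> schatten p X"
proof (cases "X = 0")
  case False
  obtain \<omega> where o: "fpsd \<omega>" "tr \<omega> = 1" "X = (schatten p X) *\<^sub>r pw \<omega> (complex_of_real (1 - p))"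
    by (rule schatten_attained[OF X False p])
  have "Re (tr (X * pw \<tau> (complex_of_real p)))
      = schatten p X * Re (tr (pw \<omega> (complex_of_real (1 - p)) * pw \<tau> (complex_of_real p)))"
    by (subst o(3)) simp
  also have "\<dots> \<le> schatten p X * 1"
    using hoelder[OF o(1) \<tau>(1) p] o(2) \<tau>(2) by (intro mult_left_mono) auto
  finally show ?thesis by simp
qed simp

text \<open>The norm is a maximum of linear functionals: the state dual to the sum is tested on
  every summand.\<close>

lemma schatten_sum_le:
  assumes p: "0 < p" "p < 1" and X: "\<And>x. x \<in> I \<Longrightarrow> fpsd (X x)" and r: "\<And>x. x \<in> I \<Longrightarrow> 0 \<le> r x"
  shows "schatten p (\<Sum>x\<in>I. (r x) *\<^sub>r X x) \<le> (\<Sum>x\<in>I. r x * schatten p (X x))"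
    (is "schatten p ?S \<le> _")
proof (cases "?S = 0")
  case True
  then show ?thesis using r by (simp add: sum_nonneg)
next
  case False
  have S: "fpsd ?S" using X r by (intro fpsd_sum fpsd_cs)
  obtain \<tau> where t: "fpsd \<tau>" "tr \<tau> = 1" "tr (?S * pw \<tau> (complex_of_real p)) = complex_of_real (schatten p ?S)"
    by (rule schatten_attained[OF S False p])
  have "schatten p ?S = Re (tr (?S * pw \<tau> (complex_of_real p)))" by (simp add: t(3))
  also have "\<dots> = (\<Sum>x\<in>I. r x * Re (tr (X x * pw \<tau> (complex_of_real p))))" by (simp add: sum_distrib_right)
  also have "\<dots> \<le> (\<Sum>x\<in>I. r x * schatten p (X x))"
    using X r by (intro sum_mono mult_left_mono hoelder_schatten t p)
  finally show ?thesis .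
qed

lemma schatten_triangle:
  assumes "0 < p" "p < 1" "fpsd A" "fpsd B" shows "schatten p (A + B) \<le> schatten p A + schatten p B"
  using schatten_sum_le[of p UNIV "\<lambda>b. if b then A else B" "\<lambda>_. 1"] assms by (simp add: UNIV_bool add.commute)

lemma schatten_mono:
  assumes p: "0 < p" "p < 1" and A: "fpsd A" and C: "fpsd C" and le: "fpsd (C - A)"
  shows "schatten p A \<le> schatten p C"
proof (cases "A = 0")
  case False
  obtain \<tau> where t: "fpsd \<tau>" "tr \<tau> = 1" "tr (A * pw \<tau> (complex_of_real p)) = complex_of_real (schatten p A)"
    by (rule schatten_attained[OF A False p])
  have "schatten p A = Re (tr (A * pw \<tau> (complex_of_real p)))" by (simp add: t(3))
  also have "\<dots> \<le> Re (tr (C * pw \<tau> (complex_of_real p)))"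
    using fpsd_tr_mult(1)[OF le fpsd_pw[OF t(1), of p]] by (simp add: left_diff_distrib)
  also have "\<dots> \<le> schatten p C" by (rule hoelder_schatten[OF C t(1,2) p])
  finally show ?thesis .
qed simp

lemma schatten_scale:
  assumes p: "0 < p" "p < 1" and A: "fpsd A" and r: "0 \<le> r"
  shows "schatten p (r *\<^sub>r A) = r * schatten p A"
proof (cases "r = 0")
  case False
  then have r: "0 < r" using r by simp
  have "pw (r *\<^sub>r A) (complex_of_real (1 / (1 - p)))
      = (r powr (1 / (1 - p))) *\<^sub>r pw A (complex_of_real (1 / (1 - p)))"
    unfolding pw_scale[OF A r] using r by (simp add: powr_def exp_of_real flip: of_real_mult of_real_divide of_real_diff)
  then have "schatten p (r *\<^sub>r A)
      = (r powr (1 / (1 - p)) * Re (tr (pw A (complex_of_real (1 / (1 - p)))))) powr (1 - p)"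
    by (simp add: schatten_def)
  also have "\<dots> = r * schatten p A"
    using r p fpsd_tr[OF fpsd_pw[OF A, of "1 / (1 - p)"]] by (simp add: powr_mult schatten_def powr_powr)
  finally show ?thesis .
qed simp

lemma schatten_tn:
  assumes A: "fpsd A" and B: "fpsd B" shows "schatten p (A \<star> B) = schatten p A * schatten p B"
proof -
  have i: "Im (tr (pw A (complex_of_real (1 / (1 - p))))) = 0" "Im (tr (pw B (complex_of_real (1 / (1 - p))))) = 0"
    by (intro tr_hermitian_real fpsd_dg fpsd_pw A B)+
  show ?thesis
    unfolding schatten_def pw_tn[OF A B] tr_tn
    by (simp only: times_complex.sel i mult_zero_left diff_zero)
      (intro powr_mult fpsd_tr fpsd_pw A B)
qed

lemma pw_reix: "inj e \<Longrightarrow> fpsd A \<Longrightarrow> pw (reix e A) z = reix e (pw A z)"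
  by (simp add: pw_def fc_reix fpsd_dg)

lemma lg_reix: "inj e \<Longrightarrow> fpsd A \<Longrightarrow> lg (reix e A) = reix e (lg A)"
  by (simp add: lg_def fc_reix fpsd_dg)

lemma sandwich_norm_reix: "inj e \<Longrightarrow> fpsd \<rho> \<Longrightarrow> fpsd \<sigma> \<Longrightarrow> sandwich_norm p (reix e \<rho>) (reix e \<sigma>) = sandwich_norm p \<rho> \<sigma>"
  using fpsd_sandwich[of \<rho> \<sigma> "- (p / 2)"]
  by (simp add: sandwich_norm_def schatten_def pw_reix tr_reix flip: reix_mult)

lemma umegaki_div_reix: "inj e \<Longrightarrow> fpsd \<rho> \<Longrightarrow> fpsd \<sigma> \<Longrightarrow> umegaki_div (reix e \<rho>) (reix e \<sigma>) = umegaki_div \<rho> \<sigma>"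
  by (simp add: umegaki_div_def lg_reix tr_reix flip: reix_mult reix_simps)

text \<open>Pairing \<open>X\<close> with \<sigma>^p gives tr \<rho> = 1, so duality bounds the norm
  from below; in the equality case the state dual to \<open>X\<close> must be \<sigma>.\<close>

lemma sandwich_norm_ge_1:
  assumes \<rho>: "fpsd \<rho>" "tr \<rho> = 1" and \<sigma>: "fpsd \<sigma>" "tr \<sigma> = 1" and sub: "sp \<sigma> * \<rho> = \<rho>" and p: "0 < p" "p < 1"
  shows "1 \<le> sandwich_norm p \<rho> \<sigma>" "sandwich_norm p \<rho> \<sigma> = 1 \<longleftrightarrow> \<rho> = \<sigma>"
proof -
  define X where "X = pw \<sigma> (- complex_of_real (p / 2)) * \<rho> * pw \<sigma> (- complex_of_real (p / 2))"
  have X: "fpsd X" unfolding X_def using fpsd_sandwich[OF \<rho>(1) \<sigma>(1), of "- (p / 2)"] by simp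
  have half: "complex_of_real p = complex_of_real (p / 2) + complex_of_real (p / 2)" by simp
  have "tr (X * pw \<sigma> (complex_of_real p)) = tr (pw \<sigma> (complex_of_real (p / 2)) * X * pw \<sigma> (complex_of_real (p / 2)))"
    by (subst half, subst pw_add[OF \<sigma>(1), symmetric])
      (simp only: mult.assoc[symmetric] tr_commute[of _ "pw \<sigma> (complex_of_real (p / 2))"])
  then have t: "tr (X * pw \<sigma> (complex_of_real p)) = 1"
    unfolding X_def using sandwich_undo[OF \<rho>(1) \<sigma>(1) sub] \<rho>(2) by simp
  show "1 \<le> sandwich_norm p \<rho> \<sigma>" using hoelder_schatten[OF X \<sigma> p] t by (simp add: sandwich_norm_def X_def)
  show "sandwich_norm p \<rho> \<sigma> = 1 \<longleftrightarrow> \<rho> = \<sigma>"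
  proof
    assume "sandwich_norm p \<rho> \<sigma> = 1"
    then have pX: "schatten p X = 1" by (simp add: sandwich_norm_def X_def)
    then have "X \<noteq> 0" by auto
    then obtain \<omega> where o: "fpsd \<omega>" "tr \<omega> = 1" "X = (schatten p X) *\<^sub>r pw \<omega> (complex_of_real (1 - p))"
      by (metis schatten_attained[OF X _ p])
    have oX: "X = pw \<omega> (complex_of_real (1 - p))" using o(3) pX by simp
    have "tr (pw \<omega> (complex_of_real (1 - p)) * pw \<sigma> (complex_of_real p)) = 1" using t unfolding oX .
    then have "\<omega> = \<sigma>" using hoelder[OF o(1) \<sigma>(1) p] by (simp add: o(2) \<sigma>(2))
    then have "X = pw \<sigma> (complex_of_real (1 - p))" using oX by simp
    moreover have "\<rho> = pw \<sigma> (complex_of_real (p / 2)) * X * pw \<sigma> (complex_of_real (p / 2))"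
      unfolding X_def using sandwich_undo[OF \<rho>(1) \<sigma>(1) sub] by simp
    ultimately show "\<rho> = \<sigma>" by (simp add: pw_add pw_one \<sigma>(1))
  next
    assume "\<rho> = \<sigma>"
    then have "X = pw \<sigma> (- complex_of_real (p / 2)) * pw \<sigma> 1 * pw \<sigma> (- complex_of_real (p / 2))"
      by (simp add: X_def pw_one \<sigma>(1))
    then have "X = pw \<sigma> (complex_of_real (1 - p))" by (simp add: pw_add \<sigma>(1))
    then have "pw X (complex_of_real (1 / (1 - p))) = pw \<sigma> (complex_of_real (1 / (1 - p)) * complex_of_real (1 - p))"
      by (simp only: pw_pw[OF \<sigma>(1)])
    also have "complex_of_real (1 / (1 - p)) * complex_of_real (1 - p) = 1" using p by (simp flip: of_real_mult of_real_diff)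
    finally have "schatten p X = 1" by (simp only: schatten_def pw_one[OF \<sigma>(1)] \<sigma>(2)) simp
    then show "sandwich_norm p \<rho> \<sigma> = 1" by (simp add: sandwich_norm_def X_def)
  qed
qed

section \<open>Channels\<close>

definition ptr :: "('i \<times> 'r) fm \<Rightarrow> 'i fm" where
  "ptr = lext (\<lambda>p q. if snd p = snd q then unit (fst p) (fst q) else 0)"

definition amp :: "('i fm \<Rightarrow> 'j fm) \<Rightarrow> ('r \<times> 'i) fm \<Rightarrow> ('r \<times> 'j) fm" where
  "amp \<Phi> = lext (\<lambda>p q. unit (fst p) (fst q) \<star> \<Phi> (unit (snd p) (snd q)))"

lemma lin_ptr: "lin ptr" unfolding ptr_def by (rule lin_lext)
lemma lin_amp: "lin (amp \<Phi>)" unfolding amp_def by (rule lin_lext)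
lemmas ptr_simps [simp] = lin_simps[OF lin_ptr]
lemmas amp_simps [simp] = lin_simps[OF lin_amp]

lemma ptr_unit [simp]: "ptr (unit (i, k) (j, l)) = (if k = l then unit i j else 0)"
  by (simp add: ptr_def)

lemma amp_unit [simp]: "amp \<Phi> (unit (i, k) (j, l)) = unit i j \<star> \<Phi> (unit k l)"
  by (simp add: amp_def)

lemma ptr_tn [simp]: "ptr (A \<star> B) = tr B *\<^sub>c A"
proof (induct A rule: fm_induct)
  case (unit c i j)
  have "ptr (unit i j \<star> B) = tr B *\<^sub>c unit i j"
    by (induct B rule: fm_induct) (simp_all add: cs_add_left cs_cs)
  then show ?case by (simp add: cs_cs mult.commute)
qed (simp_all add: cs_add_right)

lemma amp_tn: assumes "lin \<Phi>" shows "amp \<Phi> (A \<star> B) = A \<star> \<Phi> B"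
proof (induct A rule: fm_induct)
  case (unit c i j)
  have "amp \<Phi> (unit i j \<star> B) = unit i j \<star> \<Phi> B"
    by (induct B rule: fm_induct) (simp_all add: lin_simps[OF assms])
  then show ?case by simp
qed simp_all

lemma fm_induct_prod [case_names zero add unit]:
  assumes "P 0" "\<And>A B. P A \<Longrightarrow> P B \<Longrightarrow> P (A + B)" "\<And>c i k j l. P (c *\<^sub>c unit (i, k) (j, l))"
  shows "P A"
proof (rule fm_induct[of P A])
  show "P (c *\<^sub>c unit p q)" for c p q using assms(3)[of c "fst p" "snd p" "fst q" "snd q"] by simp
qed (use assms in auto)

lemma tr_ptr [simp]: "tr (ptr X) = tr X"
  by (induct X rule: fm_induct_prod) auto

lemma dg_ptr [simp]: "dg (ptr X) = ptr (dg X)"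
  by (induct X rule: fm_induct_prod) auto

lemma ptr_reix: "inj f \<Longrightarrow> ptr (reix (map_prod e f) X) = reix e (ptr X)"
  by (induct X rule: fm_induct_prod) (auto simp: inj_eq)

lemma amp_reix:
  assumes "lin \<Phi>" shows "amp \<Phi> (reix (map_prod e id) X) = reix (map_prod e id) (amp \<Phi> X)"
proof (induct X rule: fm_induct_prod)
  case (unit c i k j l)
  have "reix (map_prod e id) (unit i j \<star> \<Phi> (unit k l)) = unit (e i) (e j) \<star> \<Phi> (unit k l)"
    using reix_tn[of e "unit i j" id "\<Phi> (unit k l)"] by simp
  then show ?case by (simp add: id_def)
qed simp_all

text \<open>For identities that hold only on a finite box of labels, such as those in which
  \<open>one S\<close> acts as a unit or a channel preserves the trace.\<close>

lemma fm_box_induct: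
  assumes "finite R" "\<And>p q. ent X p q \<noteq> 0 \<Longrightarrow> fst p \<in> R \<and> fst q \<in> R \<and> snd p \<in> S \<and> snd q \<in> S"
    "finite S" "lin f" "lin g"
    "\<And>i k j l. i \<in> R \<Longrightarrow> j \<in> R \<Longrightarrow> k \<in> S \<Longrightarrow> l \<in> S \<Longrightarrow> f (unit (i, k) (j, l)) = g (unit (i, k) (j, l))"
  shows "f X = g X"
proof -
  have sub: "supp X \<subseteq> (R \<times> S) \<times> (R \<times> S)" using assms(2) by (force simp: supp_def)
  have e: "X = (\<Sum>p\<in>(R \<times> S) \<times> (R \<times> S). ent X (fst p) (snd p) *\<^sub>c unit (fst p) (snd p))"
    by (rule fm_expand[OF _ sub]) (use assms in simp)
  show ?thesis
    by (subst (1 2) e) (use assms(6) in \<open>auto simp: lin_simps[OF assms(4)] lin_simps[OF assms(5)] intro!: sum.cong\<close>)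
qed

lemma fst_box:
  fixes X :: "('i \<times> 'r) fm"
  obtains R S where "finite R" "finite S"
    "\<And>p q. ent X p q \<noteq> 0 \<Longrightarrow> fst p \<in> R \<and> fst q \<in> R \<and> snd p \<in> S \<and> snd q \<in> S"
proof -
  obtain T where T: "finite T" "supp X \<subseteq> T \<times> T" by (rule supp_box)
  show ?thesis
    by (rule that[of "fst ` T" "snd ` T"]) (use T supp_subD[OF T(2)] in auto)
qed

lemma tr_mult_ptr:
  assumes "finite R" "finite S" "\<And>p q. ent X p q \<noteq> 0 \<Longrightarrow> fst p \<in> R \<and> fst q \<in> R \<and> snd p \<in> S \<and> snd q \<in> S"
  shows "tr (C * ptr X * D) = tr ((C \<star> one S) * X * (D \<star> one S))"
proof (rule fm_box_induct[OF assms(1,3,2), where f = "\<lambda>X. tr (C * ptr X * D)"])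
  show "lin (\<lambda>X. tr (C * ptr X * D))" "lin (\<lambda>X. tr ((C \<star> one S) * X * (D \<star> one S)))"
    by (auto intro!: linI simp: algebra_simps)
  fix i j k l assume "k \<in> S" "l \<in> S"
  then show "tr (C * ptr (unit (i, k) (j, l)) * D) = tr ((C \<star> one S) * unit (i, k) (j, l) * (D \<star> one S))"
    using assms(2) by (simp flip: tn_unit)
qed

lemma fpsd_ptr: assumes "fpsd X" shows "fpsd (ptr X)"
  unfolding fpsd_def
proof (intro conjI allI)
  obtain R S where b: "finite R" "finite S"
    "\<And>p q. ent X p q \<noteq> 0 \<Longrightarrow> fst p \<in> R \<and> fst q \<in> R \<and> snd p \<in> S \<and> snd q \<in> S" by (rule fst_box[of X]) blast
  show "dg (ptr X) = ptr X" by (simp add: fpsd_dg assms)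
  fix B show "0 \<le> Re (tr (dg B * ptr X * B))"
    using fpsd_conj_tr[OF assms, of "B \<star> one S"] by (simp add: tr_mult_ptr[OF b])
qed

text \<open>Under the trace, c and e move into the full space as c \<star> one S and e \<star> one
  S, where the ordinary Cauchy-Schwarz inequality applies.\<close>

lemma schwarz_map_ptr: "schwarz_map (ptr :: ('i \<times> 'r) fm \<Rightarrow> 'i fm)"
  unfolding schwarz_map_def
proof (intro conjI allI impI)
  show "lin (ptr :: ('i \<times> 'r) fm \<Rightarrow> 'i fm)" by (rule lin_ptr)
  show "fpsd A \<Longrightarrow> fpsd (ptr A)" for A :: "('i \<times> 'r) fm" by (rule fpsd_ptr)
  show "Re (tr (ptr (dg a * a))) \<le> Re (tr (dg a * a))" for a :: "('i \<times> 'r) fm" by simp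
  fix a b :: "('i \<times> 'r) fm" and c e
  obtain R1 S1 where 1: "finite R1" "finite S1"
    "\<And>p q. ent (dg a * a) p q \<noteq> 0 \<Longrightarrow> fst p \<in> R1 \<and> fst q \<in> R1 \<and> snd p \<in> S1 \<and> snd q \<in> S1" by (rule fst_box) blast
  obtain R2 S2 where 2: "finite R2" "finite S2"
    "\<And>p q. ent (dg a * b) p q \<noteq> 0 \<Longrightarrow> fst p \<in> R2 \<and> fst q \<in> R2 \<and> snd p \<in> S2 \<and> snd q \<in> S2" by (rule fst_box) blast
  obtain R3 S3 where 3: "finite R3" "finite S3"
    "\<And>p q. ent (dg b * b) p q \<noteq> 0 \<Longrightarrow> fst p \<in> R3 \<and> fst q \<in> R3 \<and> snd p \<in> S3 \<and> snd q \<in> S3" by (rule fst_box) blast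
  \<comment> \<open>One box for all three products, so that the same local unit occurs in all three
    terms.\<close>
  define R where "R = R1 \<union> R2 \<union> R3"
  define S where "S = S1 \<union> S2 \<union> S3"
  have f: "finite R" "finite S" using 1 2 3 by (auto simp: R_def S_def)
  have t: "tr (C * ptr (dg a * a) * D) = tr ((C \<star> one S) * (dg a * a) * (D \<star> one S))"
    "tr (C * ptr (dg a * b) * D) = tr ((C \<star> one S) * (dg a * b) * (D \<star> one S))"
    "tr (C * ptr (dg b * b) * D) = tr ((C \<star> one S) * (dg b * b) * (D \<star> one S))" for C D
    by (rule tr_mult_ptr[OF f]; use 1(3) 2(3) 3(3) in \<open>force simp: R_def S_def\<close>)+
  show "2 * Re (tr (dg c * ptr (dg a * b) * e))
      \<le> Re (tr (dg c * ptr (dg a * a) * c)) + Re (tr (dg e * ptr (dg b * b) * e))"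
    unfolding t using tr_cauchy_schwarz[of "a * (c \<star> one S)" "b * (e \<star> one S)"]
    by (simp add: mult.assoc)
qed

subsection \<open>Monotonicity of the trace logarithm\<close>

lemma sdec_tn_proj:
  "sdec A K l P \<Longrightarrow> dg p = p \<Longrightarrow> p * p = p \<Longrightarrow> sdec (A \<star> p) K l (\<lambda>k. P k \<star> p)"
  unfolding sdec_def by auto

lemma fc_tn_proj: assumes "dg A = A" "dg p = p" "p * p = p" shows "fc f (A \<star> p) = fc f A \<star> p"
proof -
  obtain K :: "nat set" and l P where s: "sdec A K l P" by (rule hermitian_sdec[OF assms(1)])
  show ?thesis by (simp add: fc_sdec[OF sdec_tn_proj[OF s assms(2,3)]] fc_sdec[OF s])
qed

lemma fc_orth_add:
  assumes "dg A = A" "dg B = B" "A * B = 0" shows "fc f (A + B) = fc f A + fc f B"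
proof -
  obtain K :: "nat set" and l P where s: "sdec A K l P" "\<And>k. k \<in> K \<Longrightarrow> l k \<noteq> 0 \<and> P k \<noteq> 0"
    by (rule hermitian_sdec[OF assms(1)]) blast
  obtain J :: "nat set" and m Q where t: "sdec B J m Q" "\<And>k. k \<in> J \<Longrightarrow> m k \<noteq> 0 \<and> Q k \<noteq> 0"
    by (rule hermitian_sdec[OF assms(2)]) blast
  have PQ: "P k * Q j = 0" if "k \<in> K" "j \<in> J" for k j
  proof -
    have "(l k * m j) *\<^sub>r (P k * Q j) = (P k * A) * (B * Q j)"
      by (simp add: sdec_mult_proj[OF s(1) that(1)] sdec_mult_proj[OF t(1) that(2)] cs_cs mult.commute)
    also have "\<dots> = 0" using assms(3) by (metis mult.assoc mult_zero_left mult_zero_right)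
    finally have "(1 / complex_of_real (l k * m j)) *\<^sub>c ((l k * m j) *\<^sub>r (P k * Q j)) = 0" by simp
    then show ?thesis using s(2)[OF that(1)] t(2)[OF that(2)] by (simp add: cs_cs)
  qed
  have QP: "Q j * P k = 0" if "k \<in> K" "j \<in> J" for k j
    using arg_cong[OF PQ[OF that], of dg] sdecD(2)[OF s(1) that(1)] sdecD(2)[OF t(1) that(2)] by simp
  have "sdec (A + B) (K <+> J) (case_sum l m) (case_sum P Q)"
    unfolding sdec_def
  proof (intro conjI)
    show "A + B = (\<Sum>k\<in>K <+> J. (case_sum l m k) *\<^sub>r case_sum P Q k)"
      using s(1) t(1) by (simp add: sum.Plus sdec_def)
    show "finite (K <+> J)" using s(1) t(1) by (simp add: sdecD(1))
    show "\<forall>k\<in>K <+> J. dg (case_sum P Q k) = case_sum P Q k"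
      using sdecD(2)[OF s(1)] sdecD(2)[OF t(1)] by auto
    show "\<forall>k\<in>K <+> J. \<forall>j\<in>K <+> J. case_sum P Q k * case_sum P Q j = (if k = j then case_sum P Q k else 0)"
    proof (intro ballI)
      fix k j assume "k \<in> K <+> J" "j \<in> K <+> J"
      then show "case_sum P Q k * case_sum P Q j = (if k = j then case_sum P Q k else 0)"
        using sdecD(3)[OF s(1)] sdecD(3)[OF t(1)] PQ QP by (cases k; cases j) auto
    qed
  qed
  from fc_sdec[OF this, of f] show ?thesis
    using s(1) t(1) by (simp add: sum.Plus sdecD(1) fc_sdec[OF s(1)] fc_sdec[OF t(1)])
qed

text \<open>Data processing under the partial trace applied to \<open>A \<oplus> 0\<close> and \<open>A \<oplus> B\<close>.\<close>
lemma tr_log_mono: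
  fixes A C :: "'i fm"
  assumes A: "fpsd A" and C: "fpsd C" and le: "fpsd (C - A)"
  shows "Re (tr (A * lg A)) \<le> Re (tr (A * lg C))"
proof -
  define B where "B = C - A"
  have B: "fpsd B" and CB: "C = A + B" using le by (auto simp: B_def)
  \<comment> \<open>Two orthogonal labels realise the block sums, and tracing them out gives
    \<open>A\<close> and C = A + B. Before that the divergence is 0, because the logarithm of the
    larger matrix agrees with \<open>lg A\<close> on the first block.\<close>
  define p where "p = unit False False"
  define q where "q = unit True True"
  have p: "dg p = p" "p * p = p" "p * q = 0" "tr p = 1" and q: "dg q = q" "q * q = q" "tr q = 1"
    by (simp_all add: p_def q_def)
  have Ap: "fpsd (A \<star> p)" and Bq: "fpsd (B \<star> q)" by (intro fpsd_tn fpsd_proj A B p q)+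
  have S: "fpsd (A \<star> p + B \<star> q)" by (intro fpsd_add Ap Bq)
  have lgA: "lg (A \<star> p) = lg A \<star> p"
    unfolding lg_def by (rule fc_tn_proj) (simp_all add: p A fpsd_dg)
  have "lg (A \<star> p + B \<star> q) = lg (A \<star> p) + lg (B \<star> q)"
    unfolding lg_def by (rule fc_orth_add) (simp_all add: p q A B fpsd_dg)
  moreover have "lg (B \<star> q) = lg B \<star> q"
    unfolding lg_def by (rule fc_tn_proj) (simp_all add: q B fpsd_dg)
  ultimately have z: "umegaki_div (A \<star> p) (A \<star> p + B \<star> q) = 0"
    by (simp add: umegaki_div_def lgA distrib_left right_diff_distrib p)
  have "umegaki_div (ptr (A \<star> p)) (ptr (A \<star> p + B \<star> q)) \<le> umegaki_div (A \<star> p) (A \<star> p + B \<star> q)"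
  proof (rule umegaki_dpi[OF schwarz_map_ptr Ap S])
    show "sp (A \<star> p + B \<star> q) * (A \<star> p) = A \<star> p"
      by (rule sp_mult_dominated[of _ _ 1]) (use Ap S Bq in simp_all)
    show "sp (ptr (A \<star> p + B \<star> q)) * ptr (A \<star> p) = ptr (A \<star> p)"
      by (rule sp_mult_dominated[of _ _ 1]) (use A B C CB in \<open>simp_all add: p q\<close>)
  qed simp
  then have "umegaki_div A C \<le> 0" by (simp add: z p q flip: CB)
  then show ?thesis by (simp add: umegaki_div_def right_diff_distrib)
qed

subsection \<open>Completely positive trace-preserving maps\<close>

text \<open>A channel on \<open>nat\<close> labels, extended by 0 outside its input box; trace
  preservation is therefore relative to the local unit of that box. References labelled by
  \<open>nat\<close> include all finite ones.\<close>

definition chan :: "nat \<Rightarrow> nat \<Rightarrow> (nat fm \<Rightarrow> nat fm) \<Rightarrow> bool" where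
  "chan a' a \<Phi> \<longleftrightarrow> lin \<Phi> \<and> (\<forall>i j. \<not> (i < a' \<and> j < a') \<longrightarrow> \<Phi> (unit i j) = 0)
     \<and> (\<forall>X. one {..<a} * \<Phi> X = \<Phi> X \<and> \<Phi> X * one {..<a} = \<Phi> X)
     \<and> (\<forall>X. tr (\<Phi> X) = tr (one {..<a'} * X))
     \<and> (\<forall>X :: (nat \<times> nat) fm. fpsd X \<longrightarrow> fpsd (amp \<Phi> X))"

lemma chan_lin: "chan a' a \<Phi> \<Longrightarrow> lin \<Phi>" by (simp add: chan_def)

lemma fpsd_reixD: assumes "inj e" "fpsd (reix e Y)" shows "fpsd Y"
  unfolding fpsd_def
proof (intro conjI allI)
  have "reix e (dg Y) = reix e Y" using fpsd_dg[OF assms(2)] by simp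
  then show "dg Y = Y" by (rule reix_inject[OF assms(1)])
  show "0 \<le> Re (tr (dg B * Y * B))" for B
    using fpsd_conj_tr[OF assms(2), of "reix e B"] by (simp add: tr_reix assms(1) flip: reix_mult)
qed

text \<open>A countable reference is relabelled into \<open>nat\<close>; this admits references that
  are products, such as a bit or an earlier output joined to another reference.\<close>

lemma amp_fpsd:
  fixes X :: "('r::countable \<times> nat) fm"
  assumes c: "chan a' a \<Phi>" and X: "fpsd X" shows "fpsd (amp \<Phi> X)"
proof -
  let ?e = "map_prod (to_nat :: 'r \<Rightarrow> nat) (id :: nat \<Rightarrow> nat)"
  have i: "inj ?e" by (intro prod.inj_map) auto
  have "fpsd (amp \<Phi> (reix ?e X))" using c fpsd_reix[OF i X] by (simp add: chan_def)
  then have "fpsd (reix ?e (amp \<Phi> X))" by (simp only: amp_reix[OF chan_lin[OF c]])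
  then show ?thesis by (rule fpsd_reixD[OF prod.inj_map, rotated 2]) auto
qed

definition assoc :: "'a \<times> 'b \<times> 'c \<Rightarrow> ('a \<times> 'b) \<times> 'c" where "assoc p = ((fst p, fst (snd p)), snd (snd p))"

lemma inj_assoc: "inj assoc" by (auto simp: inj_def assoc_def)

lemma assoc_tn: "reix assoc (A \<star> (B \<star> C)) = (A \<star> B) \<star> C"
proof (induct A rule: fm_induct)
  case (unit c i j)
  have "reix assoc (unit i j \<star> (B \<star> C)) = (unit i j \<star> B) \<star> C"
  proof (induct B rule: fm_induct)
    case (unit c k l)
    have "reix assoc (unit i j \<star> (unit k l \<star> C)) = (unit i j \<star> unit k l) \<star> C"
      by (induct C rule: fm_induct) (simp_all add: assoc_def)
    then show ?case by simp
  qed simp_all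
  then show ?case by simp
qed simp_all

lemma amp_amp:
  fixes \<Phi> :: "'i fm \<Rightarrow> 'j fm" and X :: "('r \<times> 's \<times> 'i) fm"
  assumes "lin \<Phi>" shows "reix assoc (amp (amp \<Phi>) X) = amp \<Phi> (reix assoc X)"
proof (rule lin_eqI[of "\<lambda>X. reix assoc (amp (amp \<Phi>) X)" "\<lambda>X. amp \<Phi> (reix assoc X)"])
  fix p q :: "'r \<times> 's \<times> 'i"
  obtain i k m where "p = (i, k, m)" by (metis prod_cases3)
  moreover obtain j l n where "q = (j, l, n)" by (metis prod_cases3)
  ultimately show "reix assoc (amp (amp \<Phi>) (unit p q)) = amp \<Phi> (reix assoc (unit p q))"
    by (simp add: assoc_def assoc_tn[of "unit i j" "unit k l" "\<Phi> (unit m n)", simplified])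
qed (auto intro!: linI)

lemma amp_trace:
  assumes c: "chan a' a \<Phi>" and R: "finite R" "\<And>p q. ent X p q \<noteq> 0 \<Longrightarrow> fst p \<in> R \<and> fst q \<in> R"
  shows "tr (amp \<Phi> X) = tr ((one R \<star> one {..<a'}) * X)"
proof -
  obtain R' S where b: "finite R'" "finite S"
    "\<And>p q. ent X p q \<noteq> 0 \<Longrightarrow> fst p \<in> R' \<and> fst q \<in> R' \<and> snd p \<in> S \<and> snd q \<in> S" by (rule fst_box) blast
  show ?thesis
  proof (rule fm_box_induct[OF R(1) _ b(2), where f = "\<lambda>X. tr (amp \<Phi> X)"])
    show "ent X p q \<noteq> 0 \<Longrightarrow> fst p \<in> R \<and> fst q \<in> R \<and> snd p \<in> S \<and> snd q \<in> S" for p q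
      using R(2) b(3) by blast
    show "lin (\<lambda>X. tr (amp \<Phi> X))" "lin (\<lambda>X. tr ((one R \<star> one {..<a'}) * X))"
      by (auto intro!: linI simp: distrib_left)
    fix i j k l assume "i \<in> R" "j \<in> R"
    moreover have "tr (\<Phi> (unit k l)) = tr (one {..<a'} * unit k l)" using c by (simp add: chan_def)
    moreover have "(one R \<star> one {..<a'}) * unit (i, k) (j, l) = (one R * unit i j) \<star> (one {..<a'} * unit k l)"
      by (simp flip: tn_unit)
    ultimately show "tr (amp \<Phi> (unit (i, k) (j, l))) = tr ((one R \<star> one {..<a'}) * unit (i, k) (j, l))"
      using R(1) by (simp only: amp_unit tr_tn) simp
  qed
qed

text \<open>The two-by-two block matrix of the images of \<open>dg a * a\<close>,
  \<open>dg a * b\<close>, \<open>dg b * a\<close> and \<open>dg b * b\<close> is positive, because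
  a further two-level reference is just a larger reference. Testing it on the column with entries c'
  and -e gives the Cauchy-Schwarz clause.\<close>

lemma schwarz_map_amp:
  fixes \<Phi> :: "nat fm \<Rightarrow> nat fm"
  assumes c: "chan a' a \<Phi>" shows "schwarz_map (amp \<Phi> :: ('r::countable \<times> nat) fm \<Rightarrow> _)"
  unfolding schwarz_map_def
proof (intro conjI allI impI)
  note lin = chan_lin[OF c]
  show "lin (amp \<Phi> :: ('r \<times> nat) fm \<Rightarrow> _)" by (rule lin_amp)
  show "fpsd A \<Longrightarrow> fpsd (amp \<Phi> A)" for A :: "('r \<times> nat) fm" by (rule amp_fpsd[OF c])
  show "Re (tr (amp \<Phi> (dg a * a))) \<le> Re (tr (dg a * a))" for a :: "('r \<times> nat) fm"
  proof -
    obtain R S where b: "finite R" "finite S"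
      "\<And>p q. ent (dg a * a) p q \<noteq> 0 \<Longrightarrow> fst p \<in> R \<and> fst q \<in> R \<and> snd p \<in> S \<and> snd q \<in> S" by (rule fst_box) blast
    \<comment> \<open>The projection onto the input box: whatever lies outside is lost, so the trace
      can only decrease.\<close>
    define E :: "('r \<times> nat) fm" where "E = one R \<star> one {..<a'}"
    have E: "dg E = E" "E * E = E" using b by (simp_all add: E_def)
    have "tr (amp \<Phi> (dg a * a)) = tr (E * (dg a * a))"
      unfolding E_def by (rule amp_trace[OF c b(1)]) (use b(3) in blast)
    also have "\<dots> = tr (E * (E * (dg a * a)))" by (simp add: E flip: mult.assoc)
    also have "\<dots> = tr (dg (a * E) * (a * E))"
      by (subst tr_commute) (simp add: E mult.assoc)
    finally show ?thesis using contractiveD_right[of E a] contractive_isometry[of E E] E by simp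
  qed
  fix a b :: "('r \<times> nat) fm" and c' e :: "('r \<times> nat) fm"
  define B where "B = unit False False \<star> a + unit False True \<star> b"
  define Z where "Z = amp (amp \<Phi>) (dg B * B)"
  have BB: "dg B * B = unit False False \<star> (dg a * a) + unit False True \<star> (dg a * b)
      + unit True False \<star> (dg b * a) + unit True True \<star> (dg b * b)"
    by (simp add: B_def algebra_simps)
  have Z: "Z = unit False False \<star> amp \<Phi> (dg a * a) + unit False True \<star> amp \<Phi> (dg a * b)
      + unit True False \<star> amp \<Phi> (dg b * a) + unit True True \<star> amp \<Phi> (dg b * b)"
    unfolding Z_def BB by (simp add: amp_tn[OF lin_amp])
  have "fpsd (amp \<Phi> (reix assoc (dg B * B)))"
    by (intro amp_fpsd[OF c] fpsd_reix inj_assoc fpsd_dgmult)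
  then have fZ: "fpsd Z" unfolding Z_def amp_amp[OF lin, symmetric] by (rule fpsd_reixD[OF inj_assoc])
  have h: "amp \<Phi> (dg b * a) = dg (amp \<Phi> (dg a * b))"
  proof (rule fm_eqI)
    fix x y
    have "ent Z (True, x) (False, y) = ent (dg Z) (True, x) (False, y)" using fpsd_dg[OF fZ] by simp
    then show "ent (amp \<Phi> (dg b * a)) x y = ent (dg (amp \<Phi> (dg a * b))) x y"
      by (simp add: Z del: dg_simps dg_mult)
  qed
  define W where "W = unit False False \<star> c' - unit True False \<star> e"
  have "dg W * Z * W = unit False False \<star> (dg c' * amp \<Phi> (dg a * a) * c' - dg c' * amp \<Phi> (dg a * b) * e
      - dg e * amp \<Phi> (dg b * a) * c' + dg e * amp \<Phi> (dg b * b) * e)"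
    by (simp add: W_def Z algebra_simps)
  then have "0 \<le> Re (tr (dg c' * amp \<Phi> (dg a * a) * c' - dg c' * amp \<Phi> (dg a * b) * e
      - dg e * amp \<Phi> (dg b * a) * c' + dg e * amp \<Phi> (dg b * b) * e))"
    using fpsd_conj_tr[OF fZ, of W] by (simp only: tr_tn tr_unit) simp
  moreover have "tr (dg e * amp \<Phi> (dg b * a) * c') = cnj (tr (dg c' * amp \<Phi> (dg a * b) * e))"
    unfolding h by (simp flip: tr_dg add: mult.assoc)
  ultimately show "2 * Re (tr (dg c' * amp \<Phi> (dg a * b) * e))
      \<le> Re (tr (dg c' * amp \<Phi> (dg a * a) * c')) + Re (tr (dg e * amp \<Phi> (dg b * b) * e))"
    by simp
qed

definition input_supported :: "nat \<Rightarrow> ('r \<times> nat) fm \<Rightarrow> bool" where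
  "input_supported n X \<longleftrightarrow> (\<forall>p q. ent X p q \<noteq> 0 \<longrightarrow> snd p < n \<and> snd q < n)"

lemma input_supported_box:
  assumes "input_supported n X"
  obtains R where "finite R" "\<And>p q. ent X p q \<noteq> 0 \<Longrightarrow> fst p \<in> R \<and> fst q \<in> R \<and> snd p \<in> {..<n} \<and> snd q \<in> {..<n}"
proof -
  obtain R S where b: "finite R" "finite S"
    "\<And>p q. ent X p q \<noteq> 0 \<Longrightarrow> fst p \<in> R \<and> fst q \<in> R \<and> snd p \<in> S \<and> snd q \<in> S" by (rule fst_box) blast
  show ?thesis by (rule that[OF b(1)]) (use b(3) assms in \<open>auto simp: input_supported_def\<close>)
qed

lemma ptr_amp:
  assumes c: "chan a' a \<Phi>" and X: "input_supported a' X" shows "ptr (amp \<Phi> X) = ptr X"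
proof -
  obtain R where b: "finite R" "\<And>p q. ent X p q \<noteq> 0 \<Longrightarrow> fst p \<in> R \<and> fst q \<in> R \<and> snd p \<in> {..<a'} \<and> snd q \<in> {..<a'}"
    by (rule input_supported_box[OF X]) blast
  show ?thesis
  proof (rule fm_box_induct[OF b])
    fix i j k l assume "k \<in> {..<a'}" "l \<in> {..<a'}"
    then have "tr (\<Phi> (unit k l)) = tr (unit k l)" using c by (simp add: chan_def)
    then show "ptr (amp \<Phi> (unit (i, k) (j, l))) = ptr (unit (i, k) (j, l))" by simp
  qed (auto intro!: linI)
qed

lemma tr_amp: "chan a' a \<Phi> \<Longrightarrow> input_supported a' X \<Longrightarrow> tr (amp \<Phi> X) = tr X"
  using ptr_amp[of a' a \<Phi> X] tr_ptr[of "amp \<Phi> X"] tr_ptr[of X] by simp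

text \<open>Only \<rho> lies in the input box, but as the left factor it confines enough of the
  product for the trace to be preserved. Uhlmann's inequality asks for this form.\<close>

lemma tr_amp_mult:
  assumes c: "chan a' a \<Phi>" and \<rho>: "input_supported a' \<rho>" shows "tr (amp \<Phi> (\<rho> * Z)) = tr (\<rho> * Z)"
proof -
  obtain R where b: "finite R" "\<And>p q. ent \<rho> p q \<noteq> 0 \<Longrightarrow> fst p \<in> R \<and> fst q \<in> R \<and> snd p \<in> {..<a'} \<and> snd q \<in> {..<a'}"
    by (rule input_supported_box[OF \<rho>]) blast
  obtain R' S where b': "finite R'" "finite S"
    "\<And>p q. ent (\<rho> * Z) p q \<noteq> 0 \<Longrightarrow> fst p \<in> R' \<and> fst q \<in> R' \<and> snd p \<in> S \<and> snd q \<in> S" by (rule fst_box) blast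
  define T where "T = R \<union> R'"
  have T: "finite T" using b b' by (simp add: T_def)
  have one: "(one T \<star> one {..<a'}) * \<rho> = \<rho>"
  proof (rule fm_box_induct[OF T, where f = "\<lambda>X. (one T \<star> one {..<a'}) * X" and g = "\<lambda>X. X" and S = "{..<a'}"])
    show "ent \<rho> p q \<noteq> 0 \<Longrightarrow> fst p \<in> T \<and> fst q \<in> T \<and> snd p \<in> {..<a'} \<and> snd q \<in> {..<a'}" for p q
      using b(2)[of p q] by (simp add: T_def)
    fix i j k l assume "i \<in> T" "k \<in> {..<a'}"
    then show "(one T \<star> one {..<a'}) * unit (i, k) (j, l) = unit (i, k) (j, l)"
      using T by (simp flip: tn_unit)
  qed (auto intro!: linI simp: distrib_left)
  have "tr (amp \<Phi> (\<rho> * Z)) = tr ((one T \<star> one {..<a'}) * (\<rho> * Z))"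
    by (rule amp_trace[OF c T]) (use b'(3) in \<open>force simp: T_def\<close>)
  then show ?thesis by (simp add: one flip: mult.assoc)
qed

subsection \<open>Domination by the decoupled state\<close>

lemma cmod_tr_cauchy_schwarz:
  "2 * cmod (tr (dg A * B)) \<le> Re (tr (dg A * A)) + Re (tr (dg B * B))"
proof (cases "tr (dg A * B) = 0")
  case True
  then show ?thesis using tr_dg_mult_nonneg(1)[of A] tr_dg_mult_nonneg(1)[of B] by simp
next
  case False
  define w where "w = tr (dg A * B)"
  define \<zeta> where "\<zeta> = cnj w / complex_of_real (cmod w)"
  have w: "w \<noteq> 0" using False by (simp add: w_def)
  have z1: "cnj \<zeta> * \<zeta> = 1"
    using w by (simp add: \<zeta>_def complex_norm_square[symmetric] power2_eq_square field_simps)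
  have zw: "\<zeta> * w = complex_of_real (cmod w)"
    using w by (simp add: \<zeta>_def field_simps complex_norm_square[symmetric] power2_eq_square)
  have "2 * Re (tr (dg A * (\<zeta> *\<^sub>c B))) \<le> Re (tr (dg A * A)) + Re (tr (dg (\<zeta> *\<^sub>c B) * (\<zeta> *\<^sub>c B)))"
    by (rule tr_cauchy_schwarz)
  also have "tr (dg A * (\<zeta> *\<^sub>c B)) = \<zeta> * w" by (simp add: w_def)
  also have "dg (\<zeta> *\<^sub>c B) * (\<zeta> *\<^sub>c B) = dg B * B" by (simp add: cs_cs z1 mult.commute[of \<zeta>])
  finally have "2 * cmod w \<le> Re (tr (dg A * A)) + Re (tr (dg B * B))" unfolding zw by simp
  then show ?thesis by (simp add: w_def)
qed

text \<open>Expanded in matrix units, the output is a sum of terms V* \<psi> V' with coefficients of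
  modulus at most \<epsilon>. Cauchy-Schwarz replaces each mixed term by half the sum of two
  diagonal ones, each diagonal term arises a' a times from either side, and the diagonal terms add
  up to \<open>ptr \<psi> \<star> one {..<a}\<close>. Only Hermiticity of the output is assumed, so
  differences of channels are covered.\<close>

lemma amp_dominated:
  assumes lin: "lin \<Phi>" and out: "\<And>X. one {..<a} * \<Phi> X = \<Phi> X" "\<And>X. \<Phi> X * one {..<a} = \<Phi> X"
    and \<psi>: "fpsd \<psi>" "input_supported a' \<psi>" and h: "dg (amp \<Phi> \<psi>) = amp \<Phi> \<psi>"
    and \<epsilon>: "\<And>m n k l. m < a' \<Longrightarrow> n < a' \<Longrightarrow> k < a \<Longrightarrow> l < a \<Longrightarrow> cmod (ent (\<Phi> (unit m n)) k l) \<le> \<epsilon>"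
  shows "fpsd ((\<epsilon> * real (a' * a)) *\<^sub>r (ptr \<psi> \<star> one {..<a}) - amp \<Phi> \<psi>)"
proof -
  obtain R where b: "finite R" "\<And>p q. ent \<psi> p q \<noteq> 0 \<Longrightarrow> fst p \<in> R \<and> fst q \<in> R \<and> snd p \<in> {..<a'} \<and> snd q \<in> {..<a'}"
    by (rule input_supported_box[OF \<psi>(2)]) blast
  obtain G where G: "\<psi> = dg G * G" using fpsd_sqrt[OF \<psi>(1)] by blast
  \<comment> \<open>Between \<open>dg (V m k)\<close> and \<open>V n l\<close>, block (m, n) of the
    input is selected and placed at entry (k, l) of the output.\<close>
  define V where "V n l = one R \<star> unit n l" for n l :: nat
  define f where "f m n k l = ent (\<Phi> (unit m n)) k l" for m n k l
  have dV: "dg (V n l) = one R \<star> unit l n" for n l by (simp add: V_def)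
  have exp: "\<Phi> (unit i j) = (\<Sum>k<a. \<Sum>l<a. f i j k l *\<^sub>c unit k l)" for i j
  proof (rule fm_eqI)
    fix x y
    have o: "ent (\<Phi> (unit i j)) x y = (if x < a \<and> y < a then ent (\<Phi> (unit i j)) x y else 0)"
      using ent_one_mult[of "{..<a}" "\<Phi> (unit i j)" x y] ent_mult_one[of "{..<a}" "\<Phi> (unit i j)" x y] out
      by (auto split: if_splits)
    have "ent (\<Sum>k<a. \<Sum>l<a. f i j k l *\<^sub>c unit k l) x y
        = (\<Sum>k<a. if x = k then (\<Sum>l<a. if y = l then f i j k l else 0) else 0)"
    proof -
      have "(\<Sum>l<a. f i j k l * (if x = k \<and> y = l then 1 else 0))
          = (if x = k then (\<Sum>l<a. if y = l then f i j k l else 0) else 0)" for k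
      proof -
        have "f i j k l * (if x = k \<and> y = l then 1 else 0) = (if x = k then if y = l then f i j k l else 0 else 0)" for l
          by simp
        then show ?thesis by (cases "x = k") (simp_all only: simp_thms if_True if_False sum.neutral_const)
      qed
      then show ?thesis by simp
    qed
    also have "\<dots> = (if x < a \<and> y < a then f i j x y else 0)" by simp
    finally have e: "ent (\<Sum>k<a. \<Sum>l<a. f i j k l *\<^sub>c unit k l) x y
        = (if x < a \<and> y < a then f i j x y else 0)" .
    show "ent (\<Phi> (unit i j)) x y = ent (\<Sum>k<a. \<Sum>l<a. f i j k l *\<^sub>c unit k l) x y"
      unfolding e using o unfolding f_def .
  qed
  have e1: "amp \<Phi> \<psi> = (\<Sum>m<a'. \<Sum>n<a'. \<Sum>k<a. \<Sum>l<a. f m n k l *\<^sub>c (dg (V m k) * \<psi> * V n l))"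
  proof (rule fm_box_induct[OF b, where f = "amp \<Phi>"])
    fix i j k l assume ij: "i \<in> R" "j \<in> R" "k \<in> {..<a'}" "l \<in> {..<a'}"
    have t: "dg (V m x) * unit (i, k) (j, l) * V n y = (if m = k \<and> n = l then unit i j \<star> unit x y else 0)" for m n x y
      using ij b(1) by (simp add: dV V_def flip: tn_unit)
    have "(\<Sum>m<a'. \<Sum>n<a'. \<Sum>x<a. \<Sum>y<a. f m n x y *\<^sub>c (dg (V m x) * unit (i, k) (j, l) * V n y))
        = (\<Sum>m<a'. if m = k then (\<Sum>n<a'. if n = l then (\<Sum>x<a. \<Sum>y<a. f k l x y *\<^sub>c (unit i j \<star> unit x y)) else 0) else 0)"
    proof -
      have "(\<Sum>x<a. \<Sum>y<a. f m n x y *\<^sub>c (if m = k \<and> n = l then unit i j \<star> unit x y else 0))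
          = (if m = k then if n = l then (\<Sum>x<a. \<Sum>y<a. f k l x y *\<^sub>c (unit i j \<star> unit x y)) else 0 else 0)" for m n
        by (cases "m = k \<and> n = l") auto
      moreover have "(\<Sum>n<a'. if m = k then g n else 0) = (if m = k then \<Sum>n<a'. g n else 0)"
        for m and g :: "nat \<Rightarrow> ('a \<times> nat) fm" by simp
      ultimately show ?thesis unfolding t by (simp only:)
    qed
    also have "\<dots> = (\<Sum>x<a. \<Sum>y<a. f k l x y *\<^sub>c (unit i j \<star> unit x y))" using ij by simp
    also have "\<dots> = amp \<Phi> (unit (i, k) (j, l))" by (simp add: exp[of k l] del: tn_unit)
    finally show "amp \<Phi> (unit (i, k) (j, l))
        = (\<Sum>m<a'. \<Sum>n<a'. \<Sum>x<a. \<Sum>y<a. f m n x y *\<^sub>c (dg (V m x) * unit (i, k) (j, l) * V n y))" ..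
  qed (auto intro!: linI simp: distrib_left distrib_right sum.distrib cs_add_right cs_sum_right cs_cs mult.commute)
  have e2: "ptr \<psi> \<star> one {..<a} = (\<Sum>n<a'. \<Sum>l<a. dg (V n l) * \<psi> * V n l)"
  proof (rule fm_box_induct[OF b, where f = "\<lambda>X. ptr X \<star> one {..<a}"])
    fix i j k l assume ij: "i \<in> R" "j \<in> R" "k \<in> {..<a'}" "l \<in> {..<a'}"
    have t: "dg (V n y) * unit (i, k) (j, l) * V n y = (if n = k then (if k = l then unit i j \<star> unit y y else 0) else 0)" for n y
      using ij b(1) by (simp add: dV V_def flip: tn_unit)
    have "(\<Sum>n<a'. \<Sum>y<a. dg (V n y) * unit (i, k) (j, l) * V n y)
        = (\<Sum>n<a'. if n = k then (if k = l then unit i j \<star> one {..<a} else 0) else 0)"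
      unfolding t by (intro sum.cong refl) (auto simp: one_def)
    then show "ptr (unit (i, k) (j, l)) \<star> one {..<a} = (\<Sum>n<a'. \<Sum>y<a. dg (V n y) * unit (i, k) (j, l) * V n y)"
      using ij by simp
  qed (auto intro!: linI simp: distrib_left distrib_right sum.distrib cs_sum_right)
  have "Re (tr (dg B * amp \<Phi> \<psi> * B)) \<le> \<epsilon> * real (a' * a) * Re (tr (dg B * (ptr \<psi> \<star> one {..<a}) * B))" for B
  proof -
    define q where "q n l = Re (tr (dg (G * V n l * B) * (G * V n l * B)))" for n l
    define t where "t m n k l = tr (dg (G * V m k * B) * (G * V n l * B))" for m n k l
    have "tr (dg B * amp \<Phi> \<psi> * B) = (\<Sum>m<a'. \<Sum>n<a'. \<Sum>k<a. \<Sum>l<a. f m n k l * t m n k l)"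
      unfolding e1 by (simp add: G t_def sum_distrib_left sum_distrib_right mult.assoc)
    then have "Re (tr (dg B * amp \<Phi> \<psi> * B)) \<le> cmod (\<Sum>m<a'. \<Sum>n<a'. \<Sum>k<a. \<Sum>l<a. f m n k l * t m n k l)"
      by (metis complex_Re_le_cmod)
    also have "\<dots> \<le> (\<Sum>m<a'. \<Sum>n<a'. \<Sum>k<a. \<Sum>l<a. cmod (f m n k l * t m n k l))"
      by (intro order_trans[OF norm_sum] sum_mono order_refl)
    also have "\<dots> \<le> (\<Sum>m<a'. \<Sum>n<a'. \<Sum>k<a. \<Sum>l<a. \<epsilon> * ((q m k + q n l) / 2))"
    proof (intro sum_mono)
      fix m n k l assume "m \<in> {..<a'}" "n \<in> {..<a'}" "k \<in> {..<a}" "l \<in> {..<a}"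
      then have f: "cmod (f m n k l) \<le> \<epsilon>" using \<epsilon> by (simp add: f_def)
      have "cmod (t m n k l) \<le> (q m k + q n l) / 2"
        unfolding t_def q_def using cmod_tr_cauchy_schwarz[of "G * V m k * B" "G * V n l * B"] by simp
      then show "cmod (f m n k l * t m n k l) \<le> \<epsilon> * ((q m k + q n l) / 2)"
        unfolding norm_mult using f order_trans[OF norm_ge_zero f] by (intro mult_mono) auto
    qed
    also have "\<dots> = \<epsilon> / 2 * (\<Sum>m<a'. \<Sum>n<a'. \<Sum>k<a. \<Sum>l<a. q m k) + \<epsilon> / 2 * (\<Sum>m<a'. \<Sum>n<a'. \<Sum>k<a. \<Sum>l<a. q n l)"
      by (simp add: sum_distrib_left sum.distrib algebra_simps add_divide_distrib)
    also have "(\<Sum>m<a'. \<Sum>n<a'. \<Sum>k<a. \<Sum>l<a. q n l) = real (a' * a) * (\<Sum>n<a'. \<Sum>l<a. q n l)"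
      by (simp add: sum_distrib_left mult.assoc)
    also have "(\<Sum>m<a'. \<Sum>n<a'. \<Sum>k<a. \<Sum>l<a. q m k) = real (a' * a) * (\<Sum>n<a'. \<Sum>l<a. q n l)"
      by (simp add: sum_distrib_left mult.assoc)
    finally have "Re (tr (dg B * amp \<Phi> \<psi> * B)) \<le> \<epsilon> * real (a' * a) * (\<Sum>n<a'. \<Sum>l<a. q n l)"
      by (simp add: algebra_simps)
    also have "(\<Sum>n<a'. \<Sum>l<a. q n l) = Re (tr (dg B * (ptr \<psi> \<star> one {..<a}) * B))"
      unfolding e2 by (simp add: G q_def sum_distrib_left sum_distrib_right mult.assoc)
    finally show ?thesis .
  qed
  then show ?thesis using h fpsd_dg[OF \<psi>(1)] by (simp add: fpsd_def algebra_simps)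
qed

section \<open>Divergence from the thermal channel\<close>

definition input_state :: "nat \<Rightarrow> ('r \<times> nat) fm \<Rightarrow> bool" where
  "input_state n \<psi> \<longleftrightarrow> fpsd \<psi> \<and> tr \<psi> = 1 \<and> input_supported n \<psi>"

text \<open>The lower bound c turns domination by \<psi>_R \<star> one into domination by \<psi>_R
  \<star> \<gamma>.\<close>

definition faithful_state :: "nat \<Rightarrow> nat fm \<Rightarrow> bool" where
  "faithful_state a \<gamma> \<longleftrightarrow> fpsd \<gamma> \<and> tr \<gamma> = 1 \<and> sp \<gamma> = one {..<a} \<and> (\<exists>c>0. fpsd (\<gamma> - c *\<^sub>r one {..<a}))"

lemma input_stateD: "input_state n \<psi> \<Longrightarrow> fpsd \<psi>" "input_state n \<psi> \<Longrightarrow> tr \<psi> = 1" "input_state n \<psi> \<Longrightarrow> input_supported n \<psi>"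
  by (simp_all add: input_state_def)

lemma faithful_stateD: "faithful_state a \<gamma> \<Longrightarrow> fpsd \<gamma>" "faithful_state a \<gamma> \<Longrightarrow> tr \<gamma> = 1" "faithful_state a \<gamma> \<Longrightarrow> sp \<gamma> = one {..<a}"
  by (simp_all add: faithful_state_def)

definition sandwiched_div :: "real \<Rightarrow> 'i fm \<Rightarrow> 'i fm \<Rightarrow> real" where
  "sandwiched_div p \<rho> \<sigma> = ln (sandwich_norm p \<rho> \<sigma>) / p"

lemma input_supported_add: "input_supported n X \<Longrightarrow> input_supported n Y \<Longrightarrow> input_supported n (X + Y)"
  unfolding input_supported_def by (metis add.left_neutral ent_simps(2))

lemma input_supported_cs: "input_supported n X \<Longrightarrow> input_supported n (c *\<^sub>c X)"
  unfolding input_supported_def by auto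

lemma input_supported_iff: "input_supported n X \<longleftrightarrow> (\<forall>p q. \<not> (snd p < n \<and> snd q < n) \<longrightarrow> ent X p q = 0)"
  by (auto simp: input_supported_def)

lemma input_supported_amp:
  assumes c: "chan a' a \<Phi>" shows "input_supported a (amp \<Phi> X)"
proof (induct X rule: fm_induct_prod)
  case (unit c i k j l)
  have "ent (\<Phi> (unit k l)) x y = 0" if "\<not> (x < a \<and> y < a)" for x y
    using ent_one_mult[of "{..<a}" "\<Phi> (unit k l)" x y] ent_mult_one[of "{..<a}" "\<Phi> (unit k l)" x y] that
      assms by (auto simp: chan_def split: if_splits)
  then show ?case by (auto simp: input_supported_iff)
next
  case (add A B)
  then show ?case by (simp add: input_supported_add)
qed (simp add: input_supported_def)

lemma fpsd_one [simp]: "finite S \<Longrightarrow> fpsd (one S)"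
  by (rule fpsd_proj) simp_all

lemma fpsd_tn_diff: "fpsd A \<Longrightarrow> fpsd (C - B) \<Longrightarrow> fpsd (A \<star> C - A \<star> B)"
  by (metis fpsd_tn lin_diff lin_tn_right)

lemma thermal_dominates:
  assumes \<gamma>: "fpsd (\<gamma> - c *\<^sub>r one {..<a})" "0 < c" and A: "fpsd A" and \<epsilon>: "0 \<le> \<epsilon>"
    and X: "fpsd (\<epsilon> *\<^sub>r (A \<star> one {..<a}) - X)"
  shows "fpsd ((\<epsilon> / c) *\<^sub>r (A \<star> \<gamma>) - X)"
proof -
  have "fpsd ((\<epsilon> / c) *\<^sub>r (A \<star> \<gamma> - A \<star> (c *\<^sub>r one {..<a})))"
    using \<epsilon> \<gamma> by (intro fpsd_cs fpsd_tn_diff A) simp_all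
  from fpsd_add[OF this X] show ?thesis using \<gamma>(2) by (simp add: cs_diff_right cs_cs)
qed

text \<open>The constant does not depend on the input, which is what makes the suprema finite. The
  sum of the moduli of all entries is a crude but uniform choice of \<epsilon>.\<close>

lemma chan_dominated:
  fixes N M :: "nat fm \<Rightarrow> nat fm"
  assumes N: "chan a' a N" and \<gamma>: "faithful_state a \<gamma>"
  obtains C where "0 < C" "\<And>\<psi> :: ('r::countable \<times> nat) fm. input_state a' \<psi> \<Longrightarrow> fpsd (C *\<^sub>r (ptr \<psi> \<star> \<gamma>) - amp N \<psi>)"
proof -
  obtain c where c: "0 < c" "fpsd (\<gamma> - c *\<^sub>r one {..<a})" using \<gamma> by (auto simp: faithful_state_def)
  define \<epsilon> where "\<epsilon> = (\<Sum>m<a'. \<Sum>n<a'. \<Sum>k<a. \<Sum>l<a. cmod (ent (N (unit m n)) k l))"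
  have e: "cmod (ent (N (unit m n)) k l) \<le> \<epsilon>" if "m < a'" "n < a'" "k < a" "l < a" for m n k l
  proof -
    have "cmod (ent (N (unit m n)) k l) \<le> (\<Sum>l<a. cmod (ent (N (unit m n)) k l))"
      using that by (intro member_le_sum) auto
    also have "\<dots> \<le> (\<Sum>k<a. \<Sum>l<a. cmod (ent (N (unit m n)) k l))"
      using that by (intro member_le_sum[of k "{..<a}" "\<lambda>k. \<Sum>l<a. cmod (ent (N (unit m n)) k l)"]) (auto intro!: sum_nonneg)
    also have "\<dots> \<le> (\<Sum>n<a'. \<Sum>k<a. \<Sum>l<a. cmod (ent (N (unit m n)) k l))"
      using that by (intro member_le_sum[of n "{..<a'}" "\<lambda>n. \<Sum>k<a. \<Sum>l<a. cmod (ent (N (unit m n)) k l)"]) (auto intro!: sum_nonneg)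
    also have "\<dots> \<le> \<epsilon>" unfolding \<epsilon>_def
      using that by (intro member_le_sum[of m "{..<a'}" "\<lambda>m. \<Sum>n<a'. \<Sum>k<a. \<Sum>l<a. cmod (ent (N (unit m n)) k l)"]) (auto intro!: sum_nonneg)
    finally show ?thesis .
  qed
  have e0: "0 \<le> \<epsilon>" unfolding \<epsilon>_def by (intro sum_nonneg) simp
  define C where "C = \<epsilon> * real (a' * a) / c"
  have C0: "0 \<le> C" unfolding C_def using e0 c by simp
  have "fpsd ((C + 1) *\<^sub>r (ptr \<psi> \<star> \<gamma>) - amp N \<psi>)" if "input_state a' \<psi>" for \<psi> :: "('r \<times> nat) fm"
  proof -
    have ps: "fpsd (ptr \<psi>)" using that by (simp add: fpsd_ptr input_stateD)
    have "fpsd ((\<epsilon> * real (a' * a)) *\<^sub>r (ptr \<psi> \<star> one {..<a}) - amp N \<psi>)"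
      using N that e amp_fpsd[OF N, of \<psi>] by (intro amp_dominated) (auto simp: chan_def input_stateD fpsd_dg)
    then have "fpsd (C *\<^sub>r (ptr \<psi> \<star> \<gamma>) - amp N \<psi>)"
      unfolding C_def using c e0 ps by (intro thermal_dominates) simp_all
    \<comment> \<open>One more copy of the dominating state makes the constant strictly
      positive.\<close>
    from fpsd_add[OF this fpsd_tn[OF ps faithful_stateD(1)[OF \<gamma>]]] show ?thesis by (simp add: cs_add_left algebra_simps)
  qed
  then show ?thesis using that[of "C + 1"] C0 by simp
qed

lemma chan_state:
  fixes \<psi> :: "('r::countable \<times> nat) fm"
  assumes N: "chan a' a N" and \<gamma>: "faithful_state a \<gamma>" and \<psi>: "input_state a' \<psi>"
  shows "fpsd (amp N \<psi>)" "tr (amp N \<psi>) = 1" "fpsd (ptr \<psi> \<star> \<gamma>)" "tr (ptr \<psi> \<star> \<gamma>) = 1"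
    "sp (ptr \<psi> \<star> \<gamma>) * amp N \<psi> = amp N \<psi>"
proof -
  show 1: "fpsd (amp N \<psi>)" using amp_fpsd[OF N, of \<psi>] \<psi> by (simp add: input_state_def)
  show "tr (amp N \<psi>) = 1" using tr_amp[OF N, of \<psi>] \<psi> by (simp add: input_state_def)
  show 2: "fpsd (ptr \<psi> \<star> \<gamma>)" using \<psi> \<gamma> by (simp add: fpsd_tn fpsd_ptr input_state_def faithful_state_def)
  show "tr (ptr \<psi> \<star> \<gamma>) = 1" using \<psi> \<gamma> by (simp add: input_state_def faithful_state_def)
  obtain C where "\<And>\<psi> :: ('r \<times> nat) fm. input_state a' \<psi> \<Longrightarrow> fpsd (C *\<^sub>r (ptr \<psi> \<star> \<gamma>) - amp N \<psi>)"
    using chan_dominated[OF N \<gamma>] by blast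
  then show "sp (ptr \<psi> \<star> \<gamma>) * amp N \<psi> = amp N \<psi>"
    using sp_mult_dominated[OF 1 2] \<psi> by blast
qed

lemma umegaki_div_nonneg:
  assumes "fpsd \<rho>" "tr \<rho> = 1" "fpsd \<sigma>" "tr \<sigma> = 1" "sp \<sigma> * \<rho> = \<rho>"
  shows "0 \<le> umegaki_div \<rho> \<sigma>" "umegaki_div \<rho> \<sigma> = 0 \<longleftrightarrow> \<rho> = \<sigma>"
  using klein[of \<rho> \<sigma>] assms by (auto simp: umegaki_div_def)

lemma sandwiched_div_nonneg:
  assumes "fpsd \<rho>" "tr \<rho> = 1" "fpsd \<sigma>" "tr \<sigma> = 1" "sp \<sigma> * \<rho> = \<rho>" and p: "0 < p" "p < 1"
  shows "0 \<le> sandwiched_div p \<rho> \<sigma>" "sandwiched_div p \<rho> \<sigma> = 0 \<longleftrightarrow> \<rho> = \<sigma>"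
proof -
  have s: "1 \<le> sandwich_norm p \<rho> \<sigma>" "sandwich_norm p \<rho> \<sigma> = 1 \<longleftrightarrow> \<rho> = \<sigma>" using sandwich_norm_ge_1[of \<rho> \<sigma> p] assms by auto
  show "0 \<le> sandwiched_div p \<rho> \<sigma>" using s(1) p by (simp add: sandwiched_div_def)
  have "ln (sandwich_norm p \<rho> \<sigma>) = 0 \<longleftrightarrow> sandwich_norm p \<rho> \<sigma> = 1" using s(1) by simp
  then show "sandwiched_div p \<rho> \<sigma> = 0 \<longleftrightarrow> \<rho> = \<sigma>" using s(2) p by (simp add: sandwiched_div_def)
qed

section \<open>Continuity, boundedness and convexity of the state divergences\<close>

lemma sandwich_norm_self: "fpsd \<sigma> \<Longrightarrow> tr \<sigma> = 1 \<Longrightarrow> 0 < p \<Longrightarrow> p < 1 \<Longrightarrow> sandwich_norm p \<sigma> \<sigma> = 1"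
  using sandwich_norm_ge_1(2)[of \<sigma> \<sigma> p] by simp

text \<open>Monotonicity and the triangle inequality for the sandwiched matrices; the perturbation
  contributes exactly \<delta> because the norm of \<sigma> relative to itself is 1.\<close>

lemma sandwich_norm_add_le:
  assumes p: "0 < p" "p < 1" and \<rho>: "fpsd \<rho>" and \<eta>: "fpsd \<eta>" and \<sigma>: "fpsd \<sigma>" "tr \<sigma> = 1" and d: "0 \<le> \<delta>"
    and le: "fpsd (\<eta> + \<delta> *\<^sub>r \<sigma> - \<rho>)"
  shows "sandwich_norm p \<rho> \<sigma> \<le> sandwich_norm p \<eta> \<sigma> + \<delta>"
proof -
  define S where "S X = pw \<sigma> (- complex_of_real (p / 2)) * X * pw \<sigma> (- complex_of_real (p / 2))" for X
  have S: "fpsd (S X)" if "fpsd X" for X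
    unfolding S_def using fpsd_sandwich[OF that \<sigma>(1), of "- (p / 2)"] by simp
  have "S (\<eta> + \<delta> *\<^sub>r \<sigma> - \<rho>) = S \<eta> + \<delta> *\<^sub>r S \<sigma> - S \<rho>"
    by (simp add: S_def algebra_simps)
  then have "schatten p (S \<rho>) \<le> schatten p (S \<eta> + \<delta> *\<^sub>r S \<sigma>)"
    using S[OF le] by (intro schatten_mono p S \<rho> fpsd_add fpsd_cs \<eta> \<sigma> d) simp
  also have "\<dots> \<le> schatten p (S \<eta>) + schatten p (\<delta> *\<^sub>r S \<sigma>)"
    by (intro schatten_triangle p S fpsd_cs \<eta> \<sigma> d)
  also have "\<dots> = sandwich_norm p \<eta> \<sigma> + \<delta> * sandwich_norm p \<sigma> \<sigma>"
    using schatten_scale[OF p S[OF \<sigma>(1)] d] by (simp add: sandwich_norm_def S_def)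
  finally show ?thesis using sandwich_norm_self[OF \<sigma> p] by (simp add: sandwich_norm_def S_def)
qed

text \<open>The norm Q of \<eta> is at least 1, hence ln (Q + \<delta>) <= ln Q + \<delta>.\<close>

lemma sandwiched_div_continuity:
  assumes p: "0 < p" "p < 1" and \<rho>: "fpsd \<rho>" "tr \<rho> = 1" "sp \<sigma> * \<rho> = \<rho>" and \<eta>: "fpsd \<eta>" "tr \<eta> = 1" "sp \<sigma> * \<eta> = \<eta>"
    and \<sigma>: "fpsd \<sigma>" "tr \<sigma> = 1" and d: "0 \<le> \<delta>"
    and le: "fpsd (\<eta> + \<delta> *\<^sub>r \<sigma> - \<rho>)"
  shows "sandwiched_div p \<rho> \<sigma> \<le> sandwiched_div p \<eta> \<sigma> + \<delta> / p"
proof -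
  have 1: "1 \<le> sandwich_norm p \<rho> \<sigma>" "1 \<le> sandwich_norm p \<eta> \<sigma>" using sandwich_norm_ge_1(1) \<rho> \<eta> \<sigma> p by blast+
  have "ln (sandwich_norm p \<rho> \<sigma>) \<le> ln (sandwich_norm p \<eta> \<sigma> + \<delta>)"
    using sandwich_norm_add_le[OF p \<rho>(1) \<eta>(1) \<sigma> d le] 1 by simp
  also have "sandwich_norm p \<eta> \<sigma> + \<delta> = sandwich_norm p \<eta> \<sigma> * (1 + \<delta> / sandwich_norm p \<eta> \<sigma>)" using 1 by (simp add: field_simps)
  also have "ln \<dots> = ln (sandwich_norm p \<eta> \<sigma>) + ln (1 + \<delta> / sandwich_norm p \<eta> \<sigma>)" using 1 d by (intro ln_mult_pos) (auto intro: add_pos_nonneg)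
  also have "ln (1 + \<delta> / sandwich_norm p \<eta> \<sigma>) \<le> \<delta> / sandwich_norm p \<eta> \<sigma>" using 1 d by (intro ln_add_one_self_le_self) simp
  also have "\<delta> / sandwich_norm p \<eta> \<sigma> \<le> \<delta>" using 1 d by (simp add: divide_le_eq mult_left_mono mult_le_cancel_left1)
  finally show ?thesis using p by (simp add: sandwiched_div_def divide_right_mono flip: add_divide_distrib)
qed

lemma fpsd_tr_eq_Re: "fpsd A \<Longrightarrow> tr A = complex_of_real (Re (tr A))"
  by (simp add: of_real_Re_tr fpsd_dg)

text \<open>Klein's inequality is applied against t \<sigma>, which has the trace of \<rho>;
  rescaling the second argument contributes the term t ln t.\<close>

lemma klein_scaled:
  assumes \<rho>: "fpsd \<rho>" and \<sigma>: "fpsd \<sigma>" "tr \<sigma> = 1" and sub: "sp \<sigma> * \<rho> = \<rho>" and t: "0 < t" "Re (tr \<rho>) = t"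
  shows "t * ln t \<le> umegaki_div \<rho> \<sigma>"
proof -
  have s: "fpsd (t *\<^sub>r \<sigma>)" using t \<sigma> by (simp add: fpsd_cs)
  have "sp (t *\<^sub>r \<sigma>) = sp \<sigma>" using pw_scale[OF \<sigma>(1) t(1), of 0] by simp
  then have "Re (tr \<rho>) - Re (tr (t *\<^sub>r \<sigma>)) \<le> umegaki_div \<rho> (t *\<^sub>r \<sigma>)"
    using klein[OF \<rho> s] sub by simp
  moreover have "\<rho> * sp \<sigma> = \<rho>" using arg_cong[OF sub, of dg] \<rho> \<sigma> by (simp add: fpsd_dg)
  then have "umegaki_div \<rho> (t *\<^sub>r \<sigma>) = umegaki_div \<rho> \<sigma> - ln t * t"
    using t by (simp add: umegaki_div_def lg_scale \<sigma> algebra_simps)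
  ultimately show ?thesis using t \<sigma> by (simp add: mult.commute)
qed

lemma umegaki_div_bounded:
  assumes \<rho>: "fpsd \<rho>" "tr \<rho> = 1" and \<sigma>: "fpsd \<sigma>" and sub: "sp \<sigma> * \<rho> = \<rho>" and C: "0 < C"
    and le: "fpsd (C *\<^sub>r \<sigma> - \<rho>)"
  shows "umegaki_div \<rho> \<sigma> \<le> ln C"
proof -
  have "\<rho> * sp \<sigma> = \<rho>" using arg_cong[OF sub, of dg] \<rho> \<sigma> by (simp add: fpsd_dg)
  moreover have "Re (tr (\<rho> * lg \<rho>)) \<le> Re (tr (\<rho> * lg (C *\<^sub>r \<sigma>)))"
    using C by (intro tr_log_mono \<rho> fpsd_cs \<sigma> le) simp
  ultimately show ?thesis using \<rho> C by (simp add: umegaki_div_def lg_scale \<sigma> algebra_simps)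
qed

lemma sandwiched_div_bounded:
  assumes p: "0 < p" "p < 1" and \<rho>: "fpsd \<rho>" "tr \<rho> = 1" and \<sigma>: "fpsd \<sigma>" "tr \<sigma> = 1" and sub: "sp \<sigma> * \<rho> = \<rho>"
    and C: "0 < C" and le: "fpsd (C *\<^sub>r \<sigma> - \<rho>)"
  shows "sandwiched_div p \<rho> \<sigma> \<le> ln C / p"
proof -
  have "sandwich_norm p \<rho> \<sigma> \<le> sandwich_norm p 0 \<sigma> + C" using le C by (intro sandwich_norm_add_le p \<rho> \<sigma>) simp_all
  also have "sandwich_norm p 0 \<sigma> = 0" by (simp add: sandwich_norm_def)
  finally have "sandwich_norm p \<rho> \<sigma> \<le> C" by simp
  moreover have "1 \<le> sandwich_norm p \<rho> \<sigma>" using sandwich_norm_ge_1(1) \<rho> \<sigma> sub p by blast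
  ultimately show ?thesis using p C by (simp add: sandwiched_div_def divide_right_mono)
qed

text \<open>With \<open>C = \<eta> + \<delta>\<sigma>\<close> and \<open>B = C - \<rho>\<close>, monotonicity of the trace logarithm gives
  \<open>tr \<rho> log \<rho> + tr B log B \<le> tr C log C\<close>; Klein's inequality bounds the other terms.\<close>
lemma umegaki_div_continuity:
  assumes \<rho>: "fpsd \<rho>" "tr \<rho> = 1" "sp \<sigma> * \<rho> = \<rho>" and \<eta>: "fpsd \<eta>" "tr \<eta> = 1" "sp \<sigma> * \<eta> = \<eta>"
    and \<sigma>: "fpsd \<sigma>" "tr \<sigma> = 1" and d: "0 < \<delta>"
    and le: "fpsd (\<eta> + \<delta> *\<^sub>r \<sigma> - \<rho>)"
  shows "umegaki_div \<rho> \<sigma> \<le> umegaki_div \<eta> \<sigma> + (\<delta> + \<delta>\<^sup>2 - \<delta> * ln \<delta>)"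
proof -
  define C where "C = \<eta> + \<delta> *\<^sub>r \<sigma>"
  define B where "B = C - \<rho>"
  have C: "fpsd C" unfolding C_def using d by (intro fpsd_add fpsd_cs \<eta> \<sigma>) simp
  have B: "fpsd B" using le by (simp add: B_def C_def)
  have trB: "Re (tr B) = \<delta>" and trC: "Re (tr C) = 1 + \<delta>" by (simp_all add: B_def C_def \<eta> \<sigma> \<rho>)
  have spB: "sp \<sigma> * B = B" by (simp add: B_def C_def algebra_simps \<rho> \<eta> \<sigma>)
  have eC: "fpsd (C - \<eta>)" using d by (simp add: C_def fpsd_cs \<sigma>)
  have sC: "fpsd ((1 / \<delta>) *\<^sub>r C - \<sigma>)"
    using fpsd_cs[OF \<eta>(1), of "1 / \<delta>"] d by (simp add: C_def cs_add_right cs_cs)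
  have s1: "sp C * \<eta> = \<eta>" by (rule sp_mult_dominated[of _ _ 1]) (use \<eta> C eC in simp_all)
  have s2: "sp C * \<sigma> = \<sigma>" by (rule sp_mult_dominated[OF \<sigma>(1) C sC])
  have "Re (tr (\<rho> * lg \<rho>)) \<le> Re (tr (\<rho> * lg C))"
    by (intro tr_log_mono \<rho> C) (use B in \<open>simp add: B_def\<close>)
  moreover have "Re (tr (B * lg B)) \<le> Re (tr (B * lg C))"
    by (intro tr_log_mono B C) (use \<rho> in \<open>simp add: B_def\<close>)
  moreover have "tr (\<rho> * lg C) + tr (B * lg C) = tr (\<eta> * lg C) + complex_of_real \<delta> * tr (\<sigma> * lg C)"
    by (simp add: B_def C_def algebra_simps)
  then have "Re (tr (\<rho> * lg C)) + Re (tr (B * lg C)) = Re (tr (\<eta> * lg C)) + \<delta> * Re (tr (\<sigma> * lg C))"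
    by (simp add: complex_eq_iff)
  moreover have "Re (tr (\<eta> * lg C)) \<le> Re (tr (\<eta> * lg \<eta>)) + \<delta>"
    using klein[OF \<eta>(1) C s1] by (simp add: umegaki_div_def right_diff_distrib trC \<eta>)
  moreover have "Re (tr (\<sigma> * lg C)) \<le> Re (tr (\<sigma> * lg \<sigma>)) + \<delta>"
    using klein[OF \<sigma>(1) C s2] by (simp add: umegaki_div_def right_diff_distrib trC \<sigma>)
  then have "\<delta> * Re (tr (\<sigma> * lg C)) \<le> \<delta> * Re (tr (\<sigma> * lg \<sigma>)) + \<delta>\<^sup>2"
    using d by (simp add: power2_eq_square distrib_left[symmetric])
  moreover have "\<delta> * ln \<delta> \<le> umegaki_div B \<sigma>" by (rule klein_scaled[OF B \<sigma> spB d trB])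
  then have "\<delta> * ln \<delta> \<le> Re (tr (B * lg B)) - Re (tr (B * lg \<sigma>))" by (simp add: umegaki_div_def right_diff_distrib)
  moreover have "tr (\<rho> * lg \<sigma>) + tr (B * lg \<sigma>) = tr (\<eta> * lg \<sigma>) + complex_of_real \<delta> * tr (\<sigma> * lg \<sigma>)"
    by (simp add: B_def C_def algebra_simps)
  then have "Re (tr (\<rho> * lg \<sigma>)) + Re (tr (B * lg \<sigma>)) = Re (tr (\<eta> * lg \<sigma>)) + \<delta> * Re (tr (\<sigma> * lg \<sigma>))"
    by (simp add: complex_eq_iff)
  ultimately show ?thesis by (simp add: umegaki_div_def right_diff_distrib)
qed

text \<open>The term with \<open>lg \<sigma>\<close> is linear, so what has to be shown is concavity
  of the entropy: Klein's inequality compares \<rho> and \<eta> with their mixture, a multiple of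
  which dominates each of them.\<close>

lemma umegaki_div_convex:
  assumes \<rho>: "fpsd \<rho>" "tr \<rho> = 1" and \<eta>: "fpsd \<eta>" "tr \<eta> = 1" and p: "0 < p" "p < 1"
  shows "umegaki_div (p *\<^sub>r \<rho> + (1 - p) *\<^sub>r \<eta>) \<sigma> \<le> p * umegaki_div \<rho> \<sigma> + (1 - p) * umegaki_div \<eta> \<sigma>"
proof -
  define M where "M = p *\<^sub>r \<rho> + (1 - p) *\<^sub>r \<eta>"
  have M: "fpsd M" unfolding M_def using p by (intro fpsd_add fpsd_cs \<rho> \<eta>) simp_all
  have trM: "Re (tr M) = 1" by (simp add: M_def \<rho> \<eta>)
  have 1: "fpsd ((1 / p) *\<^sub>r M - \<rho>)"
    using fpsd_cs[OF \<eta>(1), of "(1 - p) / p"] p by (simp add: M_def cs_add_right cs_cs)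
  have 2: "fpsd ((1 / (1 - p)) *\<^sub>r M - \<eta>)"
  proof -
    have "(1 / (1 - p)) *\<^sub>r M - \<eta> = (p / (1 - p)) *\<^sub>r \<rho>
        + ((1 / (1 - p) * (1 - p)) *\<^sub>r \<eta> - \<eta>)"
      by (simp only: M_def cs_add_right cs_cs of_real_mult[symmetric]) (simp add: algebra_simps)
    also have "1 / (1 - p) * (1 - p) = 1" using p by simp
    finally show ?thesis using fpsd_cs[OF \<rho>(1), of "p / (1 - p)"] p by simp
  qed
  have "Re (tr (\<rho> * lg M)) \<le> Re (tr (\<rho> * lg \<rho>))"
    using klein[OF \<rho>(1) M sp_mult_dominated[OF \<rho>(1) M 1]] \<rho>(2) trM by (simp add: umegaki_div_def right_diff_distrib)
  moreover have "Re (tr (\<eta> * lg M)) \<le> Re (tr (\<eta> * lg \<eta>))"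
    using klein[OF \<eta>(1) M sp_mult_dominated[OF \<eta>(1) M 2]] \<eta>(2) trM by (simp add: umegaki_div_def right_diff_distrib)
  ultimately have "p * Re (tr (\<rho> * lg M)) + (1 - p) * Re (tr (\<eta> * lg M))
      \<le> p * Re (tr (\<rho> * lg \<rho>)) + (1 - p) * Re (tr (\<eta> * lg \<eta>))"
    using p by (intro add_mono mult_left_mono) auto
  moreover have "Re (tr (M * X)) = p * Re (tr (\<rho> * X)) + (1 - p) * Re (tr (\<eta> * X))" for X
    by (simp add: M_def distrib_right)
  ultimately show ?thesis unfolding M_def[symmetric] by (simp add: umegaki_div_def right_diff_distrib)
qed

lemma sandwich_norm_sum_le:
  assumes p: "0 < p" "p < 1" and \<rho>: "\<And>x. x \<in> I \<Longrightarrow> fpsd (\<rho> x)" and \<sigma>: "fpsd \<sigma>" and r: "\<And>x. x \<in> I \<Longrightarrow> 0 \<le> r x"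
  shows "sandwich_norm p (\<Sum>x\<in>I. (r x) *\<^sub>r \<rho> x) \<sigma> \<le> (\<Sum>x\<in>I. r x * sandwich_norm p (\<rho> x) \<sigma>)"
  unfolding sandwich_norm_def sum_distrib_left sum_distrib_right cs_mult_left cs_mult_right
  by (rule schatten_sum_le[OF p _ r]) (use fpsd_sandwich[OF \<rho> \<sigma>, of _ "- (p / 2)"] in simp)

subsection \<open>Tensor products\<close>

lemma sandwich_norm_tn:
  assumes "fpsd A" "fpsd B" "fpsd C" "fpsd D"
  shows "sandwich_norm p (A \<star> B) (C \<star> D) = sandwich_norm p A C * sandwich_norm p B D"
  using schatten_tn[of "pw C (- complex_of_real (p / 2)) * A * pw C (- complex_of_real (p / 2))"
      "pw D (- complex_of_real (p / 2)) * B * pw D (- complex_of_real (p / 2))" p]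
    fpsd_sandwich[OF assms(1,3), of "- (p / 2)"] fpsd_sandwich[OF assms(2,4), of "- (p / 2)"]
  by (simp add: sandwich_norm_def pw_tn assms)

lemma umegaki_div_tn:
  assumes A: "fpsd A" "tr A = 1" and B: "fpsd B" "tr B = 1" and C: "fpsd C" "sp C * A = A" and D: "fpsd D" "sp D * B = B"
  shows "umegaki_div (A \<star> B) (C \<star> D) = umegaki_div A C + umegaki_div B D"
proof -
  have "A * sp C = A" using arg_cong[OF C(2), of dg] A(1) C(1) by (simp add: fpsd_dg)
  moreover have "B * sp D = B" using arg_cong[OF D(2), of dg] B(1) D(1) by (simp add: fpsd_dg)
  ultimately show ?thesis by (simp add: umegaki_div_def lg_tn A B C D algebra_simps)
qed

lemma amp_mult_left:
  assumes c: "chan a' a \<Phi>" and X: "input_supported a' X"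
  shows "amp \<Phi> ((A \<star> one {..<a'}) * X) = (A \<star> one {..<a}) * amp \<Phi> X"
proof -
  obtain R where b: "finite R" "\<And>p q. ent X p q \<noteq> 0 \<Longrightarrow> fst p \<in> R \<and> fst q \<in> R \<and> snd p \<in> {..<a'} \<and> snd q \<in> {..<a'}"
    by (rule input_supported_box[OF X]) blast
  show ?thesis
  proof (rule fm_box_induct[OF b, where f = "\<lambda>X. amp \<Phi> ((A \<star> one {..<a'}) * X)"])
    fix i j k l assume "k \<in> {..<a'}"
    then have "(A \<star> one {..<a'}) * unit (i, k) (j, l) = (A * unit i j) \<star> unit k l" by (simp flip: tn_unit)
    moreover have "one {..<a} * \<Phi> (unit k l) = \<Phi> (unit k l)" using c by (simp add: chan_def)
    ultimately show "amp \<Phi> ((A \<star> one {..<a'}) * unit (i, k) (j, l)) = (A \<star> one {..<a}) * amp \<Phi> (unit (i, k) (j, l))"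
      by (simp add: amp_tn chan_lin[OF c])
  qed (auto intro!: linI simp: distrib_left)
qed

lemma amp_mult_right:
  assumes c: "chan a' a \<Phi>" and X: "input_supported a' X"
  shows "amp \<Phi> (X * (A \<star> one {..<a'})) = amp \<Phi> X * (A \<star> one {..<a})"
proof -
  obtain R where b: "finite R" "\<And>p q. ent X p q \<noteq> 0 \<Longrightarrow> fst p \<in> R \<and> fst q \<in> R \<and> snd p \<in> {..<a'} \<and> snd q \<in> {..<a'}"
    by (rule input_supported_box[OF X]) blast
  show ?thesis
  proof (rule fm_box_induct[OF b, where f = "\<lambda>X. amp \<Phi> (X * (A \<star> one {..<a'}))"])
    fix i j k l assume "l \<in> {..<a'}"
    then have "unit (i, k) (j, l) * (A \<star> one {..<a'}) = (unit i j * A) \<star> unit k l" by (simp flip: tn_unit)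
    moreover have "\<Phi> (unit k l) * one {..<a} = \<Phi> (unit k l)" using c by (simp add: chan_def)
    ultimately show "amp \<Phi> (unit (i, k) (j, l) * (A \<star> one {..<a'})) = amp \<Phi> (unit (i, k) (j, l)) * (A \<star> one {..<a})"
      by (simp add: amp_tn chan_lin[OF c])
  qed (auto intro!: linI simp: distrib_right)
qed

lemma input_supported_mult:
  assumes "input_supported n X" shows "input_supported n ((A \<star> one {..<n}) * X * (B \<star> one {..<n}))"
proof -
  have z: "ent (M * (B \<star> one {..<n})) p q = 0" if "\<not> snd q < n" for M p q and B :: "'a fm"
  proof -
    obtain R S where r: "finite R" "finite S" "\<And>p q. ent M p q \<noteq> 0 \<Longrightarrow> fst p \<in> R \<and> fst q \<in> R \<and> snd p \<in> S \<and> snd q \<in> S"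
      by (rule fst_box) blast
    have "ent (M * (B \<star> one {..<n})) p q = (\<Sum>t\<in>R \<times> S. ent M p t * ent (B \<star> one {..<n}) t q)"
      by (rule ent_mult) (use r in force)+
    also have "\<dots> = 0" using that by (cases q) (auto simp: ent_one intro!: sum.neutral)
    finally show ?thesis .
  qed
  have y: "ent ((A \<star> one {..<n}) * M) p q = 0" if "\<not> snd p < n" for M p q
    using z[OF that, of "dg M" "dg A" q] ent_simps(7)[of "(A \<star> one {..<n}) * M" q p] by simp
  show ?thesis unfolding input_supported_iff
    using z[of _ "(A \<star> one {..<n}) * X" B] y[of _ "X * (B \<star> one {..<n})"] by (auto simp: mult.assoc)
qed

lemma ptr_mult:
  assumes X: "input_supported n X"
  shows "ptr ((A \<star> one {..<n}) * X * (B \<star> one {..<n})) = A * ptr X * B"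
proof -
  obtain R where b: "finite R" "\<And>p q. ent X p q \<noteq> 0 \<Longrightarrow> fst p \<in> R \<and> fst q \<in> R \<and> snd p \<in> {..<n} \<and> snd q \<in> {..<n}"
    by (rule input_supported_box[OF X]) blast
  show ?thesis
  proof (rule fm_box_induct[OF b, where f = "\<lambda>X. ptr ((A \<star> one {..<n}) * X * (B \<star> one {..<n}))"])
    fix i j k l assume "k \<in> {..<n}" "l \<in> {..<n}"
    then have "(A \<star> one {..<n}) * unit (i, k) (j, l) * (B \<star> one {..<n}) = (A * unit i j * B) \<star> unit k l"
      by (simp flip: tn_unit)
    then show "ptr ((A \<star> one {..<n}) * unit (i, k) (j, l) * (B \<star> one {..<n})) = A * ptr (unit (i, k) (j, l)) * B"
      by simp
  qed (auto intro!: linI simp: distrib_left distrib_right)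
qed

text \<open>With the compression to the box as map, every entry in \<open>amp_dominated\<close> has
  modulus at most 1. This bounds \<rho> by a^2 times \<open>ptr \<rho> \<star> one {..<a}\<close>,
  and domination gives the support inclusion.\<close>

lemma fpsd_one_tn_support:
  assumes \<rho>: "fpsd \<rho>" "input_supported a \<rho>"
  shows "(sp (ptr \<rho>) \<star> one {..<a}) * \<rho> = \<rho>" "\<rho> * (sp (ptr \<rho>) \<star> one {..<a}) = \<rho>"
proof -
  let ?C = "1 * real (a * a)"
  have id: "amp (\<lambda>X. one {..<a} * X * one {..<a}) \<rho> = \<rho>"
  proof -
    obtain R where b: "finite R" "\<And>p q. ent \<rho> p q \<noteq> 0 \<Longrightarrow> fst p \<in> R \<and> fst q \<in> R \<and> snd p \<in> {..<a} \<and> snd q \<in> {..<a}"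
      by (rule input_supported_box[OF \<rho>(2)]) blast
    show ?thesis
      by (rule fm_box_induct[OF b, where f = "amp (\<lambda>X. one {..<a} * X * one {..<a})" and g = "\<lambda>X. X"])
        (auto intro!: linI)
  qed
  have "fpsd (?C *\<^sub>r (ptr \<rho> \<star> one {..<a}) - amp (\<lambda>X. one {..<a} * X * one {..<a}) \<rho>)"
  proof (rule amp_dominated)
    show "lin (\<lambda>X. one {..<a} * X * one {..<a})" by (rule linI) (simp_all add: distrib_left distrib_right)
    show "one {..<a} * (one {..<a} * X * one {..<a}) = one {..<a} * X * one {..<a}" for X
      by (simp flip: mult.assoc)
    show "one {..<a} * X * one {..<a} * one {..<a} = one {..<a} * X * one {..<a}" for X
      by (simp add: mult.assoc)
  qed (use \<rho> in \<open>auto simp: id fpsd_dg\<close>)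
  then have "sp (ptr \<rho> \<star> one {..<a}) * \<rho> = \<rho>"
    unfolding id by (rule sp_mult_dominated[OF \<rho>(1) fpsd_tn[OF fpsd_ptr[OF \<rho>(1)] fpsd_one], rotated]) simp
  moreover have "sp (one {..<a}) = one {..<a}"
  proof -
    have "sdec (one {..<a}) {0::nat} (\<lambda>_. 1) (\<lambda>_. one {..<a})" by (simp add: sdec_def)
    from fc_sdec[OF this] show ?thesis by (simp add: pw_def on_nonzero_def)
  qed
  ultimately show 1: "(sp (ptr \<rho>) \<star> one {..<a}) * \<rho> = \<rho>"
    by (simp add: pw_tn fpsd_ptr \<rho>)
  show "\<rho> * (sp (ptr \<rho>) \<star> one {..<a}) = \<rho>"
    using arg_cong[OF 1, of dg] \<rho>(1) by (simp add: fpsd_dg fpsd_ptr)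
qed

lemma sp_mult_sp:
  assumes "fpsd A" "fpsd B" "sp B * A = A" shows "sp B * pw A z = pw A z" "pw A z * sp B = pw A z"
proof -
  have e: "pw A z = A * pw A (z - 1)" for z using pw_add[OF assms(1), of 1 "z - 1"] by (simp add: pw_one assms(1))
  show "sp B * pw A z = pw A z" for z by (subst (1 2) e) (simp add: assms(3) flip: mult.assoc)
  from arg_cong[OF this[of "cnj z"], of dg] show "pw A z * sp B = pw A z" by (simp add: assms(1,2))
qed

lemma tr_mult_tn_one:
  assumes "input_supported a X" shows "tr (X * (A \<star> one {..<a})) = tr (ptr X * A)"
proof -
  obtain R where b: "finite R" "\<And>p q. ent X p q \<noteq> 0 \<Longrightarrow> fst p \<in> R \<and> fst q \<in> R \<and> snd p \<in> {..<a} \<and> snd q \<in> {..<a}"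
    by (rule input_supported_box[OF assms]) blast
  show ?thesis
  proof (rule fm_box_induct[OF b, where f = "\<lambda>X. tr (X * (A \<star> one {..<a}))"])
    fix i j k l assume "l \<in> {..<a}"
    then have "unit (i, k) (j, l) * (A \<star> one {..<a}) = (unit i j * A) \<star> unit k l" by (simp flip: tn_unit)
    then show "tr (unit (i, k) (j, l) * (A \<star> one {..<a})) = tr (ptr (unit (i, k) (j, l)) * A)" by simp
  qed (auto intro!: linI simp: distrib_right)
qed

text \<open>The logarithm of a product state splits into two summands. The support of \<rho> lies
  under that of its marginal, so the summand with \<open>lg \<gamma>\<close> is the same whichever
  state stands on the reference.\<close>

lemma umegaki_div_chain:
  assumes \<rho>: "fpsd \<rho>" "input_supported a \<rho>" and \<eta>: "fpsd \<eta>" "sp \<eta> * ptr \<rho> = ptr \<rho>" and \<gamma>: "faithful_state a \<gamma>"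
  shows "umegaki_div \<rho> (\<eta> \<star> \<gamma>) = umegaki_div \<rho> (ptr \<rho> \<star> \<gamma>) + umegaki_div (ptr \<rho>) \<eta>"
proof -
  define \<theta> where "\<theta> = ptr \<rho>"
  have \<theta>: "fpsd \<theta>" "sp \<eta> * \<theta> = \<theta>" using fpsd_ptr \<rho> \<eta> by (auto simp: \<theta>_def)
  note g = faithful_stateD[OF \<gamma>]
  have "Re (tr (\<rho> * lg (\<zeta> \<star> \<gamma>))) = Re (tr (\<theta> * lg \<zeta>)) + Re (tr (\<rho> * (sp \<theta> \<star> lg \<gamma>)))"
    if \<zeta>: "fpsd \<zeta>" "sp \<zeta> * \<theta> = \<theta>" for \<zeta>
  proof -
    have "\<rho> * (sp \<zeta> \<star> lg \<gamma>) = \<rho> * (sp \<theta> \<star> one {..<a}) * (sp \<zeta> \<star> lg \<gamma>)"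
      using fpsd_one_tn_support(2)[OF \<rho>] by (simp add: \<theta>_def)
    also have "\<dots> = \<rho> * (sp \<theta> \<star> lg \<gamma>)"
      using sp_mult_sp(2)[OF \<theta>(1) \<zeta>, of 0] lg_sp(2)[OF g(1)] g(3) by (simp add: mult.assoc)
    finally show ?thesis
      using tr_mult_tn_one[OF \<rho>(2), of "lg \<zeta>"] by (simp add: lg_tn \<zeta> g distrib_left \<theta>_def)
  qed
  from this[OF \<eta>(1) \<theta>(2)] this[OF \<theta>(1)] show ?thesis
    by (simp add: umegaki_div_def right_diff_distrib \<theta>(1) flip: \<theta>_def)
qed

text \<open>The conditional part of the input is renormalised: if \<open>X = c \<tau>\<^sup>1\<^sup>-\<^sup>p\<close> is the sandwiched marginal, the
  state \<open>\<phi>'\<close> below has marginal \<open>\<tau>\<close>, so that the bound for the channel applies to it.\<close>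
lemma sandwich_norm_chain:
  fixes \<phi> :: "('s::countable \<times> nat) fm"
  assumes N: "chan a' a N" and \<phi>: "input_state a' \<phi>" and \<eta>: "fpsd \<eta>" "sp \<eta> * ptr \<phi> = ptr \<phi>" and \<gamma>: "faithful_state a \<gamma>"
    and p: "0 < p" "p < 1"
    and bound: "\<And>\<phi> :: ('s \<times> nat) fm. input_state a' \<phi> \<Longrightarrow> sandwich_norm p (amp N \<phi>) (ptr \<phi> \<star> \<gamma>) \<le> b"
  shows "sandwich_norm p (amp N \<phi>) (\<eta> \<star> \<gamma>) \<le> sandwich_norm p (ptr \<phi>) \<eta> * b"
proof -
  define s where "s = complex_of_real (p / 2)"
  have cs: "cnj s = s" by (simp add: s_def)
  note g = faithful_stateD[OF \<gamma>] and f = input_stateD[OF \<phi>]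
  define e where "e = pw \<eta> (- s)"
  define X where "X = e * ptr \<phi> * e"
  define Y where "Y = (e \<star> one {..<a'}) * \<phi> * (e \<star> one {..<a'})"
  have de: "dg e = e" by (simp add: e_def \<eta> cs)
  have Y: "fpsd Y" unfolding Y_def using fpsd_conj[OF f(1), of "e \<star> one {..<a'}"] by (simp add: de)
  have iY: "input_supported a' Y" unfolding Y_def by (rule input_supported_mult[OF f(3)])
  have pY: "ptr Y = X" unfolding Y_def X_def by (rule ptr_mult[OF f(3)])
  have X: "fpsd X" using fpsd_ptr[OF Y] by (simp add: pY)
  have und: "pw \<eta> s * X * pw \<eta> s = ptr \<phi>"
    unfolding X_def e_def by (rule sandwich_undo[OF fpsd_ptr[OF f(1)] \<eta>])
  have X0: "X \<noteq> 0"
  proof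
    assume "X = 0"
    then have "ptr \<phi> = 0" using und by simp
    then show False using f(2) tr_ptr[of \<phi>] by simp
  qed
  define c where "c = schatten p X"
  have c0: "0 < c" unfolding c_def by (rule schatten_pos[OF X X0])
  obtain \<tau> where t: "fpsd \<tau>" "tr \<tau> = 1" "X = c *\<^sub>r pw \<tau> (complex_of_real (1 - p))"
    unfolding c_def by (rule schatten_attained[OF X X0 p])
  \<comment> \<open>Conjugation with \<tau>^(p/2) turns the marginal c \<tau>^(1-p) of
    \<open>Y\<close> into c \<tau>, hence the factor 1 / c.\<close>
  define \<phi>' where "\<phi>' = (1 / c) *\<^sub>r ((pw \<tau> s \<star> one {..<a'}) * Y * (pw \<tau> s \<star> one {..<a'}))"
  have "fpsd ((pw \<tau> s \<star> one {..<a'}) * Y * (pw \<tau> s \<star> one {..<a'}))"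
    using fpsd_conj[OF Y, of "pw \<tau> s \<star> one {..<a'}"] by (simp add: t cs)
  then have f': "fpsd \<phi>'" unfolding \<phi>'_def using c0 by (intro fpsd_cs) simp_all
  have i': "input_supported a' \<phi>'" unfolding \<phi>'_def by (intro input_supported_cs input_supported_mult iY)
  have "ptr \<phi>' = (1 / c) *\<^sub>r (pw \<tau> s * X * pw \<tau> s)"
    by (simp add: \<phi>'_def ptr_mult[OF iY] pY)
  also have "\<dots> = pw \<tau> (s + complex_of_real (1 - p) + s)"
    using c0 by (simp add: t(3) cs_cs pw_add t(1) del: of_real_diff)
  also have "s + complex_of_real (1 - p) + s = 1" by (simp add: s_def)
  finally have p': "ptr \<phi>' = \<tau>" by (simp add: pw_one t)
  have st': "input_state a' \<phi>'" using f' i' p' t(2) tr_ptr[of \<phi>'] by (simp add: input_state_def)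
  define V where "V = amp N Y"
  define G where "G = pw \<gamma> (- s)"
  have spX: "sp X = sp \<tau>"
    unfolding t(3) pw_scale[OF fpsd_pw[OF t(1)] c0] pw_pw[OF t(1)] by simp
  have Ve: "V = (e \<star> one {..<a}) * amp N \<phi> * (e \<star> one {..<a})"
  proof -
    have "input_supported a' ((e \<star> one {..<a'}) * \<phi>)"
    proof -
      have "\<phi> = \<phi> * (sp (ptr \<phi>) \<star> one {..<a'})" using fpsd_one_tn_support(2)[OF f(1,3)] by simp
      then show ?thesis using input_supported_mult[OF f(3), of e "sp (ptr \<phi>)"] by (metis mult.assoc)
    qed
    then show ?thesis
      unfolding V_def Y_def by (simp add: amp_mult_right[OF N] amp_mult_left[OF N f(3)])
  qed
  have Vl: "(sp \<tau> \<star> one {..<a}) * V = V" and Vr: "V * (sp \<tau> \<star> one {..<a}) = V"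
    using fpsd_one_tn_support[OF Y iY] amp_mult_left[OF N iY, of "sp \<tau>"] amp_mult_right[OF N iY, of "sp \<tau>"]
    by (simp_all add: V_def pY spX)
  have "amp N ((pw \<tau> s \<star> one {..<a'}) * Y * (pw \<tau> s \<star> one {..<a'})) = (pw \<tau> s \<star> one {..<a}) * V * (pw \<tau> s \<star> one {..<a})"
  proof -
    have "Y = Y * (sp \<tau> \<star> one {..<a'})" using fpsd_one_tn_support(2)[OF Y iY] by (simp add: pY spX)
    then have "input_supported a' ((pw \<tau> s \<star> one {..<a'}) * Y)"
      using input_supported_mult[OF iY, of "pw \<tau> s" "sp \<tau>"] by (metis mult.assoc)
    then show ?thesis unfolding V_def by (simp add: amp_mult_right[OF N] amp_mult_left[OF N iY])
  qed
  then have af: "amp N \<phi>' = (1 / c) *\<^sub>r ((pw \<tau> s \<star> one {..<a}) * V * (pw \<tau> s \<star> one {..<a}))"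
    by (simp add: \<phi>'_def)
  have G1: "G * one {..<a} = G" "one {..<a} * G = G"
    using pw_add[OF g(1), of "- s" 0] pw_add[OF g(1), of 0 "- s"] by (simp_all add: G_def g(3))
  have se: "sp \<eta> * sp \<tau> = sp \<tau>" "sp \<tau> * sp \<eta> = sp \<tau>"
  proof -
    have "sp \<eta> * X = X" by (simp add: X_def e_def pw_add \<eta> flip: mult.assoc)
    from sp_mult_sp[OF X \<eta>(1) this, of 0] show "sp \<eta> * sp \<tau> = sp \<tau>" "sp \<tau> * sp \<eta> = sp \<tau>"
      by (simp_all add: spX)
  qed
  have ee: "sp \<eta> * e = e" "e * sp \<eta> = e" by (simp_all add: e_def pw_add \<eta>)
  \<comment> \<open>Inserting the support projections of \<eta> and then of \<tau> creates room for
    \<tau>^(-p/2) \<tau>^(p/2): the outer power belongs to the sandwich of \<phi>', the inner one to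
    its definition.\<close>
  have "(e \<star> G) * amp N \<phi> * (e \<star> G) = (sp \<eta> \<star> G) * V * (sp \<eta> \<star> G)"
  proof -
    have "(sp \<eta> \<star> G) * V * (sp \<eta> \<star> G)
        = ((sp \<eta> \<star> G) * (e \<star> one {..<a})) * amp N \<phi> * ((e \<star> one {..<a}) * (sp \<eta> \<star> G))"
      by (simp only: Ve mult.assoc)
    then show ?thesis by (simp add: ee G1)
  qed
  also have "\<dots> = (sp \<eta> \<star> G) * ((sp \<tau> \<star> one {..<a}) * V * (sp \<tau> \<star> one {..<a})) * (sp \<eta> \<star> G)"
    by (simp add: Vl Vr)
  also have "\<dots> = ((sp \<eta> \<star> G) * (sp \<tau> \<star> one {..<a})) * V * ((sp \<tau> \<star> one {..<a}) * (sp \<eta> \<star> G))"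
    by (simp only: mult.assoc)
  also have "\<dots> = (sp \<tau> \<star> G) * V * (sp \<tau> \<star> G)" by (simp add: se G1)
  also have "\<dots> = ((pw \<tau> (- s) \<star> G) * (pw \<tau> s \<star> one {..<a})) * V * ((pw \<tau> s \<star> one {..<a}) * (pw \<tau> (- s) \<star> G))"
    by (simp add: pw_add t G1)
  also have "\<dots> = (pw \<tau> (- s) \<star> G) * ((pw \<tau> s \<star> one {..<a}) * V * (pw \<tau> s \<star> one {..<a})) * (pw \<tau> (- s) \<star> G)"
    by (simp only: mult.assoc)
  also have "\<dots> = c *\<^sub>r ((pw \<tau> (- s) \<star> G) * amp N \<phi>' * (pw \<tau> (- s) \<star> G))"
    unfolding af using c0 by (simp add: cs_cs del: tn_mult)
  finally have key: "(e \<star> G) * amp N \<phi> * (e \<star> G) = c *\<^sub>r ((pw \<tau> (- s) \<star> G) * amp N \<phi>' * (pw \<tau> (- s) \<star> G))" .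
  have "fpsd ((pw \<tau> (- s) \<star> G) * amp N \<phi>' * (pw \<tau> (- s) \<star> G))"
    using fpsd_conj[OF amp_fpsd[OF N f'], of "pw \<tau> (- s) \<star> G"] by (simp add: t cs G_def g)
  then have "schatten p ((e \<star> G) * amp N \<phi> * (e \<star> G)) = c * schatten p ((pw \<tau> (- s) \<star> G) * amp N \<phi>' * (pw \<tau> (- s) \<star> G))"
    unfolding key using c0 by (intro schatten_scale p) simp_all
  also have "schatten p ((pw \<tau> (- s) \<star> G) * amp N \<phi>' * (pw \<tau> (- s) \<star> G)) = sandwich_norm p (amp N \<phi>') (ptr \<phi>' \<star> \<gamma>)"
    by (simp only: sandwich_norm_def p' pw_tn[OF t(1) g(1)] G_def s_def)
  also have "c * \<dots> \<le> c * b" using bound[OF st'] c0 by simp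
  also have "c = sandwich_norm p (ptr \<phi>) \<eta>" by (simp only: c_def X_def e_def sandwich_norm_def s_def)
  finally show ?thesis by (simp only: sandwich_norm_def pw_tn[OF \<eta>(1) g(1)] e_def G_def s_def)
qed

section \<open>Tensor products of maps and rearrangement of tensor factors\<close>

definition tens :: "(nat fm \<Rightarrow> nat fm) \<Rightarrow> (nat fm \<Rightarrow> nat fm) \<Rightarrow> (nat \<times> nat) fm \<Rightarrow> (nat \<times> nat) fm" where
  "tens N M = lext (\<lambda>p q. N (unit (fst p) (fst q)) \<star> M (unit (snd p) (snd q)))"

lemma lin_tens: "lin (tens N M)" unfolding tens_def by (rule lin_lext)

lemma tens_unit [simp]: "tens N M (unit (i, k) (j, l)) = N (unit i j) \<star> M (unit k l)"
  by (simp add: tens_def)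

text \<open>\<open>rot\<close> makes the first system the input and moves the second into the
  reference; \<open>swp\<close> does the same once a channel has acted on the second system;
  \<open>mid\<close> pairs the references and the systems of two independent inputs.\<close>

definition rot :: "'r \<times> 'x \<times> 'y \<Rightarrow> ('r \<times> 'y) \<times> 'x" where
  "rot p = ((fst p, snd (snd p)), fst (snd p))"

definition mid :: "('r \<times> 'x) \<times> ('s \<times> 'y) \<Rightarrow> ('r \<times> 's) \<times> ('x \<times> 'y)" where
  "mid p = ((fst (fst p), fst (snd p)), (snd (fst p), snd (snd p)))"

definition swp :: "('r \<times> 'x) \<times> 'y \<Rightarrow> ('r \<times> 'y) \<times> 'x" where
  "swp p = ((fst (fst p), snd p), snd (fst p))"

lemma inj_rot: "inj rot" and inj_mid: "inj mid" and inj_swp: "inj swp"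
  by (auto simp: inj_def rot_def mid_def swp_def)

lemma rot_tn: "reix rot (A \<star> (B \<star> C)) = (A \<star> C) \<star> B"
proof (induct A rule: fm_induct)
  case (unit c i j)
  have "reix rot (unit i j \<star> (B \<star> C)) = (unit i j \<star> C) \<star> B"
  proof (induct B rule: fm_induct)
    case (unit c k l)
    have "reix rot (unit i j \<star> (unit k l \<star> C)) = (unit i j \<star> C) \<star> unit k l"
      by (induct C rule: fm_induct) (simp_all add: rot_def)
    then show ?case by simp
  qed simp_all
  then show ?case by simp
qed simp_all

lemma swp_tn: "reix swp ((A \<star> B) \<star> C) = (A \<star> C) \<star> B"
proof (induct A rule: fm_induct)
  case (unit c i j)
  have "reix swp ((unit i j \<star> B) \<star> C) = (unit i j \<star> C) \<star> B"
  proof (induct B rule: fm_induct)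
    case (unit c k l)
    have "reix swp ((unit i j \<star> unit k l) \<star> C) = (unit i j \<star> C) \<star> unit k l"
      by (induct C rule: fm_induct) (simp_all add: swp_def)
    then show ?case by simp
  qed simp_all
  then show ?case by simp
qed simp_all

lemma mid_unit_tn: "reix mid ((unit i j \<star> B) \<star> (unit k l \<star> D)) = (unit i j \<star> unit k l) \<star> (B \<star> D)"
proof (induct B rule: fm_induct)
  case (unit c m n)
  have "reix mid ((unit i j \<star> unit m n) \<star> (unit k l \<star> D)) = (unit i j \<star> unit k l) \<star> (unit m n \<star> D)"
    by (induct D rule: fm_induct) (simp_all add: mid_def)
  then show ?case by simp
qed simp_all

lemma mid_tn: "reix mid ((A \<star> B) \<star> (C \<star> D)) = (A \<star> C) \<star> (B \<star> D)"
proof (induct A rule: fm_induct)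
  case (unit c i j)
  have "reix mid ((unit i j \<star> B) \<star> (C \<star> D)) = (unit i j \<star> C) \<star> (B \<star> D)"
  proof (induct C rule: fm_induct)
    case (unit c k l)
    show ?case using mid_unit_tn[of i j B k l D] by simp
  qed simp_all
  then show ?case by simp
qed simp_all

lemma fm_eq_unit3:
  assumes "lin f" "lin g" "\<And>i j k l m n. f (unit (i, k, m) (j, l, n)) = g (unit (i, k, m) (j, l, n))"
  shows "f X = g X"
proof (rule lin_eqI[OF assms(1,2)])
  fix p q show "f (unit p q) = g (unit p q)"
    using assms(3)[of "fst p" "fst (snd p)" "snd (snd p)" "fst q" "fst (snd q)" "snd (snd q)"] by simp
qed

text \<open>The tensor product is carried out as \<open>M\<close> first, whose output then belongs
  to the reference over which \<open>N\<close> is amplified.\<close>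

lemma amp_tens:
  assumes N: "lin N" and M: "lin M"
  shows "reix rot (amp (tens N M) \<psi>) = amp N (reix swp (amp M (reix assoc \<psi>)))"
proof (rule fm_eq_unit3[of "\<lambda>\<psi>. reix rot (amp (tens N M) \<psi>)"])
  fix i j k l m n
  have "amp N (reix swp (amp M ((unit i j \<star> unit k l) \<star> unit m n))) = (unit i j \<star> M (unit m n)) \<star> N (unit k l)"
    by (simp only: amp_tn[OF M] swp_tn amp_tn[OF N])
  then show "reix rot (amp (tens N M) (unit (i, k, m) (j, l, n)))
      = amp N (reix swp (amp M (reix assoc (unit (i, k, m) (j, l, n)))))"
    by (simp add: assoc_def rot_tn)
qed (auto intro!: linI)

text \<open>Discarding the first system commutes with acting on the second, so the marginal that
  enters the chain rule is itself an output of \<open>M\<close>.\<close>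

lemma ptr_swp_amp:
  assumes "lin M" shows "ptr (reix swp (amp M (reix assoc \<psi>))) = amp M (ptr (reix rot \<psi>))"
proof (rule fm_eq_unit3[of "\<lambda>\<psi>. ptr (reix swp (amp M (reix assoc \<psi>)))"])
  fix i j k l m n
  have "ptr (reix swp (amp M ((unit i j \<star> unit k l) \<star> unit m n))) = tr (unit k l) *\<^sub>c (unit i j \<star> M (unit m n))"
    by (simp only: amp_tn[OF assms] swp_tn ptr_tn)
  then show "ptr (reix swp (amp M (reix assoc (unit (i, k, m) (j, l, n))))) = amp M (ptr (reix rot (unit (i, k, m) (j, l, n))))"
    by (simp add: assoc_def rot_def)
qed (auto intro!: linI)

lemma ptr_ptr_rot: "ptr (ptr (reix rot \<psi>)) = ptr \<psi>"
proof (rule fm_eq_unit3[of "\<lambda>\<psi>. ptr (ptr (reix rot \<psi>))"])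
  show "ptr (ptr (reix rot (unit (i, k, m) (j, l, n)))) = ptr (unit (i, k, m) (j, l, n))" for i j k l m n
    by (simp add: rot_def)
qed (auto intro!: linI)

lemma mid_apply [simp]: "mid ((i, k), (j, l)) = ((i, j), (k, l))"
  by (simp add: mid_def)

lemma amp_tens_mid:
  assumes N: "lin N" and M: "lin M"
  shows "amp (tens N M) (reix mid (\<psi> \<star> \<phi>)) = reix mid (amp N \<psi> \<star> amp M \<phi>)"
proof (induct \<psi> rule: fm_induct_prod)
  case (unit c i k j l)
  have "amp (tens N M) (reix mid (unit (i, k) (j, l) \<star> \<phi>)) = reix mid (amp N (unit (i, k) (j, l)) \<star> amp M \<phi>)"
  proof (induct \<phi> rule: fm_induct_prod)
    case (unit c m x n y)
    show ?case using mid_tn[of "unit i j" "N (unit k l)" "unit m n" "M (unit x y)"] by (simp add: mid_apply)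
  qed simp_all
  then show ?case by simp
qed simp_all

lemma ptr_mid: "ptr (reix mid (\<psi> \<star> \<phi>)) = ptr \<psi> \<star> ptr \<phi>"
proof (induct \<psi> rule: fm_induct_prod)
  case (unit c i k j l)
  have "ptr (reix mid (unit (i, k) (j, l) \<star> \<phi>)) = ptr (unit (i, k) (j, l)) \<star> ptr \<phi>"
    by (induct \<phi> rule: fm_induct_prod) (auto simp: mid_def)
  then show ?case by simp
qed simp_all

section \<open>Embedding concrete matrices\<close>

text \<open>\<open>g\<close> names the basis vectors. A pair-valued \<open>g\<close> carries the
  tensor structure that concrete matrices encode in index arithmetic.\<close>

definition emb :: "(nat \<Rightarrow> 'i) \<Rightarrow> nat \<Rightarrow> cmat \<Rightarrow> 'i fm" where
  "emb g d M = mk (g ` {..<d}) (\<lambda>x y. M $$ (inv_into {..<d} g x, inv_into {..<d} g y))"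

definition unemb :: "(nat \<Rightarrow> 'i) \<Rightarrow> nat \<Rightarrow> 'i fm \<Rightarrow> cmat" where
  "unemb g d X = Matrix.mat d d (\<lambda>(i, j). ent X (g i) (g j))"

lemma ent_emb_out: "x \<notin> g ` {..<d} \<or> y \<notin> g ` {..<d} \<Longrightarrow> ent (emb g d M) x y = 0"
  by (auto simp: emb_def ent_mk)

lemma ent_emb: "inj_on g {..<d} \<Longrightarrow> i < d \<Longrightarrow> j < d \<Longrightarrow> ent (emb g d M) (g i) (g j) = M $$ (i, j)"
  by (simp add: emb_def ent_mk inv_into_f_f)

lemma emb_eqI:
  assumes "inj_on g {..<d}" "\<And>i j. i < d \<Longrightarrow> j < d \<Longrightarrow> ent X (g i) (g j) = M $$ (i, j)"
    "\<And>x y. x \<notin> g ` {..<d} \<or> y \<notin> g ` {..<d} \<Longrightarrow> ent X x y = 0"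
  shows "emb g d M = X"
proof (rule fm_eqI)
  fix x y show "ent (emb g d M) x y = ent X x y"
  proof (cases "x \<in> g ` {..<d} \<and> y \<in> g ` {..<d}")
    case True
    then show ?thesis using assms(2) ent_emb[OF assms(1)] by auto
  next
    case False
    then show ?thesis using assms(3) ent_emb_out by metis
  qed
qed

lemma emb_inject:
  assumes "inj_on g {..<d}" "A \<in> carrier_mat d d" "B \<in> carrier_mat d d" "emb g d A = emb g d B"
  shows "A = B"
proof (rule eq_matI)
  fix i j assume "i < dim_row B" "j < dim_col B"
  then show "A $$ (i, j) = B $$ (i, j)"
    using assms ent_emb[OF assms(1), of i j A] ent_emb[OF assms(1), of i j B] by simp
qed (use assms in auto)

lemma emb_unemb:
  assumes "inj_on g {..<d}" "\<And>x y. x \<notin> g ` {..<d} \<or> y \<notin> g ` {..<d} \<Longrightarrow> ent X x y = 0"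
  shows "emb g d (unemb g d X) = X"
  by (rule emb_eqI[OF assms(1)]) (use assms(2) in \<open>auto simp: unemb_def\<close>)

context
  fixes g :: "nat \<Rightarrow> 'i" and d :: nat
  assumes g: "inj_on g {..<d}"
begin

lemma ent_emb_mult:
  "ent (emb g d A * X) x y = (\<Sum>k<d. ent (emb g d A) x (g k) * ent X (g k) y)"
proof -
  have "ent (emb g d A * X) x y = (\<Sum>z\<in>g ` {..<d}. ent (emb g d A) x z * ent X z y)"
    by (rule ent_mult) (simp, metis ent_emb_out)
  then show ?thesis by (simp add: sum.reindex[OF g])
qed

lemma emb_mult:
  assumes "A \<in> carrier_mat d d" "B \<in> carrier_mat d d"
  shows "emb g d (A * B) = emb g d A * emb g d B"
proof (rule emb_eqI[OF g])
  note e = ent_emb_mult[of A "emb g d B"]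
  show "ent (emb g d A * emb g d B) (g i) (g j) = (A * B) $$ (i, j)" if "i < d" "j < d" for i j
    unfolding e using that assms by (simp add: ent_emb[OF g] scalar_prod_def atLeast0LessThan)
  show "ent (emb g d A * emb g d B) x y = 0" if "x \<notin> g ` {..<d} \<or> y \<notin> g ` {..<d}" for x y
    unfolding e using that by (auto simp: ent_emb_out intro!: sum.neutral)
qed

lemma emb_dagger: "A \<in> carrier_mat d d \<Longrightarrow> emb g d (dagger A) = dg (emb g d A)"
  by (rule emb_eqI[OF g]) (auto simp: dagger_def ent_emb[OF g] ent_emb_out)

lemma emb_smult: "A \<in> carrier_mat d d \<Longrightarrow> emb g d (c \<cdot>\<^sub>m A) = c *\<^sub>c emb g d A"
  by (rule emb_eqI[OF g]) (auto simp: ent_emb[OF g] ent_emb_out)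

lemma emb_add: "A \<in> carrier_mat d d \<Longrightarrow> B \<in> carrier_mat d d \<Longrightarrow> emb g d (A + B) = emb g d A + emb g d B"
  by (rule emb_eqI[OF g]) (auto simp: ent_emb[OF g] ent_emb_out)

lemma emb_minus: "A \<in> carrier_mat d d \<Longrightarrow> B \<in> carrier_mat d d \<Longrightarrow> emb g d (A - B) = emb g d A - emb g d B"
  by (rule emb_eqI[OF g]) (auto simp: ent_emb[OF g] ent_emb_out)

lemma emb_one: "emb g d (1\<^sub>m d) = one (g ` {..<d})"
  by (rule emb_eqI[OF g]) (use g in \<open>auto simp: ent_one inj_on_eq_iff\<close>)

lemma emb_zero: "emb g d (0\<^sub>m d d) = 0"
  by (rule emb_eqI[OF g]) auto

lemma emb_trace: "A \<in> carrier_mat d d \<Longrightarrow> tr (emb g d A) = mtrace A"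
  by (subst tr_ent[of "g ` {..<d}"]) (auto simp: ent_emb_out sum.reindex[OF g] ent_emb[OF g] mtrace_def intro: ccontr)

lemma emb_mult_one: "one (g ` {..<d}) * emb g d A = emb g d A" "emb g d A * one (g ` {..<d}) = emb g d A"
  by (rule fm_eqI; auto simp: ent_one_mult ent_mult_one ent_emb_out)+

lemma emb_diag: "emb g d (mat_diag d f) = (\<Sum>k<d. f k *\<^sub>c unit (g k) (g k))"
proof (rule emb_eqI[OF g])
  fix i j assume ij: "i < d" "j < d"
  have "ent (\<Sum>k<d. f k *\<^sub>c unit (g k) (g k)) (g i) (g j) = (\<Sum>k<d. if i = k then (if i = j then f i else 0) else 0)"
    unfolding ent_sum by (intro sum.cong refl) (use ij g in \<open>auto simp: inj_on_eq_iff\<close>)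
  then show "ent (\<Sum>k<d. f k *\<^sub>c unit (g k) (g k)) (g i) (g j) = mat_diag d f $$ (i, j)"
    using ij by (simp add: mat_diag_def)
qed (auto intro!: sum.neutral)

lemma emb_qform:
  assumes A: "A \<in> carrier_mat d d" and Y: "finite Y" "\<And>x y. ent B x y \<noteq> 0 \<Longrightarrow> y \<in> Y"
  shows "tr (dg B * emb g d A * B) = (\<Sum>y\<in>Y. qform A (Matrix.vec d (\<lambda>i. ent B (g i) y)))"
proof -
  let ?S = "g ` {..<d}"
  note e1 = ent_emb_mult[of A B]
  have e2: "ent (dg B * (emb g d A * B)) y z = (\<Sum>i<d. cnj (ent B (g i) y) * ent (emb g d A * B) (g i) z)" for y z
  proof -
    have "dg B * (emb g d A * B) = (dg B * one ?S) * (emb g d A * B)"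
      using emb_mult_one(1)[of A] by (metis mult.assoc)
    moreover have "ent ((dg B * one ?S) * (emb g d A * B)) y z = (\<Sum>x\<in>?S. ent (dg B * one ?S) y x * ent (emb g d A * B) x z)"
      by (rule ent_mult) (auto simp: ent_mult_one split: if_splits)
    ultimately show ?thesis by (simp add: sum.reindex[OF g] ent_mult_one)
  qed
  have "tr (dg B * emb g d A * B) = (\<Sum>y\<in>Y. ent (dg B * (emb g d A * B)) y y)"
    unfolding mult.assoc
  proof (rule tr_ent[OF Y(1)])
    fix y assume "ent (dg B * (emb g d A * B)) y y \<noteq> 0"
    then obtain i where "ent B (g i) y \<noteq> 0" unfolding e2 by (metis (no_types, lifting) complex_cnj_zero mult_eq_0_iff sum.neutral)
    then show "y \<in> Y" by (rule Y(2))
  qed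
  also have "\<dots> = (\<Sum>y\<in>Y. qform A (Matrix.vec d (\<lambda>i. ent B (g i) y)))"
    using A by (intro sum.cong refl)
      (auto simp: e1 e2 qform_def scalar_prod_def atLeast0LessThan ent_emb[OF g] intro!: sum.cong)
  finally show ?thesis .
qed

lemma psd_emb:
  assumes A: "A \<in> carrier_mat d d"
  shows "psd d A \<longleftrightarrow> fpsd (emb g d A)"
proof
  assume P: "psd d A"
  then have "dagger A = A" by (simp add: psd_def hermitian_def)
  then have "dg (emb g d A) = emb g d A" using emb_dagger[OF A] by simp
  moreover have "0 \<le> Re (tr (dg B * emb g d A * B))" for B
  proof -
    obtain S where S: "finite S" "supp B \<subseteq> S \<times> S" by (rule supp_box)
    have "0 \<le> Re (qform A (Matrix.vec d (\<lambda>i. ent B (g i) y)))" for y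
      using P by (simp add: psd_def)
    then show ?thesis
      using emb_qform[OF A S(1), of B] supp_subD[OF S(2)] by (simp add: sum_nonneg)
  qed
  ultimately show "fpsd (emb g d A)" by (simp add: fpsd_def)
next
  assume P: "fpsd (emb g d A)"
  then have "emb g d (dagger A) = emb g d A" using emb_dagger[OF A] fpsd_dg by metis
  then have h: "dagger A = A" using emb_inject[OF g _ A] A by (simp add: dagger_def)
  have "0 \<le> Re (qform A v)" if v: "v \<in> carrier_vec d" for v
  proof (cases "d = 0")
    case True
    then show ?thesis using v by (simp add: qform_def)
  next
    case False
    \<comment> \<open>Only column 0 is nonzero and it equals v, so the trace reduces to the
      quadratic form of v.\<close>
    define B where "B = emb g d (Matrix.mat d d (\<lambda>(i, j). if j = 0 then vec_index v i else 0))"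
    have b: "ent B (g i) (g j) = (if j = 0 then vec_index v i else 0)" if "i < d" "j < d" for i j
      using that by (simp add: B_def ent_emb[OF g])
    have "ent B x y \<noteq> 0 \<Longrightarrow> y \<in> {g 0}" for x y
    proof -
      assume nz: "ent B x y \<noteq> 0"
      then obtain i j where "x = g i" "y = g j" "i < d" "j < d"
        using ent_emb_out[of x g d y] unfolding B_def by blast
      then show "y \<in> {g 0}" using nz b[of i j] by (auto split: if_splits)
    qed
    from emb_qform[OF A _ this]
    have "tr (dg B * emb g d A * B) = qform A (Matrix.vec d (\<lambda>i. ent B (g i) (g 0)))" by simp
    also have "Matrix.vec d (\<lambda>i. ent B (g i) (g 0)) = v" using v False b by (intro eq_vecI) auto
    finally show ?thesis using fpsd_conj_tr[OF P, of B] by simp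
  qed
  then show "psd d A" using A h by (simp add: psd_def hermitian_def)
qed

text \<open>Guarantees that the choice in \<open>mfun\<close> has a witness; the unitary has the
  eigenvectors as its columns.\<close>

lemma hermitian_unitary_diag:
  assumes "hermitian d A"
  shows "\<exists>U lam. unitary d U \<and> A = U * mat_diag d (\<lambda>i. complex_of_real (lam i)) * dagger U"
proof -
  have A: "A \<in> carrier_mat d d" "dagger A = A" using assms by (auto simp: hermitian_def)
  have gi: "inj_on id {..<d}" by simp
  have "cnj (A $$ (j, i)) = A $$ (i, j)" if "i < d" "j < d" for i j
    using arg_cong[OF A(2), of "\<lambda>M. M $$ (i, j)"] A(1) that by (simp add: dagger_def)
  then have "dg (emb id d A) = emb id d A"
    by (intro fm_eqI) (auto simp: emb_def ent_mk inv_into_f_f[OF gi, simplified])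
  moreover have "one {..<d} * emb id d A = emb id d A"
    by (rule fm_eqI) (auto simp: ent_one_mult ent_emb_out)
  ultimately obtain u l where ef: "eigenfamily {..<d} (emb id d A) d u l"
    and o: "(\<Sum>k<d. ketbra {..<d} (u k)) = one {..<d}"
    using hermitian_eigenbasis[of "{..<d}" "emb id d A"] by auto
  define U where "U = Matrix.mat d d (\<lambda>(i, k). u k i)"
  have U: "U \<in> carrier_mat d d" "dagger U \<in> carrier_mat d d" by (simp_all add: U_def dagger_def)
  have UD: "U * mat_diag d f * dagger U = Matrix.mat d d (\<lambda>(i, j). \<Sum>k<d. f k * ent (ketbra {..<d} (u k)) i j)" for f
  proof (rule eq_matI)
    fix i j assume "i < dim_row (Matrix.mat d d (\<lambda>(i, j). \<Sum>k<d. f k * ent (ketbra {..<d} (u k)) i j))"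
      "j < dim_col (Matrix.mat d d (\<lambda>(i, j). \<Sum>k<d. f k * ent (ketbra {..<d} (u k)) i j))"
    then have ij: "i < d" "j < d" by auto
    have "U * mat_diag d f = Matrix.mat d d (\<lambda>(i, k). u k i * f k)"
      using U by (subst mat_diag_mult_right) (auto simp: U_def)
    then show "(U * mat_diag d f * dagger U) $$ (i, j)
        = Matrix.mat d d (\<lambda>(i, j). \<Sum>k<d. f k * ent (ketbra {..<d} (u k)) i j) $$ (i, j)"
      using ij by (simp add: scalar_prod_def atLeast0LessThan ent_ketbra U_def dagger_def mult_ac)
  qed (simp_all add: U_def dagger_def)
  have md1: "mat_diag d (\<lambda>k. 1) = (1\<^sub>m d :: cmat)" by (rule eq_matI) (auto simp: mat_diag_def)
  have UU: "U * dagger U = 1\<^sub>m d"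
  proof -
    have "U * dagger U = U * mat_diag d (\<lambda>k. 1) * dagger U" using U by (simp add: md1)
    also have "\<dots> = Matrix.mat d d (\<lambda>(i, j). ent (one {..<d}) i j)" unfolding UD by (simp add: o[symmetric])
    also have "\<dots> = 1\<^sub>m d" by (rule eq_matI) (auto simp: ent_one)
    finally show ?thesis .
  qed
  have "unitary d U" using U UU mat_mult_left_right_inverse[OF U UU] by (simp add: unitary_def)
  moreover have "A = U * mat_diag d (\<lambda>i. complex_of_real (l i)) * dagger U"
  proof -
    have "emb id d A = emb id d A * one {..<d}"
      by (rule fm_eqI) (auto simp: ent_mult_one ent_emb_out)
    also have "\<dots> = (\<Sum>k<d. (l k) *\<^sub>r ketbra {..<d} (u k))"
      unfolding o[symmetric] sum_distrib_left using ef by (intro sum.cong) (auto simp: eigenfamily_def)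
    finally have e: "emb id d A = (\<Sum>k<d. (l k) *\<^sub>r ketbra {..<d} (u k))" .
    show ?thesis unfolding UD
      by (rule eq_matI) (use A(1) ent_emb[OF gi, of _ _ A] in \<open>auto simp: e\<close>)
  qed
  ultimately show ?thesis by blast
qed

text \<open>The full family is kept, eigenvalue 0 included and summing to the identity, because
  Gibbs states use a function that does not vanish at 0.\<close>

lemma mfun_emb_family:
  assumes "hermitian d A"
  obtains l P where "sdec (emb g d A) {..<d} l P" "(\<Sum>k<d. P k) = one (g ` {..<d})"
    "emb g d (mfun f d A) = (\<Sum>k<d. (f (l k)) *\<^sub>r P k)" "mfun f d A \<in> carrier_mat d d"
proof -
  have A: "A \<in> carrier_mat d d" using assms by (simp add: hermitian_def)
  define Q where "Q = (\<lambda>(U, lam). unitary d U \<and> A = U * mat_diag d (\<lambda>i. complex_of_real (lam i)) * dagger U)"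
  have "\<exists>z. Q z" using hermitian_unitary_diag[OF assms] by (auto simp: Q_def)
  then have Qz: "Q (SOME z. Q z)" by (rule someI_ex)
  obtain U lam where z: "(SOME z. Q z) = (U, lam)" by (cases "SOME z. Q z")
  note Ul = z[unfolded Q_def]
  have uU: "unitary d U" and Aeq: "A = U * mat_diag d (\<lambda>i. complex_of_real (lam i)) * dagger U"
    using Qz unfolding z by (simp_all add: Q_def)
  have U: "U \<in> carrier_mat d d" "dagger U \<in> carrier_mat d d" "dagger U * U = 1\<^sub>m d" "U * dagger U = 1\<^sub>m d"
    using uU by (auto simp: unitary_def dagger_def)
  have D: "mat_diag d h \<in> carrier_mat d d" for h :: "nat \<Rightarrow> complex" by (simp add: mat_diag_def)
  define E where "E = emb g d U"
  define P where "P k = E * unit (g k) (g k) * dg E" for k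
  have dE: "dg E = emb g d (dagger U)" by (simp add: E_def emb_dagger U)
  have EE: "dg E * E = one (g ` {..<d})" "E * dg E = one (g ` {..<d})"
    unfolding dE by (simp_all add: E_def U emb_one flip: emb_mult)
  have emb: "emb g d (U * mat_diag d h * dagger U) = (\<Sum>k<d. h k *\<^sub>c P k)" for h
    unfolding emb_mult[OF mult_carrier_mat[OF U(1) D] U(2)] emb_mult[OF U(1) D] emb_diag dE[symmetric] E_def[symmetric]
    by (simp add: P_def sum_distrib_left sum_distrib_right)
  have mf: "mfun f d A = U * mat_diag d (\<lambda>i. complex_of_real (f (lam i))) * dagger U"
    unfolding mfun_def Ul Let_def by simp
  have PP: "P k * P j = (if k = j then P k else 0)" if "k < d" "j < d" for k j
  proof -
    have "P k * P j = E * (unit (g k) (g k) * (dg E * E) * unit (g j) (g j)) * dg E"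
      by (simp add: P_def mult.assoc)
    then show ?thesis unfolding EE using that g by (auto simp: P_def inj_on_eq_iff)
  qed
  have "sdec (emb g d A) {..<d} lam P"
    unfolding sdec_def using PP Aeq emb[of "\<lambda>i. complex_of_real (lam i)"] by (auto simp: P_def mult.assoc)
  moreover have "(\<Sum>k<d. P k) = one (g ` {..<d})"
  proof -
    have "(\<Sum>k<d. P k) = E * one (g ` {..<d}) * dg E"
      by (simp add: P_def one_def sum.reindex[OF g] sum_distrib_left sum_distrib_right)
    then show ?thesis using EE(2) emb_mult_one(2)[of U] by (simp add: E_def)
  qed
  moreover have "mfun f d A \<in> carrier_mat d d" 
    unfolding mf by (rule mult_carrier_mat[OF mult_carrier_mat[OF U(1) D] U(2)])
  ultimately show ?thesis using that[of lam P] mf emb by simp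
qed

text \<open>The condition f 0 = 0 means that the abstract calculus loses nothing by ignoring the
  eigenvalue 0.\<close>

lemma mfun_emb:
  assumes "hermitian d A" "f 0 = 0"
  shows "emb g d (mfun f d A) = fc (\<lambda>x. complex_of_real (f x)) (emb g d A)" "mfun f d A \<in> carrier_mat d d"
proof -
  obtain l P where s: "sdec (emb g d A) {..<d} l P"
    "emb g d (mfun f d A) = (\<Sum>k<d. (f (l k)) *\<^sub>r P k)" "mfun f d A \<in> carrier_mat d d"
    using mfun_emb_family[OF assms(1)] by metis
  show "mfun f d A \<in> carrier_mat d d" by (rule s(3))
  show "emb g d (mfun f d A) = fc (\<lambda>x. complex_of_real (f x)) (emb g d A)"
    unfolding s(2) fc_sdec[OF s(1)] using assms(2) by (intro sum.cong) (auto simp: on_nonzero_def)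
qed

text \<open>For a full resolution of the identity the eigenvalue 0 need not be excluded.\<close>
lemma mfun_emb_full:
  assumes H: "hermitian d A" and t: "sdec (emb g d A) J m Q" "(\<Sum>j\<in>J. Q j) = one (g ` {..<d})"
  shows "emb g d (mfun f d A) = (\<Sum>j\<in>J. (f (m j)) *\<^sub>r Q j)"
proof -
  obtain l P where s: "sdec (emb g d A) {..<d} l P" "(\<Sum>k<d. P k) = one (g ` {..<d})"
    "emb g d (mfun f d A) = (\<Sum>k<d. (f (l k)) *\<^sub>r P k)"
    using mfun_emb_family[OF H] by metis
  \<comment> \<open>The constant f 0 is split off and carried by the complete family; the remainder
    vanishes at 0 and falls under the abstract calculus.\<close>
  have split: "complex_of_real (f x) = on_nonzero (\<lambda>x. complex_of_real (f x) - complex_of_real (f 0)) x + complex_of_real (f 0)" for x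
    by (simp add: on_nonzero_def)
  have "(\<Sum>k<d. (f (l k)) *\<^sub>r P k)
      = fc (\<lambda>x. complex_of_real (f x) - complex_of_real (f 0)) (emb g d A) + (f 0) *\<^sub>r one (g ` {..<d})"
    unfolding fc_sdec[OF s(1)] s(2)[symmetric] by (subst split) (simp only: cs_add_left sum.distrib cs_sum_right)
  also have "\<dots> = (\<Sum>j\<in>J. (f (m j)) *\<^sub>r Q j)"
    unfolding fc_sdec[OF t(1)] t(2)[symmetric] by (subst split) (simp only: cs_add_left sum.distrib cs_sum_right)
  finally show ?thesis using s(3) by simp
qed

lemma supp_le_emb:
  assumes \<rho>: "psd d \<rho>" and \<sigma>: "psd d \<sigma>" and sub: "sp (emb g d \<sigma>) * emb g d \<rho> = emb g d \<rho>"
  shows "supp_le d \<rho> \<sigma>"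
  unfolding supp_le_def
proof (intro ballI impI)
  fix v assume v: "v \<in> carrier_vec d" and z: "\<sigma> *\<^sub>v v = 0\<^sub>v d"
  have c: "\<rho> \<in> carrier_mat d d" "\<sigma> \<in> carrier_mat d d" using \<rho> \<sigma> by (auto simp: psd_def hermitian_def)
  have f: "fpsd (emb g d \<rho>)" "fpsd (emb g d \<sigma>)" using psd_emb c \<rho> \<sigma> by auto
  \<comment> \<open>Every column of \<open>B\<close> is v, so a statement about the kernel vector v
    becomes one about products of square matrices.\<close>
  define B where "B = Matrix.mat d d (\<lambda>(i, j). vec_index v i)"
  have B: "B \<in> carrier_mat d d" by (simp add: B_def)
  have col: "col B j = v" if "j < d" for j using that v by (intro eq_vecI) (auto simp: B_def)
  have mB: "(M * B) $$ (i, j) = vec_index (M *\<^sub>v v) i" if "M \<in> carrier_mat d d" "i < d" "j < d" for M i j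
    using that B by (simp add: col)
  have "\<sigma> * B = 0\<^sub>m d d"
  proof (rule eq_matI)
    fix i j assume "i < dim_row (0\<^sub>m d d :: cmat)" "j < dim_col (0\<^sub>m d d :: cmat)"
    then show "(\<sigma> * B) $$ (i, j) = 0\<^sub>m d d $$ (i, j)" using mB[OF c(2), of i j] z by simp
  qed (use c B in auto)
  then have "emb g d \<sigma> * emb g d B = 0" using emb_mult[OF c(2) B] emb_zero by simp
  then have "pw (emb g d \<sigma>) (- 1) * (pw (emb g d \<sigma>) 1 * emb g d B) = 0" by (simp add: pw_one f)
  then have sB: "sp (emb g d \<sigma>) * emb g d B = 0" by (simp add: pw_add' f)
  have "emb g d \<rho> * sp (emb g d \<sigma>) = emb g d \<rho>" using arg_cong[OF sub, of dg] f by (simp add: fpsd_dg)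
  then have "emb g d \<rho> * emb g d B = 0" using sB by (metis mult.assoc mult_zero_right)
  then have "emb g d (\<rho> * B) = emb g d (0\<^sub>m d d)" using emb_mult[OF c(1) B] emb_zero by simp
  then have "\<rho> * B = 0\<^sub>m d d" using emb_inject[OF g] c(1) B by simp
  then have "vec_index (\<rho> *\<^sub>v v) i = 0" if "i < d" for i
    using mB[OF c(1) that that] that by simp
  then show "\<rho> *\<^sub>v v = 0\<^sub>v d" by (intro eq_vecI) (use c(1) in simp_all)
qed

lemma umegaki_emb:
  assumes \<rho>: "psd d \<rho>" and \<sigma>: "psd d \<sigma>" and sub: "sp (emb g d \<sigma>) * emb g d \<rho> = emb g d \<rho>"
  shows "umegaki d \<rho> \<sigma> = ereal (umegaki_div (emb g d \<rho>) (emb g d \<sigma>))"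
proof -
  have h: "hermitian d \<rho>" "hermitian d \<sigma>" using \<rho> \<sigma> by (auto simp: psd_def)
  then have c: "\<rho> \<in> carrier_mat d d" "\<sigma> \<in> carrier_mat d d" by (auto simp: hermitian_def)
  have f: "fpsd (emb g d \<rho>)" "fpsd (emb g d \<sigma>)" using psd_emb c \<rho> \<sigma> by auto
  have L: "emb g d (mfun logp d M) = lg (emb g d M)" "mfun logp d M \<in> carrier_mat d d"
    if "hermitian d M" "fpsd (emb g d M)" for M
    using mfun_emb[OF that(1), of logp] fc_cong_psd[OF that(2), of "\<lambda>x. complex_of_real (logp x)"]
    by (auto simp: lg_def logp_def)
  note L1 = L[OF h(1) f(1)] and L2 = L[OF h(2) f(2)]
  have "mtrace (\<rho> * (mfun logp d \<rho> - mfun logp d \<sigma>)) = tr (emb g d (\<rho> * (mfun logp d \<rho> - mfun logp d \<sigma>)))"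
    by (rule emb_trace[symmetric], rule mult_carrier_mat[OF c(1)], rule minus_carrier_mat[OF L2(2)])
  also have "\<dots> = tr (emb g d \<rho> * (lg (emb g d \<rho>) - lg (emb g d \<sigma>)))"
    unfolding emb_mult[OF c(1) minus_carrier_mat[OF L2(2)]] emb_minus[OF L1(2) L2(2)] L1(1) L2(1) ..
  finally show ?thesis using supp_le_emb[OF assms] by (simp add: umegaki_def umegaki_div_def)
qed

lemma mfun_powp_emb:
  assumes "psd d M"
  shows "emb g d (mfun (powp r) d M) = pw (emb g d M) (complex_of_real r)" "mfun (powp r) d M \<in> carrier_mat d d"
proof -
  have h: "hermitian d M" and c: "M \<in> carrier_mat d d" using assms by (auto simp: psd_def hermitian_def)
  have f: "fpsd (emb g d M)" using psd_emb c assms by auto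
  show "mfun (powp r) d M \<in> carrier_mat d d" by (rule mfun_emb(2)[OF h]) (simp add: powp_def)
  have "emb g d (mfun (powp r) d M) = fc (\<lambda>x. complex_of_real (powp r x)) (emb g d M)"
    by (rule mfun_emb(1)[OF h]) (simp add: powp_def)
  also have "\<dots> = pw (emb g d M) (complex_of_real r)"
    unfolding pw_real by (rule fc_cong_psd[OF f]) (simp add: powp_def powr_def)
  finally show "emb g d (mfun (powp r) d M) = pw (emb g d M) (complex_of_real r)" .
qed

lemma sandwiched_emb:
  assumes a: "1 < \<alpha>" and \<rho>: "psd d \<rho>" and \<sigma>: "psd d \<sigma>" and sub: "sp (emb g d \<sigma>) * emb g d \<rho> = emb g d \<rho>"
  shows "sandwiched \<alpha> d \<rho> \<sigma> = ereal (sandwiched_div ((\<alpha> - 1) / \<alpha>) (emb g d \<rho>) (emb g d \<sigma>))"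
proof -
  define p where "p = (\<alpha> - 1) / \<alpha>"
  have p: "0 < p" "p < 1" "1 / (1 - p) = \<alpha>" "(1 - \<alpha>) / (2 * \<alpha>) = - (p / 2)" "(1 - p) / p = 1 / (\<alpha> - 1)"
    using a by (simp_all add: p_def field_simps)
  have c: "\<rho> \<in> carrier_mat d d" "\<sigma> \<in> carrier_mat d d" using \<rho> \<sigma> by (auto simp: psd_def hermitian_def)
  have f: "fpsd (emb g d \<rho>)" "fpsd (emb g d \<sigma>)" using psd_emb c \<rho> \<sigma> by auto
  define S where "S = mfun (powp ((1 - \<alpha>) / (2 * \<alpha>))) d \<sigma>"
  have S: "S \<in> carrier_mat d d" "emb g d S = pw (emb g d \<sigma>) (- complex_of_real (p / 2))"
    unfolding S_def p(4) using mfun_powp_emb[OF \<sigma>, of "- (p / 2)"] by simp_all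
  define X where "X = pw (emb g d \<sigma>) (- complex_of_real (p / 2)) * emb g d \<rho> * pw (emb g d \<sigma>) (- complex_of_real (p / 2))"
  have X: "fpsd X" unfolding X_def using fpsd_sandwich[OF f, of "- (p / 2)"] by simp
  have eX: "emb g d (S * \<rho> * S) = X" using S c by (simp add: emb_mult X_def mult.assoc)
  have cX: "S * \<rho> * S \<in> carrier_mat d d" using S c by simp
  have pX: "psd d (S * \<rho> * S)" using psd_emb[OF cX] X eX by simp
  define T where "T = Re (mtrace (mfun (powp \<alpha>) d (S * \<rho> * S)))"
  have T: "T = Re (tr (pw X (complex_of_real \<alpha>)))"
    unfolding T_def using mfun_powp_emb[OF pX, of \<alpha>] emb_trace eX by metis
  have T0: "0 \<le> T" unfolding T by (intro fpsd_tr fpsd_pw X)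
  have "schatten p X = T powr (1 - p)" by (simp only: schatten_def p(3) T)
  \<comment> \<open>For T = 0 both sides are 0, since ln 0 = 0.\<close>
  then have "ln (schatten p X) = (1 - p) * ln T" by (cases "T = 0") (auto simp: ln_powr)
  then have "sandwiched_div p (emb g d \<rho>) (emb g d \<sigma>) = (1 - p) / p * ln T"
    by (simp add: sandwiched_div_def sandwich_norm_def X_def)
  then have "sandwiched_div p (emb g d \<rho>) (emb g d \<sigma>) = 1 / (\<alpha> - 1) * ln T" by (simp only: p(5))
  then show ?thesis
    using supp_le_emb[OF \<rho> \<sigma> sub] by (simp add: sandwiched_def Let_def T_def S_def p_def)
qed

lemma trnorm_emb:
  assumes Y: "Y \<in> carrier_mat d d"
  shows "trnorm d Y = Re (tr (pw (dg (emb g d Y) * emb g d Y) (1 / 2)))"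
proof -
  have dY: "dagger Y \<in> carrier_mat d d" using Y by (simp add: dagger_def)
  have e: "emb g d (dagger Y * Y) = dg (emb g d Y) * emb g d Y" using Y dY by (simp add: emb_mult emb_dagger)
  have c: "dagger Y * Y \<in> carrier_mat d d" using Y dY by simp
  have ps: "psd d (dagger Y * Y)" using psd_emb[OF c] fpsd_dgmult[of "emb g d Y"] e by simp
  then have h: "hermitian d (dagger Y * Y)" by (simp add: psd_def)
  have "pw (dg (emb g d Y) * emb g d Y) (complex_of_real (1 / 2)) = fc (\<lambda>x. complex_of_real (sqrt x)) (emb g d (dagger Y * Y))"
    unfolding pw_real e by (rule fc_cong_psd[OF fpsd_dgmult]) (simp add: powr_half_sqrt[symmetric] powr_def)
  also have "\<dots> = emb g d (mfun sqrt d (dagger Y * Y))" using mfun_emb[OF h, of sqrt] by simp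
  finally show ?thesis unfolding trnorm_def using mfun_emb(2)[OF h, of sqrt] by (simp add: emb_trace)
qed

end

text \<open>With Z = Y* Y the entry is the inner product of E Z^(1/4) and Y Z^(-1/4), where E is a
  matrix unit. Each of the two has squared Hilbert-Schmidt norm at most tr Z^(1/2), the trace
  norm.\<close>

lemma cmod_ent_le_trnorm: "cmod (ent Y k l) \<le> Re (tr (pw (dg Y * Y) (1 / 2)))"
proof -
  define Z where "Z = dg Y * Y"
  have Z: "fpsd Z" unfolding Z_def by (rule fpsd_dgmult)
  define G where "G = Y - Y * sp Z"
  have "dg G * G = Z - Z * sp Z - (sp Z * Z - sp Z * Z * sp Z)"
  proof -
    have "dg Y * (Y * X) = Z * X" for X by (simp add: Z_def mult.assoc)
    then show ?thesis by (simp add: G_def Z algebra_simps flip: Z_def)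
  qed
  then have "dg G * G = 0" by (simp add: Z)
  then have "Y * sp Z = Y" using dg_mult_self_zero[of G] by (simp add: G_def)
  define A where "A = unit k l * pw Z (1 / 4)"
  define B where "B = Y * pw Z (- (1 / 4))"
  have "dg A * A = pw Z (1 / 4) * (unit l l * pw Z (1 / 4))" by (simp add: A_def Z mult.assoc) (simp flip: mult.assoc)
  then have "tr (dg A * A) = tr (unit l l * pw Z (1 / 2))" by (simp add: tr_commute[of "pw Z (1 / 4)"] mult.assoc pw_add Z)
  also have "\<dots> = tr (dg (unit l l) * pw Z (1 / 2) * unit l l)"
    by (simp add: tr_commute[of "unit l l * pw Z (1 / 2)"]) (simp flip: mult.assoc)
  finally have tA: "Re (tr (dg A * A)) \<le> Re (tr (pw Z (1 / 2)))"
    using fpsd_contractive[OF fpsd_pw[OF Z, of "1 / 2"], of "unit l l"] contractive_isometry[of "unit l l" "dg (unit l l)"] by simp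
  have "dg B * B = pw Z (- (1 / 4)) * (Z * pw Z (- (1 / 4)))" by (simp add: B_def Z) (simp add: Z_def mult.assoc)
  also have "\<dots> = pw Z (- (1 / 4)) * (pw Z 1 * pw Z (- (1 / 4)))" by (simp add: pw_one Z)
  also have "\<dots> = pw Z (1 / 2)" by (simp add: pw_add Z)
  finally have tB: "Re (tr (dg B * B)) = Re (tr (pw Z (1 / 2)))" by simp
  have "tr (dg A * B) = tr (pw Z (1 / 4) * (unit l k * Y * pw Z (- (1 / 4))))" by (simp add: A_def B_def Z mult.assoc)
  also have "\<dots> = tr (unit l k * (Y * sp Z))"
    by (subst tr_commute) (simp add: mult.assoc pw_add Z)
  also have "\<dots> = ent Y k l"
  proof -
    have "tr (unit l k * Y) = ent Y k l" by (induct Y rule: fm_induct) (auto simp: distrib_left)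
    then show ?thesis by (simp add: \<open>Y * sp Z = Y\<close>)
  qed
  finally have "2 * cmod (ent Y k l) \<le> Re (tr (pw Z (1 / 2))) + Re (tr (pw Z (1 / 2)))"
    using cmod_tr_cauchy_schwarz[of A B] tA tB by simp
  then show ?thesis by (simp add: Z_def)
qed

subsection \<open>Embedding of amplified maps\<close>

definition blkf :: "'r \<Rightarrow> 'r \<Rightarrow> ('r \<times> 'i) fm \<Rightarrow> 'i fm" where
  "blkf i j = lext (\<lambda>p q. if fst p = i \<and> fst q = j then unit (snd p) (snd q) else 0)"

lemma ent_blkf [simp]: "ent (blkf i j X) m n = ent X (i, m) (j, n)"
proof -
  have "ent (blkf i j X) m n = ent X (i, m) (j, n)"
    unfolding blkf_def by (induct X rule: fm_induct_prod) auto
  then show ?thesis .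
qed

lemma ent_amp:
  fixes X :: "('r \<times> 'i) fm"
  assumes "lin \<Phi>" shows "ent (amp \<Phi> X) (i, k) (j, l) = ent (\<Phi> (blkf i j X)) k l"
proof -
  have b: "blkf i j (unit (a, b) (c, d)) = (if a = i \<and> c = j then unit b d else 0)" for a c and b d :: 'i
    by (simp add: blkf_def)
  have lin: "lin (blkf i j :: ('r \<times> 'i) fm \<Rightarrow> _)" unfolding blkf_def by (rule lin_lext)
  show ?thesis
    by (induct X rule: fm_induct_prod) (auto simp: lin_simps[OF assms] lin_simps[OF lin] b)
qed

text \<open>Splits a concrete index as \<open>idt\<close> does, with the reference as the more
  significant part; \<open>h\<close> labels the inner system, which may itself be a product.\<close>

definition block_index :: "(nat \<Rightarrow> 'i) \<Rightarrow> nat \<Rightarrow> nat \<Rightarrow> nat \<times> 'i" where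
  "block_index h n i = (i div n, h (i mod n))"

lemma less_mult_div: "i < r * n \<Longrightarrow> i div n < r \<and> i mod n < (n::nat)"
  by (metis less_mult_imp_div_less mod_less_divisor mult_0_right not_less_zero neq0_conv)

lemma div_mod_less: "p < r \<Longrightarrow> k < n \<Longrightarrow> p * n + k < r * (n::nat)"
proof -
  assume "p < r" "k < n"
  then have "p * n + k < Suc p * n" by simp
  also have "\<dots> \<le> r * n" using \<open>p < r\<close> by (intro mult_right_mono) auto
  finally show ?thesis .
qed

lemma block_index_apply: "k < n \<Longrightarrow> block_index h n (p * n + k) = (p, h k)"
  by (simp add: block_index_def)

lemma inj_block_index: assumes "inj_on h {..<n}" shows "inj_on (block_index h n) {..<r * n}"
proof (rule inj_onI)
  fix i j assume "i \<in> {..<r * n}" "j \<in> {..<r * n}" and e: "block_index h n i = block_index h n j"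
  then have "i mod n < n" "j mod n < n" using less_mult_div by auto
  then have "i mod n = j mod n" "i div n = j div n"
    using e inj_onD[OF assms] by (auto simp: block_index_def)
  then show "i = j" by (metis div_mult_mod_eq)
qed

lemma block_index_image: "block_index h n ` {..<r * n} = {..<r} \<times> h ` {..<n}"
proof
  show "block_index h n ` {..<r * n} \<subseteq> {..<r} \<times> h ` {..<n}" using less_mult_div by (auto simp: block_index_def)
  show "{..<r} \<times> h ` {..<n} \<subseteq> block_index h n ` {..<r * n}"
  proof
    fix z assume "z \<in> {..<r} \<times> h ` {..<n}"
    then obtain p k where "z = (p, h k)" "p < r" "k < n" by auto
    then show "z \<in> block_index h n ` {..<r * n}"
      by (intro image_eqI[of _ _ "p * n + k"]) (auto simp: block_index_apply div_mod_less)
  qed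
qed

lemma blkf_emb:
  assumes h: "inj_on h {..<n}" and pq: "p < r" "q < r"
  shows "blkf p q (emb (block_index h n) (r * n) X) = emb h n (blk n X p q)"
proof (rule emb_eqI[OF h, symmetric])
  fix k l assume kl: "k < n" "l < n"
  then show "ent (blkf p q (emb (block_index h n) (r * n) X)) (h k) (h l) = blk n X p q $$ (k, l)"
    using ent_emb[OF inj_block_index[OF h], of "p * n + k" r "q * n + l" X] pq
    by (simp add: block_index_apply div_mod_less blk_def)
next
  fix x y assume "x \<notin> h ` {..<n} \<or> y \<notin> h ` {..<n}"
  then show "ent (blkf p q (emb (block_index h n) (r * n) X)) x y = 0"
    using ent_emb_out[of "(p, x)" "block_index h n" "r * n" "(q, y)" X] by (auto simp: block_index_image)
qed

lemma blkf_emb_out: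
  assumes "p \<ge> r \<or> q \<ge> r" shows "blkf p q (emb (block_index h n) (r * n) X) = 0"
proof (rule fm_eqI)
  fix x y
  have "(p, x) \<notin> block_index h n ` {..<r * n} \<or> (q, y) \<notin> block_index h n ` {..<r * n}"
    unfolding block_index_image using assms by auto
  then show "ent (blkf p q (emb (block_index h n) (r * n) X)) x y = ent 0 x y"
    using ent_emb_out by (metis ent_blkf ent_simps(1))
qed

lemma blk_carrier [simp]: "blk n X p q \<in> carrier_mat n n"
  by (simp add: blk_def)

lemma idt_emb:
  assumes h': "inj_on h' {..<n'}" and h: "inj_on h {..<n}" and lin: "lin \<Phi>"
    and \<Phi>: "\<And>Y. Y \<in> carrier_mat n' n' \<Longrightarrow> \<Phi> (emb h' n' Y) = emb h n (N Y)"
  shows "emb (block_index h n) (r * n) (idt r n' n N X) = amp \<Phi> (emb (block_index h' n') (r * n') X)"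
proof (rule emb_eqI[OF inj_block_index[OF h]])
  fix i j assume ij: "i < r * n" "j < r * n"
  note d = less_mult_div[OF ij(1)] less_mult_div[OF ij(2)]
  have "ent (amp \<Phi> (emb (block_index h' n') (r * n') X)) (block_index h n i) (block_index h n j)
      = ent (emb h n (N (blk n' X (i div n) (j div n)))) (h (i mod n)) (h (j mod n))"
    unfolding block_index_def[of h n i] block_index_def[of h n j] using d by (simp add: ent_amp[OF lin] blkf_emb[OF h'] \<Phi>)
  also have "\<dots> = idt r n' n N X $$ (i, j)"
    using d ij by (simp add: ent_emb[OF h] idt_def)
  finally show "ent (amp \<Phi> (emb (block_index h' n') (r * n') X)) (block_index h n i) (block_index h n j) = idt r n' n N X $$ (i, j)" .
next
  fix x y assume out: "x \<notin> block_index h n ` {..<r * n} \<or> y \<notin> block_index h n ` {..<r * n}"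
  obtain p u q v where xy: "x = (p, u)" "y = (q, v)" by (metis surj_pair)
  show "ent (amp \<Phi> (emb (block_index h' n') (r * n') X)) x y = 0"
  proof (cases "p < r \<and> q < r")
    case True
    then show ?thesis using out
      by (auto simp: xy ent_amp[OF lin] blkf_emb[OF h'] \<Phi> block_index_image intro!: ent_emb_out)
  next
    case False
    then show ?thesis by (simp add: xy ent_amp[OF lin] blkf_emb_out not_less lin_zero[OF lin])
  qed
qed

text \<open>The argument is first cut down to the input box. For a linear map the result therefore
  vanishes on units outside the box, as \<open>chan\<close> requires.\<close>

definition lift :: "nat \<Rightarrow> nat \<Rightarrow> qmap \<Rightarrow> nat fm \<Rightarrow> nat fm" where
  "lift a' a N Y = emb id a (N (unemb id a' Y))"

lemma unemb_carrier [simp]: "unemb g d X \<in> carrier_mat d d"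
  by (simp add: unemb_def)

lemma unemb_emb: "inj_on g {..<d} \<Longrightarrow> X \<in> carrier_mat d d \<Longrightarrow> unemb g d (emb g d X) = X"
  by (rule eq_matI) (auto simp: unemb_def ent_emb)

lemma lift_emb: "Y \<in> carrier_mat a' a' \<Longrightarrow> lift a' a N (emb id a' Y) = emb id a (N Y)"
  by (simp add: lift_def unemb_emb)

lemma unemb_add: "unemb g d (X + Y) = unemb g d X + unemb g d Y"
  by (rule eq_matI) (auto simp: unemb_def)

lemma unemb_cs: "unemb g d (c *\<^sub>c X) = c \<cdot>\<^sub>m unemb g d X"
  by (rule eq_matI) (auto simp: unemb_def)

lemma lin_lift:
  assumes "Defs.linear_map a' a N" shows "lin (lift a' a N)"
  by (rule linI)
    (use assms in \<open>simp_all add: lift_def unemb_add unemb_cs Defs.linear_map_def emb_add emb_smult\<close>)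

lemma idt_lift:
  assumes "lin (lift a' a N)"
  shows "emb (block_index id a) (r * a) (idt r a' a N X) = amp (lift a' a N) (emb (block_index id a') (r * a') X)"
  by (rule idt_emb[OF _ _ assms]) (auto simp: lift_emb)

lemma idt_carrier [simp]: "idt r a' a N X \<in> carrier_mat (r * a) (r * a)"
  by (simp add: idt_def)

lemma inj_block_index_id: "inj_on (block_index id n) {..<r * n}"
  by (rule inj_block_index) simp

lemma input_supported_emb: "input_supported n (emb (block_index id n) (r * n) X)"
  unfolding input_supported_iff using ent_emb_out[of _ "block_index id n" "r * n" _ X]
  by (auto simp: block_index_image split_paired_all)

text \<open>Finite support bounds the reference labels, so an input over the infinite reference
  \<open>nat\<close> is one over a reference of some finite dimension r.\<close>

lemma unemb_fm:
  fixes \<psi> :: "(nat \<times> 'i) fm"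
  assumes h: "inj_on h {..<n}" and s: "\<And>p q. ent \<psi> p q \<noteq> 0 \<Longrightarrow> snd p \<in> h ` {..<n} \<and> snd q \<in> h ` {..<n}"
  obtains r M where "M \<in> carrier_mat (r * n) (r * n)" "emb (block_index h n) (r * n) M = \<psi>"
proof -
  obtain R S where b: "finite R" "finite S"
    "\<And>p q. ent \<psi> p q \<noteq> 0 \<Longrightarrow> fst p \<in> R \<and> fst q \<in> R \<and> snd p \<in> S \<and> snd q \<in> S" by (rule fst_box) blast
  define r where "r = Suc (Max (insert 0 R))"
  have R: "x < r" if "x \<in> R" for x using that b(1) by (simp add: r_def less_Suc_eq_le)
  have "emb (block_index h n) (r * n) (unemb (block_index h n) (r * n) \<psi>) = \<psi>"
  proof (rule emb_unemb[OF inj_block_index[OF h]])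
    fix x y assume "x \<notin> block_index h n ` {..<r * n} \<or> y \<notin> block_index h n ` {..<r * n}"
    then show "ent \<psi> x y = 0" using b(3)[of x y] s[of x y] R unfolding block_index_image by (cases x; cases y) auto
  qed
  then show ?thesis by (rule that[OF unemb_carrier])
qed

lemma chan_lift:
  assumes c: "channel a' a N" shows "chan a' a (lift a' a N)"
proof -
  have lm: "Defs.linear_map a' a N" and cp: "\<And>r X. psd (r * a') X \<Longrightarrow> psd (r * a) (idt r a' a N X)"
    and tp: "\<And>X. X \<in> carrier_mat a' a' \<Longrightarrow> mtrace (N X) = mtrace X"
    using c by (auto simp: channel_def)
  have car: "N X \<in> carrier_mat a a" if "X \<in> carrier_mat a' a'" for X using lm that by (simp add: Defs.linear_map_def)
  note lin = lin_lift[OF lm]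
  define \<Phi> where "\<Phi> = lift a' a N"
  have zero: "\<Phi> (unit i j) = 0" if "\<not> (i < a' \<and> j < a')" for i j
  proof -
    have "unemb id a' (unit i j) = unemb id a' 0"
      by (rule eq_matI) (use that in \<open>auto simp: unemb_def\<close>)
    then show ?thesis using lin_zero[OF lin] by (simp add: \<Phi>_def lift_def)
  qed
  have out: "one {..<a} * \<Phi> X = \<Phi> X \<and> \<Phi> X * one {..<a} = \<Phi> X" for X
    using emb_mult_one[of id a] by (simp add: \<Phi>_def lift_def)
  have tr: "tr (\<Phi> X) = tr (one {..<a'} * X)" for X
  proof -
    have "tr (\<Phi> X) = mtrace (unemb id a' X)"
      using car tp by (simp add: \<Phi>_def lift_def emb_trace)
    also have "\<dots> = (\<Sum>i<a'. ent X i i)" by (simp add: mtrace_def unemb_def)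
    also have "\<dots> = tr (one {..<a'} * X)"
      by (subst tr_ent[of "{..<a'}"]) (auto simp: ent_one_mult split: if_splits)
    finally show ?thesis .
  qed
  have cpf: "fpsd (amp \<Phi> X)" if X: "fpsd X" for X :: "(nat \<times> nat) fm"
  proof -
    obtain R S where b: "finite R" "finite S"
      "\<And>p q. ent X p q \<noteq> 0 \<Longrightarrow> fst p \<in> R \<and> fst q \<in> R \<and> snd p \<in> S \<and> snd q \<in> S" by (rule fst_box) blast
    define E :: "(nat \<times> nat) fm" where "E = one R \<star> one {..<a'}"
    have dE: "dg E = E" by (simp add: E_def)
    \<comment> \<open>The map vanishes off its input box, so \<open>X\<close> may be compressed to
      it; the compression comes from a concrete positive matrix, to which the assumption on
      \<open>N\<close> applies.\<close>
    have e: "amp \<Phi> X = amp \<Phi> (E * X * E)"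
    proof (rule fm_box_induct[OF b(1,3,2), where f = "amp \<Phi>" and g = "\<lambda>X. amp \<Phi> (E * X * E)"])
      fix i j k l assume "i \<in> R" "j \<in> R" "k \<in> S" "l \<in> S"
      then have "E * unit (i, k) (j, l) * E = (if k < a' \<and> l < a' then unit (i, k) (j, l) else 0)"
        using b(1) by (simp add: E_def flip: tn_unit)
      then show "amp \<Phi> (unit (i, k) (j, l)) = amp \<Phi> (E * unit (i, k) (j, l) * E)"
        using zero[of k l] by auto
    qed (auto intro!: linI simp: lin_amp distrib_left distrib_right)
    have pE: "fpsd (E * X * E)" using fpsd_conj[OF X, of E] by (simp add: dE)
    have sE: "snd p \<in> id ` {..<a'} \<and> snd q \<in> id ` {..<a'}" if "ent (E * X * E) p q \<noteq> 0" for p q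
    proof -
      have l: "snd p < a'" if nz: "ent (E * Y) p q \<noteq> 0" for Y p q
      proof (rule ccontr)
        assume "\<not> snd p < a'"
        moreover have "ent (E * Y) p q = (\<Sum>t\<in>R \<times> {..<a'}. ent E p t * ent Y t q)"
          by (rule ent_mult) (use b(1) in \<open>auto simp: E_def ent_one split: if_splits\<close>)
        ultimately show False using nz by (cases p) (auto simp: E_def ent_one intro!: sum.neutral)
      qed
      have "ent (E * (X * E)) p q \<noteq> 0" "ent (E * (dg X * E)) q p \<noteq> 0"
        using that ent_simps(7)[of "E * X * E" q p] by (auto simp: mult.assoc dE)
      from l[OF this(1)] l[OF this(2)] show ?thesis by simp
    qed
    obtain r M where M: "M \<in> carrier_mat (r * a') (r * a')" "emb (block_index id a') (r * a') M = E * X * E"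
      by (rule unemb_fm[of id a' "E * X * E"]) (use sE in auto)
    have "psd (r * a') M" using psd_emb[OF inj_block_index_id M(1)] M(2) pE by simp
    then have "psd (r * a) (idt r a' a N M)" by (rule cp)
    then have "fpsd (emb (block_index id a) (r * a) (idt r a' a N M))" using psd_emb[OF inj_block_index_id idt_carrier] by simp
    then have "fpsd (amp \<Phi> (E * X * E))" unfolding idt_lift[OF lin] M(2) \<Phi>_def .
    then show ?thesis unfolding e .
  qed
  show ?thesis unfolding chan_def \<Phi>_def[symmetric] using lin zero out tr cpf by (simp add: \<Phi>_def)
qed

lemma state_emb:
  assumes "is_state (r * n) \<psi>" "inj_on h {..<n}"
  shows "fpsd (emb (block_index h n) (r * n) \<psi>)" "tr (emb (block_index h n) (r * n) \<psi>) = 1"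
proof -
  have c: "\<psi> \<in> carrier_mat (r * n) (r * n)" using assms(1) by (simp add: is_state_def psd_def hermitian_def)
  show "fpsd (emb (block_index h n) (r * n) \<psi>)" "tr (emb (block_index h n) (r * n) \<psi>) = 1"
    using assms(1) psd_emb[OF inj_block_index[OF assms(2)] c] emb_trace[OF inj_block_index[OF assms(2)] c] by (auto simp: is_state_def)
qed

lemma state_emb_input_state: "is_state (r * n) \<psi> \<Longrightarrow> input_state n (emb (block_index id n) (r * n) \<psi>)"
  using state_emb[of r n \<psi> id] input_supported_emb by (simp add: input_state_def)

lemma state_unemb:
  fixes \<psi> :: "(nat \<times> 'i) fm"
  assumes h: "inj_on h {..<n}" and s: "\<And>p q. ent \<psi> p q \<noteq> 0 \<Longrightarrow> snd p \<in> h ` {..<n} \<and> snd q \<in> h ` {..<n}"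
    and \<psi>: "fpsd \<psi>" "tr \<psi> = 1"
  obtains r M where "is_state (r * n) M" "emb (block_index h n) (r * n) M = \<psi>"
proof -
  obtain r M where M: "M \<in> carrier_mat (r * n) (r * n)" "emb (block_index h n) (r * n) M = \<psi>"
    by (rule unemb_fm[OF h, of \<psi>]) (use s in blast)+
  then have "is_state (r * n) M"
    using psd_emb[OF inj_block_index[OF h] M(1)] emb_trace[OF inj_block_index[OF h] M(1)] \<psi> by (simp add: is_state_def)
  then show ?thesis using that M(2) by blast
qed

subsection \<open>Thermal states\<close>

lemma emb_gibbs_family:
  fixes \<beta> :: real
  assumes g: "inj_on g {..<d}" and H: "hermitian d H"
    and t: "sdec (emb g d H) J m Q" "(\<Sum>j\<in>J. Q j) = one (g ` {..<d})"
  defines "E \<equiv> \<Sum>j\<in>J. (exp (- \<beta> * m j)) *\<^sub>r Q j"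
  shows "emb g d (gibbs \<beta> d H) = (1 / tr E) *\<^sub>c E" "gibbs \<beta> d H \<in> carrier_mat d d"
proof -
  have c: "mfun (\<lambda>x. exp (- \<beta> * x)) d H \<in> carrier_mat d d"
    using mfun_emb_family[OF g H] by metis
  then show "gibbs \<beta> d H \<in> carrier_mat d d" by (simp add: gibbs_def Let_def)
  have "emb g d (mfun (\<lambda>x. exp (- \<beta> * x)) d H) = E" unfolding E_def by (rule mfun_emb_full[OF g H t])
  then show "emb g d (gibbs \<beta> d H) = (1 / tr E) *\<^sub>c E"
    unfolding gibbs_def Let_def emb_smult[OF g c] emb_trace[OF g c, symmetric] by simp
qed

lemma faithful_state_gibbs:
  assumes "hamiltonian a H" shows "faithful_state a (emb id a (gibbs \<beta> a H))"
proof -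
  have H: "hermitian a H" "1 \<le> a" using assms by (auto simp: hamiltonian_def)
  have i: "inj_on id {..<a}" by simp
  obtain m Q where t: "sdec (emb id a H) {..<a} m Q" "(\<Sum>k<a. Q k) = one (id ` {..<a})"
    using mfun_emb_family[OF i H(1)] by metis
  define w where "w k = exp (- \<beta> * m k)" for k
  define E where "E = (\<Sum>j<a. (w j) *\<^sub>r Q j)"
  have sE: "sdec E {..<a} w Q" using t(1) by (auto simp: sdec_def E_def)
  have pQ: "fpsd (Q k)" if "k < a" for k
    using sdecD(2,3)[OF t(1)] that by (intro fpsd_proj) auto
  have trQ: "(\<Sum>k<a. Re (tr (Q k))) = real a" using arg_cong[OF t(2), of "\<lambda>X. Re (tr X)"] by simp
  have E: "fpsd E" by (rule fpsd_sdecI[OF sE]) (simp add: w_def)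
  define Z where "Z = Re (tr E)"
  have trE: "tr E = complex_of_real Z" unfolding Z_def using fpsd_tr_eq_Re[OF E] .
  have Z0: "0 < Z"
  proof (rule ccontr)
    assume "\<not> 0 < Z"
    then have "E = 0" using fpsd_tr_zero[OF E] fpsd_tr[OF E] by (simp add: Z_def)
    have "(w k) *\<^sub>r Q k = 0" if "k < a" for k
      using sdec_mult_proj(1)[OF sE, of k] that \<open>E = 0\<close> by simp
    then have "(1 / complex_of_real (w k)) *\<^sub>c ((w k) *\<^sub>r Q k) = 0" if "k < a" for k
      using that by simp
    then have "Q k = 0" if "k < a" for k using that by (simp add: cs_cs w_def)
    then show False using trQ H(2) by simp
  qed
  define \<gamma> where "\<gamma> = emb id a (gibbs \<beta> a H)"
  have g: "\<gamma> = (1 / Z) *\<^sub>r E"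
    unfolding \<gamma>_def using emb_gibbs_family(1)[OF i H(1) t, of \<beta>] trE by (simp add: E_def w_def)
  have sg: "sdec \<gamma> {..<a} (\<lambda>k. 1 / Z * w k) Q" unfolding g by (rule sdec_cs[OF sE])
  have pos: "0 < 1 / Z * w k" for k using Z0 by (simp add: w_def)
  have "fpsd \<gamma>" by (rule fpsd_sdecI[OF sg]) (use pos less_imp_le in blast)
  moreover have "tr \<gamma> = 1" using Z0 by (simp add: g trE)
  moreover have "sp \<gamma> = one {..<a}"
  proof -
    have "sp \<gamma> = (\<Sum>k<a. Q k)"
      unfolding pw_def fc_sdec[OF sg] using pos by (intro sum.cong) (auto simp: on_nonzero_def w_def Z0 less_imp_neq[OF Z0, symmetric])
    then show ?thesis using t(2) by simp
  qed
  moreover have "\<exists>c>0. fpsd (\<gamma> - c *\<^sub>r one {..<a})"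
  proof -
    \<comment> \<open>The smallest Gibbs weight; it is positive because there are finitely many
      weights.\<close>
    define c where "c = Min ((\<lambda>k. 1 / Z * w k) ` {..<a})"
    have ne: "(\<lambda>k. 1 / Z * w k) ` {..<a} \<noteq> {}" 
    proof -
      have "0 \<in> {..<a}" using H(2) by simp
      then show ?thesis by blast
    qed
    have c0: "0 < c" unfolding c_def using ne pos by (subst Min_gr_iff) auto
    have cl: "c \<le> 1 / Z * w k" if "k < a" for k unfolding c_def using that by (intro Min_le) auto
    have "\<gamma> - c *\<^sub>r one {..<a} = (\<Sum>k<a. (1 / Z * w k - c) *\<^sub>r Q k)"
      using sdecD(4)[OF sg] t(2) by (simp add: cs_diff_left sum_subtractf cs_sum_right[symmetric])
    also have "fpsd \<dots>" using cl pQ by (intro fpsd_sum fpsd_cs) auto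
    finally show ?thesis using c0 by blast
  qed
  ultimately show ?thesis by (simp add: faithful_state_def \<gamma>_def)
qed

lemma one_times: "finite S \<Longrightarrow> finite T \<Longrightarrow> one S \<star> one T = one (S \<times> T)"
  by (rule fm_eqI) (auto simp: ent_one split: prod.splits if_splits)

lemma emb_kron:
  assumes "A \<in> carrier_mat n n" "B \<in> carrier_mat m m"
  shows "emb (block_index id m) (n * m) (kron A B) = emb id n A \<star> emb id m B"
proof (rule emb_eqI[OF inj_block_index_id])
  fix i j assume ij: "i < n * m" "j < n * m"
  then show "ent (emb id n A \<star> emb id m B) (block_index id m i) (block_index id m j) = kron A B $$ (i, j)"
    using less_mult_div[OF ij(1)] less_mult_div[OF ij(2)] assms
      ent_emb[of id n "i div m" "j div m" A] ent_emb[of id m "i mod m" "j mod m" B]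
    by (simp add: block_index_def kron_def)
next
  fix x y assume "x \<notin> block_index id m ` {..<n * m} \<or> y \<notin> block_index id m ` {..<n * m}"
  then show "ent (emb id n A \<star> emb id m B) x y = 0"
    using ent_emb_out[of _ id n _ A] ent_emb_out[of _ id m _ B] by (cases x; cases y) (auto simp: block_index_image)
qed

lemma kron_carrier [simp]:
  "A \<in> carrier_mat n n \<Longrightarrow> B \<in> carrier_mat m m \<Longrightarrow> kron A B \<in> carrier_mat (n * m) (n * m)"
  by (intro carrier_matI) (simp_all add: kron_def)

text \<open>The products Q k \<star> P j form a complete spectral family of the total Hamiltonian
  with eigenvalues m k + n j, and the exponential turns these sums into products.\<close>

lemma gibbs_kron:
  assumes H1: "hermitian a1 H1" and H2: "hermitian a2 H2"
  shows "emb (block_index id a2) (a1 * a2) (gibbs \<beta> (a1 * a2) (kron H1 (1\<^sub>m a2) + kron (1\<^sub>m a1) H2))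
    = emb id a1 (gibbs \<beta> a1 H1) \<star> emb id a2 (gibbs \<beta> a2 H2)"
    "hermitian (a1 * a2) (kron H1 (1\<^sub>m a2) + kron (1\<^sub>m a1) H2)"
    "gibbs \<beta> (a1 * a2) (kron H1 (1\<^sub>m a2) + kron (1\<^sub>m a1) H2) \<in> carrier_mat (a1 * a2) (a1 * a2)"
proof -
  define H where "H = kron H1 (1\<^sub>m a2) + kron (1\<^sub>m a1) H2"
  have c: "H1 \<in> carrier_mat a1 a1" "H2 \<in> carrier_mat a2 a2" using H1 H2 by (auto simp: hermitian_def)
  have cH: "H \<in> carrier_mat (a1 * a2) (a1 * a2)" unfolding H_def using c by simp
  have i: "inj_on id {..<a}" for a :: nat by simp
  obtain m Q where t: "sdec (emb id a1 H1) {..<a1} m Q" "(\<Sum>k<a1. Q k) = one (id ` {..<a1})"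
    using mfun_emb_family[OF i H1] by metis
  obtain n P where u: "sdec (emb id a2 H2) {..<a2} n P" "(\<Sum>k<a2. P k) = one (id ` {..<a2})"
    using mfun_emb_family[OF i H2] by metis
  have eH: "emb (block_index id a2) (a1 * a2) H = emb id a1 H1 \<star> one {..<a2} + one {..<a1} \<star> emb id a2 H2"
    unfolding H_def using c by (simp add: emb_add[OF inj_block_index_id] emb_kron emb_one)
  have "dg (emb (block_index id a2) (a1 * a2) H) = emb (block_index id a2) (a1 * a2) H"
    unfolding eH by (simp add: sdec_hermitian[OF t(1)] sdec_hermitian[OF u(1)])
  then have "emb (block_index id a2) (a1 * a2) (dagger H) = emb (block_index id a2) (a1 * a2) H"
    by (simp add: emb_dagger[OF inj_block_index_id cH])
  then have "dagger H = H" using emb_inject[OF inj_block_index_id _ cH] cH by (simp add: dagger_def)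
  then show hH: "hermitian (a1 * a2) (kron H1 (1\<^sub>m a2) + kron (1\<^sub>m a1) H2)"
    using cH by (simp add: hermitian_def H_def)
  define J where "J = {..<a1} \<times> {..<a2}"
  define R where "R = (\<lambda>(k, j). Q k \<star> P j)"
  define s where "s = (\<lambda>(k, j). m k + n j)"
  have sumR: "(\<Sum>z\<in>J. R z) = one (block_index id a2 ` {..<a1 * a2})"
  proof -
    have "(\<Sum>z\<in>J. R z) = (\<Sum>k<a1. Q k) \<star> (\<Sum>j<a2. P j)"
      by (simp add: J_def R_def sum.cartesian_product'[symmetric] sum.cartesian_product' sum.swap[of _ "{..<a2}"])
    then show ?thesis using t(2) u(2) by (simp add: one_times block_index_image)
  qed
  have dec: "sdec (emb (block_index id a2) (a1 * a2) H) J s R"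
  proof -
    have "emb (block_index id a2) (a1 * a2) H
        = (\<Sum>k<a1. (m k) *\<^sub>r Q k) \<star> (\<Sum>j<a2. P j) + (\<Sum>k<a1. Q k) \<star> (\<Sum>j<a2. (n j) *\<^sub>r P j)"
      unfolding eH using sdecD(4)[OF t(1)] sdecD(4)[OF u(1)] t(2) u(2) by simp
    also have "\<dots> = (\<Sum>k<a1. \<Sum>j<a2. (m k + n j) *\<^sub>r (Q k \<star> P j))"
      by (simp add: cs_add_left sum.distrib cs_sum_right sum.swap[of _ "{..<a1}"])
    finally have e: "emb (block_index id a2) (a1 * a2) H = (\<Sum>z\<in>J. (s z) *\<^sub>r R z)"
      by (simp add: J_def R_def s_def sum.cartesian_product')
    show ?thesis unfolding sdec_def
    proof (intro conjI)
      show "finite J" by (simp add: J_def)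
      show "\<forall>k\<in>J. dg (R k) = R k" using sdecD(2)[OF t(1)] sdecD(2)[OF u(1)] by (auto simp: J_def R_def)
      show "\<forall>k\<in>J. \<forall>j\<in>J. R k * R j = (if k = j then R k else 0)"
        using sdecD(3)[OF t(1)] sdecD(3)[OF u(1)] by (auto simp: J_def R_def)
    qed (rule e)
  qed
  show "gibbs \<beta> (a1 * a2) (kron H1 (1\<^sub>m a2) + kron (1\<^sub>m a1) H2) \<in> carrier_mat (a1 * a2) (a1 * a2)"
    by (rule emb_gibbs_family(2)[OF inj_block_index_id hH dec[unfolded H_def] sumR])
  define E1 where "E1 = (\<Sum>j<a1. (exp (- \<beta> * m j)) *\<^sub>r Q j)"
  define E2 where "E2 = (\<Sum>j<a2. (exp (- \<beta> * n j)) *\<^sub>r P j)"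
  have "(\<Sum>z\<in>J. (exp (- \<beta> * s z)) *\<^sub>r R z) = E1 \<star> E2"
    unfolding J_def R_def s_def sum.cartesian_product' E1_def E2_def
    by (simp add: cs_sum_right cs_cs algebra_simps exp_add exp_diff exp_minus inverse_eq_divide)
      (subst sum.swap, simp)
  from emb_gibbs_family(1)[OF inj_block_index_id hH dec[unfolded H_def] sumR, of \<beta>, unfolded this]
  show "emb (block_index id a2) (a1 * a2) (gibbs \<beta> (a1 * a2) (kron H1 (1\<^sub>m a2) + kron (1\<^sub>m a1) H2))
    = emb id a1 (gibbs \<beta> a1 H1) \<star> emb id a2 (gibbs \<beta> a2 H2)"
    unfolding emb_gibbs_family(1)[OF i H1 t, of \<beta>, folded E1_def] emb_gibbs_family(1)[OF i H2 u, of \<beta>, folded E2_def]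
    by (simp add: cs_cs mult.commute)
qed

section \<open>The channel divergences\<close>

text \<open>\<open>None\<close> stands for the Umegaki divergence, \<open>Some p\<close> for the sandwiched divergence of order
  \<open>\<alpha> = 1 / (1 - p)\<close>.\<close>
definition matrix_div :: "real option \<Rightarrow> sdiv" where
  "matrix_div z = (case z of None \<Rightarrow> umegaki | Some p \<Rightarrow> sandwiched (1 / (1 - p)))"

definition fm_div :: "real option \<Rightarrow> 'i fm \<Rightarrow> 'i fm \<Rightarrow> real" where
  "fm_div z \<rho> \<sigma> = (case z of None \<Rightarrow> umegaki_div \<rho> \<sigma> | Some p \<Rightarrow> sandwiched_div p \<rho> \<sigma>)"

definition admissible :: "real option \<Rightarrow> bool" where
  "admissible z \<longleftrightarrow> (\<forall>p. z = Some p \<longrightarrow> 0 < p \<and> p < 1)"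

definition state_pair :: "'i fm \<Rightarrow> 'i fm \<Rightarrow> bool" where
  "state_pair \<rho> \<sigma> \<longleftrightarrow> fpsd \<rho> \<and> tr \<rho> = 1 \<and> fpsd \<sigma> \<and> tr \<sigma> = 1 \<and> sp \<sigma> * \<rho> = \<rho>"

lemma admissible_cases:
  assumes "admissible z" obtains "z = None" | p where "z = Some p" "0 < p" "p < 1"
  using assms by (cases z) (auto simp: admissible_def)

lemma matrix_div_emb:
  assumes z: "admissible z" and g: "inj_on g {..<d}" and "psd d \<rho>" "psd d \<sigma>"
    "sp (emb g d \<sigma>) * emb g d \<rho> = emb g d \<rho>"
  shows "matrix_div z d \<rho> \<sigma> = ereal (fm_div z (emb g d \<rho>) (emb g d \<sigma>))"
  using z
proof (cases rule: admissible_cases)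
  case 1
  then show ?thesis using umegaki_emb[OF g assms(3-5)] by (simp add: matrix_div_def fm_div_def)
next
  case (2 p)
  have "1 < 1 / (1 - p)" "(1 / (1 - p) - 1) / (1 / (1 - p)) = p" using 2 by (simp_all add: field_simps)
  then show ?thesis using sandwiched_emb[OF g _ assms(3-5), of "1 / (1 - p)"] 2 by (simp add: matrix_div_def fm_div_def)
qed

lemma fm_div_nonneg: "admissible z \<Longrightarrow> state_pair \<rho> \<sigma> \<Longrightarrow> 0 \<le> fm_div z \<rho> \<sigma>"
  by (erule admissible_cases) (auto simp: fm_div_def state_pair_def intro: umegaki_div_nonneg sandwiched_div_nonneg)

lemma fm_div_eq_0: "admissible z \<Longrightarrow> state_pair \<rho> \<sigma> \<Longrightarrow> fm_div z \<rho> \<sigma> = 0 \<longleftrightarrow> \<rho> = \<sigma>"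
  by (erule admissible_cases) (simp_all add: fm_div_def state_pair_def umegaki_div_nonneg(2) sandwiched_div_nonneg(2))

lemma fm_div_reix: "inj e \<Longrightarrow> fpsd \<rho> \<Longrightarrow> fpsd \<sigma> \<Longrightarrow> fm_div z (reix e \<rho>) (reix e \<sigma>) = fm_div z \<rho> \<sigma>"
  by (simp add: fm_div_def umegaki_div_reix sandwiched_div_def sandwich_norm_reix split: option.split)

lemma state_pair_self: "fpsd \<sigma> \<Longrightarrow> tr \<sigma> = 1 \<Longrightarrow> state_pair \<sigma> \<sigma>"
  by (simp add: state_pair_def)

lemma fm_div_tn:
  assumes z: "admissible z" and 1: "state_pair A C" and 2: "state_pair B D" shows "fm_div z (A \<star> B) (C \<star> D) = fm_div z A C + fm_div z B D"
  using z
proof (cases rule: admissible_cases)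
  case 1
  then show ?thesis using assms umegaki_div_tn[of A B C D] by (simp add: fm_div_def state_pair_def)
next
  case (2 p)
  have "1 \<le> sandwich_norm p A C" "1 \<le> sandwich_norm p B D" using sandwich_norm_ge_1(1)[of A C p] sandwich_norm_ge_1(1)[of B D p] assms(2,3) 2 by (auto simp: state_pair_def)
  then have "ln (sandwich_norm p A C * sandwich_norm p B D) = ln (sandwich_norm p A C) + ln (sandwich_norm p B D)" by (intro ln_mult_pos) auto
  then show ?thesis using assms(2,3) sandwich_norm_tn[of A B C D p] 2 by (simp add: fm_div_def sandwiched_div_def state_pair_def add_divide_distrib)
qed

lemma fm_div_bounded:
  assumes z: "admissible z" and C: "0 < C"
  obtains K where "\<And>\<rho> \<sigma> :: 'i fm. state_pair \<rho> \<sigma> \<Longrightarrow> fpsd (C *\<^sub>r \<sigma> - \<rho>) \<Longrightarrow> fm_div z \<rho> \<sigma> \<le> K"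
  using z
proof (cases rule: admissible_cases)
  case 1
  then show ?thesis using that[of "ln C"] umegaki_div_bounded C by (auto simp: fm_div_def state_pair_def)
next
  case (2 p)
  then show ?thesis using that[of "ln C / p"] sandwiched_div_bounded[of p] C by (auto simp: fm_div_def state_pair_def)
qed

definition modulus :: "real option \<Rightarrow> real \<Rightarrow> real" where
  "modulus z \<delta> = (case z of None \<Rightarrow> \<delta> + \<delta>\<^sup>2 - \<delta> * ln \<delta> | Some p \<Rightarrow> \<delta> / p)"

lemma fm_div_continuity:
  assumes "admissible z" "state_pair \<rho> \<sigma>" "state_pair \<eta> \<sigma>" "0 < \<delta>" "fpsd (\<eta> + \<delta> *\<^sub>r \<sigma> - \<rho>)"
  shows "fm_div z \<rho> \<sigma> \<le> fm_div z \<eta> \<sigma> + modulus z \<delta>"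
  using assms(1)
proof (cases rule: admissible_cases)
  case 1
  then show ?thesis using umegaki_div_continuity[of \<rho> \<sigma> \<eta> \<delta>] assms by (simp add: fm_div_def state_pair_def modulus_def)
next
  case (2 p)
  then show ?thesis using sandwiched_div_continuity[of p \<rho> \<sigma> \<eta> \<delta>] assms by (simp add: fm_div_def state_pair_def modulus_def)
qed

lemma modulus_limit:
  assumes "admissible z" "0 < K" shows "((\<lambda>\<epsilon>. modulus z (K * \<epsilon>)) \<longlongrightarrow> 0) (at_right 0)"
  using assms(1)
proof (cases rule: admissible_cases)
  case 1
  have "((\<lambda>\<epsilon>. K * \<epsilon> + (K * \<epsilon>)\<^sup>2 - K * \<epsilon> * ln (K * \<epsilon>)) \<longlongrightarrow> 0) (at_right 0)"
    using assms(2) by real_asymp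
  then show ?thesis using 1 by (simp add: modulus_def)
next
  case (2 p)
  have "((\<lambda>\<epsilon>. K * \<epsilon> / p) \<longlongrightarrow> K * 0 / p) (at_right 0)" using 2 by (intro tendsto_intros) auto
  then show ?thesis using 2 by (simp add: modulus_def)
qed

lemma fm_div_dpi:
  assumes z: "admissible z" and s: "schwarz_map \<Phi>" and d: "state_pair \<rho> \<sigma>" "state_pair (\<Phi> \<rho>) (\<Phi> \<sigma>)"
    and tp: "\<And>Z. tr (\<Phi> (\<rho> * Z)) = tr (\<rho> * Z)"
  shows "fm_div z (\<Phi> \<rho>) (\<Phi> \<sigma>) \<le> fm_div z \<rho> \<sigma>"
  using z
proof (cases rule: admissible_cases)
  case 1
  then show ?thesis using umegaki_dpi[OF s _ _ _ _ tp] d by (simp add: fm_div_def state_pair_def)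
next
  case (2 p)
  have "sandwich_norm p (\<Phi> \<rho>) (\<Phi> \<sigma>) \<le> sandwich_norm p \<rho> \<sigma>" using sandwiched_dpi[OF s] d 2 by (simp add: state_pair_def)
  moreover have "1 \<le> sandwich_norm p (\<Phi> \<rho>) (\<Phi> \<sigma>)" using sandwich_norm_ge_1(1)[of "\<Phi> \<rho>" "\<Phi> \<sigma>" p] d 2 by (simp add: state_pair_def)
  ultimately show ?thesis using 2 by (simp add: fm_div_def sandwiched_div_def divide_right_mono)
qed

lemma chan_state_pair:
  fixes \<psi> :: "('r::countable \<times> nat) fm"
  assumes "chan a' a N" "faithful_state a \<gamma>" "input_state a' \<psi>" shows "state_pair (amp N \<psi>) (ptr \<psi> \<star> \<gamma>)"
  using chan_state[OF assms] by (simp add: state_pair_def)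

lemma ln_le_iff_exp: "1 \<le> x \<Longrightarrow> ln x \<le> c \<longleftrightarrow> x \<le> exp (c :: real)"
  using exp_le_cancel_iff[of "ln x" c] by simp

text \<open>The bound is assumed for all inputs with this reference, since in the sandwiched case it
  is applied to a renormalised input rather than to \<phi> itself.\<close>

lemma fm_div_chain:
  fixes \<phi> :: "('s::countable \<times> nat) fm"
  assumes z: "admissible z" and N: "chan a' a N" and \<phi>: "input_state a' \<phi>" and \<eta>: "state_pair (ptr \<phi>) \<eta>" and \<gamma>: "faithful_state a \<gamma>"
    and bound: "\<And>\<phi> :: ('s \<times> nat) fm. input_state a' \<phi> \<Longrightarrow> fm_div z (amp N \<phi>) (ptr \<phi> \<star> \<gamma>) \<le> b"
  shows "fm_div z (amp N \<phi>) (\<eta> \<star> \<gamma>) \<le> b + fm_div z (ptr \<phi>) \<eta>"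
proof -
  have p: "ptr (amp N \<phi>) = ptr \<phi>" by (rule ptr_amp[OF N input_stateD(3)[OF \<phi>]])
  have e: "fpsd \<eta>" "sp \<eta> * ptr \<phi> = ptr \<phi>" using \<eta> by (auto simp: state_pair_def)
  show ?thesis
    using z
  proof (cases rule: admissible_cases)
    case 1
    have "umegaki_div (amp N \<phi>) (\<eta> \<star> \<gamma>) = umegaki_div (amp N \<phi>) (ptr \<phi> \<star> \<gamma>) + umegaki_div (ptr \<phi>) \<eta>"
      using umegaki_div_chain[OF amp_fpsd[OF N input_stateD(1)[OF \<phi>]] input_supported_amp[OF N] e(1) _ \<gamma>] e(2) by (simp add: p)
    then show ?thesis using bound[OF \<phi>] 1 by (simp add: fm_div_def)
  next
    case (2 p)
    have ex: "sandwich_norm p (amp N \<phi>) (ptr \<phi> \<star> \<gamma>) \<le> exp (p * b)" if "input_state a' \<phi>" for \<phi> :: "('s \<times> nat) fm"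
    proof -
      have "1 \<le> sandwich_norm p (amp N \<phi>) (ptr \<phi> \<star> \<gamma>)"
        using chan_state_pair[OF N \<gamma> that] 2 by (auto simp: state_pair_def intro: sandwich_norm_ge_1(1))
      moreover have "ln (sandwich_norm p (amp N \<phi>) (ptr \<phi> \<star> \<gamma>)) \<le> p * b"
        using bound[OF that] 2 by (simp add: fm_div_def sandwiched_div_def divide_le_eq mult.commute)
      ultimately show ?thesis by (simp add: ln_le_iff_exp)
    qed
    have le: "sandwich_norm p (amp N \<phi>) (\<eta> \<star> \<gamma>) \<le> sandwich_norm p (ptr \<phi>) \<eta> * exp (p * b)"
      by (rule sandwich_norm_chain[OF N \<phi> e \<gamma> 2(2,3) ex])
    have s1: "1 \<le> sandwich_norm p (ptr \<phi>) \<eta>" using \<eta> 2 by (auto simp: state_pair_def intro: sandwich_norm_ge_1(1))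
    have "ln (sandwich_norm p (amp N \<phi>) (\<eta> \<star> \<gamma>)) \<le> ln (sandwich_norm p (ptr \<phi>) \<eta> * exp (p * b))"
    \<comment> \<open>Monotonicity of ln needs a positive argument. If the norm is 0, the left side
      is ln 0 = 0 and the right side is nonnegative.\<close>
    proof (cases "0 < sandwich_norm p (amp N \<phi>) (\<eta> \<star> \<gamma>)")
      case False
      then have "sandwich_norm p (amp N \<phi>) (\<eta> \<star> \<gamma>) = 0" by (metis schatten_nonneg sandwich_norm_def less_eq_real_def)
      moreover have "ln (sandwich_norm p (amp N \<phi>) (ptr \<phi> \<star> \<gamma>)) \<ge> 0"
        using chan_state_pair[OF N \<gamma> \<phi>] 2 sandwich_norm_ge_1(1)[of "amp N \<phi>" "ptr \<phi> \<star> \<gamma>" p] by (auto simp: state_pair_def)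
      then have "0 \<le> p * b" using bound[OF \<phi>] 2 by (simp add: fm_div_def sandwiched_div_def divide_le_eq mult.commute)
      ultimately show ?thesis using s1 by (simp add: ln_mult_pos)
    qed (use le in simp)
    also have "\<dots> = ln (sandwich_norm p (ptr \<phi>) \<eta>) + p * b" using s1 by (simp add: ln_mult_pos)
    finally show ?thesis using 2 by (simp add: fm_div_def sandwiched_div_def divide_le_eq algebra_simps)
  qed
qed

subsection \<open>The supremum over input states\<close>

lemma lift_replacer:
  assumes "\<omega> \<in> carrier_mat a a"
  shows "lift a' a (replacer \<omega>) Y = (\<Sum>i<a'. ent Y i i) *\<^sub>c emb id a \<omega>"
  using assms by (simp add: lift_def replacer_def emb_smult mtrace_def unemb_def)

lemma lin_lift_replacer: "\<omega> \<in> carrier_mat a a \<Longrightarrow> lin (lift a' a (replacer \<omega>))"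
  by (rule linI) (simp_all add: lift_replacer sum.distrib cs_add_left cs_cs sum_distrib_left)

lemma amp_replacer:
  assumes w: "\<omega> \<in> carrier_mat a a" and X: "input_supported a' X"
  shows "amp (lift a' a (replacer \<omega>)) X = ptr X \<star> emb id a \<omega>"
proof -
  obtain R where b: "finite R" "\<And>p q. ent X p q \<noteq> 0 \<Longrightarrow> fst p \<in> R \<and> fst q \<in> R \<and> snd p \<in> {..<a'} \<and> snd q \<in> {..<a'}"
    by (rule input_supported_box[OF X]) blast
  show ?thesis
  proof (rule fm_box_induct[OF b, where g = "\<lambda>X. ptr X \<star> emb id a \<omega>"])
    fix i j k l assume "k \<in> {..<a'}" "l \<in> {..<a'}"
    moreover have "(\<Sum>i<a'. if i = k \<and> i = l then 1 else 0) = (\<Sum>i<a'. if k = i then if k = l then 1 else 0 else 0 :: complex)"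
      by (intro sum.cong) auto
    ultimately show "amp (lift a' a (replacer \<omega>)) (unit (i, k) (j, l)) = ptr (unit (i, k) (j, l)) \<star> emb id a \<omega>"
      by (simp add: lift_replacer[OF w])
  qed (auto intro!: linI)
qed

lemma gibbs_carrier: assumes "hamiltonian a H" shows "gibbs \<beta> a H \<in> carrier_mat a a"
proof -
  have H: "hermitian a H" and i: "inj_on id {..<a}" using assms by (auto simp: hamiltonian_def)
  have "mfun (\<lambda>x. exp (- \<beta> * x)) a H \<in> carrier_mat a a" using mfun_emb_family[OF i H] by metis
  then show ?thesis by (simp add: gibbs_def Let_def)
qed

abbreviation thermal_state :: "real \<Rightarrow> nat \<Rightarrow> cmat \<Rightarrow> nat fm" where
  "thermal_state \<beta> a H \<equiv> emb id a (gibbs \<beta> a H)"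

lemma emb_idt_thermal:
  assumes "hamiltonian a H"
  shows "emb (block_index id a) (r * a) (idt r a' a (thermal \<beta> a H) \<psi>) = ptr (emb (block_index id a') (r * a') \<psi>) \<star> thermal_state \<beta> a H"
  unfolding thermal_def idt_lift[OF lin_lift_replacer[OF gibbs_carrier[OF assms]]]
  by (rule amp_replacer[OF gibbs_carrier[OF assms] input_supported_emb])

lemma chdiv_term:
  assumes z: "admissible z" and H: "hamiltonian a H" and lin: "lin (lift a' a N)" and \<psi>: "is_state (r * a') \<psi>"
  defines "X \<equiv> emb (block_index id a') (r * a') \<psi>"
  assumes d: "state_pair (amp (lift a' a N) X) (ptr X \<star> thermal_state \<beta> a H)"
  shows "matrix_div z (r * a) (idt r a' a N \<psi>) (idt r a' a (thermal \<beta> a H) \<psi>)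
    = ereal (fm_div z (amp (lift a' a N) X) (ptr X \<star> thermal_state \<beta> a H))"
proof -
  have e: "emb (block_index id a) (r * a) (idt r a' a N \<psi>) = amp (lift a' a N) X"
    "emb (block_index id a) (r * a) (idt r a' a (thermal \<beta> a H) \<psi>) = ptr X \<star> thermal_state \<beta> a H"
    unfolding X_def by (rule idt_lift[OF lin], rule emb_idt_thermal[OF H])
  have "psd (r * a) (idt r a' a N \<psi>)" "psd (r * a) (idt r a' a (thermal \<beta> a H) \<psi>)"
    using psd_emb[OF inj_block_index_id idt_carrier] d by (simp_all add: e state_pair_def)
  from matrix_div_emb[OF z inj_block_index_id this] show ?thesis using d by (simp add: e state_pair_def)
qed

lemma chdiv_le:
  assumes z: "admissible z" and H: "hamiltonian a H" and lin: "lin (lift a' a N)"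
    and d: "\<And>\<psi> :: (nat \<times> nat) fm. input_state a' \<psi> \<Longrightarrow> state_pair (amp (lift a' a N) \<psi>) (ptr \<psi> \<star> thermal_state \<beta> a H)"
    and B: "\<And>\<psi> :: (nat \<times> nat) fm. input_state a' \<psi> \<Longrightarrow> ereal (fm_div z (amp (lift a' a N) \<psi>) (ptr \<psi> \<star> thermal_state \<beta> a H)) \<le> B"
  shows "chdiv (matrix_div z) a' a N (thermal \<beta> a H) \<le> B"
  unfolding chdiv_def
proof (intro SUP_least, clarify)
  fix r \<psi> assume \<psi>: "is_state (r * a') \<psi>"
  note s = state_emb_input_state[OF \<psi>]
  show "matrix_div z (r * a) (idt r a' a N \<psi>) (idt r a' a (thermal \<beta> a H) \<psi>) \<le> B"
    unfolding chdiv_term[OF z H lin \<psi> d[OF s]] by (rule B[OF s])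
qed

lemma input_state_reix:
  fixes e :: "'r \<Rightarrow> 's"
  assumes e: "inj e" and \<psi>: "input_state n \<psi>" shows "input_state n (reix (map_prod e id) \<psi>)"
proof -
  have i: "inj (map_prod e (id :: nat \<Rightarrow> nat))" by (intro prod.inj_map e) simp
  obtain R where b: "finite R" "\<And>p q. ent \<psi> p q \<noteq> 0 \<Longrightarrow> fst p \<in> R \<and> fst q \<in> R \<and> snd p \<in> {..<n} \<and> snd q \<in> {..<n}"
    by (rule input_supported_box[OF input_stateD(3)[OF \<psi>]]) blast
  have "input_supported n (reix (map_prod e id) \<psi>)"
    unfolding input_supported_iff
  proof (intro allI impI)
    fix p q :: "'s \<times> nat" assume o: "\<not> (snd p < n \<and> snd q < n)"
    show "ent (reix (map_prod e id) \<psi>) p q = 0"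
    proof (rule fm_box_induct[OF b, where f = "\<lambda>X. ent (reix (map_prod e id) X) p q" and g = "\<lambda>_. 0"])
      show "ent (reix (map_prod e id) (unit (i, k) (j, l))) p q = 0" if "k \<in> {..<n}" "l \<in> {..<n}" for i k j l
        using o that by auto
    qed (auto intro!: linI)
  qed
  then show ?thesis using \<psi> fpsd_reix[OF i] tr_reix[OF i] by (simp add: input_state_def)
qed

lemma chdiv_ge_nat:
  fixes \<psi> :: "(nat \<times> nat) fm"
  assumes z: "admissible z" and H: "hamiltonian a H" and lin: "lin (lift a' a N)" and \<psi>: "input_state a' \<psi>"
    and d: "state_pair (amp (lift a' a N) \<psi>) (ptr \<psi> \<star> thermal_state \<beta> a H)"
  shows "ereal (fm_div z (amp (lift a' a N) \<psi>) (ptr \<psi> \<star> thermal_state \<beta> a H)) \<le> chdiv (matrix_div z) a' a N (thermal \<beta> a H)"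
proof -
  have "inj_on id {..<a'}" by simp
  then obtain r M where M: "is_state (r * a') M" "emb (block_index id a') (r * a') M = \<psi>"
    using state_unemb[of id a' \<psi>] \<psi> by (metis image_id input_supported_def lessThan_iff input_state_def id_apply)
  have "ereal (fm_div z (amp (lift a' a N) \<psi>) (ptr \<psi> \<star> thermal_state \<beta> a H))
      = matrix_div z (r * a) (idt r a' a N M) (idt r a' a (thermal \<beta> a H) M)"
    using chdiv_term[OF z H lin M(1), of \<beta>] d M(2) by simp
  also have "\<dots> \<le> chdiv (matrix_div z) a' a N (thermal \<beta> a H)"
    unfolding chdiv_def by (rule SUP_upper2[of "(r, M)"]) (use M in auto)
  finally show ?thesis .
qed

text \<open>The reference is encoded in \<open>nat\<close> by an injection, which changes neither
  the outputs up to relabelling nor the divergence.\<close>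

lemma chdiv_ge:
  fixes \<psi> :: "('r::countable \<times> nat) fm"
  assumes z: "admissible z" and H: "hamiltonian a H" and N: "channel a' a N" and \<psi>: "input_state a' \<psi>"
  shows "ereal (fm_div z (amp (lift a' a N) \<psi>) (ptr \<psi> \<star> thermal_state \<beta> a H)) \<le> chdiv (matrix_div z) a' a N (thermal \<beta> a H)"
proof -
  note c = chan_lift[OF N] and g = faithful_state_gibbs[OF H, of \<beta>]
  let ?e = "map_prod (to_nat :: 'r \<Rightarrow> nat) (id :: nat \<Rightarrow> nat)"
  have i: "inj ?e" by (intro prod.inj_map) auto
  have s: "input_state a' (reix ?e \<psi>)" by (intro input_state_reix \<psi>) simp
  have "ptr (reix ?e \<psi>) \<star> thermal_state \<beta> a H = reix ?e (ptr \<psi> \<star> thermal_state \<beta> a H)"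
    using ptr_reix[of id to_nat \<psi>] reix_tn[of to_nat "ptr \<psi>" id "thermal_state \<beta> a H"] by simp
  then have "fm_div z (amp (lift a' a N) (reix ?e \<psi>)) (ptr (reix ?e \<psi>) \<star> thermal_state \<beta> a H)
      = fm_div z (amp (lift a' a N) \<psi>) (ptr \<psi> \<star> thermal_state \<beta> a H)"
    using chan_state_pair[OF c g \<psi>] by (simp only: amp_reix[OF chan_lin[OF c]]) (rule fm_div_reix[OF i], auto simp: state_pair_def)
  then show ?thesis
    using chdiv_ge_nat[OF z H chan_lin[OF c] s chan_state_pair[OF c g s]] by simp
qed

text \<open>A concrete input, available in dimension at least 1, keeps the supremum from ranging
  over the empty set.\<close>

lemma input_state_basis: "1 \<le> n \<Longrightarrow> input_state n (unit (0 :: nat, 0) (0, 0))"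
  unfolding input_state_def
  by (auto simp: input_supported_def intro!: fpsd_proj split: if_splits)

text \<open>Packages finiteness and the least upper bound property as real statements. The upper
  bound comes from domination with a constant that is independent of the input.\<close>

lemma chdiv_real:
  assumes z: "admissible z" and H: "hamiltonian a H" and N: "channel a' a N" and a': "1 \<le> a'"
  obtains c where "chdiv (matrix_div z) a' a N (thermal \<beta> a H) = ereal c" "0 \<le> c"
    "\<And>B. (\<And>\<psi> :: (nat \<times> nat) fm. input_state a' \<psi> \<Longrightarrow> fm_div z (amp (lift a' a N) \<psi>) (ptr \<psi> \<star> thermal_state \<beta> a H) \<le> B) \<Longrightarrow> c \<le> B"
proof -
  note c = chan_lift[OF N] and g = faithful_state_gibbs[OF H, of \<beta>]
  let ?D = "chdiv (matrix_div z) a' a N (thermal \<beta> a H)"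
  have le: "?D \<le> ereal B"
    if "\<And>\<psi> :: (nat \<times> nat) fm. input_state a' \<psi> \<Longrightarrow> fm_div z (amp (lift a' a N) \<psi>) (ptr \<psi> \<star> thermal_state \<beta> a H) \<le> B" for B
    by (rule chdiv_le[OF z H chan_lin[OF c] chan_state_pair[OF c g]]) (use that in auto)
  obtain C where C: "0 < C" "\<And>\<psi> :: (nat \<times> nat) fm. input_state a' \<psi> \<Longrightarrow> fpsd (C *\<^sub>r (ptr \<psi> \<star> thermal_state \<beta> a H) - amp (lift a' a N) \<psi>)"
    using chan_dominated[OF c g] by metis
  obtain K where K: "\<And>\<rho> \<sigma> :: (nat \<times> nat) fm. state_pair \<rho> \<sigma> \<Longrightarrow> fpsd (C *\<^sub>r \<sigma> - \<rho>) \<Longrightarrow> fm_div z \<rho> \<sigma> \<le> K"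
    using fm_div_bounded[OF z C(1)] by metis
  have "?D \<le> ereal K" by (rule le) (use K C(2) chan_state_pair[OF c g] in blast)
  moreover have "0 \<le> ?D"
    using chdiv_ge[OF z H N input_state_basis[OF a'], of \<beta>] fm_div_nonneg[OF z chan_state_pair[OF c g input_state_basis[OF a']]]
    by (meson ereal_less_eq(5) order_trans)
  ultimately obtain r where r: "?D = ereal r" "0 \<le> r" by (cases ?D) auto
  show ?thesis by (rule that[OF r]) (use le r(1) in auto)
qed

lemma fm_div_le_chdiv:
  fixes \<psi> :: "('r::countable \<times> nat) fm"
  assumes "admissible z" "hamiltonian a H" "channel a' a N" "input_state a' \<psi>" "chdiv (matrix_div z) a' a N (thermal \<beta> a H) = ereal c"
  shows "fm_div z (amp (lift a' a N) \<psi>) (ptr \<psi> \<star> thermal_state \<beta> a H) \<le> c"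
  using chdiv_ge[OF assms(1-4), of \<beta>] assms(5) by simp

subsection \<open>Properties (A2), (A3) and (A6), quasi-convexity\<close>

text \<open>Both outputs share the reference state \<psi>_R, which contributes 0 by additivity, so
  every input yields the same value.\<close>

lemma A2_matrix_div: assumes z: "admissible z" shows "A2 (matrix_div z) \<beta>"
  unfolding A2_def
proof (intro allI impI)
  fix a' a HA \<omega> assume a': "1 \<le> (a'::nat)" and H: "hamiltonian a HA" and w: "is_state a \<omega>"
  have cw: "\<omega> \<in> carrier_mat a a" using w by (simp add: is_state_def psd_def hermitian_def)
  have i: "inj_on id {..<a}" by simp
  note g = faithful_stateD[OF faithful_state_gibbs[OF H, of \<beta>]]
  have fw: "fpsd (emb id a \<omega>)" "tr (emb id a \<omega>) = 1"
    using w psd_emb[OF i cw] emb_trace[OF i cw] by (auto simp: is_state_def)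
  have dw: "state_pair (emb id a \<omega>) (thermal_state \<beta> a HA)"
    using fw g emb_mult_one(1)[OF i, of \<omega>] by (simp add: state_pair_def)
  have "psd a (gibbs \<beta> a HA)" using psd_emb[OF i gibbs_carrier[OF H]] g(1) by simp
  then have D: "matrix_div z a \<omega> (gibbs \<beta> a HA) = ereal (fm_div z (emb id a \<omega>) (thermal_state \<beta> a HA))"
    using w dw by (intro matrix_div_emb[OF z i]) (auto simp: is_state_def state_pair_def)
  note lin = lin_lift_replacer[OF cw, of a']
  have val: "state_pair (amp (lift a' a (replacer \<omega>)) \<psi>) (ptr \<psi> \<star> thermal_state \<beta> a HA)
      \<and> fm_div z (amp (lift a' a (replacer \<omega>)) \<psi>) (ptr \<psi> \<star> thermal_state \<beta> a HA) = fm_div z (emb id a \<omega>) (thermal_state \<beta> a HA)"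
    if \<psi>: "input_state a' \<psi>" for \<psi> :: "(nat \<times> nat) fm"
  proof -
    have e: "amp (lift a' a (replacer \<omega>)) \<psi> = ptr \<psi> \<star> emb id a \<omega>"
      by (rule amp_replacer[OF cw input_stateD(3)[OF \<psi>]])
    have p: "state_pair (ptr \<psi>) (ptr \<psi>)" by (rule state_pair_self) (use \<psi> in \<open>auto simp: input_state_def fpsd_ptr\<close>)
    then have "state_pair (ptr \<psi> \<star> emb id a \<omega>) (ptr \<psi> \<star> thermal_state \<beta> a HA)"
      using dw by (simp add: state_pair_def fpsd_tn pw_tn)
    then show ?thesis unfolding e using fm_div_tn[OF z p dw] fm_div_eq_0[OF z p] by simp
  qed
  have "chdiv (matrix_div z) a' a (replacer \<omega>) (thermal \<beta> a HA) = matrix_div z a \<omega> (gibbs \<beta> a HA)"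
  proof (rule antisym)
    show "chdiv (matrix_div z) a' a (replacer \<omega>) (thermal \<beta> a HA) \<le> matrix_div z a \<omega> (gibbs \<beta> a HA)"
      unfolding D by (rule chdiv_le[OF z H lin]) (use val in auto)
    show "matrix_div z a \<omega> (gibbs \<beta> a HA) \<le> chdiv (matrix_div z) a' a (replacer \<omega>) (thermal \<beta> a HA)"
      unfolding D using chdiv_ge_nat[OF z H lin input_state_basis[OF a']] val[OF input_state_basis[OF a']] by metis
  qed
  then show "chfree (matrix_div z) \<beta> a' a HA (replacer \<omega>) = ereal (1 / \<beta>) * matrix_div z a \<omega> (gibbs \<beta> a HA)"
    by (simp add: chfree_def)
qed

lemma lift_map_eq: "map_eq a' N M \<Longrightarrow> lift a' a N = lift a' a M"
  by (simp add: map_eq_def lift_def fun_eq_iff)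

lemma input_state_max_entangled:
  assumes "1 \<le> n"
  defines "\<psi> \<equiv> \<Sum>i<n. \<Sum>j<n. (1 / real n) *\<^sub>r unit (i, i) (j, j)"
  shows "input_state n \<psi>"
proof -
  define B :: "(nat \<times> nat) fm" where "B = (1 / sqrt (real n)) *\<^sub>r (\<Sum>j<n. unit (0, 0) (j, j))"
  have "dg B * B = (1 / sqrt (real n) * (1 / sqrt (real n))) *\<^sub>r (\<Sum>i<n. \<Sum>j<n. unit (i, i) (j, j))"
    by (simp only: B_def dg_simps cs_mult_left cs_mult_right cs_cs of_real_mult complex_cnj_complex_of_real)
      (simp add: sum_distrib_left sum_distrib_right, subst sum.swap, simp)
  also have "1 / sqrt (real n) * (1 / sqrt (real n)) = 1 / real n" by simp
  finally have "dg B * B = \<psi>" by (simp add: \<psi>_def cs_sum_right)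
  then have "fpsd \<psi>" using fpsd_dgmult[of B] by simp
  moreover have "tr \<psi> = 1"
  proof -
    have "tr \<psi> = (\<Sum>i<n. \<Sum>j<n. if j = i then complex_of_real (1 / real n) else 0)"
      unfolding \<psi>_def tr_simps by (intro sum.cong refl) auto
    then show ?thesis using assms(1) by simp
  qed
  moreover have "input_supported n \<psi>" unfolding input_supported_iff by (auto simp: \<psi>_def intro!: sum.neutral)
  ultimately show ?thesis by (simp add: input_state_def)
qed

lemma A3_matrix_div: assumes z: "admissible z" and b: "0 < \<beta>" shows "A3 (matrix_div z) \<beta>"
  unfolding A3_def
proof (intro allI impI)
  fix a' a HA N assume a': "1 \<le> (a'::nat)" and H: "hamiltonian a HA" and N: "channel a' a N"
  note c = chan_lift[OF N] and g = faithful_state_gibbs[OF H, of \<beta>]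
  obtain r where r: "chdiv (matrix_div z) a' a N (thermal \<beta> a HA) = ereal r" "0 \<le> r"
    "\<And>B. (\<And>\<psi> :: (nat \<times> nat) fm. input_state a' \<psi> \<Longrightarrow> fm_div z (amp (lift a' a N) \<psi>) (ptr \<psi> \<star> thermal_state \<beta> a HA) \<le> B) \<Longrightarrow> r \<le> B"
    by (rule chdiv_real[OF z H N a', of \<beta>]) blast
  have f: "chfree (matrix_div z) \<beta> a' a HA N = ereal (r / \<beta>)" by (simp add: chfree_def r(1))
  have "r = 0 \<longleftrightarrow> map_eq a' N (thermal \<beta> a HA)"
  proof
    assume r0: "r = 0"
    define \<psi> :: "(nat \<times> nat) fm" where "\<psi> = (\<Sum>i<a'. \<Sum>j<a'. (1 / real a') *\<^sub>r unit (i, i) (j, j))"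
    have \<psi>: "input_state a' \<psi>" unfolding \<psi>_def by (rule input_state_max_entangled[OF a'])
    have "fm_div z (amp (lift a' a N) \<psi>) (ptr \<psi> \<star> thermal_state \<beta> a HA) \<le> 0"
      using fm_div_le_chdiv[OF z H N \<psi> r(1)] r0 by simp
    then have "amp (lift a' a N) \<psi> = ptr \<psi> \<star> thermal_state \<beta> a HA"
      using fm_div_nonneg[OF z chan_state_pair[OF c g \<psi>]] fm_div_eq_0[OF z chan_state_pair[OF c g \<psi>]] by simp
    also have "\<dots> = amp (lift a' a (thermal \<beta> a HA)) \<psi>"
      unfolding thermal_def by (rule amp_replacer[OF gibbs_carrier[OF H] input_stateD(3)[OF \<psi>], symmetric])
    finally have eq: "amp (lift a' a N) \<psi> = amp (lift a' a (thermal \<beta> a HA)) \<psi>" .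
    have linT: "lin (lift a' a (thermal \<beta> a HA))"
      unfolding thermal_def by (rule lin_lift_replacer[OF gibbs_carrier[OF H]])
    \<comment> \<open>Block (i, j) of the output of the maximally entangled input is the image of
      the matrix unit divided by a', so the output determines the map.\<close>
    have val: "ent (amp \<Phi> \<psi>) (i, k) (j, l) = complex_of_real (1 / real a') * ent (\<Phi> (unit i j)) k l"
      if "lin \<Phi>" "i < a'" "j < a'" for \<Phi> :: "nat fm \<Rightarrow> nat fm" and i j k l
    proof -
      let ?u = "(1 / real a') *\<^sub>r unit i j"
      have lin: "lin (blkf i j :: (nat \<times> nat) fm \<Rightarrow> _)" unfolding blkf_def by (rule lin_lext)
      have "blkf i j \<psi> = (\<Sum>m<a'. \<Sum>n<a'. if m = i then if n = j then ?u else 0 else 0)"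
        unfolding \<psi>_def lin_sum[OF lin] lin_cs[OF lin] by (intro sum.cong refl) (auto simp: blkf_def)
      also have "\<dots> = (\<Sum>m<a'. if m = i then ?u else 0)" by (intro sum.cong refl) (use that in auto)
      also have "\<dots> = ?u" using that by simp
      finally have "blkf i j \<psi> = ?u" .
      then show ?thesis by (simp add: ent_amp[OF that(1)] lin_cs[OF that(1)] del: of_real_divide)
    qed
    have "lift a' a N (unit i j) = lift a' a (thermal \<beta> a HA) (unit i j)" for i j
    proof (cases "i < a' \<and> j < a'")
      case True
      then have ne: "complex_of_real (1 / real a') \<noteq> 0" by simp
      show ?thesis
        by (rule fm_eqI) (use True ne val[OF chan_lin[OF c]] val[OF linT] eq in \<open>metis mult_left_cancel\<close>)
    next
      case False
      then have "(\<Sum>x<a'. ent (unit i j) x x) = 0" by (auto intro!: sum.neutral)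
      then show ?thesis using False c by (simp add: chan_def thermal_def lift_replacer[OF gibbs_carrier[OF H]])
    qed
    from lin_eqI[OF chan_lin[OF c] linT this]
    have l: "lift a' a N X = lift a' a (thermal \<beta> a HA) X" for X .
    show "map_eq a' N (thermal \<beta> a HA)"
      unfolding map_eq_def
    proof
      fix X :: cmat assume X: "X \<in> carrier_mat a' a'"
      have "emb id a (N X) = emb id a (thermal \<beta> a HA X)"
        using l[of "emb id a' X"] by (simp add: lift_emb[OF X])
      then show "N X = thermal \<beta> a HA X"
        using N X gibbs_carrier[OF H] by (intro emb_inject[of id a]) (auto simp: channel_def Defs.linear_map_def thermal_def replacer_def)
    qed
  next
    assume m: "map_eq a' N (thermal \<beta> a HA)"
    have "fm_div z (amp (lift a' a N) \<psi>) (ptr \<psi> \<star> thermal_state \<beta> a HA) \<le> 0" if \<psi>: "input_state a' \<psi>" for \<psi> :: "(nat \<times> nat) fm"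
    proof -
      have "amp (lift a' a N) \<psi> = ptr \<psi> \<star> thermal_state \<beta> a HA"
        unfolding lift_map_eq[OF m] thermal_def by (rule amp_replacer[OF gibbs_carrier[OF H] input_stateD(3)[OF \<psi>]])
      then show ?thesis using fm_div_eq_0[OF z chan_state_pair[OF c g \<psi>]] by simp
    qed
    then show "r = 0" using r(2,3) by fastforce
  qed
  then show "0 \<le> chfree (matrix_div z) \<beta> a' a HA N \<and> (chfree (matrix_div z) \<beta> a' a HA N = 0 \<longleftrightarrow> map_eq a' N (thermal \<beta> a HA))"
    using b r(2) by (simp add: f)
qed

lemma lift_mixture:
  assumes "\<And>x. x \<in> I \<Longrightarrow> channel a' a (N x)"
  shows "lift a' a (mixture a I p N) = (\<lambda>Y. \<Sum>x\<in>I. (p x) *\<^sub>r lift a' a (N x) Y)"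
proof
  fix Y
  have i: "inj_on id {..<a}" by simp
  show "lift a' a (mixture a I p N) Y = (\<Sum>x\<in>I. (p x) *\<^sub>r lift a' a (N x) Y)"
    unfolding lift_def[of a' a "mixture a I p N"]
    by (rule emb_eqI[OF i]) (auto simp: lift_def mixture_def ent_emb[of id, simplified] ent_emb_out intro!: sum.neutral)
qed

lemma lin_sum_cs: "(\<And>x. x \<in> I \<Longrightarrow> lin (f x)) \<Longrightarrow> lin (\<lambda>Y. \<Sum>x\<in>I. c x *\<^sub>c f x Y)"
  by (rule linI) (simp_all add: lin_simps cs_add_right sum.distrib cs_sum_right cs_cs mult.commute)

lemma amp_sum_cs:
  "amp (\<lambda>Y. \<Sum>x\<in>I. c x *\<^sub>c f x Y) X = (\<Sum>x\<in>I. c x *\<^sub>c amp (f x) X)"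
  by (induct X rule: fm_induct_prod) (simp_all add: cs_add_right sum.distrib cs_sum_right cs_cs mult.commute)

lemma mixture_state_pair:
  fixes \<psi> :: "(nat \<times> nat) fm"
  assumes H: "hamiltonian a H" and N: "\<And>x. x \<in> I \<Longrightarrow> channel a' a (N x)"
    and p: "\<And>x. x \<in> I \<Longrightarrow> 0 \<le> p x" "(\<Sum>x\<in>I. p x) = 1" and \<psi>: "input_state a' \<psi>"
  shows "lin (lift a' a (mixture a I p N))"
    "amp (lift a' a (mixture a I p N)) \<psi> = (\<Sum>x\<in>I. (p x) *\<^sub>r amp (lift a' a (N x)) \<psi>)"
    "state_pair (amp (lift a' a (mixture a I p N)) \<psi>) (ptr \<psi> \<star> thermal_state \<beta> a H)"
proof -
  have l: "lift a' a (mixture a I p N) = (\<lambda>Y. \<Sum>x\<in>I. (p x) *\<^sub>r lift a' a (N x) Y)"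
    by (rule lift_mixture) (rule N)
  show "lin (lift a' a (mixture a I p N))"
    unfolding l by (rule lin_sum_cs) (rule chan_lin[OF chan_lift[OF N]])
  show e: "amp (lift a' a (mixture a I p N)) \<psi> = (\<Sum>x\<in>I. (p x) *\<^sub>r amp (lift a' a (N x)) \<psi>)"
    unfolding l by (rule amp_sum_cs)
  have d: "state_pair (amp (lift a' a (N x)) \<psi>) (ptr \<psi> \<star> thermal_state \<beta> a H)" if "x \<in> I" for x
    by (rule chan_state_pair[OF chan_lift[OF N[OF that]] faithful_state_gibbs[OF H] \<psi>])
  have t: "fpsd (ptr \<psi> \<star> thermal_state \<beta> a H)" "tr (ptr \<psi> \<star> thermal_state \<beta> a H) = 1"
    using \<psi> faithful_state_gibbs[OF H, of \<beta>] by (auto simp: input_state_def faithful_state_def fpsd_tn fpsd_ptr)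
  show "state_pair (amp (lift a' a (mixture a I p N)) \<psi>) (ptr \<psi> \<star> thermal_state \<beta> a H)"
    unfolding e state_pair_def
  proof (intro conjI t)
    show "fpsd (\<Sum>x\<in>I. (p x) *\<^sub>r amp (lift a' a (N x)) \<psi>)"
      using d p by (intro fpsd_sum fpsd_cs) (auto simp: state_pair_def)
    have "tr (\<Sum>x\<in>I. (p x) *\<^sub>r amp (lift a' a (N x)) \<psi>) = (\<Sum>x\<in>I. complex_of_real (p x))"
      using d by (auto simp: state_pair_def intro!: sum.cong)
    then show "tr (\<Sum>x\<in>I. (p x) *\<^sub>r amp (lift a' a (N x)) \<psi>) = 1"
      using p(2) by (simp flip: of_real_sum)
    show "sp (ptr \<psi> \<star> thermal_state \<beta> a H) * (\<Sum>x\<in>I. (p x) *\<^sub>r amp (lift a' a (N x)) \<psi>)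
        = (\<Sum>x\<in>I. (p x) *\<^sub>r amp (lift a' a (N x)) \<psi>)"
      using d by (auto simp: state_pair_def sum_distrib_left intro!: sum.cong)
  qed
qed

text \<open>The norm inside the logarithm is convex in the output, and each component is at most exp
  (q c) for the largest channel divergence c. Taking the logarithm of the averaged bound leaves only
  that maximum.\<close>

lemma quasiconvex_matrix_div:
  assumes p0: "0 < q" "q < 1" and b: "0 < \<beta>" shows "quasiconvex (matrix_div (Some q)) \<beta> TYPE('x)"
  unfolding quasiconvex_def
proof (intro allI impI)
  fix a' a HA and I :: "'x set" and p N
  assume a': "1 \<le> (a'::nat)" and H: "hamiltonian a HA" and I: "finite I" "I \<noteq> {}"
    and p: "\<forall>x\<in>I. 0 \<le> p x" "(\<Sum>x\<in>I. p x) = (1::real)" and N: "\<forall>x\<in>I. channel a' a (N x)"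
  let ?z = "Some q"
  have z: "admissible ?z" using p0 by (simp add: admissible_def)
  note g = faithful_state_gibbs[OF H, of \<beta>]
  have "\<exists>c. \<forall>x\<in>I. chdiv (matrix_div ?z) a' a (N x) (thermal \<beta> a HA) = ereal (c x)"
    by (intro bchoice ballI) (metis N H a' z chdiv_real)
  then obtain c where c: "\<And>x. x \<in> I \<Longrightarrow> chdiv (matrix_div ?z) a' a (N x) (thermal \<beta> a HA) = ereal (c x)" by blast
  have "Max (c ` I) \<in> c ` I" using I by (intro Max_in) auto
  then obtain y where y: "y \<in> I" "c y = Max (c ` I)" by auto
  have m: "c x \<le> c y" if "x \<in> I" for x unfolding y(2) using that I by (intro Max_ge) auto
  have lin: "lin (lift a' a (mixture a I p N))"
    using mixture_state_pair(1)[OF H, of I a' N p, OF _ _ _ input_state_basis[OF a']] N p by auto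
  have "chdiv (matrix_div ?z) a' a (mixture a I p N) (thermal \<beta> a HA) \<le> ereal (c y)"
  proof (rule chdiv_le[OF z H lin])
    fix \<psi> :: "(nat \<times> nat) fm" assume \<psi>: "input_state a' \<psi>"
    show d: "state_pair (amp (lift a' a (mixture a I p N)) \<psi>) (ptr \<psi> \<star> thermal_state \<beta> a HA)"
      using mixture_state_pair(3)[OF H, of I a' N p \<psi>] N p \<psi> by auto
    have dx: "state_pair (amp (lift a' a (N x)) \<psi>) (ptr \<psi> \<star> thermal_state \<beta> a HA)" if "x \<in> I" for x
      by (rule chan_state_pair[OF chan_lift g \<psi>]) (use N that in auto)
    have "sandwich_norm q (amp (lift a' a (mixture a I p N)) \<psi>) (ptr \<psi> \<star> thermal_state \<beta> a HA)
        = sandwich_norm q (\<Sum>x\<in>I. (p x) *\<^sub>r amp (lift a' a (N x)) \<psi>) (ptr \<psi> \<star> thermal_state \<beta> a HA)"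
      using mixture_state_pair(2)[OF H, of I a' N p \<psi>] N p \<psi> by auto
    also have "\<dots> \<le> (\<Sum>x\<in>I. p x * sandwich_norm q (amp (lift a' a (N x)) \<psi>) (ptr \<psi> \<star> thermal_state \<beta> a HA))"
      using dx p d by (intro sandwich_norm_sum_le p0) (auto simp: state_pair_def)
    also have "\<dots> \<le> (\<Sum>x\<in>I. p x * exp (q * c y))"
    proof (intro sum_mono mult_left_mono)
      fix x assume x: "x \<in> I"
      have "sandwiched_div q (amp (lift a' a (N x)) \<psi>) (ptr \<psi> \<star> thermal_state \<beta> a HA) \<le> c x"
        using fm_div_le_chdiv[OF z H _ \<psi> c[OF x]] N x by (simp add: fm_div_def)
      also have "c x \<le> c y" by (rule m[OF x])
      finally have "ln (sandwich_norm q (amp (lift a' a (N x)) \<psi>) (ptr \<psi> \<star> thermal_state \<beta> a HA)) \<le> q * c y"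
        using p0 by (simp add: sandwiched_div_def divide_le_eq mult.commute)
      moreover have "1 \<le> sandwich_norm q (amp (lift a' a (N x)) \<psi>) (ptr \<psi> \<star> thermal_state \<beta> a HA)"
        using dx[OF x] p0 by (auto simp: state_pair_def intro: sandwich_norm_ge_1(1))
      ultimately show "sandwich_norm q (amp (lift a' a (N x)) \<psi>) (ptr \<psi> \<star> thermal_state \<beta> a HA) \<le> exp (q * c y)"
        by (simp add: ln_le_iff_exp)
    qed (use p in auto)
    also have "\<dots> = exp (q * c y)" using p(2) by (simp flip: sum_distrib_right)
    finally have "sandwich_norm q (amp (lift a' a (mixture a I p N)) \<psi>) (ptr \<psi> \<star> thermal_state \<beta> a HA) \<le> exp (q * c y)" .
    moreover have "1 \<le> sandwich_norm q (amp (lift a' a (mixture a I p N)) \<psi>) (ptr \<psi> \<star> thermal_state \<beta> a HA)"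
      using d p0 by (auto simp: state_pair_def intro: sandwich_norm_ge_1(1))
    ultimately have "ln (sandwich_norm q (amp (lift a' a (mixture a I p N)) \<psi>) (ptr \<psi> \<star> thermal_state \<beta> a HA)) \<le> q * c y"
      by (simp add: ln_le_iff_exp)
    then show "ereal (fm_div ?z (amp (lift a' a (mixture a I p N)) \<psi>) (ptr \<psi> \<star> thermal_state \<beta> a HA)) \<le> ereal (c y)"
      using p0 by (simp add: fm_div_def sandwiched_div_def divide_le_eq mult.commute)
  qed
  then have "chfree (matrix_div ?z) \<beta> a' a HA (mixture a I p N) \<le> chfree (matrix_div ?z) \<beta> a' a HA (N y)"
    unfolding chfree_def c[OF y(1)] using b by (intro ereal_mult_left_mono) auto
  also have "\<dots> \<le> Max ((\<lambda>x. chfree (matrix_div ?z) \<beta> a' a HA (N x)) ` I)" using I y(1) by (intro Max_ge) auto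
  finally show "chfree (matrix_div ?z) \<beta> a' a HA (mixture a I p N) \<le> Max ((\<lambda>x. chfree (matrix_div ?z) \<beta> a' a HA (N x)) ` I)" .
qed

lemma mixmap_mixture: "mixmap a p N M = mixture a UNIV (\<lambda>b. if b then p else 1 - p) (\<lambda>b. if b then N else M)"
  by (simp add: mixmap_def mixture_def UNIV_bool fun_eq_iff add.commute)

text \<open>For a fixed input both channels are compared with the same thermal output, so convexity
  of the state divergence in its first argument suffices.\<close>

lemma A6_umegaki: assumes b: "0 < \<beta>" shows "A6 umegaki \<beta>"
  unfolding A6_def
proof (intro allI impI)
  fix a' a HA N M p
  assume a': "1 \<le> (a'::nat)" and H: "hamiltonian a HA" and N: "channel a' a N" and M: "channel a' a M"
    and p: "0 \<le> (p::real)" "p \<le> 1"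
  have z: "admissible None" by (simp add: admissible_def)
  have u: "umegaki = matrix_div None" by (simp add: matrix_div_def)
  obtain c where c: "chdiv (matrix_div None) a' a N (thermal \<beta> a HA) = ereal c" using chdiv_real[OF z H N a'] by metis
  obtain d where d: "chdiv (matrix_div None) a' a M (thermal \<beta> a HA) = ereal d" using chdiv_real[OF z H M a'] by metis
  let ?N = "\<lambda>b. if b then N else M" and ?p = "\<lambda>b. if b then p else 1 - p"
  have ch: "\<And>x. x \<in> UNIV \<Longrightarrow> channel a' a (?N x)" using N M by simp
  have pp: "\<And>x. x \<in> UNIV \<Longrightarrow> 0 \<le> ?p x" "(\<Sum>x\<in>UNIV. ?p x) = 1" using p by (auto simp: UNIV_bool)
  have "chdiv (matrix_div None) a' a (mixmap a p N M) (thermal \<beta> a HA) \<le> ereal (p * c + (1 - p) * d)"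
    unfolding mixmap_mixture
  proof (rule chdiv_le[OF z H mixture_state_pair(1)[OF H ch pp input_state_basis[OF a']] mixture_state_pair(3)[OF H ch pp]])
    fix \<psi> :: "(nat \<times> nat) fm" assume \<psi>: "input_state a' \<psi>"
    let ?\<rho> = "amp (lift a' a N) \<psi>" and ?\<eta> = "amp (lift a' a M) \<psi>" and ?\<sigma> = "ptr \<psi> \<star> thermal_state \<beta> a HA"
    have e: "amp (lift a' a (mixture a UNIV ?p ?N)) \<psi> = p *\<^sub>r ?\<rho> + (1 - p) *\<^sub>r ?\<eta>"
      using mixture_state_pair(2)[OF H ch pp \<psi>] by (simp add: UNIV_bool add.commute)
    have 1: "umegaki_div ?\<rho> ?\<sigma> \<le> c" "umegaki_div ?\<eta> ?\<sigma> \<le> d"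
      using fm_div_le_chdiv[OF z H N \<psi> c] fm_div_le_chdiv[OF z H M \<psi> d] by (simp_all add: fm_div_def)
    note g = faithful_state_gibbs[OF H, of \<beta>]
    have 2: "state_pair ?\<rho> ?\<sigma>" "state_pair ?\<eta> ?\<sigma>" using chan_state_pair[OF chan_lift g \<psi>] N M by auto
    have "umegaki_div (p *\<^sub>r ?\<rho> + (1 - p) *\<^sub>r ?\<eta>) ?\<sigma> \<le> p * umegaki_div ?\<rho> ?\<sigma> + (1 - p) * umegaki_div ?\<eta> ?\<sigma>"
    proof (cases "p = 0 \<or> p = 1")
      case False
      then show ?thesis using p 2 by (intro umegaki_div_convex) (auto simp: state_pair_def)
    qed auto
    also have "\<dots> \<le> p * c + (1 - p) * d" using p 1 by (intro add_mono mult_left_mono) auto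
    finally show "ereal (fm_div None (amp (lift a' a (mixture a UNIV ?p ?N)) \<psi>) ?\<sigma>) \<le> ereal (p * c + (1 - p) * d)"
      unfolding e by (simp add: fm_div_def)
  qed
  then have "ereal (1 / \<beta>) * chdiv (matrix_div None) a' a (mixmap a p N M) (thermal \<beta> a HA) \<le> ereal (1 / \<beta>) * ereal (p * c + (1 - p) * d)"
    using b by (intro ereal_mult_left_mono) auto
  then show "chfree umegaki \<beta> a' a HA (mixmap a p N M)
      \<le> ereal p * chfree umegaki \<beta> a' a HA N + ereal (1 - p) * chfree umegaki \<beta> a' a HA M"
    unfolding u chfree_def c d by (simp add: add_divide_distrib)
qed

subsection \<open>Monotonicity (A1)\<close>

lemma thermal_channel:
  assumes H: "hamiltonian a H" shows "channel a' a (thermal \<beta> a H)"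
  unfolding channel_def
proof (intro conjI allI impI ballI)
  note c = gibbs_carrier[OF H, of \<beta>] and g = faithful_stateD[OF faithful_state_gibbs[OF H, of \<beta>]]
  have i: "inj_on id {..<a}" by simp
  have tg: "mtrace (gibbs \<beta> a H) = 1" using emb_trace[OF i c] g(2) by simp
  have ta: "mtrace (X + Y) = mtrace X + mtrace Y" if "X \<in> carrier_mat a' a'" "Y \<in> carrier_mat a' a'" for X Y
    using that by (simp add: mtrace_def sum.distrib)
  have ts: "mtrace (k \<cdot>\<^sub>m X) = k * mtrace X" if "X \<in> carrier_mat n n" for k X n
    using that by (simp add: mtrace_def sum_distrib_left)
  show "Defs.linear_map a' a (thermal \<beta> a H)"
    unfolding Defs.linear_map_def thermal_def replacer_def using c
    by (auto simp: ta ts add_smult_distrib_right_mat)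
  show "mtrace (thermal \<beta> a H X) = mtrace X" if "X \<in> carrier_mat a' a'" for X
    unfolding thermal_def replacer_def ts[OF c] tg by simp
  show "psd (r * a) (idt r a' a (thermal \<beta> a H) X)" if "psd (r * a') X" for r X
  proof -
    have "X \<in> carrier_mat (r * a') (r * a')" using that by (simp add: psd_def hermitian_def)
    then have "fpsd (emb (block_index id a') (r * a') X)" using psd_emb[OF inj_block_index_id] that by blast
    then have "fpsd (emb (block_index id a) (r * a) (idt r a' a (thermal \<beta> a H) X))"
      unfolding emb_idt_thermal[OF H] using g(1) by (simp add: fpsd_tn fpsd_ptr)
    then show ?thesis using psd_emb[OF inj_block_index_id idt_carrier] by blast
  qed
qed

lemma state_carrier: "is_state d \<psi> \<Longrightarrow> \<psi> \<in> carrier_mat d d"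
  by (simp add: is_state_def psd_def hermitian_def)

lemma idt_state:
  assumes N: "channel a' a N" and \<psi>: "is_state (r * a') \<psi>" shows "is_state (r * a) (idt r a' a N \<psi>)"
proof -
  note c = chan_lift[OF N]
  have "mtrace (idt r a' a N \<psi>) = tr (emb (block_index id a) (r * a) (idt r a' a N \<psi>))"
    by (rule emb_trace[OF inj_block_index_id idt_carrier, symmetric])
  also have "\<dots> = tr (emb (block_index id a') (r * a') \<psi>)"
    unfolding idt_lift[OF chan_lin[OF c]] by (rule tr_amp[OF c input_supported_emb])
  also have "\<dots> = 1" using input_stateD(2)[OF state_emb_input_state[OF \<psi>]] .
  finally show ?thesis using N \<psi> by (simp add: is_state_def channel_def)
qed

lemma idt_idt:
  assumes "\<And>X. X \<in> carrier_mat n n \<Longrightarrow> F X \<in> carrier_mat k k"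
  shows "idt r k m G (idt r n k F \<psi>) = idt r n m (\<lambda>X. G (F X)) \<psi>"
proof -
  have "blk k (idt r n k F \<psi>) p q = F (blk n \<psi> p q)" if "p < r" "q < r" for p q
    by (rule eq_matI) (use assms[OF blk_carrier, of \<psi> p q] that in \<open>auto simp: blk_def idt_def div_mod_less\<close>)
  then show ?thesis by (intro eq_matI) (auto simp: idt_def[of r k] idt_def[of r n m] less_mult_div)
qed

text \<open>The memory of a superchannel merges into the reference: splitting a combined index in
  either order gives the same three parts.\<close>

lemma idt_nested: "idt r (e * a') (e * a) (idt e a' a N) \<phi> = idt (r * e) a' a N \<phi>"
proof (rule eq_matI)
  fix i j assume "i < dim_row (idt (r * e) a' a N \<phi>)" "j < dim_col (idt (r * e) a' a N \<phi>)"
  then have ij: "i < r * (e * a)" "j < r * (e * a)" by (simp_all add: idt_def mult.assoc)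
  have b: "blk a' (blk (e * a') \<phi> P Q) p q = blk a' \<phi> (P * e + p) (Q * e + q)" if "p < e" "q < e" for P Q p q
    by (rule eq_matI) (use that in \<open>auto simp: blk_def div_mod_less distrib_right mult.assoc add.assoc\<close>)
  have d: "x div (e * a) = x div a div e" for x by (metis div_mult2_eq mult.commute)
  have m: "x mod (e * a) div a = x div a mod e" "x mod (e * a) mod a = x mod a" if "x < r * (e * a)" for x
  proof -
    have a: "0 < a" using that by (cases "a = 0") auto
    have e: "x mod (e * a) = a * (x div a mod e) + x mod a" by (metis mod_mult2_eq mult.commute)
    show "x mod (e * a) div a = x div a mod e" "x mod (e * a) mod a = x mod a" unfolding e using a by simp_all
  qed
  have l: "x div a mod e < e" "x mod (e * a) < e * a" if "x < r * (e * a)" for x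
    using less_mult_div[OF that] less_mult_div[of "x mod (e * a)" e a] m[OF that] by auto
  have "idt r (e * a') (e * a) (idt e a' a N) \<phi> $$ (i, j)
      = N (blk a' (blk (e * a') \<phi> (i div a div e) (j div a div e)) (i div a mod e) (j div a mod e)) $$ (i mod a, j mod a)"
    using ij l by (simp add: idt_def d m)
  also have "\<dots> = idt (r * e) a' a N \<phi> $$ (i, j)"
    unfolding b[OF l(1)[OF ij(1)] l(1)[OF ij(2)]] using ij by (simp add: idt_def mult.assoc)
  finally show "idt r (e * a') (e * a) (idt e a' a N) \<phi> $$ (i, j) = idt (r * e) a' a N \<phi> $$ (i, j)" .
qed (simp_all add: idt_def mult.assoc)

lemma idt_cong: "map_eq n F G \<Longrightarrow> idt r n k F \<psi> = idt r n k G \<psi>"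
  by (simp add: idt_def map_eq_def)

text \<open>Domination rather than support inclusion is assumed, because it passes through the
  channel by linearity and positivity and so gives the inclusions both before and after.\<close>

lemma idt_channel_monotone:
  assumes z: "admissible z" and Q: "channel n' n Q" and \<rho>: "is_state (r * n') \<rho>" and \<sigma>: "is_state (r * n') \<sigma>"
    and C: "psd (r * n') (complex_of_real C \<cdot>\<^sub>m \<sigma> - \<rho>)"
  shows "matrix_div z (r * n) (idt r n' n Q \<rho>) (idt r n' n Q \<sigma>) \<le> matrix_div z (r * n') \<rho> \<sigma>"
proof -
  note c = chan_lift[OF Q] and cr = state_carrier[OF \<rho>] and cs = state_carrier[OF \<sigma>]
  define X where "X = emb (block_index id n') (r * n') \<rho>"
  define Y where "Y = emb (block_index id n') (r * n') \<sigma>"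
  have s: "input_state n' X" "input_state n' Y" unfolding X_def Y_def by (rule state_emb_input_state[OF \<rho>], rule state_emb_input_state[OF \<sigma>])
  have eX: "emb (block_index id n) (r * n) (idt r n' n Q \<rho>) = amp (lift n' n Q) X"
    "emb (block_index id n) (r * n) (idt r n' n Q \<sigma>) = amp (lift n' n Q) Y"
    unfolding X_def Y_def by (rule idt_lift[OF chan_lin[OF c]])+
  have "complex_of_real C \<cdot>\<^sub>m \<sigma> - \<rho> \<in> carrier_mat (r * n') (r * n')" by (intro minus_carrier_mat cr)
  then have "fpsd (emb (block_index id n') (r * n') (complex_of_real C \<cdot>\<^sub>m \<sigma> - \<rho>))" using psd_emb[OF inj_block_index_id] C by blast
  then have D: "fpsd (C *\<^sub>r Y - X)"
    using cr cs by (simp add: X_def Y_def emb_minus[OF inj_block_index_id] emb_smult[OF inj_block_index_id])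
  have "fpsd (amp (lift n' n Q) (C *\<^sub>r Y - X))" by (rule amp_fpsd[OF c D])
  then have D': "fpsd (C *\<^sub>r amp (lift n' n Q) Y - amp (lift n' n Q) X)" by simp
  have t: "fpsd (amp (lift n' n Q) Z)" "tr (amp (lift n' n Q) Z) = 1" if "input_state n' Z" for Z :: "(nat \<times> nat) fm"
    using that amp_fpsd[OF c, of Z] tr_amp[OF c, of Z] by (simp_all add: input_state_def)
  have d: "state_pair X Y" "state_pair (amp (lift n' n Q) X) (amp (lift n' n Q) Y)"
    unfolding state_pair_def using input_stateD[OF s(1)] input_stateD[OF s(2)] t[OF s(1)] t[OF s(2)]
      sp_mult_dominated[OF input_stateD(1)[OF s(1)] input_stateD(1)[OF s(2)] D]
      sp_mult_dominated[OF t(1)[OF s(1)] t(1)[OF s(2)] D'] by simp_all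
  have p: "psd (r * n') \<rho>" "psd (r * n') \<sigma>" "psd (r * n) (idt r n' n Q \<rho>)" "psd (r * n) (idt r n' n Q \<sigma>)"
    using \<rho> \<sigma> idt_state[OF Q \<rho>] idt_state[OF Q \<sigma>] by (auto simp: is_state_def)
  have "matrix_div z (r * n) (idt r n' n Q \<rho>) (idt r n' n Q \<sigma>) = ereal (fm_div z (amp (lift n' n Q) X) (amp (lift n' n Q) Y))"
    using matrix_div_emb[OF z inj_block_index_id p(3,4)] d(2) by (simp add: eX state_pair_def)
  also have "\<dots> \<le> ereal (fm_div z X Y)"
    using fm_div_dpi[OF z schwarz_map_amp[OF c] d] tr_amp_mult[OF c input_stateD(3)[OF s(1)]] by simp
  also have "\<dots> = matrix_div z (r * n') \<rho> \<sigma>"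
    using matrix_div_emb[OF z inj_block_index_id p(1,2)] d(1) by (simp add: X_def Y_def state_pair_def)
  finally show ?thesis .
qed

lemma A1_matrix_div: assumes z: "admissible z" and b: "0 < \<beta>" shows "A1 (matrix_div z) \<beta>"
  unfolding A1_def
proof (intro allI impI)
  fix a' a HA b' b HB e P Q N
  assume H: "hamiltonian a HA" and P: "channel b' (e * a') P" and Q: "channel (e * a) b Q"
    and G: "map_eq b' (superch e a' a P Q (thermal \<beta> a HA)) (thermal \<beta> b HB)" and N: "channel a' a N"
  note T = thermal_channel[OF H, of a' \<beta>]
  have "chdiv (matrix_div z) b' b (superch e a' a P Q N) (thermal \<beta> b HB) \<le> chdiv (matrix_div z) a' a N (thermal \<beta> a HA)"
    unfolding chdiv_def[of _ b']
  proof (intro SUP_least, clarify)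
    fix r \<psi> assume \<psi>: "is_state (r * b') \<psi>"
    \<comment> \<open>The preprocessed input is a competitor in the supremum for \<open>N\<close>,
      with the memory counted as part of a reference of dimension r * e.\<close>
    define \<phi> where "\<phi> = idt r b' (e * a') P \<psi>"
    have \<phi>: "is_state (r * e * a') \<phi>" unfolding \<phi>_def using idt_state[OF P \<psi>] by (simp add: mult.assoc)
    have s: "idt r b' b (superch e a' a P Q M) \<psi> = idt r (e * a) b Q (idt (r * e) a' a M \<phi>)" for M
    proof -
      have cP: "P X \<in> carrier_mat (e * a') (e * a')" if "X \<in> carrier_mat b' b'" for X
        using P that by (simp add: channel_def Defs.linear_map_def)
      have "idt r b' b (superch e a' a P Q M) \<psi> = idt r b' b (\<lambda>X. Q (idt e a' a M (P X))) \<psi>"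
        by (simp add: superch_def comp_def)
      also have "\<dots> = idt r (e * a) b Q (idt r b' (e * a) (\<lambda>X. idt e a' a M (P X)) \<psi>)"
        by (rule idt_idt[symmetric]) simp
      also have "idt r b' (e * a) (\<lambda>X. idt e a' a M (P X)) \<psi> = idt r (e * a') (e * a) (idt e a' a M) \<phi>"
        unfolding \<phi>_def by (rule idt_idt[symmetric]) (rule cP)
      also have "\<dots> = idt (r * e) a' a M \<phi>" by (rule idt_nested)
      finally show ?thesis .
    qed
    have t: "idt r b' b (thermal \<beta> b HB) \<psi> = idt r (e * a) b Q (idt (r * e) a' a (thermal \<beta> a HA) \<phi>)"
      using idt_cong[OF G] s by metis
    have st: "is_state (r * (e * a)) (idt (r * e) a' a N \<phi>)" "is_state (r * (e * a)) (idt (r * e) a' a (thermal \<beta> a HA) \<phi>)"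
      using idt_state[OF N \<phi>] idt_state[OF T \<phi>] by (simp_all add: mult.assoc)
    note c = chan_lift[OF N]
    obtain C where C: "\<And>\<psi> :: (nat \<times> nat) fm. input_state a' \<psi> \<Longrightarrow> fpsd (C *\<^sub>r (ptr \<psi> \<star> thermal_state \<beta> a HA) - amp (lift a' a N) \<psi>)"
      using chan_dominated[OF c faithful_state_gibbs[OF H]] by metis
    let ?D = "complex_of_real C \<cdot>\<^sub>m idt (r * e) a' a (thermal \<beta> a HA) \<phi> - idt (r * e) a' a N \<phi>"
    have "emb (block_index id a) (r * e * a) ?D
        = C *\<^sub>r (ptr (emb (block_index id a') (r * e * a') \<phi>) \<star> thermal_state \<beta> a HA) - amp (lift a' a N) (emb (block_index id a') (r * e * a') \<phi>)"
      by (simp add: emb_minus[OF inj_block_index_id] emb_smult[OF inj_block_index_id] emb_idt_thermal[OF H] idt_lift[OF chan_lin[OF c]])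
    then have "fpsd (emb (block_index id a) (r * e * a) ?D)" using C[OF state_emb_input_state[OF \<phi>]] by simp
    moreover have "?D \<in> carrier_mat (r * e * a) (r * e * a)" by (intro minus_carrier_mat idt_carrier)
    ultimately have "psd (r * e * a) ?D" using psd_emb[OF inj_block_index_id] by blast
    then have dom: "psd (r * (e * a)) ?D" by (simp add: mult.assoc)
    have "matrix_div z (r * b) (idt r b' b (superch e a' a P Q N) \<psi>) (idt r b' b (thermal \<beta> b HB) \<psi>)
        \<le> matrix_div z (r * (e * a)) (idt (r * e) a' a N \<phi>) (idt (r * e) a' a (thermal \<beta> a HA) \<phi>)"
      unfolding s t by (rule idt_channel_monotone[OF z Q st dom])
    also have "\<dots> \<le> chdiv (matrix_div z) a' a N (thermal \<beta> a HA)"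
      unfolding chdiv_def by (rule SUP_upper2[of "(r * e, \<phi>)"]) (use \<phi> in \<open>auto simp: mult.assoc\<close>)
    finally show "matrix_div z (r * b) (idt r b' b (superch e a' a P Q N) \<psi>) (idt r b' b (thermal \<beta> b HB) \<psi>)
        \<le> chdiv (matrix_div z) a' a N (thermal \<beta> a HA)" .
  qed
  then show "chfree (matrix_div z) \<beta> b' b HB (superch e a' a P Q N) \<le> chfree (matrix_div z) \<beta> a' a HA N"
    unfolding chfree_def using b by (intro ereal_mult_left_mono) auto
qed

subsection \<open>Uniform continuity (A4)\<close>

lemma pw_unit: "pw (unit n n) z = unit n n"
proof -
  have s: "sdec (unit n n) {()} (\<lambda>_. 1) (\<lambda>_. unit n n)" by (simp add: sdec_def)
  show ?thesis unfolding pw_def fc_sdec[OF s] by (simp add: on_nonzero_def)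
qed

text \<open>A matrix unit has trace norm 1 and can be used with the trivial reference r = 1. The
  factor 2 undoes the half in the hypothesis.\<close>

lemma diamond_entry:
  assumes d: "ereal (1 / 2) * diamond a' a \<Phi> \<le> ereal \<epsilon>" and m: "m < a'" "n < a'"
    and \<Phi>: "\<And>X. X \<in> carrier_mat a' a' \<Longrightarrow> \<Phi> X \<in> carrier_mat a a"
  shows "cmod (ent (lift a' a \<Phi> (unit m n)) k l) \<le> 2 * \<epsilon>"
proof -
  define X where "X = unemb id a' (unit m n)"
  have i: "inj_on id {..<d}" for d :: nat by simp
  have c: "X \<in> carrier_mat (1 * a') (1 * a')" by (simp add: X_def)
  have eX: "emb id a' X = unit m n" unfolding X_def by (rule emb_unemb[OF i]) (use m in auto)
  have "trnorm (1 * a') X = 1" using trnorm_emb[OF i c] by (simp add: eX pw_unit)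
  then have "(1, X) \<in> {(r, X). X \<in> carrier_mat (r * a') (r * a') \<and> trnorm (r * a') X \<le> 1}" using c by simp
  then have "ereal (trnorm (1 * a) (idt 1 a' a \<Phi> X)) \<le> diamond a' a \<Phi>"
    unfolding diamond_def by (rule SUP_upper2) simp
  moreover have "idt 1 a' a \<Phi> X = \<Phi> X"
  proof -
    have b: "blk a' X 0 0 = X" by (rule eq_matI) (use c in \<open>auto simp: blk_def\<close>)
    show ?thesis by (rule eq_matI) (use \<Phi>[of X] c in \<open>auto simp: idt_def b\<close>)
  qed
  ultimately have "ereal (trnorm a (\<Phi> X)) \<le> diamond a' a \<Phi>" by simp
  moreover have "diamond a' a \<Phi> \<le> ereal (2 * \<epsilon>)" using d by (cases "diamond a' a \<Phi>") auto
  ultimately have "trnorm a (\<Phi> X) \<le> 2 * \<epsilon>" using order_trans by fastforce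
  moreover have "cmod (ent (emb id a (\<Phi> X)) k l) \<le> trnorm a (\<Phi> X)"
    using cmod_ent_le_trnorm trnorm_emb[OF i \<Phi>[of X]] c by simp
  ultimately show ?thesis by (simp add: lift_def X_def)
qed

lemma amp_diff: "amp (\<lambda>Y. F Y - G Y) X = amp F X - amp G X"
proof (induct X rule: fm_induct_prod)
  case (unit c i k j l)
  have "unit i j \<star> (F (unit k l) - G (unit k l)) = unit i j \<star> F (unit k l) - unit i j \<star> G (unit k l)" by simp
  then show ?case by (simp add: cs_diff_right)
qed simp_all

text \<open>In the argument of the modulus the factor a' a comes from \<open>amp_dominated\<close>,
  applied to the difference of the channels, and 1 / c from replacing the local unit by the thermal
  state.\<close>

lemma chdiv_modulus:
  assumes z: "admissible z" and H: "hamiltonian a H" and c: "0 < c" "fpsd (thermal_state \<beta> a H - c *\<^sub>r one {..<a})"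
    and N: "channel a' a N" and M: "channel a' a M" and a': "1 \<le> a'" and e: "0 < \<epsilon>"
    and le: "\<And>m n k l. m < a' \<Longrightarrow> n < a' \<Longrightarrow> cmod (ent (lift a' a N (unit m n) - lift a' a M (unit m n)) k l) \<le> \<epsilon>"
    and v: "chdiv (matrix_div z) a' a N (thermal \<beta> a H) = ereal x" "chdiv (matrix_div z) a' a M (thermal \<beta> a H) = ereal y"
  shows "x \<le> y + modulus z (\<epsilon> * real (a' * a) / c)"
proof -
  note cN = chan_lift[OF N] and cM = chan_lift[OF M] and g = faithful_state_gibbs[OF H, of \<beta>]
  obtain x' where x': "chdiv (matrix_div z) a' a N (thermal \<beta> a H) = ereal x'"
    "\<And>B. (\<And>\<psi> :: (nat \<times> nat) fm. input_state a' \<psi> \<Longrightarrow> fm_div z (amp (lift a' a N) \<psi>) (ptr \<psi> \<star> thermal_state \<beta> a H) \<le> B) \<Longrightarrow> x' \<le> B"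
    by (rule chdiv_real[OF z H N a', of \<beta>]) blast
  have ub: "x \<le> B" if "\<And>\<psi> :: (nat \<times> nat) fm. input_state a' \<psi> \<Longrightarrow> fm_div z (amp (lift a' a N) \<psi>) (ptr \<psi> \<star> thermal_state \<beta> a H) \<le> B" for B
    using x'(1) x'(2)[OF that] v(1) by simp
  show ?thesis
  proof (rule ub)
    fix \<psi> :: "(nat \<times> nat) fm" assume \<psi>: "input_state a' \<psi>"
    let ?\<sigma> = "ptr \<psi> \<star> thermal_state \<beta> a H" and ?\<delta> = "\<epsilon> * real (a' * a) / c"
    let ?\<Phi> = "\<lambda>Y. lift a' a N Y - lift a' a M Y"
    note d = chan_state_pair[OF cN g \<psi>] chan_state_pair[OF cM g \<psi>]
    have lin: "lin ?\<Phi>" using chan_lin[OF cN] chan_lin[OF cM] by (intro linI) (simp_all add: lin_simps cs_diff_right)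
    have out: "one {..<a} * ?\<Phi> Y = ?\<Phi> Y" "?\<Phi> Y * one {..<a} = ?\<Phi> Y" for Y
      using cN cM by (simp_all add: chan_def right_diff_distrib left_diff_distrib)
    have h: "dg (amp ?\<Phi> \<psi>) = amp ?\<Phi> \<psi>" unfolding amp_diff using d by (simp add: state_pair_def fpsd_dg)
    have "fpsd ((\<epsilon> * real (a' * a)) *\<^sub>r (ptr \<psi> \<star> one {..<a}) - amp ?\<Phi> \<psi>)"
      by (rule amp_dominated[OF lin out input_stateD(1)[OF \<psi>] input_stateD(3)[OF \<psi>] h]) (rule le)
    from thermal_dominates[OF c(2,1) fpsd_ptr[OF input_stateD(1)[OF \<psi>]] _ this]
    have "fpsd (complex_of_real ?\<delta> *\<^sub>c ?\<sigma> - (amp (lift a' a N) \<psi> - amp (lift a' a M) \<psi>))"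
      using e by (simp add: amp_diff)
    then have dom: "fpsd (amp (lift a' a M) \<psi> + complex_of_real ?\<delta> *\<^sub>c ?\<sigma> - amp (lift a' a N) \<psi>)"
      by (simp add: algebra_simps)
    have "a \<noteq> 0" using H by (simp add: hamiltonian_def)
    then have "0 < ?\<delta>" using a' e c(1) by simp
    then have "fm_div z (amp (lift a' a N) \<psi>) ?\<sigma> \<le> fm_div z (amp (lift a' a M) \<psi>) ?\<sigma> + modulus z ?\<delta>"
      by (rule fm_div_continuity[OF z d _ dom])
    then show "fm_div z (amp (lift a' a N) \<psi>) ?\<sigma> \<le> y + modulus z ?\<delta>"
      using fm_div_le_chdiv[OF z H M \<psi> v(2)] by simp
  qed
qed

text \<open>Allows a pair of equal channels to be placed in the index set of (A4); over an empty set
  that supremum would be negative infinity.\<close>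

lemma diamond_zero:
  assumes "\<And>X. X \<in> carrier_mat a' a' \<Longrightarrow> N X \<in> carrier_mat a a"
  shows "diamond a' a (mapdiff N N) \<le> 0"
  unfolding diamond_def
proof (intro SUP_least, clarify)
  fix r X
  have "idt r a' a (mapdiff N N) X = 0\<^sub>m (r * a) (r * a)"
    by (rule eq_matI) (use carrier_matD[OF assms[OF blk_carrier]] in \<open>auto simp: idt_def mapdiff_def less_mult_div\<close>)
  then have "emb (block_index id a) (r * a) (idt r a' a (mapdiff N N) X) = 0" using emb_zero[OF inj_block_index_id] by simp
  then show "ereal (trnorm (r * a) (idt r a' a (mapdiff N N) X)) \<le> 0"
    using trnorm_emb[OF inj_block_index_id idt_carrier] by simp
qed

lemma A4_matrix_div: assumes z: "admissible z" and b: "0 < \<beta>" shows "A4 (matrix_div z) \<beta>"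
  unfolding A4_def
proof (intro allI impI)
  fix a' a HA assume a': "1 \<le> (a'::nat)" and H: "hamiltonian a HA"
  let ?S = "\<lambda>\<epsilon>::real. {(N, M). channel a' a N \<and> channel a' a M \<and> ereal (1/2) * diamond a' a (mapdiff N M) \<le> ereal \<epsilon>}"
  let ?F = "\<lambda>\<epsilon>. SUP (N, M) \<in> ?S \<epsilon>. \<bar>chfree (matrix_div z) \<beta> a' a HA N - chfree (matrix_div z) \<beta> a' a HA M\<bar>"
  obtain c where c: "0 < c" "fpsd (thermal_state \<beta> a HA - c *\<^sub>r one {..<a})"
    using faithful_state_gibbs[OF H, of \<beta>] by (auto simp: faithful_state_def)
  have car: "N X \<in> carrier_mat a a" if "channel a' a N" "X \<in> carrier_mat a' a'" for N X
    using that by (simp add: channel_def Defs.linear_map_def)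
  \<comment> \<open>The 2 comes from \<open>diamond_entry\<close>, the rest from
    \<open>chdiv_modulus\<close>.\<close>
  define K where "K = 2 * real (a' * a) / c"
  have "a \<noteq> 0" using H by (simp add: hamiltonian_def)
  then have K: "0 < K" using a' c(1) by (simp add: K_def)
  have up: "?F \<epsilon> \<le> ereal (modulus z (K * \<epsilon>) / \<beta>)" if e: "0 < \<epsilon>" for \<epsilon>
  proof (intro SUP_least, clarify)
    fix N M assume N: "channel a' a N" and M: "channel a' a M"
      and d: "ereal (1/2) * diamond a' a (mapdiff N M) \<le> ereal \<epsilon>"
    have l: "lift a' a (mapdiff N M) Y = lift a' a N Y - lift a' a M Y" for Y
      unfolding lift_def mapdiff_def by (rule emb_minus) (auto intro: car[OF N] car[OF M])
    have cd: "mapdiff N M X \<in> carrier_mat a a" if "X \<in> carrier_mat a' a'" for X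
      unfolding mapdiff_def by (intro minus_carrier_mat car[OF M] that)
    have 1: "cmod (ent (lift a' a N (unit m n) - lift a' a M (unit m n)) k l) \<le> 2 * \<epsilon>" if "m < a'" "n < a'" for m n k l
      using diamond_entry[OF d that cd, of k l] unfolding l .
    have 2: "cmod (ent (lift a' a M (unit m n) - lift a' a N (unit m n)) k l) \<le> 2 * \<epsilon>" if "m < a'" "n < a'" for m n k l
      using 1[OF that, of k l] by (simp add: norm_minus_commute)
    obtain x where x: "chdiv (matrix_div z) a' a N (thermal \<beta> a HA) = ereal x" using chdiv_real[OF z H N a'] by metis
    obtain y where y: "chdiv (matrix_div z) a' a M (thermal \<beta> a HA) = ereal y" using chdiv_real[OF z H M a'] by metis
    have e2: "0 < 2 * \<epsilon>" using e by simp
    have k: "2 * \<epsilon> * real (a' * a) / c = K * \<epsilon>" by (simp add: K_def)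
    have "x \<le> y + modulus z (K * \<epsilon>)" "y \<le> x + modulus z (K * \<epsilon>)"
      using chdiv_modulus[OF z H c N M a' e2 1 x y] chdiv_modulus[OF z H c M N a' e2 2 y x] unfolding k by blast+
    then have "\<bar>x - y\<bar> / \<beta> \<le> modulus z (K * \<epsilon>) / \<beta>" using b by (intro divide_right_mono) auto
    moreover have "\<bar>x / \<beta> - y / \<beta>\<bar> = \<bar>x - y\<bar> / \<beta>" using b by (simp add: abs_divide flip: diff_divide_distrib)
    ultimately show "\<bar>chfree (matrix_div z) \<beta> a' a HA N - chfree (matrix_div z) \<beta> a' a HA M\<bar> \<le> ereal (modulus z (K * \<epsilon>) / \<beta>)"
      by (simp add: chfree_def x y)
  qed
  have lo: "0 \<le> ?F \<epsilon>" if e: "0 < \<epsilon>" for \<epsilon>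
  proof -
    let ?T = "thermal \<beta> a HA"
    note T = thermal_channel[OF H, of a' \<beta>]
    have "ereal (1/2) * diamond a' a (mapdiff ?T ?T) \<le> ereal (1/2) * 0"
      by (rule ereal_mult_left_mono[OF diamond_zero[OF car[OF T]]]) auto
    also have "\<dots> \<le> ereal \<epsilon>" using e by simp
    finally have "(?T, ?T) \<in> ?S \<epsilon>" using T by simp
    then show ?thesis by (rule SUP_upper2) simp
  qed
  have "((\<lambda>\<epsilon>. modulus z (K * \<epsilon>) / \<beta>) \<longlongrightarrow> 0 / \<beta>) (at_right 0)"
    using b by (intro tendsto_intros modulus_limit z K) auto
  then have lim: "((\<lambda>\<epsilon>. ereal (modulus z (K * \<epsilon>) / \<beta>)) \<longlongrightarrow> ereal 0) (at_right 0)" by simp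
  show "(?F \<longlongrightarrow> 0) (at_right 0)"
  proof (rule tendsto_sandwich)
    show "\<forall>\<^sub>F \<epsilon> in at_right 0. 0 \<le> ?F \<epsilon>" "\<forall>\<^sub>F \<epsilon> in at_right 0. ?F \<epsilon> \<le> ereal (modulus z (K * \<epsilon>) / \<beta>)"
      using lo up by (auto simp: eventually_at_filter)
  qed (use lim in \<open>simp_all add: zero_ereal_def\<close>)
qed

subsection \<open>Additivity (A5)\<close>

lemma swap_tn: "reix prod.swap (A \<star> B) = B \<star> A"
proof (induct A rule: fm_induct)
  case (unit c i j)
  have "reix prod.swap (unit i j \<star> B) = B \<star> unit i j" by (induct B rule: fm_induct) simp_all
  then show ?case by simp
qed simp_all

lemma ent_swap: "ent (reix prod.swap X) (p, k) (q, l) = ent X (k, p) (l, q)"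
  using ent_reix[of prod.swap X "(k, p)" "(l, q)"] by simp

lemma tens_amp:
  assumes "lin N" "lin M" shows "tens N M X = reix prod.swap (amp N (reix prod.swap (amp M X)))"
  by (induct X rule: fm_induct_prod) (simp_all add: lin_simps[OF lin_tens] swap_tn amp_tn[OF assms(1)])

text \<open>A map on the first factor is an amplification conjugated by the swap.\<close>

lemma tid_emb:
  assumes lin: "lin (lift a' a N)"
  shows "emb (block_index id s) (a * s) (tid a' a s N W)
    = reix prod.swap (amp (lift a' a N) (reix prod.swap (emb (block_index id s) (a' * s) W)))"
proof -
  let ?E = "emb (block_index id s) (a' * s) W"
  have i: "inj_on id {..<d}" for d :: nat by simp
  have b: "blkf p q (reix prod.swap ?E) = emb id a' (blkL a' s W p q)" if pq: "p < s" "q < s" for p q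
  proof (rule emb_eqI[OF i, symmetric])
    fix k l assume "k < a'" "l < a'"
    then show "ent (blkf p q (reix prod.swap ?E)) (id k) (id l) = blkL a' s W p q $$ (k, l)"
      using ent_emb[OF inj_block_index_id, of "k * s + p" a' s "l * s + q" W] pq
      by (simp add: ent_swap blkL_def div_mod_less block_index_apply)
  next
    fix k l assume "k \<notin> id ` {..<a'} \<or> l \<notin> id ` {..<a'}"
    then show "ent (blkf p q (reix prod.swap ?E)) k l = 0"
      using ent_emb_out[of "(k, p)" "block_index id s" "a' * s" "(l, q)" W] by (auto simp: ent_swap block_index_image)
  qed
  have c: "blkL a' s W p q \<in> carrier_mat a' a'" for p q by (simp add: blkL_def)
  have e: "ent (reix prod.swap (amp (lift a' a N) (reix prod.swap ?E))) (k, p) (l, q)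
      = ent (emb id a (N (blkL a' s W p q))) k l" if "p < s" "q < s" for k l p q
    by (simp add: ent_swap ent_amp[OF lin] b[OF that] lift_emb[OF c])
  show ?thesis
  proof (rule emb_eqI[OF inj_block_index_id])
    fix x y assume xy: "x < a * s" "y < a * s"
    then show "ent (reix prod.swap (amp (lift a' a N) (reix prod.swap ?E))) (block_index id s x) (block_index id s y) = tid a' a s N W $$ (x, y)"
      using less_mult_div[OF xy(1)] less_mult_div[OF xy(2)] ent_emb[OF i, of "x div s" a "y div s"]
      by (simp add: block_index_def e tid_def)
  next
    fix x y assume out: "x \<notin> block_index id s ` {..<a * s} \<or> y \<notin> block_index id s ` {..<a * s}"
    obtain k p l q where xy: "x = (k, p)" "y = (l, q)" by (metis surj_pair)
    show "ent (reix prod.swap (amp (lift a' a N) (reix prod.swap ?E))) x y = 0"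
    proof (cases "p < s \<and> q < s")
      case True
      then show ?thesis using out by (auto simp: xy e block_index_image intro!: ent_emb_out)
    next
      case False
      have "blkf p q (reix prod.swap ?E) = 0"
      proof (rule fm_eqI)
        fix m n
        show "ent (blkf p q (reix prod.swap ?E)) m n = ent 0 m n"
          using False ent_emb_out[of "(m, p)" "block_index id s" "a' * s" "(n, q)" W] by (auto simp: ent_swap block_index_image)
      qed
      then show ?thesis by (simp add: xy ent_swap ent_amp[OF lin] lin_zero[OF lin])
    qed
  qed
qed

lemma ctensor_emb:
  assumes "lin (lift a1' a1 N)" "lin (lift a2' a2 M)"
  shows "emb (block_index id a2) (a1 * a2) (ctensor a1' a1 a2' a2 N M Y)
    = tens (lift a1' a1 N) (lift a2' a2 M) (emb (block_index id a2') (a1' * a2') Y)"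
  unfolding ctensor_def tid_emb[OF assms(1)] idt_lift[OF assms(2)] tens_amp[OF assms] ..

lemma amp_trace_const: "amp (\<lambda>Y. tr Y *\<^sub>c G) X = ptr X \<star> G"
  by (induct X rule: fm_induct_prod) auto

context
  fixes a1' a1 a2' a2 :: nat and N M :: "nat fm \<Rightarrow> nat fm" and \<gamma>1 \<gamma>2 :: "nat fm" and X :: "('r::countable \<times> nat \<times> nat) fm"
  assumes N: "chan a1' a1 N" and M: "chan a2' a2 M" and \<gamma>1: "faithful_state a1 \<gamma>1" and \<gamma>2: "faithful_state a2 \<gamma>2"
    and X: "fpsd X" "tr X = 1" "\<And>p q. ent X p q \<noteq> 0 \<Longrightarrow> snd p \<in> {..<a1'} \<times> {..<a2'} \<and> snd q \<in> {..<a1'} \<times> {..<a2'}"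
begin

lemma X_box_induct:
  assumes "lin f" "\<And>i j k l m n. k < a1' \<Longrightarrow> l < a1' \<Longrightarrow> m < a2' \<Longrightarrow> n < a2' \<Longrightarrow> f (unit (i, k, m) (j, l, n)) = (0 :: complex)"
  shows "f X = 0"
proof -
  obtain R S where b: "finite R" "finite S"
    "\<And>p q. ent X p q \<noteq> 0 \<Longrightarrow> fst p \<in> R \<and> fst q \<in> R \<and> snd p \<in> S \<and> snd q \<in> S" by (rule fst_box) blast
  show ?thesis
  proof (rule fm_box_induct[where R = R and S = "{..<a1'} \<times> {..<a2'}" and g = "\<lambda>_. 0"])
    show "\<And>p q. ent X p q \<noteq> 0 \<Longrightarrow> fst p \<in> R \<and> fst q \<in> R \<and> snd p \<in> {..<a1'} \<times> {..<a2'} \<and> snd q \<in> {..<a1'} \<times> {..<a2'}"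
      using b(3) X(3) by blast
  qed (use assms b(1) in \<open>auto intro!: linI\<close>)
qed

lemma input_state_second: "input_state a2' (ptr (reix rot X))"
proof -
  have "input_supported a2' (ptr (reix rot X))"
    unfolding input_supported_iff
  proof (intro allI impI)
    fix p q :: "'r \<times> nat" assume o: "\<not> (snd p < a2' \<and> snd q < a2')"
    show "ent (ptr (reix rot X)) p q = 0"
      by (rule X_box_induct[of "\<lambda>X. ent (ptr (reix rot X)) p q"]) (use o in \<open>auto simp: rot_def intro!: linI\<close>)
  qed
  then show ?thesis using X(1,2) by (simp add: input_state_def fpsd_ptr fpsd_reix inj_rot tr_reix)
qed

text \<open>After \<open>M\<close> has acted, its output counts as reference and the first system is
  still untouched; this is the input to which the chain rule for \<open>N\<close> is
  applied.\<close>

lemma input_state_first: "input_state a1' (reix swp (amp M (reix assoc X)))"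
proof -
  let ?\<phi> = "reix swp (amp M (reix assoc X))"
  have "input_supported a1' ?\<phi>"
    unfolding input_supported_iff
  proof (intro allI impI)
    fix p q :: "('r \<times> nat) \<times> nat" assume o: "\<not> (snd p < a1' \<and> snd q < a1')"
    show "ent ?\<phi> p q = 0"
    proof (rule X_box_induct[of "\<lambda>X. ent (reix swp (amp M (reix assoc X))) p q"])
      fix i j :: 'r and k l m n :: nat assume "k < a1'" "l < a1'"
      moreover have "reix swp (amp M (reix assoc (unit (i, k, m) (j, l, n)))) = (unit i j \<star> M (unit m n)) \<star> unit k l"
        using swp_tn[of "unit i j" "unit k l" "M (unit m n)"] by (simp add: assoc_def)
      ultimately show "ent (reix swp (amp M (reix assoc (unit (i, k, m) (j, l, n))))) p q = 0"
        using o by (cases p; cases q) auto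
    qed (auto intro!: linI)
  qed
  moreover have "fpsd ?\<phi>" by (intro fpsd_reix inj_swp amp_fpsd[OF M] inj_assoc X)
  moreover have "tr ?\<phi> = 1"
  proof -
    have "tr ?\<phi> = tr (ptr ?\<phi>)" by simp
    also have "\<dots> = 1"
      unfolding ptr_swp_amp[OF chan_lin[OF M]] tr_amp[OF M input_stateD(3)[OF input_state_second]] by (rule input_stateD(2)[OF input_state_second])
    finally show ?thesis .
  qed
  ultimately show ?thesis by (simp add: input_state_def)
qed

lemma rot_tens:
  "reix rot (amp (tens N M) X) = amp N (reix swp (amp M (reix assoc X)))"
  "reix rot (ptr X \<star> (\<gamma>1 \<star> \<gamma>2)) = (ptr (ptr (reix rot X)) \<star> \<gamma>2) \<star> \<gamma>1"
  by (rule amp_tens[OF chan_lin[OF N] chan_lin[OF M]]) (simp only: rot_tn ptr_ptr_rot)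

lemma tens_state_pair: "state_pair (amp (tens N M) X) (ptr X \<star> (\<gamma>1 \<star> \<gamma>2))"
proof -
  let ?A = "amp (tens N M) X" and ?S = "ptr X \<star> (\<gamma>1 \<star> \<gamma>2)"
  let ?\<phi> = "reix swp (amp M (reix assoc X))" and ?\<psi> = "ptr (reix rot X)"
  let ?\<eta> = "ptr ?\<psi> \<star> \<gamma>2"
  have p: "ptr ?\<phi> = amp M ?\<psi>" by (rule ptr_swp_amp[OF chan_lin[OF M]])
  note d = chan_state_pair[OF N \<gamma>1 input_state_first]
  have A: "fpsd ?A" by (rule fpsd_reixD[OF inj_rot]) (use d in \<open>simp add: rot_tens state_pair_def\<close>)
  have "tr ?A = tr (reix rot ?A)" by (rule tr_reix[OF inj_rot, symmetric])
  then have tA: "tr ?A = 1" using d by (simp add: rot_tens state_pair_def)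
  have S: "fpsd ?S" "tr ?S = 1" using X faithful_stateD[OF \<gamma>1] faithful_stateD[OF \<gamma>2] by (simp_all add: fpsd_tn fpsd_ptr)
  \<comment> \<open>The dominations for the two channels compose: the marginal in the bound for
    \<open>N\<close> is an output of \<open>M\<close>, so the product of the constants serves for
    the tensor product.\<close>
  obtain C where C: "0 < C" "fpsd (C *\<^sub>r (ptr ?\<phi> \<star> \<gamma>1) - amp N ?\<phi>)"
    using chan_dominated[OF N \<gamma>1] input_state_first by metis
  obtain D where D: "0 < D" "fpsd (D *\<^sub>r ?\<eta> - amp M ?\<psi>)"
    using chan_dominated[OF M \<gamma>2] input_state_second by metis
  have "fpsd (C *\<^sub>r ((D *\<^sub>r ?\<eta> - amp M ?\<psi>) \<star> \<gamma>1))"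
    using C(1) D(2) faithful_stateD(1)[OF \<gamma>1] by (intro fpsd_cs fpsd_tn) auto
  from fpsd_add[OF this C(2)]
  have "fpsd ((C * D) *\<^sub>r (?\<eta> \<star> \<gamma>1) - amp N ?\<phi>)" by (simp add: p cs_diff_right cs_cs)
  then have "fpsd (reix rot ((C * D) *\<^sub>r ?S - ?A))" by (simp add: rot_tens)
  then have "fpsd ((C * D) *\<^sub>r ?S - ?A)" by (rule fpsd_reixD[OF inj_rot])
  from sp_mult_dominated[OF A S(1) this] show ?thesis using A tA S by (simp add: state_pair_def)
qed

lemma tens_fm_div_le:
  assumes z: "admissible z"
    and 1: "\<And>\<phi> :: (('r \<times> nat) \<times> nat) fm. input_state a1' \<phi> \<Longrightarrow> fm_div z (amp N \<phi>) (ptr \<phi> \<star> \<gamma>1) \<le> b1"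
    and 2: "\<And>\<phi> :: ('r \<times> nat) fm. input_state a2' \<phi> \<Longrightarrow> fm_div z (amp M \<phi>) (ptr \<phi> \<star> \<gamma>2) \<le> b2"
  shows "fm_div z (amp (tens N M) X) (ptr X \<star> (\<gamma>1 \<star> \<gamma>2)) \<le> b1 + b2"
proof -
  let ?\<phi> = "reix swp (amp M (reix assoc X))" and ?\<psi> = "ptr (reix rot X)"
  let ?\<eta> = "ptr ?\<psi> \<star> \<gamma>2"
  have p: "ptr ?\<phi> = amp M ?\<psi>" by (rule ptr_swp_amp[OF chan_lin[OF M]])
  have d: "state_pair (ptr ?\<phi>) ?\<eta>" unfolding p by (rule chan_state_pair[OF M \<gamma>2 input_state_second])
  have "fm_div z (amp (tens N M) X) (ptr X \<star> (\<gamma>1 \<star> \<gamma>2)) = fm_div z (amp N ?\<phi>) (?\<eta> \<star> \<gamma>1)"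
    using fm_div_reix[OF inj_rot, of "amp (tens N M) X" "ptr X \<star> (\<gamma>1 \<star> \<gamma>2)" z] tens_state_pair by (simp add: rot_tens state_pair_def)
  also have "\<dots> \<le> b1 + fm_div z (ptr ?\<phi>) ?\<eta>" by (rule fm_div_chain[OF z N input_state_first d \<gamma>1 1])
  also have "fm_div z (ptr ?\<phi>) ?\<eta> \<le> b2" unfolding p by (rule 2[OF input_state_second])
  finally show ?thesis by simp
qed

end

lemma tens_fm_div_product:
  fixes \<psi> :: "('r::countable \<times> nat) fm" and \<phi> :: "('s::countable \<times> nat) fm"
  assumes z: "admissible z" and N: "chan a1' a1 N" and M: "chan a2' a2 M" and \<gamma>: "faithful_state a1 \<gamma>1" "faithful_state a2 \<gamma>2"
    and \<psi>: "input_state a1' \<psi>" and \<phi>: "input_state a2' \<phi>"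
  defines "X \<equiv> reix mid (\<psi> \<star> \<phi>)"
  shows "fm_div z (amp (tens N M) X) (ptr X \<star> (\<gamma>1 \<star> \<gamma>2)) = fm_div z (amp N \<psi>) (ptr \<psi> \<star> \<gamma>1) + fm_div z (amp M \<phi>) (ptr \<phi> \<star> \<gamma>2)"
proof -
  note d = chan_state_pair[OF N \<gamma>(1) \<psi>] chan_state_pair[OF M \<gamma>(2) \<phi>]
  have "amp (tens N M) X = reix mid (amp N \<psi> \<star> amp M \<phi>)"
    unfolding X_def by (rule amp_tens_mid[OF chan_lin[OF N] chan_lin[OF M]])
  moreover have "ptr X \<star> (\<gamma>1 \<star> \<gamma>2) = reix mid ((ptr \<psi> \<star> \<gamma>1) \<star> (ptr \<phi> \<star> \<gamma>2))"
    unfolding X_def ptr_mid mid_tn ..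
  moreover have "fpsd (amp N \<psi> \<star> amp M \<phi>)" "fpsd ((ptr \<psi> \<star> \<gamma>1) \<star> (ptr \<phi> \<star> \<gamma>2))"
    using d by (auto simp: state_pair_def intro: fpsd_tn)
  ultimately show ?thesis by (simp only: fm_div_reix[OF inj_mid] fm_div_tn[OF z d])
qed

lemma A5_matrix_div: assumes z: "admissible z" and b: "0 < \<beta>" shows "A5 (matrix_div z) \<beta>"
  unfolding A5_def
proof (intro allI impI)
  fix a1' a1 H1 a2' a2 H2 N M
  assume a1': "1 \<le> (a1'::nat)" and H1: "hamiltonian a1 H1" and a2': "1 \<le> (a2'::nat)" and H2: "hamiltonian a2 H2"
    and N: "channel a1' a1 N" and M: "channel a2' a2 M"
  let ?H = "kron H1 (1\<^sub>m a2) + kron (1\<^sub>m a1) H2" and ?C = "ctensor a1' a1 a2' a2 N M"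
  let ?g = "block_index id a2" and ?n = "a1 * a2" and ?g' = "block_index id a2'" and ?n' = "a1' * a2'"
  note cN = chan_lift[OF N] and cM = chan_lift[OF M] and g1 = faithful_state_gibbs[OF H1, of \<beta>] and g2 = faithful_state_gibbs[OF H2, of \<beta>]
  let ?T = "tens (lift a1' a1 N) (lift a2' a2 M)" and ?\<Gamma> = "thermal_state \<beta> a1 H1 \<star> thermal_state \<beta> a2 H2"
  have hH: "hermitian a1 H1" "hermitian a2 H2" using H1 H2 by (auto simp: hamiltonian_def)
  note gk = gibbs_kron(1,3)[OF hH, of \<beta>]
  note ig = inj_block_index[OF inj_block_index_id]
  let ?X = "\<lambda>r \<psi>. emb (block_index ?g' ?n') (r * ?n') \<psi>"
  have eC: "emb (block_index ?g ?n) (r * ?n) (idt r ?n' ?n ?C \<psi>) = amp ?T (?X r \<psi>)" for r \<psi>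
    by (rule idt_emb[OF inj_block_index_id inj_block_index_id lin_tens]) (rule ctensor_emb[OF chan_lin[OF cN] chan_lin[OF cM], symmetric])
  have eT: "emb (block_index ?g ?n) (r * ?n) (idt r ?n' ?n (thermal \<beta> ?n ?H) \<psi>) = ptr (?X r \<psi>) \<star> ?\<Gamma>" for r \<psi>
  proof -
    have "emb (block_index ?g ?n) (r * ?n) (idt r ?n' ?n (thermal \<beta> ?n ?H) \<psi>) = amp (\<lambda>Y. tr Y *\<^sub>c ?\<Gamma>) (?X r \<psi>)"
      by (rule idt_emb[OF inj_block_index_id inj_block_index_id])
        (auto simp: linI cs_add_left cs_cs emb_trace[OF inj_block_index_id] thermal_def replacer_def emb_smult[OF inj_block_index_id gk(2)] gk(1))
    then show ?thesis by (simp add: amp_trace_const)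
  qed
  have supp: "snd p \<in> {..<a1'} \<times> {..<a2'} \<and> snd q \<in> {..<a1'} \<times> {..<a2'}" if "ent (?X r \<psi>) p q \<noteq> 0" for r \<psi> p q
  proof -
    have "p \<in> block_index ?g' ?n' ` {..<r * ?n'} \<and> q \<in> block_index ?g' ?n' ` {..<r * ?n'}" using that ent_emb_out by metis
    then show ?thesis by (auto simp: block_index_image)
  qed
  have val: "matrix_div z (r * ?n) (idt r ?n' ?n ?C \<psi>) (idt r ?n' ?n (thermal \<beta> ?n ?H) \<psi>)
      = ereal (fm_div z (amp ?T (?X r \<psi>)) (ptr (?X r \<psi>) \<star> ?\<Gamma>))" if \<psi>: "is_state (r * ?n') \<psi>" for r \<psi>
  proof -
    have d: "state_pair (amp ?T (?X r \<psi>)) (ptr (?X r \<psi>) \<star> ?\<Gamma>)"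
      by (rule tens_state_pair[OF cN cM g1 g2 state_emb[OF \<psi> inj_block_index_id] supp])
    have "psd (r * ?n) (idt r ?n' ?n ?C \<psi>)" "psd (r * ?n) (idt r ?n' ?n (thermal \<beta> ?n ?H) \<psi>)"
      using psd_emb[OF ig idt_carrier] d by (simp_all add: eC eT state_pair_def)
    from matrix_div_emb[OF z ig this] show ?thesis using d by (simp add: eC eT state_pair_def)
  qed
  obtain x where x: "chdiv (matrix_div z) a1' a1 N (thermal \<beta> a1 H1) = ereal x" "0 \<le> x"
    "\<And>B. (\<And>\<psi> :: (nat \<times> nat) fm. input_state a1' \<psi> \<Longrightarrow> fm_div z (amp (lift a1' a1 N) \<psi>) (ptr \<psi> \<star> thermal_state \<beta> a1 H1) \<le> B) \<Longrightarrow> x \<le> B"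
    by (rule chdiv_real[OF z H1 N a1', of \<beta>]) blast
  obtain y where y: "chdiv (matrix_div z) a2' a2 M (thermal \<beta> a2 H2) = ereal y" "0 \<le> y"
    "\<And>B. (\<And>\<psi> :: (nat \<times> nat) fm. input_state a2' \<psi> \<Longrightarrow> fm_div z (amp (lift a2' a2 M) \<psi>) (ptr \<psi> \<star> thermal_state \<beta> a2 H2) \<le> B) \<Longrightarrow> y \<le> B"
    by (rule chdiv_real[OF z H2 M a2', of \<beta>]) blast
  let ?D = "chdiv (matrix_div z) ?n' ?n ?C (thermal \<beta> ?n ?H)"
  have le: "?D \<le> ereal (x + y)"
    unfolding chdiv_def
  proof (intro SUP_least, clarify)
    fix r \<psi> assume \<psi>: "is_state (r * ?n') \<psi>"
    have "fm_div z (amp ?T (?X r \<psi>)) (ptr (?X r \<psi>) \<star> ?\<Gamma>) \<le> x + y"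
      by (rule tens_fm_div_le[OF cN cM g1 g2 state_emb[OF \<psi> inj_block_index_id] supp z])
        (auto intro: fm_div_le_chdiv[OF z H1 N _ x(1)] fm_div_le_chdiv[OF z H2 M _ y(1)])
    then show "matrix_div z (r * ?n) (idt r ?n' ?n ?C \<psi>) (idt r ?n' ?n (thermal \<beta> ?n ?H) \<psi>) \<le> ereal (x + y)"
      unfolding val[OF \<psi>] by simp
  qed
  have ge: "ereal (fm_div z (amp (lift a1' a1 N) \<psi>) (ptr \<psi> \<star> thermal_state \<beta> a1 H1) + fm_div z (amp (lift a2' a2 M) \<phi>) (ptr \<phi> \<star> thermal_state \<beta> a2 H2)) \<le> ?D"
    if \<psi>: "input_state a1' \<psi>" and \<phi>: "input_state a2' \<phi>" for \<psi> \<phi> :: "(nat \<times> nat) fm"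
  proof -
    define Z where "Z = reix mid (\<psi> \<star> \<phi>)"
    \<comment> \<open>The two references are encoded in a single \<open>nat\<close> while the
      systems stay fixed.\<close>
    let ?e = "map_prod prod_encode (id :: nat \<times> nat \<Rightarrow> _)"
    have ie: "inj ?e" by (intro prod.inj_map) (auto simp: inj_prod_encode)
    have Z: "fpsd Z" "tr Z = 1"
      using \<psi> \<phi> by (simp_all add: Z_def input_state_def fpsd_reix inj_mid fpsd_tn tr_reix)
    have sZ: "snd p \<in> {..<a1'} \<times> {..<a2'} \<and> snd q \<in> {..<a1'} \<times> {..<a2'}" if nz: "ent Z p q \<noteq> 0" for p q
    proof -
      obtain i j k l where p: "p = mid ((i, k), (j, l))" by (metis mid_apply surj_pair)
      obtain i' j' k' l' where q: "q = mid ((i', k'), (j', l'))" by (metis mid_apply surj_pair)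
      have "ent \<psi> (i, k) (i', k') \<noteq> 0" "ent \<phi> (j, l) (j', l') \<noteq> 0"
        using nz unfolding Z_def p q ent_reix[OF inj_mid] by auto
      then show ?thesis using input_stateD(3)[OF \<psi>] input_stateD(3)[OF \<phi>] by (auto simp: input_supported_def p q)
    qed
    have sZ': "snd p \<in> ?g' ` {..<?n'} \<and> snd q \<in> ?g' ` {..<?n'}" if nz: "ent (reix ?e Z) p q \<noteq> 0" for p q
    proof -
      obtain p' q' where pq: "p = ?e p'" "q = ?e q'"
        by (metis map_prod_simp prod_decode_inverse id_apply surj_pair)
      then have "ent Z p' q' \<noteq> 0" using nz ent_reix[OF ie, of Z p' q'] by simp
      then show ?thesis using sZ[of p' q'] by (cases p'; cases q') (simp add: pq block_index_image)
    qed
    obtain r W where W: "is_state (r * ?n') W" "?X r W = reix ?e Z"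
      by (rule state_unemb[OF inj_block_index_id sZ' fpsd_reix[OF ie Z(1)]]) (use Z(2) tr_reix[OF ie] in auto)
    have 1: "amp ?T (reix ?e Z) = reix ?e (amp ?T Z)" by (rule amp_reix[OF lin_tens])
    have 2: "ptr (reix ?e Z) \<star> ?\<Gamma> = reix ?e (ptr Z \<star> ?\<Gamma>)"
      using ptr_reix[of id prod_encode Z] reix_tn[of prod_encode "ptr Z" id ?\<Gamma>] by simp
    have d: "state_pair (amp ?T Z) (ptr Z \<star> ?\<Gamma>)" by (rule tens_state_pair[OF cN cM g1 g2 Z sZ])
    have "fm_div z (amp (lift a1' a1 N) \<psi>) (ptr \<psi> \<star> thermal_state \<beta> a1 H1) + fm_div z (amp (lift a2' a2 M) \<phi>) (ptr \<phi> \<star> thermal_state \<beta> a2 H2)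
        = fm_div z (amp ?T Z) (ptr Z \<star> ?\<Gamma>)"
      unfolding Z_def by (rule tens_fm_div_product[OF z cN cM g1 g2 \<psi> \<phi>, symmetric])
    also have "\<dots> = fm_div z (amp ?T (?X r W)) (ptr (?X r W) \<star> ?\<Gamma>)"
      unfolding W(2) 1 2 by (rule fm_div_reix[OF ie, symmetric]) (use d in \<open>auto simp: state_pair_def\<close>)
    finally have e: "ereal (fm_div z (amp (lift a1' a1 N) \<psi>) (ptr \<psi> \<star> thermal_state \<beta> a1 H1) + fm_div z (amp (lift a2' a2 M) \<phi>) (ptr \<phi> \<star> thermal_state \<beta> a2 H2))
        = matrix_div z (r * ?n) (idt r ?n' ?n ?C W) (idt r ?n' ?n (thermal \<beta> ?n ?H) W)"
      unfolding val[OF W(1)] by simp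
    show ?thesis unfolding e chdiv_def by (rule SUP_upper2[of "(r, W)"]) (use W(1) in auto)
  qed
  obtain w where w: "?D = ereal w"
    using le ge[OF input_state_basis[OF a1'] input_state_basis[OF a2']] by (cases ?D) auto
  have "x + y \<le> w"
  proof -
    \<comment> \<open>The suprema are taken one at a time: over \<psi> for fixed \<phi>, then over
      \<phi>.\<close>
    have "y \<le> w - x"
    proof (rule y(3))
      fix \<phi> :: "(nat \<times> nat) fm" assume \<phi>: "input_state a2' \<phi>"
      have "x \<le> w - fm_div z (amp (lift a2' a2 M) \<phi>) (ptr \<phi> \<star> thermal_state \<beta> a2 H2)"
        by (rule x(3)) (use ge[OF _ \<phi>] w in \<open>simp add: le_diff_eq\<close>)
      then show "fm_div z (amp (lift a2' a2 M) \<phi>) (ptr \<phi> \<star> thermal_state \<beta> a2 H2) \<le> w - x" by simp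
    qed
    then show ?thesis by simp
  qed
  then have "?D = ereal (x + y)" using le w by simp
  then show "chfree (matrix_div z) \<beta> ?n' ?n ?H ?C = chfree (matrix_div z) \<beta> a1' a1 H1 N + chfree (matrix_div z) \<beta> a2' a2 H2 M"
    by (simp add: chfree_def x(1) y(1) add_divide_distrib)
qed

theorem theorem1:
  fixes \<beta> :: real
  assumes "\<beta> > 0"
  shows "A1 umegaki \<beta> \<and> A2 umegaki \<beta> \<and> A3 umegaki \<beta> \<and> A4 umegaki \<beta> \<and> A5 umegaki \<beta> \<and> A6 umegaki \<beta>
    \<and> (\<forall>\<alpha>>1. A1 (sandwiched \<alpha>) \<beta> \<and> A2 (sandwiched \<alpha>) \<beta> \<and> A3 (sandwiched \<alpha>) \<beta>
              \<and> A4 (sandwiched \<alpha>) \<beta> \<and> A5 (sandwiched \<alpha>) \<beta>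
              \<and> quasiconvex (sandwiched \<alpha>) \<beta> TYPE(nat))"
proof (intro conjI)
  have u: "umegaki = matrix_div None" and z: "admissible None" by (simp_all add: matrix_div_def admissible_def)
  show "A1 umegaki \<beta>" "A2 umegaki \<beta>" "A3 umegaki \<beta>" "A4 umegaki \<beta>" "A5 umegaki \<beta>"
    unfolding u using assms z by (simp_all add: A1_matrix_div A2_matrix_div A3_matrix_div A4_matrix_div A5_matrix_div)
  show "A6 umegaki \<beta>" by (rule A6_umegaki[OF assms])
  show "\<forall>\<alpha>>1. A1 (sandwiched \<alpha>) \<beta> \<and> A2 (sandwiched \<alpha>) \<beta> \<and> A3 (sandwiched \<alpha>) \<beta>
      \<and> A4 (sandwiched \<alpha>) \<beta> \<and> A5 (sandwiched \<alpha>) \<beta> \<and> quasiconvex (sandwiched \<alpha>) \<beta> TYPE(nat)"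
  proof (intro allI impI)
    fix \<alpha> :: real assume a: "1 < \<alpha>"
    \<comment> \<open>The solution of \<alpha> = 1 / (1 - p), which identifies the order \<alpha>
      with \<open>Some p\<close>.\<close>
    define p where "p = (\<alpha> - 1) / \<alpha>"
    have p: "0 < p" "p < 1" and "1 / (1 - p) = \<alpha>" using a by (simp_all add: p_def field_simps)
    then have s: "sandwiched \<alpha> = matrix_div (Some p)" and z: "admissible (Some p)" by (simp_all add: matrix_div_def admissible_def)
    show "A1 (sandwiched \<alpha>) \<beta> \<and> A2 (sandwiched \<alpha>) \<beta> \<and> A3 (sandwiched \<alpha>) \<beta>
      \<and> A4 (sandwiched \<alpha>) \<beta> \<and> A5 (sandwiched \<alpha>) \<beta> \<and> quasiconvex (sandwiched \<alpha>) \<beta> TYPE(nat)"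
      unfolding s using assms z p by (simp add: A1_matrix_div A2_matrix_div A3_matrix_div A4_matrix_div A5_matrix_div quasiconvex_matrix_div)
  qed
qed

end
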